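(* Let $(M_1,N_1,F,\gamma_1,\Sigma,g_1)$ be the single coating construction of the cylindrical obstacle $B_2(0,1)\times\mathbb R$, and let $k\in\mathbb R\setminus\{0\}$. Let $E$ and $H$ be 1-forms with measurable coefficients on $M_1\setminus\gamma_1$ and $\tilde E$ and $\tilde H$ be 1-forms with measurable coefficients on $N_1$ such that $E=F^*\tilde E$, $H=F^*\tilde H$. Let $J$ and $\tilde J$ be 2-forms with smooth coefficients on $M_1\setminus\gamma_1$ and $N_1\setminus\Sigma$, with $J=F^*\tilde J$, that are supported away from $\gamma_1$ and $\Sigma$ (and away from $\partial M_1$ and $\partial N$). Then the following are equivalent: (1) On $N_1$, the 1-forms $\tilde E$ and $\tilde H$ are finite energy solutions of Maxwell's equations with soft-and-hard (SHS) boundary conditions on $\Sigma$, $$\nabla\times\tilde E=ik\tilde\mu(x)\tilde H,\quad \nabla\times\tilde H=-ik\tilde\varepsilon(x)\tilde E+\tilde J\ \text{ on }N_1,$$ $$\eta\cdot\tilde E|_\Sigma=0,\quad\eta\cdot\tilde H|_\Sigma=0,\qquad\nu\times\tilde E|_{\partial N}=f.$$ (2) On $M_1$, the forms $E$ and $H$ are classical solutions of Maxwell's equations $$\nabla\times E=ik\mu(x)H,\quad\nabla\times H=-ik\varepsilon(x)E+J\ \text{ in }M_1,\qquad \nu\times E|_{\partial M_1}=f.$$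
   Context: Geometry: $B_2(0,r)\subset\mathbb R^2$ is the Euclidean disc of radius $r$ centered at $0$. $M_1=B_2(0,2)\times\mathbb R$, $\gamma_1=\{(0,0)\}\times\mathbb R$; $N_1=(B_2(0,2)\times\mathbb R)\setminus(\overline B_2(0,1)\times\mathbb R)$, $\Sigma=\partial B_2(0,1)\times\mathbb R$, and $\partial N=\partial N_1\setminus\Sigma=\partial B_2(0,2)\times\mathbb R$. $F:M_1\setminus\gamma_1\to N_1$ is a diffeomorphism stretching only in the radial direction: in cylindrical coordinates $(r,\theta,z)$ it is $(r,\theta,z)\mapsto(F_1(r),\theta,z)$ with $F_1(r)$ increasing from $1$ to $2$ for $0<r\le2$ (e.g. $F_1(r)=1+r/2$). $g_1$ is the Euclidean metric on $M_1$ and $\tilde g=F_*g_1=(F^{-1})^*g_1$ on $N_1$. $\eta=\partial_\theta$ is the angular vector field, tangential to $\Sigma$. Maxwell's equations: $\varepsilon^{jk}=\mu^{jk}=|g_1|^{1/2}g_1^{jk}$ on $M_1$ and $\tilde\varepsilon^{jk}=\tilde\mu^{jk}=|\tilde g|^{1/2}\tilde g^{jk}$ on $N_1$, where $|g|=\det(g_{jk})$, $(g^{jk})=(g_{jk})^{-1}$. Fields are 1-forms $E=E_jdx^j$, $H=H_jdx^j$; the current is a 2-form $J=\frac12J^ls_{lpq}dx^p\wedge dx^q$, with $s_{lpq}$ the Levi-Civita symbol. $(\nabla\times H)^l=s^{lpq}\partial_pH_q$ and $(\varepsilon E)^l=\varepsilon^{jl}E_j$. Summation convention is used, $dV_0$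 is Euclidean volume, $\cdot$ is the Euclidean inner product, $\nu$ is the Euclidean unit normal. Finite energy solution with SHS boundary conditions: 1-forms $\tilde E,\tilde H$ on $N_1$ are finite energy solutions of the problem in (1) if $\tilde E,\tilde H$ are 1-forms and $\tilde\varepsilon\tilde E$, $\tilde\mu\tilde H$ are 2-forms with measurable coefficients satisfying $$\int_{N_1}\tilde\varepsilon^{jk}\tilde E_j\overline{\tilde E_k}\,dV_0<\infty,\qquad\int_{N_1}\tilde\mu^{jk}\tilde H_j\overline{\tilde H_k}\,dV_0<\infty;$$ Maxwell's equations hold in the classical sense in a neighborhood $U$ of $\partial N$ with $\nu\times\tilde E|_{\partial N}=f$; and $$\int_{N_1}\big((\nabla\times\tilde h)\cdot\tilde E-ik\,\tilde h\cdot\tilde\mu\tilde H\big)dV_0=0,\qquad\int_{N_1}\big((\nabla\times\tilde e)\cdot\tilde H+\tilde e\cdot(ik\tilde\varepsilon\tilde E-\tilde J)\big)dV_0=0$$ for all $\tilde e,\tilde h\in C_0^\infty(\Omega^1N_1)$ satisfying $\eta\cdot\tilde e|_\Sigma=0$ and $\eta\cdot\tilde h|_\Sigma=0$. Here $C_0^\infty(\Omega^1N_1)$ denotes smooth 1-forms on $N_1$ (up to $\Sigma$) whose supports do not intersect $\partial N$; they may meet $\Sigma$.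
   Formalization: Condition (2) is supplemented by the requirement that E and H have finite energy on M_1; without it (2)⇒(1) fails, e.g. for E = e^{ikz}dx, H = e^{ikz}dy, J = 0, whose energy on the infinite cylinder is infinite. *)

theory Defs
  imports "HOL-Analysis.Analysis"
begin

section \<open>Smoothness\<close>

text \<open>Functions of class \<open>C\<^sup>n\<close> on an open set.\<close>

primrec Ck_on :: "nat \<Rightarrow> 'a::euclidean_space set \<Rightarrow> ('a \<Rightarrow> 'b::real_normed_vector) \<Rightarrow> bool" where
  "Ck_on 0 U f \<longleftrightarrow> continuous_on U f"
| "Ck_on (Suc n) U f \<longleftrightarrow>
     (\<forall>x\<in>U. f differentiable (at x)) \<and>
     (\<forall>v. Ck_on n U (\<lambda>x. frechet_derivative f (at x) v))"

text \<open>On a set that need not be open, smooth means being the restriction of a smooth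
  function on an open neighbourhood. This expresses smoothness up to a boundary component.\<close>

definition smooth_on :: "'a::euclidean_space set \<Rightarrow> ('a \<Rightarrow> 'b::real_normed_vector) \<Rightarrow> bool" where
  "smooth_on S f \<longleftrightarrow>
     (\<exists>U g. open U \<and> S \<subseteq> U \<and> (\<forall>n. Ck_on n U g) \<and> (\<forall>x\<in>S. g x = f x))"

definition diffeomorphism_on ::
  "'a::euclidean_space set \<Rightarrow> 'b::euclidean_space set \<Rightarrow> ('a \<Rightarrow> 'b) \<Rightarrow> bool" where
  "diffeomorphism_on S T F \<longleftrightarrow>
     bij_betw F S T \<and> smooth_on S F \<and> smooth_on T (inv_into S F)"


section \<open>Geometry of the single coating\<close>

definition cyl_radius :: "real^3 \<Rightarrow> real" where
  "cyl_radius x = sqrt ((x$1)\<^sup>2 + (x$2)\<^sup>2)"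

definition M1 :: "(real^3) set" where
  "M1 = {x. cyl_radius x < 2}"

definition gamma1 :: "(real^3) set" where
  "gamma1 = {x. x$1 = 0 \<and> x$2 = 0}"

definition N1 :: "(real^3) set" where
  "N1 = M1 - {x. cyl_radius x \<le> 1}"

definition Sigma1 :: "(real^3) set" where
  "Sigma1 = {x. cyl_radius x = 1}"

text \<open>The boundary of \<open>M\<^sub>1\<close> and the outer boundary \<open>\<partial>N = \<partial>N\<^sub>1 - \<Sigma>\<close> are the same cylinder.\<close>

definition outer_bdry :: "(real^3) set" where
  "outer_bdry = {x. cyl_radius x = 2}"

text \<open>The map \<open>(r, \<theta>, z) \<mapsto> (F\<^sub>1 r, \<theta>, z)\<close> in Cartesian coordinates.\<close>

definition radial_stretch :: "(real \<Rightarrow> real) \<Rightarrow> real^3 \<Rightarrow> real^3" where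
  "radial_stretch F1 x = (let r = cyl_radius x in
     vector [F1 r * (x$1 / r), F1 r * (x$2 / r), x$3])"

text \<open>\<open>F\<^sub>1\<close> is prescribed for \<open>0 < r \<le> 2\<close>, so \<open>F\<close> is a diffeomorphism up to the outer
  boundary; no regularity is imposed at the axis.\<close>

definition single_coating :: "(real \<Rightarrow> real) \<Rightarrow> (real^3 \<Rightarrow> real^3) \<Rightarrow> bool" where
  "single_coating F1 F \<longleftrightarrow>
     strict_mono_on {0<..2} F1 \<and> (F1 \<longlongrightarrow> 1) (at_right 0) \<and> F1 2 = 2 \<and>
     (\<forall>x\<in>(M1 - gamma1) \<union> outer_bdry. F x = radial_stretch F1 x) \<and>
     diffeomorphism_on ((M1 - gamma1) \<union> outer_bdry) (N1 \<union> outer_bdry) F"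

definition F_inv :: "(real^3 \<Rightarrow> real^3) \<Rightarrow> real^3 \<Rightarrow> real^3" where
  "F_inv F = inv_into (M1 - gamma1) F"

text \<open>The Euclidean unit normal, to be used on \<open>outer_bdry\<close>.\<close>

definition nu :: "real^3 \<Rightarrow> real^3" where
  "nu x = vector [x$1 / cyl_radius x, x$2 / cyl_radius x, 0]"

text \<open>The angular vector field \<open>\<partial>\<^sub>\<theta> = - x\<^sub>2 \<partial>\<^sub>1 + x\<^sub>1 \<partial>\<^sub>2\<close>.\<close>

definition eta :: "real^3 \<Rightarrow> real^3" where
  "eta x = vector [- (x$2), x$1, 0]"


section \<open>Forms, metrics and material parameters\<close>

text \<open>A 1-form is the field of its Cartesian components \<open>E\<^sub>j\<close>. A 2-form
  \<open>\<half> J\<^sup>l s\<^sub>l\<^sub>p\<^sub>q dx\<^sup>p \<and> dx\<^sup>q\<close> is the field of its components \<open>J\<^sup>l\<close>.\<close>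

type_synonym form = "real^3 \<Rightarrow> complex^3"
type_synonym tensor = "real^3 \<Rightarrow> real^3^3"

definition levi_civita :: "3 \<Rightarrow> 3 \<Rightarrow> 3 \<Rightarrow> complex" where
  "levi_civita l p q =
     (if (l, p, q) \<in> {(1,2,3), (2,3,1), (3,1,2)} then 1
      else if (l, p, q) \<in> {(1,3,2), (3,2,1), (2,1,3)} then -1 else 0)"

definition partial :: "3 \<Rightarrow> (real^3 \<Rightarrow> 'b::real_normed_vector) \<Rightarrow> real^3 \<Rightarrow> 'b" where
  "partial p u x = frechet_derivative u (at x) (axis p 1)"

definition curl :: "form \<Rightarrow> form" where
  "curl H x = (\<chi> l. \<Sum>p\<in>UNIV. \<Sum>q\<in>UNIV. levi_civita l p q * partial p (\<lambda>y. H y $ q) x)"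

definition cross_rc :: "real^3 \<Rightarrow> complex^3 \<Rightarrow> complex^3" where
  "cross_rc v w = (\<chi> l. \<Sum>p\<in>UNIV. \<Sum>q\<in>UNIV. levi_civita l p q * of_real (v$p) * w$q)"

text \<open>The bilinear extension of the Euclidean inner product (no conjugation).\<close>

definition cdot :: "complex^3 \<Rightarrow> complex^3 \<Rightarrow> complex" where
  "cdot v w = (\<Sum>j\<in>UNIV. v$j * w$j)"

definition cvec :: "real^3 \<Rightarrow> complex^3" where
  "cvec v = (\<chi> j. of_real (v$j))"

definition pullback1 :: "(real^3 \<Rightarrow> real^3) \<Rightarrow> form \<Rightarrow> form" where
  "pullback1 F E x = (\<chi> j. \<Sum>a\<in>UNIV. of_real (jacobian F (at x) $ a $ j) * E (F x) $ a)"

definition form2_coeff :: "complex^3 \<Rightarrow> 3 \<Rightarrow> 3 \<Rightarrow> complex" where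
  "form2_coeff J p q = (\<Sum>l\<in>UNIV. J$l * levi_civita l p q)"

text \<open>\<open>J = F\<^sup>* Jt\<close> at the point \<open>x\<close>, for 2-forms.\<close>

definition is_pullback2 :: "(real^3 \<Rightarrow> real^3) \<Rightarrow> form \<Rightarrow> form \<Rightarrow> real^3 \<Rightarrow> bool" where
  "is_pullback2 F Jt J x \<longleftrightarrow>
     (\<forall>p q. form2_coeff (J x) p q =
        (\<Sum>a\<in>UNIV. \<Sum>b\<in>UNIV. of_real (jacobian F (at x) $ a $ p) *
           of_real (jacobian F (at x) $ b $ q) * form2_coeff (Jt (F x)) a b))"

definition flat_metric :: tensor where
  "flat_metric x = mat 1"

definition pullback_metric :: "(real^3 \<Rightarrow> real^3) \<Rightarrow> tensor \<Rightarrow> tensor" where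
  "pullback_metric G g y = (\<chi> j k. \<Sum>a\<in>UNIV. \<Sum>b\<in>UNIV.
     jacobian G (at y) $ a $ j * jacobian G (at y) $ b $ k * g (G y) $ a $ b)"

definition g_tilde :: "(real^3 \<Rightarrow> real^3) \<Rightarrow> tensor" where
  "g_tilde F = pullback_metric (F_inv F) flat_metric"

definition material :: "tensor \<Rightarrow> tensor" where
  "material g x = sqrt (det (g x)) *\<^sub>R matrix_inv (g x)"

text \<open>\<open>(\<epsilon>E)\<^sup>l = \<epsilon>\<^sup>j\<^sup>l E\<^sub>j\<close>\<close>

definition apply_material :: "tensor \<Rightarrow> form \<Rightarrow> form" where
  "apply_material eps E x = (\<chi> l. \<Sum>j\<in>UNIV. of_real (eps x $ j $ l) * E x $ j)"


section \<open>Solutions of Maxwell's equations\<close>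

text \<open>The integrand is nonnegative for the materials above, so for measurable forms
  integrability means that the energy is finite.\<close>

definition finite_energy :: "(real^3) set \<Rightarrow> tensor \<Rightarrow> form \<Rightarrow> bool" where
  "finite_energy S eps E \<longleftrightarrow>
     integrable (lebesgue_on S)
       (\<lambda>x. \<Sum>j\<in>UNIV. \<Sum>k\<in>UNIV. of_real (eps x $ j $ k) * E x $ j * cnj (E x $ k))"

text \<open>Forms with measurable coefficients are identified when equal almost everywhere: \<open>E\<close>, \<open>H\<close>
  are a classical solution on the open set \<open>W\<close> if they have continuously differentiable
  representatives satisfying the equations pointwise. On the boundary part \<open>B\<close> the values are
  those of the continuous extension.\<close>

definition classical_solution ::
  "(real^3) set \<Rightarrow> (real^3) set \<Rightarrow> tensor \<Rightarrow> tensor \<Rightarrow> real \<Rightarrow> form \<Rightarrow> form \<Rightarrow> form \<Rightarrow> form \<Rightarrow> bool"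
where
  "classical_solution W B eps mu k J f E H \<longleftrightarrow>
     (\<exists>E' H'.
        (AE x in lebesgue_on W. E x = E' x \<and> H x = H' x) \<and>
        Ck_on 1 W E' \<and> Ck_on 1 W H' \<and>
        continuous_on (W \<union> B) E' \<and> continuous_on (W \<union> B) H' \<and>
        (\<forall>x\<in>W. curl E' x = (\<i> * of_real k) *s apply_material mu H' x) \<and>
        (\<forall>x\<in>W. curl H' x = - ((\<i> * of_real k) *s apply_material eps E' x) + J x) \<and>
        (\<forall>x\<in>B. cross_rc (nu x) (E' x) = f x))"

text \<open>The test forms \<open>C\<^sub>0\<^sup>\<infinity>(\<Omega>\<^sup>1 N\<^sub>1)\<close>: smooth up to \<open>\<Sigma>\<close>, with compact support in
  \<open>N\<^sub>1 \<union> \<Sigma>\<close>. The support may meet \<open>\<Sigma>\<close> but not the outer boundary.\<close>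

definition test_forms :: "form set" where
  "test_forms = {h. smooth_on (N1 \<union> Sigma1) h \<and>
     (\<exists>K. compact K \<and> K \<subseteq> N1 \<union> Sigma1 \<and> (\<forall>x\<in>(N1 \<union> Sigma1) - K. h x = 0))}"

definition SHS_test_forms :: "form set" where
  "SHS_test_forms = {h \<in> test_forms. \<forall>x\<in>Sigma1. cdot (cvec (eta x)) (h x) = 0}"

text \<open>\<open>has_bochner_integral\<close> rather than an equation for the integral, since the
  library assigns the value 0 to the integral of a non-integrable function.\<close>

definition finite_energy_SHS_solution ::
  "tensor \<Rightarrow> tensor \<Rightarrow> real \<Rightarrow> form \<Rightarrow> form \<Rightarrow> form \<Rightarrow> form \<Rightarrow> bool"
where
  "finite_energy_SHS_solution eps mu k J f E H \<longleftrightarrow>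
     E \<in> borel_measurable (lebesgue_on N1) \<and> H \<in> borel_measurable (lebesgue_on N1) \<and>
     apply_material eps E \<in> borel_measurable (lebesgue_on N1) \<and>
     apply_material mu H \<in> borel_measurable (lebesgue_on N1) \<and>
     finite_energy N1 eps E \<and> finite_energy N1 mu H \<and>
     (\<exists>U. open U \<and> outer_bdry \<subseteq> U \<and>
        classical_solution (U \<inter> N1) outer_bdry eps mu k J f E H) \<and>
     (\<forall>h\<in>SHS_test_forms. has_bochner_integral (lebesgue_on N1)
        (\<lambda>x. cdot (curl h x) (E x) - \<i> * of_real k * cdot (h x) (apply_material mu H x)) 0) \<and>
     (\<forall>e\<in>SHS_test_forms. has_bochner_integral (lebesgue_on N1)
        (\<lambda>x. cdot (curl e x) (H x) +
             cdot (e x) ((\<i> * of_real k) *s apply_material eps E x - J x)) 0)"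

end

theory Submission
  imports Defs "HOL-Computational_Algebra.Polynomial"
begin

text \<open>The materials on \<open>N\<^sub>1\<close> are the push-forward of the flat ones, so by the change of variables \<open>F\<close> the energies
  and the weak equations on \<open>N\<^sub>1\<close> agree with those on \<open>M\<^sub>1\<close> minus the axis.

  From (1) to (2): \<open>E\<close> and \<open>H\<close> are square integrable and weak solutions off the axis. Multiplying a test form
  by a cutoff that vanishes at distance \<open>1 / n\<close> from the axis produces an error with a gradient of size \<open>n\<close> on a
  set of measure of order \<open>1 / n\<^sup>2\<close>, which tends to 0 by the Cauchy-Schwarz inequality because the energy is
  finite; so the equations hold weakly across the axis. Their components then satisfy the
  Helmholtz equation weakly, and interior regularity follows by testing with a regularised
  fundamental solution.

  From (2) to (1): the same cutoffs are used, but now the fields are bounded and the pulled-back test forms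
  are not: their angular component is of order \<open>1 / r\<close> times \<open>\<eta> \<cdot> h\<close>. The boundary condition \<open>\<eta> \<cdot> h = 0\<close> on \<open>\<Sigma>\<close>
  is exactly what makes the error term tend to 0.\<close>

section \<open>Calculus of functions of class \<open>C\<^sup>n\<close>\<close>

text \<open>The axis has codimension two, which is the borderline case: cutoff gradients of size n
  on tubes of volume of order 1 / n^2 stay bounded in L^2 but do not tend to 0. So one direction
  rests on the energy inside the shrinking tubes tending to 0, and the other on a cancellation. In
  the latter, the derivative of \<open>F1\<close> has no bound at the axis; it enters the cutoff
  error only through the radial component of the test form, which the cross product with a radial
  gradient removes, and elsewhere it is at most twice the Jacobian determinant, whose integral is a
  volume in \<open>N1\<close>.

  The Helmholtz equation needs a divergence condition. It is not assumed: testing the second weak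
  equation with a gradient, whose curl is 0, supplies it.

  \<open>M1\<close> is unbounded along the axis, so a classical solution may have infinite energy;
  hence the energies stand beside the classical statement. Interior regularity says nothing about
  \<open>outer_bdry\<close>. The boundary values are carried across by F, which fixes
  \<open>outer_bdry\<close> pointwise and therefore preserves tangential components.\<close>

lemma frechet_derivative_cong_open:
  assumes "open U" "x \<in> U" "\<And>y. y \<in> U \<Longrightarrow> f y = g y"
  shows "frechet_derivative f (at x) = frechet_derivative g (at x)"
proof -
  have "(f has_derivative D) (at x) \<longleftrightarrow> (g has_derivative D) (at x)" for D
    using assms by (metis has_derivative_transform_within_open)
  then show ?thesis unfolding frechet_derivative_def by simp
qed

lemma differentiable_cong_open:
  assumes "open U" "x \<in> U" "\<And>y. y \<in> U \<Longrightarrow> f y = g y"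
  shows "f differentiable (at x) \<longleftrightarrow> g differentiable (at x)"
  using assms by (metis differentiable_def has_derivative_transform_within_open)

lemma Ck_on_cong:
  assumes "open U" "\<And>x. x \<in> U \<Longrightarrow> f x = g x" "Ck_on n U f"
  shows "Ck_on n U g"
  using assms(2,3)
proof (induction n arbitrary: f g)
  case 0
  then show ?case using continuous_on_cong[of U U f g] by simp
next
  case (Suc n)
  have "Ck_on n U (\<lambda>x. frechet_derivative g (at x) v)" for v
    by (rule Suc.IH[of "\<lambda>x. frechet_derivative f (at x) v"])
      (use Suc.prems frechet_derivative_cong_open[OF \<open>open U\<close>, of _ f g] in auto)
  then show ?case using Suc.prems differentiable_cong_open[OF \<open>open U\<close>, of _ f g] by simp
qed

text \<open>\<open>Ck_on\<close> is phrased with \<open>frechet_derivative\<close>; uniqueness of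
  the derivative lets an explicit formula take its place. The closure properties below are proved by
  induction through this rule.\<close>

lemma Ck_on_SucI:
  assumes der: "\<And>x. x \<in> U \<Longrightarrow> (f has_derivative f' x) (at x)"
    and U: "open U" and C: "\<And>v. Ck_on n U (\<lambda>x. f' x v)"
  shows "Ck_on (Suc n) U f"
  unfolding Ck_on.simps
proof (intro conjI ballI allI)
  show "f differentiable at x" if "x \<in> U" for x
    using der[OF that] by (auto simp: differentiable_def)
  show "Ck_on n U (\<lambda>x. frechet_derivative f (at x) v)" for v
    by (rule Ck_on_cong[OF U _ C[of v]]) (simp add: frechet_derivative_at[OF der, symmetric])
qed

lemma Ck_on_subset: "Ck_on n U f \<Longrightarrow> V \<subseteq> U \<Longrightarrow> Ck_on n V f"
  by (induction n arbitrary: f) (auto intro: continuous_on_subset)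

lemma Ck_on_Suc_imp_continuous: "Ck_on (Suc n) U f \<Longrightarrow> continuous_on U f"
  by (simp add: differentiable_imp_continuous_within continuous_at_imp_continuous_on)

lemma Ck_on_imp_continuous: "Ck_on n U f \<Longrightarrow> continuous_on U f"
  by (cases n) (auto simp: differentiable_imp_continuous_within continuous_at_imp_continuous_on)

lemma Ck_on_Suc_imp: "Ck_on (Suc n) U f \<Longrightarrow> Ck_on n U f"
proof (induction n arbitrary: f)
  case 0
  then show ?case using Ck_on_Suc_imp_continuous[of 0] by simp
next
  case (Suc n)
  then show ?case by simp
qed

lemma Ck_on_SucD:
  assumes "Ck_on (Suc n) U f" "x \<in> U"
  shows "(f has_derivative frechet_derivative f (at x)) (at x)"
  using assms by (simp add: frechet_derivative_works[symmetric])

lemma Ck_on_local: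
  assumes "\<And>x. x \<in> U \<Longrightarrow> \<exists>V. open V \<and> x \<in> V \<and> Ck_on n V f"
  shows "Ck_on n U f"
  using assms
proof (induction n arbitrary: f)
  case 0
  then show ?case
    by (metis Ck_on.simps(1) continuous_at_imp_continuous_on continuous_on_eq_continuous_at)
next
  case (Suc n)
  have "Ck_on n U (\<lambda>x. frechet_derivative f (at x) v)" for v
    by (rule Suc.IH) (use Suc.prems in fastforce)
  then show ?case using Suc.prems by fastforce
qed

lemma Ck_on_const [simp]: "Ck_on n U (\<lambda>x. c)"
  by (induction n arbitrary: c) auto

lemma Ck_on_bounded_linear_comp:
  assumes L: "bounded_linear L" and U: "open U" and f: "Ck_on n U f"
  shows "Ck_on n U (\<lambda>x. L (f x))"
  using f
proof (induction n arbitrary: f)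
  case 0
  then show ?case using L by (simp add: linear_continuous_on bounded_linear.continuous_on)
next
  case (Suc n)
  show ?case
  proof (rule Ck_on_SucI[OF _ U])
    show "((\<lambda>x. L (f x)) has_derivative (\<lambda>v. L (frechet_derivative f (at x) v))) (at x)" if "x \<in> U" for x
      using bounded_linear.has_derivative[OF L Ck_on_SucD[OF Suc.prems that]] .
    show "Ck_on n U (\<lambda>x. L (frechet_derivative f (at x) v))" for v
      by (rule Suc.IH) (use Suc.prems in simp)
  qed
qed

lemma Ck_on_bounded_linear:
  assumes L: "bounded_linear L" and U: "open U"
  shows "Ck_on n U L"
proof (cases n)
  case 0
  then show ?thesis using L by (simp add: linear_continuous_on)
next
  case (Suc m)
  show ?thesis unfolding Suc
    by (rule Ck_on_SucI[OF _ U, where f' = "\<lambda>x. L"])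
       (auto intro: bounded_linear_imp_has_derivative[OF L])
qed

lemma Ck_on_id: "open U \<Longrightarrow> Ck_on n U (\<lambda>x. x)"
  by (rule Ck_on_bounded_linear) auto

lemma Ck_on_add:
  assumes U: "open U" and f: "Ck_on n U f" "Ck_on n U g"
  shows "Ck_on n U (\<lambda>x. f x + g x)"
  using f
proof (induction n arbitrary: f g)
  case 0
  then show ?case by (simp add: continuous_on_add)
next
  case (Suc n)
  show ?case
  proof (rule Ck_on_SucI[OF _ U])
    show "((\<lambda>x. f x + g x) has_derivative (\<lambda>v. frechet_derivative f (at x) v + frechet_derivative g (at x) v)) (at x)" if "x \<in> U" for x
      using has_derivative_add[OF Ck_on_SucD[OF Suc.prems(1) that] Ck_on_SucD[OF Suc.prems(2) that]] .
    show "Ck_on n U (\<lambda>x. frechet_derivative f (at x) v + frechet_derivative g (at x) v)" for v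
      by (rule Suc.IH) (use Suc.prems in simp_all)
  qed
qed

lemma Ck_on_bilinear:
  assumes B: "bounded_bilinear B" and U: "open U" and f: "Ck_on n U f" "Ck_on n U g"
  shows "Ck_on n U (\<lambda>x. B (f x) (g x))"
  using f
proof (induction n arbitrary: f g)
  case 0
  then show ?case using B by (simp add: bounded_bilinear.continuous_on)
next
  case (Suc n)
  show ?case
  proof (rule Ck_on_SucI[OF _ U])
    show "((\<lambda>x. B (f x) (g x)) has_derivative (\<lambda>v. B (f x) (frechet_derivative g (at x) v) + B (frechet_derivative f (at x) v) (g x))) (at x)" if "x \<in> U" for x
      using bounded_bilinear.FDERIV[OF B Ck_on_SucD[OF Suc.prems(1) that] Ck_on_SucD[OF Suc.prems(2) that]] .
    show "Ck_on n U (\<lambda>x. B (f x) (frechet_derivative g (at x) v) + B (frechet_derivative f (at x) v) (g x))" for v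
      by (intro Ck_on_add U Suc.IH)
        (use Suc.prems Ck_on_Suc_imp[OF Suc.prems(1)] Ck_on_Suc_imp[OF Suc.prems(2)] in auto)
  qed
qed

lemmas Ck_on_mult = Ck_on_bilinear[OF bounded_bilinear_mult]
lemmas Ck_on_scaleR = Ck_on_bilinear[OF bounded_bilinear_scaleR]
lemmas Ck_on_minus = Ck_on_bounded_linear_comp[OF bounded_linear_minus[OF bounded_linear_ident]]

lemma Ck_on_diff:
  "open U \<Longrightarrow> Ck_on n U f \<Longrightarrow> Ck_on n U g \<Longrightarrow> Ck_on n U (\<lambda>x. f x - g x)"
  using Ck_on_add[of U n f "\<lambda>x. - g x"] Ck_on_minus[of U n g] by simp

lemma Ck_on_sum:
  "open U \<Longrightarrow> (\<And>i. i \<in> I \<Longrightarrow> Ck_on n U (f i)) \<Longrightarrow> Ck_on n U (\<lambda>x. \<Sum>i\<in>I. f i x)"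
  by (induction I rule: infinite_finite_induct) (auto intro: Ck_on_add)

lemma Ck_on_of_real: "open U \<Longrightarrow> Ck_on n U f \<Longrightarrow> Ck_on n U (\<lambda>x. of_real (f x) :: 'a::{real_normed_algebra_1})"
  by (rule Ck_on_bounded_linear_comp[OF bounded_linear_of_real])

lemma Ck_on_vec_nth: "open U \<Longrightarrow> Ck_on n U f \<Longrightarrow> Ck_on n U (\<lambda>x. f x $ i)"
  by (rule Ck_on_bounded_linear_comp[OF bounded_linear_vec_nth])

lemma bounded_linear_axis: "bounded_linear (axis i :: 'a::real_normed_vector \<Rightarrow> 'a^'n)"
proof
  show "axis i (x + y) = axis i x + axis i y" for x y :: 'a by (simp add: axis_def vec_eq_iff)
  show "axis i (r *\<^sub>R x) = r *\<^sub>R axis i x" for r and x :: 'a by (simp add: axis_def vec_eq_iff)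
  show "\<exists>K. \<forall>x::'a. norm (axis i x :: 'a^'n) \<le> norm x * K"
    by (rule exI[of _ 1]) (simp add: norm_vec_def L2_set_def axis_def if_distrib[of norm] if_distrib[of "\<lambda>x. x\<^sup>2"] cong: if_cong)
qed

lemma vec_eq_sum_axis: "(x :: 'a::real_normed_vector^'n) = (\<Sum>i\<in>UNIV. axis i (x $ i))"
  by (simp add: vec_eq_iff axis_def if_distrib cong: if_cong)

lemma Ck_on_vec:
  assumes "open U" "\<And>i. Ck_on n U (\<lambda>x. f x $ i)"
  shows "Ck_on n U (f :: _ \<Rightarrow> 'a::real_normed_vector^'n)"
proof -
  have "Ck_on n U (\<lambda>x. \<Sum>i\<in>UNIV. axis i (f x $ i))"
    using assms by (intro Ck_on_sum Ck_on_bounded_linear_comp[OF bounded_linear_axis])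
  then show ?thesis by (simp flip: vec_eq_sum_axis)
qed

lemma Ck_on_compose:
  fixes f :: "'a::euclidean_space \<Rightarrow> 'b::euclidean_space"
  assumes U: "open U" and V: "open V" and "f ` U \<subseteq> V" and "Ck_on n U f" "Ck_on n V g"
  shows "Ck_on n U (\<lambda>x. g (f x))"
  using assms(3-)
proof (induction n arbitrary: g)
  case 0
  then show ?case by (auto intro: continuous_on_compose2)
next
  case (Suc n)
  \<comment> \<open>The direction in which g is differentiated, the derivative of f along v, moves
    with x, while \<open>Ck_on\<close> controls the derivative of g in fixed directions only.
    Expanding in the basis restores fixed directions b.\<close>
  let ?D = "\<lambda>x v. \<Sum>b\<in>Basis. (frechet_derivative f (at x) v \<bullet> b) *\<^sub>R frechet_derivative g (at (f x)) b"
  show ?case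
  proof (rule Ck_on_SucI[OF _ U])
    show "((\<lambda>x. g (f x)) has_derivative ?D x) (at x)" if "x \<in> U" for x
    proof -
      have fx: "f x \<in> V" using that Suc.prems by auto
      note g = Ck_on_SucD[OF Suc.prems(3) fx]
      have "((g \<circ> f) has_derivative frechet_derivative g (at (f x)) \<circ> frechet_derivative f (at x)) (at x)"
        by (rule diff_chain_at[OF Ck_on_SucD[OF Suc.prems(2) that] g])
      moreover have "frechet_derivative g (at (f x)) \<circ> frechet_derivative f (at x) = ?D x"
      proof
        fix v
        have lin: "linear (frechet_derivative g (at (f x)))"
          using g by (rule has_derivative_linear)
        have "frechet_derivative g (at (f x)) (frechet_derivative f (at x) v)
          = frechet_derivative g (at (f x)) (\<Sum>b\<in>Basis. (frechet_derivative f (at x) v \<bullet> b) *\<^sub>R b)"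
          by (simp add: euclidean_representation)
        also have "\<dots> = ?D x v"
          by (simp add: linear_sum[OF lin] linear_cmul[OF lin])
        finally show "(frechet_derivative g (at (f x)) \<circ> frechet_derivative f (at x)) v = ?D x v" by simp
      qed
      ultimately show ?thesis by (simp add: o_def)
    qed
    show "Ck_on n U (\<lambda>x. ?D x v)" for v
    proof (intro Ck_on_sum Ck_on_scaleR U)
      fix b :: 'b
      show "Ck_on n U (\<lambda>x. frechet_derivative f (at x) v \<bullet> b)"
        using Suc.prems(2) by (intro Ck_on_bounded_linear_comp[OF bounded_linear_inner_left] U) simp
      show "Ck_on n U (\<lambda>x. frechet_derivative g (at (f x)) b)"
        by (rule Suc.IH) (use Suc.prems(1) Suc.prems(3) Ck_on_Suc_imp[OF Suc.prems(2)] in auto)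
    qed
  qed
qed

text \<open>Differentiability gives continuity, and the induction on n never leaves a class that is
  closed under differentiation. This avoids writing down higher derivatives.\<close>

lemma Ck_on_deriv_class:
  fixes S :: "(real \<Rightarrow> 'b::real_normed_vector) set"
  assumes U: "open U" and "f \<in> S"
    and S: "\<And>f. f \<in> S \<Longrightarrow> \<exists>g\<in>S. \<forall>x\<in>U. (f has_vector_derivative g x) (at x)"
  shows "Ck_on n U f"
  using \<open>f \<in> S\<close>
proof (induction n arbitrary: f)
  case 0
  then obtain g where "\<forall>x\<in>U. (f has_vector_derivative g x) (at x)" using S by blast
  then show ?case
    by (auto intro!: continuous_at_imp_continuous_on has_vector_derivative_continuous)
next
  case (Suc n)
  obtain g where g: "g \<in> S" "\<forall>x\<in>U. (f has_vector_derivative g x) (at x)"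
    using S[OF Suc.prems] by blast
  show ?case
  proof (rule Ck_on_SucI[OF _ U])
    show "(f has_derivative (\<lambda>v. v *\<^sub>R g x)) (at x)" if "x \<in> U" for x
      using g that by (simp add: has_vector_derivative_def)
    show "Ck_on n U (\<lambda>x. v *\<^sub>R g x)" for v
      by (rule Ck_on_scaleR[OF U]) (use Suc.IH g in auto)
  qed
qed

lemma Ck_on_powr: "Ck_on n {0<..} (\<lambda>x::real. x powr a)"
proof (rule Ck_on_deriv_class[where S = "{\<lambda>x. c * x powr a |c a. True}"])
  show "(\<lambda>x::real. x powr a) \<in> {\<lambda>x. c * x powr a |c a. True}"
    by (intro CollectI exI[of _ 1] exI[of _ a]) auto
  fix f :: "real \<Rightarrow> real" assume "f \<in> {\<lambda>x. c * x powr a |c a. True}"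
  then obtain c a where f: "f = (\<lambda>x. c * x powr a)" by auto
  have "\<forall>x\<in>{0<..}. (f has_vector_derivative c * a * x powr (a - 1)) (at x)"
    unfolding f has_real_derivative_iff_has_vector_derivative[symmetric]
    by (auto intro!: derivative_eq_intros simp: powr_diff field_simps)
  then show "\<exists>g\<in>{\<lambda>x::real. c * x powr a |c a. True}. \<forall>x\<in>{0<..}. (f has_vector_derivative g x) (at x)"
    by (intro bexI[of _ "\<lambda>x. c * a * x powr (a - 1)"] CollectI) blast+
qed auto

lemma Ck_on_cos: "Ck_on n UNIV (\<lambda>x::real. cos (k * x))"
proof (rule Ck_on_deriv_class[where S = "{\<lambda>x. a * cos (k * x) + b * sin (k * x) |a b. True}"])
  show "(\<lambda>x::real. cos (k * x)) \<in> {\<lambda>x. a * cos (k * x) + b * sin (k * x) |a b. True}"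
    by (intro CollectI exI[of _ 1] exI[of _ 0]) auto
  fix f :: "real \<Rightarrow> real" assume "f \<in> {\<lambda>x. a * cos (k * x) + b * sin (k * x) |a b. True}"
  then obtain a b where f: "f = (\<lambda>x. a * cos (k * x) + b * sin (k * x))" by auto
  have "\<forall>x\<in>UNIV. (f has_vector_derivative (b * k) * cos (k * x) + (- a * k) * sin (k * x)) (at x)"
    unfolding f has_real_derivative_iff_has_vector_derivative[symmetric]
    by (auto intro!: derivative_eq_intros simp: field_simps)
  then show "\<exists>g\<in>{\<lambda>x. a * cos (k * x) + b * sin (k * x) |a b. True}. \<forall>x\<in>UNIV. (f has_vector_derivative g x) (at x)"
    by (intro bexI[of _ "\<lambda>x. (b * k) * cos (k * x) + (- a * k) * sin (k * x)"] CollectI) blast+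
qed auto

section \<open>Cutoff functions\<close>

lemma poly_times_exp_minus_tendsto_0: "((\<lambda>s. poly p s * exp (- s)) \<longlongrightarrow> 0) at_top"
  for p :: "real poly"
proof -
  have "((\<lambda>s. \<Sum>i\<le>degree p. coeff p i * (s ^ i / exp s)) \<longlongrightarrow> (\<Sum>i\<le>degree p. coeff p i * 0)) at_top"
    by (intro tendsto_intros tendsto_power_div_exp_0)
  moreover have "poly p s * exp (- s) = (\<Sum>i\<le>degree p. coeff p i * (s ^ i / exp s))" for s
    by (simp add: poly_altdef exp_minus sum_divide_distrib flip: divide_inverse)
  ultimately show ?thesis by simp
qed

text \<open>For p = 1 this is the flat function exp(-1/t). The polynomial in 1/t is carried along so
  that the family is closed under differentiation.\<close>

definition flat_exp :: "real poly \<Rightarrow> real \<Rightarrow> real" where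
  "flat_exp p t = (if t > 0 then poly p (1 / t) * exp (- (1 / t)) else 0)"

text \<open>For t > 0 the derivative of p(1/t) exp(-1/t) is t^(-2) (p - p')(1/t) exp(-1/t), and
  t^(-2) is the value of \<open>[:0,0,1:]\<close> at 1/t. At 0 the difference quotient is s p(s)
  exp(-s) with s = 1/t, which tends to 0.\<close>

lemma flat_exp_has_derivative:
  "(flat_exp p has_real_derivative flat_exp ([:0,0,1:] * (p - pderiv p)) t) (at t)"
proof (cases t "0::real" rule: linorder_cases)
  case less
  have "((\<lambda>t. 0) has_real_derivative 0) (at t)" by simp
  then have "(flat_exp p has_real_derivative 0) (at t)"
    by (rule has_field_derivative_transform_within_open[of _ _ _ "{..<0}"])
      (use less in \<open>auto simp: flat_exp_def\<close>)
  then show ?thesis using less by (simp add: flat_exp_def)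
next
  case greater
  have "((\<lambda>t. poly p (1 / t) * exp (- (1 / t))) has_real_derivative
      flat_exp ([:0,0,1:] * (p - pderiv p)) t) (at t)"
    using greater
    by (auto intro!: derivative_eq_intros DERIV_chain2[OF poly_DERIV]
        simp: flat_exp_def field_simps power2_eq_square)
  then show ?thesis
    by (rule has_field_derivative_transform_within_open[of _ _ _ "{0<..}"])
      (use greater in \<open>auto simp: flat_exp_def\<close>)
next
  case equal
  have "((\<lambda>t. flat_exp p t / t) \<longlongrightarrow> 0) (at_right 0)"
  proof (rule Lim_transform_eventually)
    have "filterlim (\<lambda>t::real. 1 / t) at_top (at_right 0)"
      using filterlim_inverse_at_top_right by (simp add: inverse_eq_divide)
    then show "((\<lambda>t. poly ([:0,1:] * p) (1 / t) * exp (- (1 / t))) \<longlongrightarrow> 0) (at_right 0)"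
      by (rule filterlim_compose[OF poly_times_exp_minus_tendsto_0])
    show "\<forall>\<^sub>F t in at_right 0. poly ([:0,1:] * p) (1 / t) * exp (- (1 / t)) = flat_exp p t / t"
      by (rule eventually_at_right_less[THEN eventually_mono]) (auto simp: flat_exp_def)
  qed
  moreover have "((\<lambda>t. flat_exp p t / t) \<longlongrightarrow> 0) (at_left 0)"
    by (rule Lim_transform_eventually[OF tendsto_const])
      (auto simp: eventually_at_filter flat_exp_def)
  ultimately show ?thesis
    using equal by (simp add: has_field_derivative_iff filterlim_split_at flat_exp_def)
qed

lemma Ck_on_flat_exp: "Ck_on n UNIV (flat_exp p)"
proof (rule Ck_on_deriv_class[where S = "range flat_exp"])
  fix f :: "real \<Rightarrow> real" assume "f \<in> range flat_exp"
  then obtain p where "f = flat_exp p" by auto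
  then show "\<exists>g\<in>range flat_exp. \<forall>x\<in>UNIV. (f has_vector_derivative g x) (at x)"
    using flat_exp_has_derivative[of p]
    by (auto simp: has_real_derivative_iff_has_vector_derivative)
qed auto

text \<open>A smooth transition whose window is the interval from 1 to 2. The two summands of the
  denominator are positive for t > 1 and for t < 2 respectively, so it never vanishes.\<close>

definition smooth_step :: "real \<Rightarrow> real" where
  "smooth_step t = flat_exp 1 (t - 1) / (flat_exp 1 (t - 1) + flat_exp 1 (2 - t))"

lemma smooth_step_denom_pos: "0 < flat_exp 1 (t - 1) + flat_exp 1 (2 - t)"
  by (cases "t > 1"; cases "t < 2") (auto simp: flat_exp_def add_pos_pos)

lemma smooth_step_eq_0: "t \<le> 1 \<Longrightarrow> smooth_step t = 0"
  by (simp add: smooth_step_def flat_exp_def)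

lemma smooth_step_eq_1: "t \<ge> 2 \<Longrightarrow> smooth_step t = 1"
  by (simp add: smooth_step_def flat_exp_def)

lemma smooth_step_bounds: "0 \<le> smooth_step t" "smooth_step t \<le> 1"
  using smooth_step_denom_pos[of t]
  by (auto simp: smooth_step_def flat_exp_def divide_simps)

lemma Ck_on_smooth_step: "Ck_on n UNIV smooth_step"
proof -
  have A: "Ck_on n UNIV (\<lambda>t. flat_exp 1 (t - 1))"
    by (rule Ck_on_compose[of UNIV UNIV "\<lambda>t. t - 1"]) (rule open_UNIV subset_UNIV Ck_on_diff Ck_on_id Ck_on_const Ck_on_flat_exp)+
  have B: "Ck_on n UNIV (\<lambda>t. flat_exp 1 (2 - t))"
    by (rule Ck_on_compose[of UNIV UNIV "\<lambda>t. 2 - t"]) (rule open_UNIV subset_UNIV Ck_on_diff Ck_on_id Ck_on_const Ck_on_flat_exp)+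
  have C: "Ck_on n UNIV (\<lambda>t. (flat_exp 1 (t - 1) + flat_exp 1 (2 - t)) powr (-1))"
    by (rule Ck_on_compose[OF _ _ _ _ Ck_on_powr])
      (auto intro: Ck_on_add A B simp: smooth_step_denom_pos)
  have "Ck_on n UNIV (\<lambda>t. flat_exp 1 (t - 1) * (flat_exp 1 (t - 1) + flat_exp 1 (2 - t)) powr (-1))"
    by (intro Ck_on_mult A C) auto
  then show ?thesis
    by (rule Ck_on_cong[rotated 2])
      (use smooth_step_denom_pos in \<open>auto simp: smooth_step_def powr_minus divide_inverse abs_of_pos\<close>)
qed

lemma smooth_step_deriv:
  "(smooth_step has_real_derivative deriv smooth_step t) (at t)"
  "continuous_on UNIV (deriv smooth_step)"
  "t \<le> 1 \<or> t \<ge> 2 \<Longrightarrow> deriv smooth_step t = 0"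
  "\<exists>C>0. \<forall>t. \<bar>deriv smooth_step t\<bar> \<le> C"
proof -
  have C2: "Ck_on (Suc 0) UNIV smooth_step" by (rule Ck_on_smooth_step)
  have d: "(smooth_step has_real_derivative deriv smooth_step t) (at t)" for t
    using C2 by (simp add: DERIV_deriv_iff_real_differentiable)
  then show "(smooth_step has_real_derivative deriv smooth_step t) (at t)" .
  have fr: "frechet_derivative smooth_step (at t) 1 = deriv smooth_step t" for t
    using frechet_derivative_at[OF d[of t, unfolded has_field_derivative_def]] by (metis mult_1_right)
  show cont: "continuous_on UNIV (deriv smooth_step)"
    using C2 unfolding Ck_on.simps by (metis (no_types, lifting) ext fr)
  have zero: "deriv smooth_step t = 0" if t: "t < 1 \<or> t > 2" for t
  proof -
    have "(smooth_step has_real_derivative 0) (at t)"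
      using t
    proof
      assume "t < 1"
      have "((\<lambda>t. 0) has_real_derivative 0) (at t)" by simp
      then show ?thesis
        by (rule has_field_derivative_transform_within_open[of _ _ _ "{..<1}"])
          (use \<open>t < 1\<close> in \<open>auto simp: smooth_step_eq_0\<close>)
    next
      assume "t > 2"
      have "((\<lambda>t. 1) has_real_derivative 0) (at t)" by simp
      then show ?thesis
        by (rule has_field_derivative_transform_within_open[of _ _ _ "{2<..}"])
          (use \<open>t > 2\<close> in \<open>auto simp: smooth_step_eq_1\<close>)
    qed
    then show ?thesis using d DERIV_unique by blast
  qed
  have "closed {t. deriv smooth_step t = 0}"
    using continuous_closed_vimage[of "{0::real}" "deriv smooth_step"] cont
    by (simp add: vimage_def continuous_on_eq_continuous_at)
  \<comment> \<open>The end points 1 and 2 are limits of points where the derivative is known to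
    vanish, so continuity settles them.\<close>
  then have cl: "closure ({..<1} \<union> {2<..}) \<subseteq> {t. deriv smooth_step t = 0}"
    by (intro closure_minimal) (auto simp: zero)
  then show zero': "t \<le> 1 \<or> t \<ge> 2 \<Longrightarrow> deriv smooth_step t = 0" for t
    by (auto simp: closure_Un)
  have "bounded (deriv smooth_step ` {1..2})"
    by (intro compact_imp_bounded compact_continuous_image continuous_on_subset[OF cont]) auto
  then obtain C where C: "\<And>t. t \<in> {1..2} \<Longrightarrow> \<bar>deriv smooth_step t\<bar> \<le> C"
    unfolding bounded_iff by (metis imageI real_norm_def)
  have "\<bar>deriv smooth_step t\<bar> \<le> max C 1" for t
  proof (cases "t \<in> {1..2}")
    case True
    then show ?thesis using C[OF True] by linarith
  next
    case False
    then have "deriv smooth_step t = 0" by (intro zero') auto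
    then show ?thesis by simp
  qed
  then show "\<exists>C>0. \<forall>t. \<bar>deriv smooth_step t\<bar> \<le> C" by (intro exI[of _ "max C 1"]) auto
qed

section \<open>Test functions\<close>

definition test_on :: "'a::euclidean_space set \<Rightarrow> ('a \<Rightarrow> 'b::real_normed_vector) \<Rightarrow> bool" where
  "test_on W \<phi> \<longleftrightarrow> (\<forall>n. Ck_on n UNIV \<phi>) \<and>
     (\<exists>K. compact K \<and> K \<subseteq> W \<and> (\<forall>x. x \<notin> K \<longrightarrow> \<phi> x = 0))"

text \<open>A function of the squared norm, hence smooth at the origin. The factor 2 maps the window
  of \<open>smooth_step\<close> to the radii from r / sqrt 2 to r.\<close>

definition ball_cutoff :: "real \<Rightarrow> 'a::euclidean_space \<Rightarrow> real" where
  "ball_cutoff r x = 1 - smooth_step (2 * (x \<bullet> x) / r\<^sup>2)"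

lemma Ck_on_inner_self: "open U \<Longrightarrow> Ck_on n U (\<lambda>x. x \<bullet> x)"
  by (rule Ck_on_bilinear[OF bounded_bilinear_inner]) (auto intro: Ck_on_id)

lemma Ck_on_ball_cutoff: "Ck_on n UNIV (ball_cutoff r :: 'a::euclidean_space \<Rightarrow> real)"
proof -
  have "Ck_on n UNIV (\<lambda>x::'a. smooth_step ((2 / r\<^sup>2) * (x \<bullet> x)))"
    by (rule Ck_on_compose[of UNIV UNIV "\<lambda>x. (2 / r\<^sup>2) * (x \<bullet> x)", OF _ _ _ _ Ck_on_smooth_step])
      (rule Ck_on_mult[OF _ Ck_on_const Ck_on_inner_self] open_UNIV subset_UNIV)+
  then show ?thesis unfolding ball_cutoff_def by (intro Ck_on_diff) auto
qed

lemma ball_cutoff_eq_0: "r > 0 \<Longrightarrow> norm x \<ge> r \<Longrightarrow> ball_cutoff r x = 0"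
proof -
  assume "r > 0" "norm x \<ge> r"
  then have "r\<^sup>2 \<le> (norm x)\<^sup>2" by (intro power_mono) auto
  then have "2 * (x \<bullet> x) / r\<^sup>2 \<ge> 2" using \<open>r > 0\<close> by (simp add: divide_simps power2_norm_eq_inner)
  then show ?thesis by (simp add: ball_cutoff_def smooth_step_eq_1)
qed

lemma ball_cutoff_eq_1: "r > 0 \<Longrightarrow> norm x \<le> r / 2 \<Longrightarrow> ball_cutoff r x = 1"
proof -
  assume *: "r > 0" "norm x \<le> r / 2"
  then have "(norm x)\<^sup>2 \<le> (r / 2)\<^sup>2" by (intro power_mono) auto
  then have "2 * (x \<bullet> x) / r\<^sup>2 \<le> 1"
    using \<open>r > 0\<close> inner_ge_zero[of x]
    by (simp add: divide_simps power2_norm_eq_inner power_divide del: inner_ge_zero)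
  then show ?thesis by (simp add: ball_cutoff_def smooth_step_eq_0)
qed

lemma ball_cutoff_bounds: "0 \<le> ball_cutoff r x" "ball_cutoff r x \<le> 1"
  using smooth_step_bounds by (auto simp: ball_cutoff_def)

lemma test_on_subset: "test_on V \<phi> \<Longrightarrow> V \<subseteq> W \<Longrightarrow> test_on W \<phi>"
  unfolding test_on_def by blast

lemma test_on_Ck: "test_on W \<phi> \<Longrightarrow> Ck_on n UNIV \<phi>"
  unfolding test_on_def by blast

text \<open>W and the complement of K are open and together cover the space, and f is of class C^n
  on each of them.\<close>

lemma Ck_on_extend_zero:
  assumes W: "open W" and K: "closed K" "K \<subseteq> W" "\<And>x. x \<notin> K \<Longrightarrow> f x = 0" and f: "Ck_on n W f"
  shows "Ck_on n UNIV f"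
proof (rule Ck_on_local)
  fix x
  show "\<exists>V. open V \<and> x \<in> V \<and> Ck_on n V f"
  proof (cases "x \<in> W")
    case True
    then show ?thesis using W f by blast
  next
    case False
    have "Ck_on n (- K) f"
      by (rule Ck_on_cong[of _ "\<lambda>x. 0"]) (use K in auto)
    then show ?thesis using K False by (intro exI[of _ "- K"]) auto
  qed
qed

text \<open>Lets a compactly supported factor be multiplied by a field that is controlled on W only,
  whatever values that field has elsewhere.\<close>

lemma Ck_on_bilinear_extend_zero:
  assumes B: "bounded_bilinear B" and W: "open W"
    and K: "compact K" "K \<subseteq> W" "\<And>x. x \<notin> K \<Longrightarrow> \<phi> x = 0"
    and f: "Ck_on n W \<phi>" "Ck_on n W f"
  shows "Ck_on n UNIV (\<lambda>x. B (\<phi> x) (f x))"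
  by (rule Ck_on_extend_zero[OF W compact_imp_closed[OF K(1)] K(2) _ Ck_on_bilinear[OF B W f]])
    (simp add: K(3) bounded_bilinear.zero_left[OF B])

lemma test_on_compose_linear:
  assumes L: "bounded_linear L" and \<phi>: "test_on W \<phi>"
  shows "test_on W (\<lambda>x. L (\<phi> x))"
proof -
  obtain K where K: "compact K" "K \<subseteq> W" "\<And>x. x \<notin> K \<Longrightarrow> \<phi> x = 0"
    using \<phi> unfolding test_on_def by blast
  have "Ck_on n UNIV (\<lambda>x. L (\<phi> x))" for n
    by (rule Ck_on_bounded_linear_comp[OF L open_UNIV test_on_Ck[OF \<phi>]])
  moreover have "L (\<phi> x) = 0" if "x \<notin> K" for x
    using K(3)[OF that] L by (simp add: linear_simps)
  ultimately show ?thesis unfolding test_on_def using K by blast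
qed

lemma frechet_derivative_eq_0_open:
  assumes "open U" "x \<in> U" "\<And>y. y \<in> U \<Longrightarrow> f y = 0"
  shows "frechet_derivative f (at x) v = 0"
proof -
  have "frechet_derivative f (at x) = frechet_derivative (\<lambda>x. 0) (at x)"
    by (rule frechet_derivative_cong_open[OF assms(1,2)]) (use assms in auto)
  then show ?thesis by simp
qed

lemma test_on_derivative:
  assumes \<phi>: "test_on W \<phi>"
  shows "test_on W (\<lambda>x. frechet_derivative \<phi> (at x) v)"
proof -
  obtain K where K: "compact K" "K \<subseteq> W" "\<And>x. x \<notin> K \<Longrightarrow> \<phi> x = 0"
    using \<phi> unfolding test_on_def by blast
  have "Ck_on n UNIV (\<lambda>x. frechet_derivative \<phi> (at x) v)" for n
    using test_on_Ck[OF \<phi>, of "Suc n"] by simp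
  moreover have "frechet_derivative \<phi> (at x) v = 0" if "x \<notin> K" for x
    by (rule frechet_derivative_eq_0_open[of "- K"]) (use K that compact_imp_closed in auto)
  ultimately show ?thesis unfolding test_on_def using K by blast
qed

section \<open>Integration by parts\<close>

lemma has_bochner_integral_lborel_lebesgue:
  fixes f :: "'a::euclidean_space \<Rightarrow> 'b::{banach, second_countable_topology}"
  assumes "has_bochner_integral lborel f z"
  shows "has_bochner_integral lebesgue f z"
proof -
  have "f \<in> borel_measurable lborel" using assms by (auto simp: has_bochner_integral_iff)
  then show ?thesis
    using assms integrable_completion[of f lborel] integral_completion[of f lborel]
    unfolding has_bochner_integral_iff by simp
qed

lemma lborel_integral_translate:
  fixes f :: "'a::euclidean_space \<Rightarrow> 'b::{banach, second_countable_topology}"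
  assumes "integrable lborel f"
  shows "integrable lborel (\<lambda>x. f (c + x))" "integral\<^sup>L lborel (\<lambda>x. f (c + x)) = integral\<^sup>L lborel f"
proof -
  have [measurable]: "f \<in> borel_measurable borel" using borel_measurable_integrable[OF assms] by simp
  have "integrable (distr lborel borel ((+) c)) f"
    using assms by (simp add: lborel_distr_plus)
  then show "integrable lborel (\<lambda>x. f (c + x))" by (simp add: integrable_distr_eq)
  have "integral\<^sup>L lborel f = integral\<^sup>L (distr lborel borel ((+) c)) f"
    by (simp add: lborel_distr_plus)
  also have "\<dots> = integral\<^sup>L lborel (\<lambda>x. f (c + x))" by (simp add: integral_distr)
  finally show "integral\<^sup>L lborel (\<lambda>x. f (c + x)) = integral\<^sup>L lborel f" by simp
qed

lemma integrable_compact_support: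
  fixes f :: "'a::euclidean_space \<Rightarrow> 'b::{banach, second_countable_topology}"
  assumes "continuous_on UNIV f" "compact K" "\<And>x. x \<notin> K \<Longrightarrow> f x = 0"
  shows "integrable lborel f"
proof -
  have "integrable lborel (\<lambda>x. indicator K x *\<^sub>R f x)"
    by (intro borel_integrable_compact continuous_on_subset[OF assms(1)] assms) auto
  also have "(\<lambda>x. indicator K x *\<^sub>R f x) = f" using assms by (auto simp: indicator_def fun_eq_iff)
  finally show ?thesis .
qed

lemma bounded_compact_support:
  assumes "continuous_on UNIV f" "compact K" "\<And>x. x \<notin> K \<Longrightarrow> f x = 0"
  obtains C where "C > 0" "\<And>x. norm (f x) \<le> C"
proof -
  have "bounded (f ` K)"
    by (intro compact_imp_bounded compact_continuous_image continuous_on_subset[OF assms(1)] assms) auto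
  then obtain C where "\<And>x. x \<in> K \<Longrightarrow> norm (f x) \<le> C" unfolding bounded_iff by blast
  then have "norm (f x) \<le> max C 1" for x
    using assms(3)[of x] by (cases "x \<in> K") (auto simp: le_max_iff_disj)
  then show ?thesis by (intro that[of "max C 1"]) auto
qed

text \<open>By translation invariance every difference quotient of w along v has integral 0. The
  quotients converge to the derivative and are bounded by one constant on one ball, so dominated
  convergence carries the 0 to the limit.\<close>

lemma has_bochner_integral_derivative_compact_support:
  fixes w :: "'a::euclidean_space \<Rightarrow> 'b::{banach, second_countable_topology}"
  assumes w: "Ck_on 1 UNIV w" and K: "compact K" "\<And>x. x \<notin> K \<Longrightarrow> w x = 0"
  shows "has_bochner_integral lborel (\<lambda>x. frechet_derivative w (at x) v) 0"
proof -
  let ?D = "\<lambda>x. frechet_derivative w (at x) v"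
  let ?t = "\<lambda>n::nat. inverse (real (Suc n))"
  have w1: "Ck_on (Suc 0) UNIV w" using w by simp
  have der: "(w has_derivative frechet_derivative w (at x)) (at x)" for x
    using Ck_on_SucD[OF w1] by simp
  have cw: "continuous_on UNIV w" using Ck_on_Suc_imp_continuous[OF w1] .
  have cD: "continuous_on UNIV ?D" using w1 by simp
  have D0: "?D x = 0" if "x \<notin> K" for x
    by (rule frechet_derivative_eq_0_open[of "- K"]) (use K that compact_imp_closed in auto)
  obtain C where C: "C > 0" "\<And>x. norm (?D x) \<le> C"
    using bounded_compact_support[OF cD K(1) D0] by blast
  obtain R where R: "\<And>x. x \<in> K \<Longrightarrow> norm x \<le> R"
    using compact_imp_bounded[OF K(1)] unfolding bounded_iff by blast
  have iw: "integrable lborel w" by (rule integrable_compact_support[OF cw K])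
  have affine: "((\<lambda>s. s *\<^sub>R v + x) has_derivative (\<lambda>h. h *\<^sub>R v)) (at s within S)" for x s and S :: "real set"
    by (auto intro!: derivative_eq_intros)
  have line: "norm (w (t *\<^sub>R v + x) - w x) \<le> C * t" if "t > 0" for t x
  proof -
    have "norm ((\<lambda>s. w (s *\<^sub>R v + x)) t - (\<lambda>s. w (s *\<^sub>R v + x)) 0) \<le> C * norm (t - 0)"
    proof (rule differentiable_bound[of "{0..t}" _ "\<lambda>s h. h *\<^sub>R ?D (s *\<^sub>R v + x)"])
      fix s assume "s \<in> {0..t}"
      have "((\<lambda>s. w (s *\<^sub>R v + x)) has_derivative (\<lambda>h. frechet_derivative w (at (s *\<^sub>R v + x)) (h *\<^sub>R v))) (at s within {0..t})"
        by (rule has_derivative_compose[OF affine der])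
      then show "((\<lambda>s. w (s *\<^sub>R v + x)) has_derivative (\<lambda>h. h *\<^sub>R ?D (s *\<^sub>R v + x))) (at s within {0..t})"
        using linear_cmul[OF has_derivative_linear[OF der]] by simp
      show "onorm (\<lambda>h. h *\<^sub>R ?D (s *\<^sub>R v + x)) \<le> C"
      proof (rule onorm_le)
        show "norm (h *\<^sub>R ?D (s *\<^sub>R v + x)) \<le> C * norm h" for h
          using mult_left_mono[OF C(2)[of "s *\<^sub>R v + x"] abs_ge_zero[of h]]
          by (simp only: norm_scaleR real_norm_def mult.commute[of C])
      qed
    qed (use that in auto)
    then show ?thesis using that by simp
  qed
  have "(\<lambda>n. ?t n) \<longlonglongrightarrow> 0" by (rule LIMSEQ_inverse_real_of_nat)
  have lim: "(\<lambda>n. (w (?t n *\<^sub>R v + x) - w x) /\<^sub>R ?t n) \<longlonglongrightarrow> ?D x" for x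
  proof -
    have "((\<lambda>s. w (s *\<^sub>R v + x)) has_derivative (\<lambda>h. h *\<^sub>R ?D x)) (at 0)"
      using has_derivative_compose[OF affine[of x 0 UNIV] der] linear_cmul[OF has_derivative_linear[OF der]]
      by simp
    then have L: "((\<lambda>h. norm (w (h *\<^sub>R v + x) - w x - h *\<^sub>R ?D x) / norm h) \<longlongrightarrow> 0) (at 0)"
      by (simp add: has_derivative_at)
    have E: "norm (w (h *\<^sub>R v + x) - w x - h *\<^sub>R ?D x) / norm h
        = norm ((w (h *\<^sub>R v + x) - w x) /\<^sub>R h - ?D x)" if "h \<noteq> 0" for h
    proof -
      have "(w (h *\<^sub>R v + x) - w x) /\<^sub>R h - ?D x = (w (h *\<^sub>R v + x) - w x - h *\<^sub>R ?D x) /\<^sub>R h"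
        using that by (simp add: scaleR_diff_right)
      then show ?thesis by (simp add: divide_inverse mult.commute)
    qed
    have "((\<lambda>h. norm ((w (h *\<^sub>R v + x) - w x) /\<^sub>R h - ?D x)) \<longlongrightarrow> 0) (at 0)"
      by (rule Lim_transform_eventually[OF L]) (simp add: eventually_at_filter E del: real_norm_def)
    then have "((\<lambda>h. (w (h *\<^sub>R v + x) - w x) /\<^sub>R h) \<longlongrightarrow> ?D x) (at 0)"
      by (rule LIM_zero_cancel[OF tendsto_norm_zero_cancel])
    then show ?thesis
      by (rule filterlim_compose) (intro filterlim_atI LIMSEQ_inverse_real_of_nat, simp)
  qed
  let ?q = "\<lambda>n x. (w (?t n *\<^sub>R v + x) - w x) /\<^sub>R ?t n"
  \<comment> \<open>The steps \<open>?t n\<close> are at most 1, so for |x| > R + |v| both x and its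
    translate lie outside K.\<close>
  let ?g = "\<lambda>x. C * indicator (cball 0 (R + norm v)) x :: real"
  have iq: "integrable lborel (?q n)" and q0: "integral\<^sup>L lborel (?q n) = 0" for n
    using iw lborel_integral_translate[OF iw] by auto
  have bound: "norm (?q n x) \<le> ?g x" for n x
  proof (cases "x \<in> cball 0 (R + norm v)")
    case True
    have "norm (?q n x) = norm (w (?t n *\<^sub>R v + x) - w x) / ?t n"
      by (subst norm_scaleR) (simp add: divide_inverse mult.commute del: of_nat_Suc)
    also have "\<dots> \<le> C" using line[of "?t n" x] by (simp add: field_simps)
    finally show ?thesis using True by simp
  next
    case False
    have lt: "R + norm v < norm x" using False by simp
    have "x \<notin> K"
    proof
      assume "x \<in> K"
      then show False using R[of x] lt norm_ge_zero[of v] by linarith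
    qed
    moreover have "?t n *\<^sub>R v + x \<notin> K"
    proof
      assume "?t n *\<^sub>R v + x \<in> K"
      then have "norm (?t n *\<^sub>R v + x) \<le> R" by (rule R)
      moreover have "norm x \<le> norm (?t n *\<^sub>R v + x) + norm (?t n *\<^sub>R v)"
        by (metis add.commute add_diff_cancel_right' norm_triangle_ineq4)
      moreover have "norm (?t n *\<^sub>R v) \<le> norm v"
        by (simp add: mult_left_le_one_le field_simps)
      ultimately show False using lt by linarith
    qed
    ultimately show ?thesis using K(2) False by simp
  qed
  have ig: "integrable lborel ?g"
    using emeasure_lborel_cball_finite by (intro integrable_mult_right integrable_real_indicator) auto
  have mD: "?D \<in> borel_measurable lborel" using cD by (simp add: borel_measurable_continuous_onI)
  have "integrable lborel ?D" "(\<lambda>n. integral\<^sup>L lborel (?q n)) \<longlonglongrightarrow> integral\<^sup>L lborel ?D"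
    using integrable_dominated_convergence[OF mD _ ig, of ?q] integral_dominated_convergence[OF mD _ ig, of ?q]
      iq lim bound by (auto dest: borel_measurable_integrable)
  then show ?thesis
    unfolding q0 LIMSEQ_const_iff by (simp add: has_bochner_integral_iff)
qed

lemma integration_by_parts_test:
  fixes \<phi> f :: "'a::euclidean_space \<Rightarrow> 'b::{real_normed_algebra, banach, second_countable_topology}"
  assumes W: "open W" and K: "compact K" "K \<subseteq> W" "\<And>x. x \<notin> K \<Longrightarrow> \<phi> x = 0"
    and \<phi>: "Ck_on 1 W \<phi>" and f: "Ck_on 1 W f"
  shows "has_bochner_integral lebesgue
    (\<lambda>x. frechet_derivative \<phi> (at x) v * f x + \<phi> x * frechet_derivative f (at x) v) 0"
proof -
  let ?w = "\<lambda>x. \<phi> x * f x"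
  have C: "Ck_on 1 UNIV ?w"
    by (rule Ck_on_bilinear_extend_zero[OF bounded_bilinear_mult W K \<phi> f])
  have "frechet_derivative ?w (at x) v
      = frechet_derivative \<phi> (at x) v * f x + \<phi> x * frechet_derivative f (at x) v" for x
  proof (cases "x \<in> W")
    case True
    have "(?w has_derivative (\<lambda>v. \<phi> x * frechet_derivative f (at x) v
        + frechet_derivative \<phi> (at x) v * f x)) (at x)"
      by (intro has_derivative_mult Ck_on_SucD[of 0 W, OF _ True]) (use \<phi> f in simp_all)
    then show ?thesis by (simp add: frechet_derivative_at[symmetric])
  next
    case False
    \<comment> \<open>Off W the derivative of f is an unspecified value, but it is multiplied by
      \<phi> x = 0; all other terms vanish on the open complement of K.\<close>
    then have x: "x \<in> - K" using K by auto
    have o: "open (- K)" using K(1) compact_imp_closed by auto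
    have "frechet_derivative ?w (at x) v = 0" "frechet_derivative \<phi> (at x) v = 0" "\<phi> x = 0"
      using frechet_derivative_eq_0_open[OF o x, of ?w] frechet_derivative_eq_0_open[OF o x, of \<phi>] K(3) x by auto
    then show ?thesis by simp
  qed
  then show ?thesis
    using has_bochner_integral_lborel_lebesgue[OF has_bochner_integral_derivative_compact_support[OF C K(1), of v]] K(3)
    by simp
qed

text \<open>The curl is formally self-adjoint for \<open>cdot\<close>: the sign produced by
  integration by parts is compensated by the antisymmetry of the Levi-Civita symbol.\<close>

lemma curl_by_parts:
  assumes W: "open W" and K: "compact K" "K \<subseteq> W" "\<And>x. x \<notin> K \<Longrightarrow> h x = 0"
    and h: "Ck_on 1 W h" and X: "Ck_on 1 W X"
  shows "has_bochner_integral lebesgue (\<lambda>x. cdot (curl h x) (X x) - cdot (h x) (curl X x)) 0"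
proof -
  let ?I = "\<lambda>p q l x. partial p (\<lambda>y. h y $ q) x * X x $ l + h x $ q * partial p (\<lambda>y. X y $ l) x"
  have "has_bochner_integral lebesgue (?I p q l) 0" for p q l
    unfolding partial_def
    by (rule integration_by_parts_test[OF W K(1,2)])
      (use W h X K in \<open>auto intro: Ck_on_vec_nth simp del: Ck_on.simps\<close>)
  then have "has_bochner_integral lebesgue
     (\<lambda>x. \<Sum>l\<in>UNIV. \<Sum>p\<in>UNIV. \<Sum>q\<in>UNIV. levi_civita l p q * ?I p q l x)
     (\<Sum>l\<in>UNIV. \<Sum>p\<in>UNIV. \<Sum>q\<in>UNIV. levi_civita l p q * 0)"
    by (intro has_bochner_integral_sum has_bochner_integral_mult_right)
  moreover have "(\<Sum>l\<in>UNIV. \<Sum>p\<in>UNIV. \<Sum>q\<in>UNIV. levi_civita l p q * ?I p q l x)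
     = cdot (curl h x) (X x) - cdot (h x) (curl X x)" for x
    by (simp add: cdot_def curl_def sum_3 levi_civita_def algebra_simps)
  ultimately show ?thesis by simp
qed

section \<open>Functions with vanishing integrals\<close>

text \<open>Boxes form an intersection-stable generator of the Borel sets, and the sets over which f
  integrates to 0 form a Dynkin system. So the integral vanishes over every Borel set.\<close>

lemma AE_eq_0_if_integral_boxes_eq_0:
  fixes f :: "'a::euclidean_space \<Rightarrow> 'b::{banach, second_countable_topology}"
  assumes f: "integrable lborel f" and box: "\<And>a b. (\<integral>x\<in>box a b. f x \<partial>lborel) = 0"
  shows "AE x in lborel. f x = 0"
proof (rule sigma_finite_measure.density_zero[OF sigma_finite_lborel f])
  have [measurable]: "f \<in> borel_measurable borel" using borel_measurable_integrable[OF f] by simp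
  let ?E = "range (\<lambda>(a, b). box a b::'a set)"
  let ?A = "\<lambda>n::nat. box (- (real n *\<^sub>R One)) (real n *\<^sub>R One) :: 'a set"
  have set_int: "set_integrable lborel A f" if "A \<in> sets borel" for A
    using f that unfolding set_integrable_def by (intro integrable_mult_indicator) auto
  \<comment> \<open>Closure under complements needs the integral over the whole space, which is the
    limit over an exhaustion by boxes.\<close>
  have "(\<lambda>n. \<integral>x\<in>?A n. f x \<partial>lborel) \<longlonglongrightarrow> (\<integral>x\<in>(\<Union>n. ?A n). f x \<partial>lborel)"
  proof (rule set_integral_cont_up)
    show "incseq ?A"
      unfolding incseq_def by (intro allI impI subset_box_imp(4)) (auto simp: inner_sum_left_Basis)
  qed (auto intro: set_int)
  then have "(\<integral>x\<in>(\<Union>n. ?A n). f x \<partial>lborel) = 0"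
    by (simp add: box LIMSEQ_const_iff)
  then have univ: "(\<integral>x. f x \<partial>lborel) = 0"
    unfolding UN_box_eq_UNIV by (simp add: set_lebesgue_integral_def)
  fix A :: "'a set" assume A: "A \<in> sets lborel"
  have "Int_stable ?E" by (auto simp: Int_stable_def box_Int_box)
  moreover have "?E \<subseteq> Pow UNIV" by simp
  moreover have "A \<in> sigma_sets UNIV ?E" using A by (simp add: borel_eq_box)
  ultimately show "(\<integral>x\<in>A. f x \<partial>lborel) = 0"
  proof (induction rule: sigma_sets_induct_disjoint)
    case (basic A)
    then show ?case using box by auto
  next
    case empty
    show ?case by (simp add: set_lebesgue_integral_def)
  next
    case (compl A)
    then have [measurable]: "A \<in> sets borel" by (simp add: borel_eq_box)
    have "(\<integral>x\<in>(UNIV - A) \<union> A. f x \<partial>lborel) = (\<integral>x\<in>UNIV - A. f x \<partial>lborel) + (\<integral>x\<in>A. f x \<partial>lborel)"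
      by (intro set_integral_Un set_int) auto
    then show ?case using compl univ by (simp add: set_lebesgue_integral_def[of _ UNIV])
  next
    case (union A)
    then have [measurable]: "A i \<in> sets borel" for i by (auto simp: borel_eq_box)
    have "(\<integral>x\<in>(\<Union>i. A i). f x \<partial>lborel) = (\<Sum>i. \<integral>x\<in>A i. f x \<partial>lborel)"
      using union(1) by (intro lebesgue_integral_countable_add set_int) (auto simp: disjoint_family_on_def)
    then show ?case using union by simp
  qed
qed

section \<open>Integrability and parameter integrals\<close>

text \<open>The function is dominated by the sum of the step functions with value \<open>a n\<close>
  on \<open>A n\<close>, which is integrated term by term; the sets may overlap.\<close>

lemma integrable_by_shells:
  fixes f :: "'a \<Rightarrow> real" and A :: "nat \<Rightarrow> 'a set"
  assumes [measurable]: "f \<in> borel_measurable M" "\<And>n. A n \<in> sets M"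
    and nn: "\<And>x. 0 \<le> f x" "\<And>n. 0 \<le> a n"
    and le: "\<And>x. x \<in> space M \<Longrightarrow> f x \<noteq> 0 \<Longrightarrow> \<exists>n. x \<in> A n \<and> f x \<le> a n"
    and fin: "\<And>n. emeasure M (A n) = ennreal (m n)" "\<And>n. 0 \<le> m n"
    and summ: "summable (\<lambda>n. a n * m n)"
  shows "integrable M f"
proof (rule integrableI_bounded)
  have "(\<integral>\<^sup>+x. ennreal (norm (f x)) \<partial>M) \<le> (\<integral>\<^sup>+x. (\<Sum>n. ennreal (a n) * indicator (A n) x) \<partial>M)"
  proof (rule nn_integral_mono)
    fix x assume x: "x \<in> space M"
    show "ennreal (norm (f x)) \<le> (\<Sum>n. ennreal (a n) * indicator (A n) x)"
    proof (cases "f x = 0")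
      case False
      then obtain n where n: "x \<in> A n" "f x \<le> a n" using le x by blast
      define g where "g = (\<lambda>n. ennreal (a n) * indicator (A n) x)"
      have "ennreal (norm (f x)) \<le> g n"
        using n nn by (simp add: ennreal_leI g_def)
      also have "\<dots> \<le> suminf g"
        using sum_le_suminf[of g "{n}"] by (simp add: summableI)
      finally show ?thesis by (simp add: g_def)
    qed simp
  qed
  also have "\<dots> = (\<Sum>n. ennreal (a n) * emeasure M (A n))"
    by (subst nn_integral_suminf) (auto simp: nn_integral_cmult)
  also have "\<dots> = (\<Sum>n. ennreal (a n * m n))" using fin nn by (simp add: ennreal_mult)
  also have "\<dots> = ennreal (\<Sum>n. a n * m n)" using summ fin nn by (intro suminf_ennreal2) auto
  also have "\<dots> < \<infinity>" by simp
  finally show "(\<integral>\<^sup>+x. ennreal (norm (f x)) \<partial>M) < \<infinity>" .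
qed simp

lemma prod_UNIV_3: "(\<Prod>i\<in>UNIV. f i) = f 1 * f 2 * f (3::3)"
  unfolding UNIV_3 by (simp add: mult.assoc)

lemma emeasure_lborel_cbox_cart:
  fixes a b :: "real^'n"
  assumes "\<forall>i. a $ i \<le> b $ i"
  shows "emeasure lborel (cbox a b) = ennreal (\<Prod>i\<in>UNIV. b $ i - a $ i)"
proof -
  have "emeasure lborel (cbox a b) = ennreal (measure lborel (cbox a b))"
    using emeasure_lborel_cbox_finite[of a b] by (intro emeasure_eq_ennreal_measure) auto
  also have "measure lborel (cbox a b) = (\<Prod>i\<in>UNIV. b $ i - a $ i)"
    using assms by (intro content_cbox_cart) (auto simp: interval_ne_empty_cart)
  finally show ?thesis .
qed

lemma borel_measurable_vec_nth' [measurable]: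
  "(\<lambda>x::real^'n. x $ i) \<in> borel_measurable borel"
  by (simp add: borel_measurable_continuous_onI linear_continuous_on)

lemma borel_measurable_cyl_radius [measurable]: "cyl_radius \<in> borel_measurable borel"
  unfolding cyl_radius_def by measurable

lemma cyl_radius_nonneg [simp]: "0 \<le> cyl_radius x"
  by (simp add: cyl_radius_def)

lemma abs_le_cyl_radius: "\<bar>x $ 1\<bar> \<le> cyl_radius x" "\<bar>x $ 2\<bar> \<le> cyl_radius x"
  unfolding cyl_radius_def by (auto intro!: real_le_rsqrt)

text \<open>The set of radii of order 2^(-n) has volume of order 4^(-n), and the function is at most
  2^n there, so the contributions form a geometric series with ratio 1/2.\<close>

lemma integrable_inverse_cyl_radius:
  assumes "0 \<le> L"
  shows "integrable lborel (\<lambda>x. indicator {x. cyl_radius x \<le> 2 \<and> \<bar>x $ 3\<bar> \<le> L} x / cyl_radius x)"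
proof -
  define A :: "nat \<Rightarrow> (real^3) set" where
    "A n = cbox (vector [- (2 * (1 / 2) ^ n), - (2 * (1 / 2) ^ n), - L])
       (vector [2 * (1 / 2) ^ n, 2 * (1 / 2) ^ n, L])" for n
  show ?thesis
  proof (rule integrable_by_shells[where A = A and a = "\<lambda>n. 2 ^ n" and m = "\<lambda>n. 32 * L * (1 / 2) ^ n * (1 / 2) ^ n"])
    show "(\<lambda>x. indicator {x. cyl_radius x \<le> 2 \<and> \<bar>x $ 3\<bar> \<le> L} x / cyl_radius x) \<in> borel_measurable lborel"
      by measurable
    show "A n \<in> sets lborel" for n by (simp add: A_def)
    show "emeasure lborel (A n) = ennreal (32 * L * (1 / 2) ^ n * (1 / 2) ^ n)" for n
    proof -
      have "emeasure lborel (A n) = ennreal ((4 * (1 / 2) ^ n) * (4 * (1 / 2) ^ n) * (2 * L))"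
        unfolding A_def using assms
        by (subst emeasure_lborel_cbox_cart) (simp_all add: forall_3 prod_UNIV_3)
      then show ?thesis by (simp add: mult_ac)
    qed
    have "summable (\<lambda>n. 32 * L * (1 / 2 :: real) ^ n)"
      by (intro summable_mult summable_geometric) simp
    moreover have "2 ^ n * (32 * L * (1 / 2) ^ n * (1 / 2) ^ n) = 32 * L * (1 / 2 :: real) ^ n" for n
      by (simp add: power_divide)
    ultimately show "summable (\<lambda>n. 2 ^ n * (32 * L * (1 / 2) ^ n * (1 / 2 :: real) ^ n))"
      by (simp only:)
    fix x :: "real^3"
    let ?s = "cyl_radius x"
    assume "indicator {x. cyl_radius x \<le> 2 \<and> \<bar>x $ 3\<bar> \<le> L} x / ?s \<noteq> 0"
    then have s: "0 < ?s" "?s \<le> 2" "\<bar>x $ 3\<bar> \<le> L" 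
      using cyl_radius_nonneg[of x] by (auto simp: indicator_def less_le split: if_splits)
    obtain n0 where n0: "(1 / 2) ^ n0 < ?s" using real_arch_pow_inv[OF s(1), of "1/2"] by auto
    \<comment> \<open>Minimality of n gives the upper bound of twice 2^(-n) for the radius; for n =
      0 the same bound is the assumption that the radius is at most 2.\<close>
    define n where "n = (LEAST n. (1 / 2) ^ n < ?s)"
    have n: "(1 / 2) ^ n < ?s" unfolding n_def by (rule LeastI[of _ n0]) (rule n0)
    have "?s \<le> 2 * (1 / 2) ^ n"
    proof (cases n)
      case (Suc m)
      then have "\<not> (1 / 2) ^ m < ?s" using not_less_Least[of m "\<lambda>n. (1 / 2) ^ n < ?s"] by (simp add: n_def)
      then show ?thesis using Suc by (simp add: power_divide)
    qed (use s in simp)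
    then have "x \<in> A n"
      using s abs_le_cyl_radius[of x] by (auto simp: A_def mem_box_cart forall_3 abs_le_iff)
    moreover have "1 / ?s \<le> 2 ^ n" using n s by (simp add: power_divide field_simps)
    ultimately show "\<exists>n. x \<in> A n \<and> indicator {x. cyl_radius x \<le> 2 \<and> \<bar>x $ 3\<bar> \<le> L} x / ?s \<le> 2 ^ n"
      using s by auto
  qed (use assms in auto)
qed

lemma cyl_radius_le_norm: "cyl_radius x \<le> norm x"
proof -
  have "norm x = sqrt ((x$1)\<^sup>2 + (x$2)\<^sup>2 + (x$3)\<^sup>2)"
    by (simp add: norm_vec_def L2_set_def sum_3)
  then show ?thesis unfolding cyl_radius_def by simp
qed

text \<open>Comparison with the inverse of \<open>cyl_radius\<close>, which is larger; R \<le> 2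
  keeps the ball inside the range where that function was integrated.\<close>

lemma integrable_inverse_norm:
  assumes "R \<le> 2"
  shows "integrable lborel (\<lambda>x::real^3. indicator (cball 0 R) x / norm x)"
proof -
  let ?g = "\<lambda>x. indicator {x. cyl_radius x \<le> 2 \<and> \<bar>x $ 3\<bar> \<le> 2} x / cyl_radius x"
  have ig: "integrable lborel ?g" by (rule integrable_inverse_cyl_radius) simp
  have null: "AE x in lborel. cyl_radius x \<noteq> 0"
  proof -
    have "negligible {x::real^3. axis 1 1 \<bullet> x = 0}"
      by (rule negligible_hyperplane) (simp add: axis_eq_0_iff)
    then have "negligible {x::real^3. cyl_radius x = 0}"
      by (rule negligible_subset) (auto simp: cyl_radius_def inner_axis' add_nonneg_eq_0_iff)
    moreover have "{x::real^3. cyl_radius x = 0} \<in> sets lborel" by measurable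
    ultimately show ?thesis
      by (auto simp: negligible_iff_null_sets null_sets_completion_iff intro: AE_I'[of "{x::real^3. cyl_radius x = 0}"])
  qed
  show ?thesis
  proof (rule Bochner_Integration.integrable_bound[OF ig])
    show "AE x in lborel. norm (indicator (cball 0 R) x / norm x :: real) \<le> norm (?g x)"
      using null
    proof eventually_elim
      case (elim x)
      then have s: "0 < cyl_radius x" using cyl_radius_nonneg[of x] by linarith
      show ?case
      proof (cases "x \<in> cball 0 R")
        case True
        then have "norm x \<le> 2" using assms by auto
        then have "cyl_radius x \<le> 2" "\<bar>x $ 3\<bar> \<le> 2"
          using cyl_radius_le_norm[of x] component_le_norm_cart[of x 3] by auto
        then show ?thesis using s cyl_radius_le_norm[of x] True by (auto simp: frac_le)
      qed simp
    qed
    show "(\<lambda>x::real^3. indicator (cball 0 R) x / norm x :: real) \<in> borel_measurable lborel"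
      by (intro borel_measurable_divide borel_measurable_indicator borel_measurable_norm) auto
  qed
qed

text \<open>Decay of order |z|^(-4) against shells of volume of order 2^(3 n). This is the majorant
  for the rescaled kernel.\<close>

lemma integrable_bracket:
  "integrable lborel (\<lambda>z::real^3. 1 / (1 + z \<bullet> z)\<^sup>2)"
proof -
  define A :: "nat \<Rightarrow> (real^3) set" where
    "A n = cbox (vector [- (2 ^ n), - (2 ^ n), - (2 ^ n)]) (vector [2 ^ n, 2 ^ n, 2 ^ n])" for n
  show ?thesis
  proof (rule integrable_by_shells[where A = A and a = "\<lambda>n. 16 * (1 / 2) ^ (4 * n)" and m = "\<lambda>n. 8 * 2 ^ (3 * n)"])
    show "A n \<in> sets lborel" for n by (simp add: A_def)
    show "emeasure lborel (A n) = ennreal (8 * 2 ^ (3 * n))" for n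
    proof -
      have "emeasure lborel (A n) = ennreal ((2 * 2 ^ n) * (2 * 2 ^ n) * (2 * 2 ^ n))"
        unfolding A_def
        by (subst emeasure_lborel_cbox_cart) (simp_all add: forall_3 prod_UNIV_3)
      moreover have "(2 * 2 ^ n) * (2 * 2 ^ n) * (2 * 2 ^ n) = (8::real) * 2 ^ (3 * n)"
        by (simp add: power_mult power3_eq_cube power_mult_distrib mult.commute[of 3 n])
      ultimately show ?thesis by simp
    qed
    have "summable (\<lambda>n. 128 * (1 / 2 :: real) ^ n)"
      by (intro summable_mult summable_geometric) simp
    moreover have "16 * (1 / 2) ^ (4 * n) * (8 * 2 ^ (3 * n)) = 128 * (1 / 2 :: real) ^ n" for n
    proof -
      have "(2::real) ^ (4 * n) = 2 ^ (3 * n) * 2 ^ n" by (simp flip: power_add)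
      then show ?thesis by (simp add: power_divide)
    qed
    ultimately show "summable (\<lambda>n. 16 * (1 / 2) ^ (4 * n) * (8 * 2 ^ (3 * n)) :: real)" by simp
    fix z :: "real^3"
    obtain n0 where n0: "norm z < 2 ^ n0" using real_arch_pow[of 2 "norm z"] by auto
    define n where "n = (LEAST n. norm z < 2 ^ n)"
    have n: "norm z < 2 ^ n" unfolding n_def by (rule LeastI[of _ n0]) (rule n0)
    have "z \<in> A n"
      using n component_le_norm_cart[of z 1] component_le_norm_cart[of z 2] component_le_norm_cart[of z 3]
      by (auto simp: A_def mem_box_cart forall_3 abs_le_iff)
    moreover have "1 / (1 + z \<bullet> z)\<^sup>2 \<le> 16 * (1 / 2) ^ (4 * n)"
    proof (cases n)
      case 0
      have "1 \<le> (1 + z \<bullet> z)\<^sup>2" by (simp add: one_le_power)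
      then have "1 / (1 + z \<bullet> z)\<^sup>2 \<le> 1" by (intro divide_le_eq_1[THEN iffD2]) auto
      then show ?thesis using 0 by simp
    next
      case (Suc m)
      \<comment> \<open>Minimality of n bounds |z| from below by 2^(n - 1) only; the factor 16 = 2^4
        in the majorant pays for this shift.\<close>
      then have "\<not> norm z < 2 ^ m" using not_less_Least[of m "\<lambda>n. norm z < 2 ^ n"] by (simp add: n_def)
      then have "(2 ^ m)\<^sup>2 \<le> (norm z)\<^sup>2" by (intro power_mono) auto
      then have "(2 ^ m)\<^sup>2 \<le> 1 + z \<bullet> z" by (simp add: power2_norm_eq_inner)
      then have "((2 ^ m)\<^sup>2)\<^sup>2 \<le> (1 + z \<bullet> z)\<^sup>2" by (intro power_mono) auto
      moreover have "((2 ^ m)\<^sup>2)\<^sup>2 = (2::real) ^ (4 * m)" by (simp flip: power_mult add: mult.commute)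
      ultimately have "1 / (1 + z \<bullet> z)\<^sup>2 \<le> 1 / (2 ^ (4 * m))" by (intro divide_left_mono) (auto simp: add_pos_nonneg intro!: mult_pos_pos zero_less_power)
      also have "\<dots> = 16 * (1 / 2) ^ (4 * n)" using Suc by (simp add: power_divide power_add)
      finally show ?thesis .
    qed
    ultimately show "\<exists>n. z \<in> A n \<and> 1 / (1 + z \<bullet> z)\<^sup>2 \<le> 16 * (1 / 2) ^ (4 * n)" by blast
  qed auto
qed

section \<open>Differentiation under the integral sign\<close>

lemma norm_diff_le_frechet:
  fixes f :: "'a::euclidean_space \<Rightarrow> 'b::real_normed_vector"
  assumes "Ck_on 1 S f" "ball x r \<subseteq> S" "y \<in> ball x r"
    and bd: "\<And>x v. x \<in> S \<Longrightarrow> norm (frechet_derivative f (at x) v) \<le> B * norm v"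
  shows "norm (f y - f x) \<le> B * norm (y - x)"
proof (rule differentiable_bound[of "ball x r" f "\<lambda>x. frechet_derivative f (at x)"])
  show "(f has_derivative frechet_derivative f (at z)) (at z within ball x r)" if "z \<in> ball x r" for z
  proof (rule has_derivative_at_withinI, rule Ck_on_SucD)
    show "Ck_on (Suc 0) S f" using assms(1) by (simp only: One_nat_def)
    show "z \<in> S" using assms(2) that by blast
  qed
  show "onorm (frechet_derivative f (at z)) \<le> B" if "z \<in> ball x r" for z
    using bd assms(2) that by (intro onorm_le) blast
  show "x \<in> ball x r" using assms(3) by (auto simp: dist_norm intro: le_less_trans[OF norm_ge_zero])
qed (use assms in auto)

text \<open>The bound b is a Lipschitz constant of the integrand in x that is integrable in t, so
  dominated convergence applies to the difference quotients and to the derivative. Measurability of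
  the derivative in t is derived by writing it as a limit of difference quotients.\<close>

lemma Ck_on_parameter_integral:
  fixes f :: "'a::euclidean_space \<Rightarrow> 't \<Rightarrow> 'b::{banach, second_countable_topology}"
  assumes S: "open S"
    and C1: "\<And>t. Ck_on 1 S (\<lambda>x. f x t)"
    and int: "\<And>x. x \<in> S \<Longrightarrow> integrable M (f x)"
    and bd: "\<And>x t v. x \<in> S \<Longrightarrow> norm (frechet_derivative (\<lambda>x. f x t) (at x) v) \<le> b t * norm v"
    and b: "integrable M b"
  shows "Ck_on 1 S (\<lambda>x. \<integral>t. f x t \<partial>M)"
proof -
  let ?D = "\<lambda>x t v. frechet_derivative (\<lambda>x. f x t) (at x) v"
  have der: "((\<lambda>x. f x t) has_derivative ?D x t) (at x)" if "x \<in> S" for x t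
    using Ck_on_SucD[of 0 S "\<lambda>x. f x t" x] C1 that by simp
  have cD: "continuous_on S (\<lambda>x. ?D x t v)" for t v using C1[of t] by simp
  have lin: "linear (?D x t)" if "x \<in> S" for x t using has_derivative_linear[OF der[OF that]] .
  have [measurable]: "f x \<in> borel_measurable M" if "x \<in> S" for x
    using int[OF that] by (rule borel_measurable_integrable)
  have mD: "(\<lambda>t. ?D x t v) \<in> borel_measurable M" if x: "x \<in> S" for x v
  proof -
    obtain r where r: "r > 0" "ball x r \<subseteq> S" using S x open_contains_ball by blast
    \<comment> \<open>The factor r / (|v| + 1) keeps x + h v in the ball for every v, including v =
      0.\<close>
    define h where "h n = (r / (norm v + 1)) * inverse (real (Suc n))" for n
    have h: "h n > 0" for n using r by (simp add: h_def add_nonneg_pos)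
    have hne: "h n \<noteq> 0" for n using h[of n] by simp
    have hS: "x + h n *\<^sub>R v \<in> S" for n
    proof -
      have "h n * norm v \<le> (r / (norm v + 1)) * norm v"
        unfolding h_def using r by (intro mult_right_mono) (auto simp: divide_simps add_nonneg_pos)
      also have "\<dots> < r" using r by (simp add: divide_simps add_nonneg_pos)
      finally show ?thesis using r h[of n] by (auto simp: dist_norm subset_eq)
    qed
    have h0: "h \<longlonglongrightarrow> 0" unfolding h_def by (rule tendsto_mult_right_zero[OF LIMSEQ_inverse_real_of_nat])
    have "(\<lambda>n. (f (x + h n *\<^sub>R v) t - f x t) /\<^sub>R h n) \<longlonglongrightarrow> ?D x t v" for t
    proof -
      have affine: "((\<lambda>s::real. x + s *\<^sub>R v) has_derivative (\<lambda>s. s *\<^sub>R v)) (at 0)"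
        by (auto intro!: derivative_eq_intros)
      have "((\<lambda>s. f (x + s *\<^sub>R v) t) has_derivative (\<lambda>s. ?D x t (s *\<^sub>R v))) (at 0)"
        using has_derivative_compose[OF affine, of "\<lambda>x. f x t"] der[OF x] by simp
      then have "((\<lambda>s. f (x + s *\<^sub>R v) t) has_vector_derivative ?D x t v) (at 0)"
        using linear_cmul[OF lin[OF x]] by (simp add: has_vector_derivative_def)
      then have L: "((\<lambda>s. norm (f (x + s *\<^sub>R v) t - f x t - s *\<^sub>R ?D x t v) / norm s) \<longlongrightarrow> 0) (at 0)"
        by (simp add: has_vector_derivative_def has_derivative_at)
      have "(\<lambda>n. norm (f (x + h n *\<^sub>R v) t - f x t - h n *\<^sub>R ?D x t v) / norm (h n)) \<longlonglongrightarrow> 0"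
        by (rule filterlim_compose[OF L filterlim_atI[OF h0]]) (simp add: hne)
      moreover have "norm (f (x + h n *\<^sub>R v) t - f x t - h n *\<^sub>R ?D x t v) / norm (h n)
          = norm ((f (x + h n *\<^sub>R v) t - f x t) /\<^sub>R h n - ?D x t v)" for n
      proof -
        have "(f (x + h n *\<^sub>R v) t - f x t) /\<^sub>R h n - ?D x t v = (f (x + h n *\<^sub>R v) t - f x t - h n *\<^sub>R ?D x t v) /\<^sub>R h n"
          using h[of n] by (simp add: scaleR_diff_right)
        then show ?thesis by (simp add: divide_inverse mult.commute)
      qed
      ultimately have "(\<lambda>n. norm ((f (x + h n *\<^sub>R v) t - f x t) /\<^sub>R h n - ?D x t v)) \<longlonglongrightarrow> 0" by simp
      then show ?thesis by (rule LIM_zero_cancel[OF tendsto_norm_zero_cancel])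
    qed
    then show ?thesis
      by (rule borel_measurable_LIMSEQ_metric[rotated]) (use hS x in measurable)
  qed
  have iD: "integrable M (\<lambda>t. ?D x t v)" if x: "x \<in> S" for x v
    by (rule Bochner_Integration.integrable_bound[OF integrable_mult_left[OF b, of "norm v"] mD[OF x]])
      (use bd[OF x] in \<open>auto intro: order_trans[OF _ abs_ge_self]\<close>)
  have has: "((\<lambda>x. \<integral>t. f x t \<partial>M) has_derivative (\<lambda>v. \<integral>t. ?D x t v \<partial>M)) (at x)" if x: "x \<in> S" for x
  proof -
    obtain r where r: "r > 0" "ball x r \<subseteq> S" using S x open_contains_ball by blast
    let ?q = "\<lambda>h t. norm (f (x + h) t - f x t - ?D x t h) / norm h"
    have lim: "((\<lambda>h. \<integral>t. ?q h t \<partial>M) \<longlongrightarrow> 0) (at 0)"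
      unfolding tendsto_at_iff_sequentially
    proof (intro allI impI)
      fix X :: "nat \<Rightarrow> 'a" assume X: "\<forall>i. X i \<in> UNIV - {0}" "X \<longlonglongrightarrow> 0"
      obtain N where "\<forall>n\<ge>N. dist (X n) 0 < r" using X(2) r(1) unfolding lim_sequentially by blast
      then have N: "\<And>n. n \<ge> N \<Longrightarrow> norm (X n) < r" by simp
      have inS: "x + X (n + N) \<in> ball x r" for n using N[of "n + N"] by (simp add: dist_norm)
      have "(\<lambda>n. \<integral>t. ?q (X (n + N)) t \<partial>M) \<longlonglongrightarrow> (\<integral>t. (0::real) \<partial>M)"
      \<comment> \<open>The increment of f and the linear term each contribute b t times the norm of
        the step.\<close>
      proof (rule integral_dominated_convergence[where w = "\<lambda>t. 2 * b t"])
        show "(\<lambda>t. ?q (X (n + N)) t) \<in> borel_measurable M" for n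
        proof -
          have xS: "x + X (n + N) \<in> S" using inS r by blast
          note [measurable] = borel_measurable_integrable[OF int[OF xS]] borel_measurable_integrable[OF int[OF x]]
            mD[OF x, of "X (n + N)"]
          show ?thesis by measurable
        qed
        show "AE t in M. (\<lambda>n. ?q (X (n + N)) t) \<longlonglongrightarrow> 0"
        proof (intro AE_I2)
          fix t
          have "((\<lambda>h. ?q h t) \<longlongrightarrow> 0) (at 0)" using der[OF x, of t] by (simp add: has_derivative_at)
          then have "(\<lambda>n. ?q (X n) t) \<longlonglongrightarrow> 0"
            using X unfolding tendsto_at_iff_sequentially by (auto simp: o_def)
          then show "(\<lambda>n. ?q (X (n + N)) t) \<longlonglongrightarrow> 0" by (rule LIMSEQ_ignore_initial_segment)
        qed
        show "AE t in M. norm (?q (X (n + N)) t) \<le> 2 * b t" for n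
        proof (intro AE_I2)
          fix t
          let ?h = "X (n + N)"
          have "norm (f (x + ?h) t - f x t) \<le> b t * norm ((x + ?h) - x)"
            by (rule norm_diff_le_frechet[OF C1 r(2) inS]) (rule bd)
          moreover have "norm (?D x t ?h) \<le> b t * norm ?h" by (rule bd[OF x])
          ultimately have "norm (f (x + ?h) t - f x t - ?D x t ?h) \<le> 2 * b t * norm ?h"
            using norm_triangle_ineq4[of "f (x + ?h) t - f x t" "?D x t ?h"] by simp
          moreover have "norm ?h > 0" using X by auto
          ultimately show "norm (?q ?h t) \<le> 2 * b t" by (simp add: divide_simps)
        qed
      qed (use b in auto)
      then have "(\<lambda>n. \<integral>t. ?q (X (n + N)) t \<partial>M) \<longlonglongrightarrow> 0" by simp
      then show "((\<lambda>h. \<integral>t. ?q h t \<partial>M) \<circ> X) \<longlonglongrightarrow> 0"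
        unfolding o_def by (rule LIMSEQ_offset[where k = N])
    qed
    have "((\<lambda>h. norm ((\<integral>t. f (x + h) t \<partial>M) - (\<integral>t. f x t \<partial>M) - (\<integral>t. ?D x t h \<partial>M)) / norm h) \<longlongrightarrow> 0) (at 0)"
    proof (rule tendsto_sandwich[OF _ _ tendsto_const lim])
      have "\<forall>\<^sub>F h in at 0. norm h < r"
        using r unfolding eventually_at by (intro exI[of _ r]) (auto simp: dist_norm)
      then show "\<forall>\<^sub>F h in at 0. norm ((\<integral>t. f (x + h) t \<partial>M) - (\<integral>t. f x t \<partial>M) - (\<integral>t. ?D x t h \<partial>M)) / norm h
          \<le> (\<integral>t. ?q h t \<partial>M)"
      proof eventually_elim
        case (elim h)
        then have h: "x + h \<in> S" using r by (auto simp: dist_norm subset_eq)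
        have "(\<integral>t. f (x + h) t \<partial>M) - (\<integral>t. f x t \<partial>M) - (\<integral>t. ?D x t h \<partial>M)
            = (\<integral>t. f (x + h) t - f x t - ?D x t h \<partial>M)"
          using int h x iD[OF x] by simp
        also have "norm \<dots> \<le> (\<integral>t. norm (f (x + h) t - f x t - ?D x t h) \<partial>M)"
          by (rule integral_norm_bound)
        finally show ?case by (simp add: divide_right_mono)
      qed
    qed auto
    moreover have "bounded_linear (\<lambda>v. \<integral>t. ?D x t v \<partial>M)"
      unfolding linear_conv_bounded_linear[symmetric]
      by (rule linearI) (use iD[OF x] in \<open>simp_all add: linear_add[OF lin[OF x]] linear_cmul[OF lin[OF x]]\<close>)
    ultimately show ?thesis by (simp add: has_derivative_at)
  qed
  have cont: "continuous_on S (\<lambda>x. \<integral>t. ?D x t v \<partial>M)" for v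
    unfolding continuous_on_sequentially
  proof (intro allI ballI impI)
    fix X x assume X: "x \<in> S" "(\<forall>n. X n \<in> S) \<and> X \<longlonglongrightarrow> x"
    show "((\<lambda>x. \<integral>t. ?D x t v \<partial>M) \<circ> X) \<longlonglongrightarrow> (\<integral>t. ?D x t v \<partial>M)"
      unfolding o_def
    proof (rule integral_dominated_convergence[where w = "\<lambda>t. b t * norm v"])
      show "AE t in M. (\<lambda>n. ?D (X n) t v) \<longlonglongrightarrow> ?D x t v"
      proof (rule AE_I2)
        show "(\<lambda>n. ?D (X n) t v) \<longlonglongrightarrow> ?D x t v" for t
          using continuous_on_tendsto_compose[OF cD[of t v], of X x sequentially] X by simp
      qed
      show "AE t in M. norm (?D (X n) t v) \<le> b t * norm v" for n
        using X bd by simp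
      show "(\<lambda>t. ?D (X n) t v) \<in> borel_measurable M" for n
        using X mD by simp
      show "(\<lambda>t. ?D x t v) \<in> borel_measurable M"
        using X mD by simp
      show "integrable M (\<lambda>t. b t * norm v)" using b by simp
    qed
  qed
  have c0: "Ck_on 0 S (\<lambda>x. \<integral>t. ?D x t v \<partial>M)" for v
    unfolding Ck_on.simps(1) by (rule cont)
  have "Ck_on (Suc 0) S (\<lambda>x. \<integral>t. f x t \<partial>M)"
  proof (rule Ck_on_SucI[where f' = "\<lambda>x v. \<integral>t. ?D x t v \<partial>M"])
    show "((\<lambda>x. \<integral>t. f x t \<partial>M) has_derivative (\<lambda>v. \<integral>t. ?D x t v \<partial>M)) (at x)" if "x \<in> S" for x
      by (rule has[OF that])
  qed (fact S c0)+
  then show ?thesis by (simp only: One_nat_def)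
qed

section \<open>A regularised fundamental solution of the Helmholtz equation\<close>

definition lap :: "(real^3 \<Rightarrow> 'b::real_normed_vector) \<Rightarrow> real^3 \<Rightarrow> 'b" where
  "lap f x = (\<Sum>j\<in>UNIV. partial j (partial j f) x)"

lemma partial_eqI: "(f has_derivative D) (at x) \<Longrightarrow> partial j f x = D (axis j 1)"
  by (simp add: partial_def frechet_derivative_at[symmetric])

lemma partial_cong:
  assumes "open U" "x \<in> U" "\<And>y. y \<in> U \<Longrightarrow> f y = g y"
  shows "partial j f x = partial j g x"
  unfolding partial_def using frechet_derivative_cong_open[OF assms] by simp

lemma Ck_on_partial: "Ck_on (Suc n) U f \<Longrightarrow> Ck_on n U (partial j f)"
  unfolding partial_def[abs_def] by simp

lemma partial_mult:
  fixes f g :: "real^3 \<Rightarrow> 'b::real_normed_algebra"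
  assumes "Ck_on (Suc n) U f" "Ck_on (Suc m) U g" "x \<in> U"
  shows "partial j (\<lambda>x. f x * g x) x = f x * partial j g x + partial j f x * g x"
  using partial_eqI[OF has_derivative_mult[OF Ck_on_SucD[OF assms(1,3)] Ck_on_SucD[OF assms(2,3)]]]
  by (simp add: partial_def)

lemma partial_add:
  fixes f g :: "real^3 \<Rightarrow> 'b::real_normed_vector"
  assumes "Ck_on (Suc n) U f" "Ck_on (Suc m) U g" "x \<in> U"
  shows "partial j (\<lambda>x. f x + g x) x = partial j f x + partial j g x"
  using partial_eqI[OF has_derivative_add[OF Ck_on_SucD[OF assms(1,3)] Ck_on_SucD[OF assms(2,3)]]]
  by (simp add: partial_def)

lemma lap_mult:
  fixes f g :: "real^3 \<Rightarrow> real"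
  assumes U: "open U" "x \<in> U" and f: "Ck_on 2 U f" and g: "Ck_on 2 U g"
  shows "lap (\<lambda>x. f x * g x) x
    = f x * lap g x + 2 * (\<Sum>j\<in>UNIV. partial j f x * partial j g x) + lap f x * g x"
proof -
  have f2: "Ck_on (Suc (Suc 0)) U f" and g2: "Ck_on (Suc (Suc 0)) U g"
    using f g by (simp_all only: numeral_2_eq_2)
  note f1 = Ck_on_Suc_imp[OF f2] and g1 = Ck_on_Suc_imp[OF g2]
  note pf = Ck_on_partial[OF f2] and pg = Ck_on_partial[OF g2]
  have "partial j (partial j (\<lambda>x. f x * g x)) x
      = partial j (\<lambda>x. f x * partial j g x + partial j f x * g x) x" for j
    by (rule partial_cong[OF U]) (rule partial_mult[OF f1 g1])
  also have "\<dots> j = f x * partial j (partial j g) x + 2 * (partial j f x * partial j g x)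
      + partial j (partial j f) x * g x" for j
    using partial_add[OF Ck_on_mult[OF U(1) f1 pg] Ck_on_mult[OF U(1) pf g1] U(2), of j]
      partial_mult[OF f1 pg U(2), of j] partial_mult[OF pf g1 U(2), of j]
    by simp
  finally show ?thesis
    by (simp add: lap_def sum.distrib sum_distrib_left sum_distrib_right)
qed

lemma partial_translate:
  assumes "Ck_on (Suc n) UNIV f"
  shows "partial j (\<lambda>x. f (x - y)) = (\<lambda>x. partial j f (x - y))"
proof
  fix x
  have t: "((\<lambda>x. x - y) has_derivative (\<lambda>h. h)) (at x)" by (auto intro!: derivative_eq_intros)
  show "partial j (\<lambda>x. f (x - y)) x = partial j f (x - y)"
    using partial_eqI[OF has_derivative_compose[OF t, of f], OF Ck_on_SucD[OF assms]]
    by (simp add: partial_def)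
qed

lemma lap_translate:
  assumes "Ck_on 2 UNIV f"
  shows "lap (\<lambda>x. f (x - y)) x = lap f (x - y)"
proof -
  have f2: "Ck_on (Suc (Suc 0)) UNIV f" using assms by (simp only: numeral_2_eq_2)
  show ?thesis
    unfolding lap_def by (simp add: partial_translate[OF f2] partial_translate[OF Ck_on_partial[OF f2]])
qed

text \<open>The kernel \<open>cos (k \<bar>x\<bar>) / \<bar>x\<bar>\<close> of \<open>\<Delta> + k\<^sup>2\<close> is regularised by replacing \<open>\<bar>x\<bar>\<^sup>2\<close> with
  \<open>q = \<bar>x\<bar>\<^sup>2 + \<epsilon>\<^sup>2\<close>; \<open>W1\<close> and \<open>W2\<close> are the derivatives of \<open>W0\<close> in \<open>q\<close>.\<close>

definition W0 :: "real \<Rightarrow> real \<Rightarrow> real" where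
  "W0 k q = cos (k * sqrt q) / sqrt q"

definition W1 :: "real \<Rightarrow> real \<Rightarrow> real" where
  "W1 k q = - cos (k * sqrt q) / (2 * sqrt q ^ 3) - k * sin (k * sqrt q) / (2 * sqrt q ^ 2)"

definition W2 :: "real \<Rightarrow> real \<Rightarrow> real" where
  "W2 k q = 3 * cos (k * sqrt q) / (4 * sqrt q ^ 5) + 3 * k * sin (k * sqrt q) / (4 * sqrt q ^ 4)
     - k\<^sup>2 * cos (k * sqrt q) / (4 * sqrt q ^ 3)"

lemma W0_deriv: "q > 0 \<Longrightarrow> (W0 k has_real_derivative W1 k q) (at q)"
proof -
  assume q: "q > 0"
  then have s: "sqrt q > 0" by simp
  have "((\<lambda>s. cos (k * s) / s) has_real_derivative
      - k * sin (k * sqrt q) / sqrt q - cos (k * sqrt q) / (sqrt q)\<^sup>2) (at (sqrt q))"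
    using s by (auto intro!: derivative_eq_intros simp del: real_sqrt_pow2 simp: field_simps power2_eq_square)
  from DERIV_chain2[OF this DERIV_real_sqrt[OF q]]
  have "(W0 k has_real_derivative (- k * sin (k * sqrt q) / sqrt q - cos (k * sqrt q) / (sqrt q)\<^sup>2)
      * (inverse (sqrt q) / 2)) (at q)"
    unfolding W0_def[abs_def] .
  also have "(- k * sin (k * s) / s - cos (k * s) / s\<^sup>2) * (inverse s / 2)
      = - cos (k * s) / (2 * s ^ 3) - k * sin (k * s) / (2 * s ^ 2)" if "s > 0" for s :: real
    using that by (simp add: field_simps eval_nat_numeral)
  from this[OF s] have "(- k * sin (k * sqrt q) / sqrt q - cos (k * sqrt q) / (sqrt q)\<^sup>2)
      * (inverse (sqrt q) / 2) = W1 k q" unfolding W1_def .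
  finally show ?thesis .
qed

lemma W1_deriv: "q > 0 \<Longrightarrow> (W1 k has_real_derivative W2 k q) (at q)"
proof -
  assume q: "q > 0"
  then have s: "sqrt q > 0" by simp
  let ?D = "\<lambda>s. 3 * cos (k * s) / (2 * s ^ 4) + 3 * k * sin (k * s) / (2 * s ^ 3) - k\<^sup>2 * cos (k * s) / (2 * s\<^sup>2)"
  have D: "((\<lambda>s. - cos (k * s) / (2 * s ^ 3) - k * sin (k * s) / (2 * s ^ 2)) has_real_derivative ?D s) (at s)"
    if "s > 0" for s
    using that by (auto intro!: derivative_eq_intros simp: field_simps eval_nat_numeral)
  from DERIV_chain2[OF D[OF s] DERIV_real_sqrt[OF q]]
  have "(W1 k has_real_derivative ?D (sqrt q) * (inverse (sqrt q) / 2)) (at q)"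
    unfolding W1_def[abs_def] .
  also have "?D s * (inverse s / 2) = 3 * cos (k * s) / (4 * s ^ 5) + 3 * k * sin (k * s) / (4 * s ^ 4)
     - k\<^sup>2 * cos (k * s) / (4 * s ^ 3)" if "s > 0" for s :: real
    using that by (simp add: field_simps eval_nat_numeral)
  from this[OF s] have "?D (sqrt q) * (inverse (sqrt q) / 2) = W2 k q" unfolding W2_def .
  finally show ?thesis .
qed

text \<open>In three dimensions the Laplacian of f(q) with q = |x|^2 is 4 q f'' + 6 f'. So this is
  the Helmholtz equation for cos(k |x|) / |x|, written in the variable q.\<close>

lemma W_ode: "q > 0 \<Longrightarrow> 4 * q * W2 k q + 6 * W1 k q + k\<^sup>2 * W0 k q = 0"
proof -
  assume q: "q > 0"
  have "4 * s\<^sup>2 * (3 * c / (4 * s ^ 5) + 3 * k * n / (4 * s ^ 4) - k\<^sup>2 * c / (4 * s ^ 3))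
     + 6 * (- c / (2 * s ^ 3) - k * n / (2 * s ^ 2)) + k\<^sup>2 * (c / s) = 0" if "s > 0" for s c n :: real
  proof -
    have "4 * s\<^sup>2 * (a / (4 * s ^ 5)) = a / s ^ 3" "4 * s\<^sup>2 * (a / (4 * s ^ 4)) = a / s ^ 2"
      "4 * s\<^sup>2 * (a / (4 * s ^ 3)) = a / s" "6 * (a / (2 * s ^ 3)) = 3 * a / s ^ 3"
      "6 * (a / (2 * s ^ 2)) = 3 * a / s ^ 2" for a
      using that by (simp_all add: eval_nat_numeral)
    then show ?thesis by (simp only: distrib_left right_diff_distrib) simp
  qed
  from this[of "sqrt q" "cos (k * sqrt q)" "sin (k * sqrt q)"]
  have "4 * (sqrt q)\<^sup>2 * W2 k q + 6 * W1 k q + k\<^sup>2 * W0 k q = 0"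
    unfolding W0_def W1_def W2_def using q by (simp only: real_sqrt_gt_0_iff)
  then show ?thesis using q by simp
qed

lemma Ck_on_W0: "Ck_on n {0<..} (W0 k)"
proof (rule Ck_on_cong)
  have "Ck_on n {0<..} (\<lambda>q::real. cos (k * q powr (1/2)))"
    by (rule Ck_on_compose[of _ UNIV, OF _ _ _ Ck_on_powr Ck_on_cos]) auto
  then show "Ck_on n {0<..} (\<lambda>q::real. cos (k * q powr (1/2)) * q powr (- (1/2)))"
    by (intro Ck_on_mult Ck_on_powr) auto
  show "cos (k * q powr (1/2)) * q powr (- (1/2)) = W0 k q" if "q \<in> {0<..}" for q
    unfolding W0_def powr_minus divide_inverse[of "cos (k * sqrt q)"] using powr_half_sqrt[of q] that by simp
qed auto

lemma Ck_on_W1: "Ck_on n {0<..} (W1 k)"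
proof (rule Ck_on_cong)
  show "Ck_on n {0<..} (\<lambda>q. frechet_derivative (W0 k) (at q) 1)"
    using Ck_on_W0[of "Suc n" k] by simp
  show "frechet_derivative (W0 k) (at q) 1 = W1 k q" if "q \<in> {0<..}" for q
    using frechet_derivative_at[OF W0_deriv[unfolded has_field_derivative_def], of q k] that
    by (metis greaterThan_iff mult_1_right)
qed auto

lemma continuous_on_W: "continuous_on {0<..} (W0 k)" "continuous_on {0<..} (W1 k)" "continuous_on {0<..} (W2 k)"
proof -
  show "continuous_on {0<..} (W0 k)" "continuous_on {0<..} (W1 k)"
    using Ck_on_imp_continuous[OF Ck_on_W0[of 0 k]] Ck_on_imp_continuous[OF Ck_on_W1[of 0 k]] by auto
  show "continuous_on {0<..} (W2 k)"
    unfolding W2_def[abs_def] by (auto intro!: continuous_intros)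
qed

definition helm :: "real \<Rightarrow> real \<Rightarrow> real^3 \<Rightarrow> real" where
  "helm k \<epsilon> x = W0 k (x \<bullet> x + \<epsilon>\<^sup>2)"

lemma inner_self_deriv: "((\<lambda>x. x \<bullet> x + c) has_derivative (\<lambda>h. 2 * (x \<bullet> h))) (at x)"
  for x :: "'a::real_inner"
  by (auto intro!: derivative_eq_intros simp: inner_commute)

lemma radial_deriv:
  fixes x :: "real^3"
  assumes "(f has_real_derivative d) (at (x \<bullet> x + c))"
  shows "((\<lambda>x. f (x \<bullet> x + c)) has_derivative (\<lambda>h. 2 * (x \<bullet> h) * d)) (at x)"
  using has_derivative_compose[OF inner_self_deriv assms[unfolded has_field_derivative_def]]
  by (simp add: mult.commute)

lemma partial_helm:
  assumes "0 < x \<bullet> x + \<epsilon>\<^sup>2"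
  shows "partial j (helm k \<epsilon>) x = 2 * (x $ j) * W1 k (x \<bullet> x + \<epsilon>\<^sup>2)"
  unfolding helm_def[abs_def]
  by (subst partial_eqI[OF radial_deriv[OF W0_deriv[OF assms]]]) (simp add: inner_axis)

text \<open>The Laplacian produces 4 (x \<bullet> x) times \<open>W2\<close>, whereas
  \<open>W_ode\<close> asks for the factor 4 q with q = x \<bullet> x + \<epsilon>^2. The mismatch
  is the right-hand side, which concentrates at the origin as \<epsilon> tends to 0.\<close>

lemma lap_helm:
  assumes "\<epsilon> \<noteq> 0"
  shows "lap (helm k \<epsilon>) x + k\<^sup>2 * helm k \<epsilon> x = - 4 * \<epsilon>\<^sup>2 * W2 k (x \<bullet> x + \<epsilon>\<^sup>2)"
proof -
  let ?q = "x \<bullet> x + \<epsilon>\<^sup>2"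
  have pos: "0 < x \<bullet> x + \<epsilon>\<^sup>2" for x :: "real^3" using assms by (simp add: add_nonneg_pos)
  have p: "partial j (helm k \<epsilon>) = (\<lambda>x. 2 * (x $ j) * W1 k (x \<bullet> x + \<epsilon>\<^sup>2))" for j
    by (rule ext) (rule partial_helm[OF pos])
  have lin: "((\<lambda>x::real^3. 2 * (x $ j)) has_derivative (\<lambda>h. 2 * (h $ j))) (at x)" for j
    by (rule has_derivative_mult_right bounded_linear_imp_has_derivative bounded_linear_vec_nth)+
  have pp: "partial j (partial j (helm k \<epsilon>)) x = 2 * W1 k ?q + 4 * (x $ j)\<^sup>2 * W2 k ?q" for j
    unfolding p
    by (subst partial_eqI[OF has_derivative_mult[OF lin radial_deriv[OF W1_deriv[OF pos]]]])
      (simp add: inner_axis power2_eq_square)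
  have xx: "x \<bullet> x = (x $ 1)\<^sup>2 + (x $ 2)\<^sup>2 + (x $ 3)\<^sup>2"
    by (simp add: inner_vec_def sum_3 power2_eq_square)
  have "lap (helm k \<epsilon>) x = 6 * W1 k ?q + 4 * (x \<bullet> x) * W2 k ?q"
    unfolding lap_def pp sum_3 xx by (simp add: algebra_simps)
  moreover have "4 * ?q * W2 k ?q + 6 * W1 k ?q + k\<^sup>2 * W0 k ?q = 0"
    by (rule W_ode[OF pos])
  ultimately show ?thesis by (simp add: helm_def algebra_simps)
qed

lemma Ck_on_helm:
  assumes U: "open U" "\<And>x. x \<in> U \<Longrightarrow> 0 < x \<bullet> x + \<epsilon>\<^sup>2"
  shows "Ck_on n U (helm k \<epsilon>)"
  unfolding helm_def[abs_def]
  by (rule Ck_on_compose[OF U(1) _ _ _ Ck_on_W0]) (use U in \<open>auto intro!: Ck_on_add Ck_on_inner_self\<close>)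

text \<open>The truncation gives compact support, so for \<epsilon> \<noteq> 0 the translates of the
  kernel are admissible test functions.\<close>

definition kern :: "real \<Rightarrow> real \<Rightarrow> real \<Rightarrow> real^3 \<Rightarrow> real" where
  "kern R k \<epsilon> x = ball_cutoff R x * helm k \<epsilon> x"

text \<open>\<open>(\<Delta> + k\<^sup>2) kern\<close> splits into \<open>kern_rest\<close>, which is smooth uniformly in \<open>\<epsilon>\<close> because it lives where the
  cutoff varies, and \<open>kern_main\<close>, which tends to a multiple of the Dirac measure.\<close>

definition kern_rest :: "real \<Rightarrow> real \<Rightarrow> real \<Rightarrow> real^3 \<Rightarrow> real" where
  "kern_rest R k \<epsilon> x = 2 * (\<Sum>j\<in>UNIV. partial j (ball_cutoff R) x * (2 * (x $ j) * W1 k (x \<bullet> x + \<epsilon>\<^sup>2)))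
     + lap (ball_cutoff R) x * W0 k (x \<bullet> x + \<epsilon>\<^sup>2)"

definition kern_main :: "real \<Rightarrow> real \<Rightarrow> real \<Rightarrow> real^3 \<Rightarrow> real" where
  "kern_main R k \<epsilon> x = ball_cutoff R x * (4 * \<epsilon>\<^sup>2 * W2 k (x \<bullet> x + \<epsilon>\<^sup>2))"

lemma Ck_on_kern: "\<epsilon> \<noteq> 0 \<Longrightarrow> Ck_on n UNIV (kern R k \<epsilon>)"
  unfolding kern_def[abs_def] by (intro Ck_on_mult Ck_on_ball_cutoff Ck_on_helm) (auto simp: add_nonneg_pos)

lemma kern_helmholtz:
  assumes "\<epsilon> \<noteq> 0"
  shows "lap (kern R k \<epsilon>) x + k\<^sup>2 * kern R k \<epsilon> x = kern_rest R k \<epsilon> x - kern_main R k \<epsilon> x"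
proof -
  have pos: "0 < x \<bullet> x + \<epsilon>\<^sup>2" for x :: "real^3" using assms by (simp add: add_nonneg_pos)
  have h: "Ck_on 2 UNIV (helm k \<epsilon>)" by (rule Ck_on_helm) (auto simp: pos)
  have "lap (kern R k \<epsilon>) x + k\<^sup>2 * kern R k \<epsilon> x
     = ball_cutoff R x * (lap (helm k \<epsilon>) x + k\<^sup>2 * helm k \<epsilon> x)
       + 2 * (\<Sum>j\<in>UNIV. partial j (ball_cutoff R) x * partial j (helm k \<epsilon>) x)
       + lap (ball_cutoff R) x * helm k \<epsilon> x"
    unfolding kern_def[abs_def]
    by (subst lap_mult[OF open_UNIV UNIV_I Ck_on_ball_cutoff h]) (simp add: algebra_simps)
  then show ?thesis
    unfolding lap_helm[OF assms] partial_helm[OF pos] kern_rest_def kern_main_def by (simp add: helm_def)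
qed

lemma partial_ball_cutoff_eq_0:
  assumes "R > 0" "norm x < R / 2 \<or> norm x > R"
  shows "partial j (ball_cutoff R) x = 0" "lap (ball_cutoff R) x = 0"
proof -
  have A: "partial j (ball_cutoff R) y = 0" if y: "norm y < R / 2 \<or> norm y > R" for y :: "real^3" and j
    using y
  proof
    assume "norm y < R / 2"
    then show ?thesis
      using partial_cong[of "ball 0 (R / 2)" y "ball_cutoff R" "\<lambda>x. 1" j] assms(1)
      by (simp add: ball_cutoff_eq_1 partial_def)
  next
    assume "norm y > R"
    then show ?thesis
      using partial_cong[of "- cball 0 R" y "ball_cutoff R" "\<lambda>x. 0" j] assms(1) open_Compl[OF closed_cball[of "0::real^3" R]]
      by (simp add: ball_cutoff_eq_0 partial_def)
  qed
  show "partial j (ball_cutoff R) x = 0" by (rule A[OF assms(2)])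
  have "partial j (partial j (ball_cutoff R)) x = 0" for j
    using assms(2)
  proof
    assume "norm x < R / 2"
    then show ?thesis
      using partial_cong[of "ball 0 (R / 2)" x "partial j (ball_cutoff R)" "\<lambda>x. 0" j]
      by (simp add: A partial_def[of _ "\<lambda>x. 0"])
  next
    assume "norm x > R"
    then show ?thesis
      using partial_cong[of "- cball 0 R" x "partial j (ball_cutoff R)" "\<lambda>x. 0" j] open_Compl[OF closed_cball[of "0::real^3" R]]
      by (simp add: A partial_def[of _ "\<lambda>x. 0"])
  qed
  then show "lap (ball_cutoff R) x = 0" by (simp add: lap_def)
qed

lemma kern_rest_eq_0:
  "R > 0 \<Longrightarrow> norm x < R / 2 \<or> norm x > R \<Longrightarrow> kern_rest R k \<epsilon> x = 0"
  using partial_ball_cutoff_eq_0[of R x] by (simp add: kern_rest_def)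

lemma Ck_on_lap: "Ck_on (Suc (Suc n)) U f \<Longrightarrow> open U \<Longrightarrow> Ck_on n U (lap f)"
  unfolding lap_def[abs_def] by (intro Ck_on_sum Ck_on_partial) (auto simp del: Ck_on.simps)

text \<open>This includes \<epsilon> = 0: the derivatives of the cutoff vanish for |x| < R / 2, so
  the singularity of \<open>W0\<close> and \<open>W1\<close> at q = 0 is never met.\<close>

lemma Ck_on_kern_rest:
  assumes "R > 0"
  shows "Ck_on n UNIV (kern_rest R k \<epsilon>)"
proof (rule Ck_on_extend_zero[of "- {0}" "{x. R / 2 \<le> norm x \<and> norm x \<le> R}"])
  show "closed {x::real^3. R / 2 \<le> norm x \<and> norm x \<le> R}"
    by (intro closed_Collect_conj closed_Collect_le continuous_intros)
  show "kern_rest R k \<epsilon> x = 0" if "x \<notin> {x. R / 2 \<le> norm x \<and> norm x \<le> R}" for x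
    using that assms by (intro kern_rest_eq_0) auto
  have pos: "0 < x \<bullet> x + \<epsilon>\<^sup>2" if "x \<noteq> 0" for x :: "real^3"
    using that by (intro add_pos_nonneg) auto
  have W: "Ck_on n (- {0::real^3}) (\<lambda>x. F (x \<bullet> x + \<epsilon>\<^sup>2))" if "Ck_on n {0<..} F" for F :: "real \<Rightarrow> real"
    by (rule Ck_on_compose[OF _ _ _ _ that])
      (auto intro!: Ck_on_add Ck_on_inner_self pos)
  have p: "Ck_on n (- {0}) (partial j (ball_cutoff R))" for j
    by (rule Ck_on_subset[OF Ck_on_partial[OF Ck_on_ball_cutoff]]) simp
  have l: "Ck_on n (- {0}) (lap (ball_cutoff R))"
    by (rule Ck_on_subset[OF Ck_on_lap[OF Ck_on_ball_cutoff]]) auto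
  show "Ck_on n (- {0}) (kern_rest R k \<epsilon>)"
    unfolding kern_rest_def[abs_def]
    by (intro Ck_on_add Ck_on_mult Ck_on_sum p l W Ck_on_W0 Ck_on_W1 Ck_on_const Ck_on_vec_nth Ck_on_id) auto
qed (use assms in auto)

text \<open>On the closed annulus q stays positive even for \<epsilon> = 0, so continuity on the
  compact product of the annulus with the interval from 0 to 1 gives a bound that is uniform in
  \<epsilon>.\<close>

lemma kern_rest_bounded:
  assumes R: "R > 0"
  obtains C where "C > 0" "\<And>\<epsilon> x. \<epsilon> \<in> {0..1} \<Longrightarrow> \<bar>kern_rest R k \<epsilon> x\<bar> \<le> C"
proof -
  let ?S = "{x::real^3. R / 2 \<le> norm x \<and> norm x \<le> R} \<times> {0..1::real}"
  let ?f = "\<lambda>z. kern_rest R k (snd z) (fst z)"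
  have "closed {x::real^3. R / 2 \<le> norm x \<and> norm x \<le> R}"
    by (intro closed_Collect_conj closed_Collect_le continuous_intros)
  moreover have "bounded {x::real^3. R / 2 \<le> norm x \<and> norm x \<le> R}"
    by (rule bounded_subset[of "cball 0 R"]) auto
  ultimately have S: "compact ?S" by (intro compact_Times) (auto simp: compact_eq_bounded_closed)
  have pos: "0 < fst z \<bullet> fst z + (snd z)\<^sup>2" if "z \<in> ?S" for z
    using that R by (auto intro!: add_pos_nonneg)
  have cW: "continuous_on ?S (\<lambda>z. F (fst z \<bullet> fst z + (snd z)\<^sup>2))" if "continuous_on {0<..} F" for F :: "real \<Rightarrow> real"
    by (rule continuous_on_compose2[OF that]) (use pos in \<open>auto intro!: continuous_intros\<close>)
  have cp: "continuous_on UNIV (partial j (ball_cutoff R))" for j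
    using Ck_on_imp_continuous[OF Ck_on_partial[OF Ck_on_ball_cutoff]] .
  have cl: "continuous_on UNIV (lap (ball_cutoff R))"
    using Ck_on_imp_continuous[OF Ck_on_lap[OF Ck_on_ball_cutoff]] by simp
  have "continuous_on ?S ?f"
    unfolding kern_rest_def
    by (intro continuous_intros cW continuous_on_W continuous_on_compose2[OF cp] continuous_on_compose2[OF cl]) auto
  then have "bounded (?f ` ?S)" using S by (intro compact_imp_bounded compact_continuous_image)
  then obtain C where C0: "\<forall>y\<in>?f ` ?S. norm y \<le> C" unfolding bounded_iff by blast
  have C: "\<bar>?f z\<bar> \<le> C" if "z \<in> ?S" for z
    using bspec[OF C0 imageI[OF that]] unfolding real_norm_def .
  have "\<bar>kern_rest R k \<epsilon> x\<bar> \<le> max C 1" if "\<epsilon> \<in> {0..1}" for \<epsilon> x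
  proof (cases "R / 2 \<le> norm x \<and> norm x \<le> R")
    case True
    then show ?thesis using C[of "(x, \<epsilon>)"] that by simp
  next
    case False
    then have "kern_rest R k \<epsilon> x = 0" using R by (intro kern_rest_eq_0) auto
    then show ?thesis by simp
  qed
  then show ?thesis by (intro that[of "max C 1"]) auto
qed

lemma kern_rest_tendsto:
  assumes R: "R > 0" and X: "X \<longlonglongrightarrow> 0"
  shows "(\<lambda>n. kern_rest R k (X n) x) \<longlonglongrightarrow> kern_rest R k 0 x"
proof (cases "x = 0")
  case True
  then show ?thesis using kern_rest_eq_0[of R x] R by simp
next
  case False
  then have pos: "0 < x \<bullet> x + \<epsilon>\<^sup>2" for \<epsilon> by (intro add_pos_nonneg) auto
  have iso: "isCont F (x \<bullet> x + 0\<^sup>2)" if "continuous_on {0<..} F" for F :: "real \<Rightarrow> real"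
    using that pos[of 0] by (simp add: continuous_on_eq_continuous_at)
  have lim: "(\<lambda>n. F (x \<bullet> x + (X n)\<^sup>2)) \<longlonglongrightarrow> F (x \<bullet> x + 0\<^sup>2)" if "continuous_on {0<..} F" for F :: "real \<Rightarrow> real"
    by (rule isCont_tendsto_compose[OF iso[OF that]]) (intro tendsto_intros X)
  show ?thesis
    unfolding kern_rest_def by (intro tendsto_intros lim continuous_on_W)
qed

text \<open>The root of q is at least |x| and the cosine is at most 1. The bound is integrable and
  independent of \<epsilon>, so it serves as majorant in the limit.\<close>

lemma norm_kern_le:
  assumes "R > 0" "x \<noteq> 0"
  shows "\<bar>kern R k \<epsilon> x\<bar> \<le> indicator (cball 0 R) x / norm x"
proof (cases "x \<in> cball 0 R")
  case True
  have "norm x \<le> sqrt (x \<bullet> x + \<epsilon>\<^sup>2)" by (simp add: norm_eq_sqrt_inner)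
  then have "\<bar>helm k \<epsilon> x\<bar> \<le> 1 / norm x"
    using assms(2) by (auto simp: helm_def W0_def intro!: frac_le)
  then have "\<bar>ball_cutoff R x\<bar> * \<bar>helm k \<epsilon> x\<bar> \<le> 1 * (1 / norm x)"
    using ball_cutoff_bounds[of R x] by (intro mult_mono) auto
  then show ?thesis using True by (simp add: kern_def abs_mult)
next
  case False
  then show ?thesis using assms by (simp add: kern_def ball_cutoff_eq_0)
qed

lemma kern_tendsto:
  assumes "x \<noteq> 0" "X \<longlonglongrightarrow> 0"
  shows "(\<lambda>n. kern R k (X n) x) \<longlonglongrightarrow> kern R k 0 x"
proof -
  have "isCont (W0 k) (x \<bullet> x + 0\<^sup>2)"
    using continuous_on_W(1)[of k] assms(1) by (simp add: continuous_on_eq_continuous_at)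
  then have "(\<lambda>n. W0 k (x \<bullet> x + (X n)\<^sup>2)) \<longlonglongrightarrow> W0 k (x \<bullet> x + 0\<^sup>2)"
    by (rule isCont_tendsto_compose) (intro tendsto_intros assms)
  then show ?thesis unfolding kern_def helm_def by (intro tendsto_intros)
qed

text \<open>\<open>kern_main\<close> after the substitution x = \<epsilon> z, including the volume
  factor \<epsilon>^3. In this form the powers of \<epsilon> have cancelled from the leading term,
  so the limit \<epsilon> = 0 can be read off.\<close>

definition kern_scaled :: "real \<Rightarrow> real \<Rightarrow> real \<Rightarrow> real^3 \<Rightarrow> real" where
  "kern_scaled R k \<epsilon> z = ball_cutoff R (\<epsilon> *\<^sub>R z) *
     (3 * cos (k * \<epsilon> * sqrt (1 + z \<bullet> z)) / sqrt (1 + z \<bullet> z) ^ 5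
      + 3 * k * \<epsilon> * sin (k * \<epsilon> * sqrt (1 + z \<bullet> z)) / sqrt (1 + z \<bullet> z) ^ 4
      - k\<^sup>2 * \<epsilon>\<^sup>2 * cos (k * \<epsilon> * sqrt (1 + z \<bullet> z)) / sqrt (1 + z \<bullet> z) ^ 3)"

lemma kern_main_scaled:
  assumes "\<epsilon> > 0"
  shows "\<epsilon> ^ 3 * kern_main R k \<epsilon> (\<epsilon> *\<^sub>R z) = kern_scaled R k \<epsilon> z"
proof -
  let ?s = "sqrt (1 + z \<bullet> z)"
  have "(\<epsilon> *\<^sub>R z) \<bullet> (\<epsilon> *\<^sub>R z) + \<epsilon>\<^sup>2 = \<epsilon>\<^sup>2 * (1 + z \<bullet> z)" by (simp add: algebra_simps power2_eq_square)
  then have sq: "sqrt ((\<epsilon> *\<^sub>R z) \<bullet> (\<epsilon> *\<^sub>R z) + \<epsilon>\<^sup>2) = \<epsilon> * ?s"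
    using assms by (simp add: real_sqrt_mult)
  have s: "?s > 0" by (simp add: add_pos_nonneg)
  have "\<epsilon> ^ 3 * (4 * \<epsilon>\<^sup>2 * (3 * c / (4 * (\<epsilon> * s) ^ 5) + 3 * k * n / (4 * (\<epsilon> * s) ^ 4) - k\<^sup>2 * c / (4 * (\<epsilon> * s) ^ 3)))
    = 3 * c / s ^ 5 + 3 * k * \<epsilon> * n / s ^ 4 - k\<^sup>2 * \<epsilon>\<^sup>2 * c / s ^ 3" if "s > 0" for s c n
  proof -
    have "\<epsilon> ^ 3 * (4 * \<epsilon>\<^sup>2 * (a / (4 * (\<epsilon> * s) ^ 5))) = a / s ^ 5"
      "\<epsilon> ^ 3 * (4 * \<epsilon>\<^sup>2 * (a / (4 * (\<epsilon> * s) ^ 4))) = \<epsilon> * a / s ^ 4"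
      "\<epsilon> ^ 3 * (4 * \<epsilon>\<^sup>2 * (a / (4 * (\<epsilon> * s) ^ 3))) = \<epsilon>\<^sup>2 * a / s ^ 3" for a
      using that assms by (simp_all add: eval_nat_numeral)
    then show ?thesis by (simp only: distrib_left right_diff_distrib) (simp add: mult_ac)
  qed
  from this[OF s, of "cos (k * \<epsilon> * ?s)" "sin (k * \<epsilon> * ?s)"]
  have F: "\<epsilon> ^ 3 * (4 * \<epsilon>\<^sup>2 * W2 k ((\<epsilon> *\<^sub>R z) \<bullet> (\<epsilon> *\<^sub>R z) + \<epsilon>\<^sup>2))
    = 3 * cos (k * \<epsilon> * ?s) / ?s ^ 5 + 3 * k * \<epsilon> * sin (k * \<epsilon> * ?s) / ?s ^ 4
      - k\<^sup>2 * \<epsilon>\<^sup>2 * cos (k * \<epsilon> * ?s) / ?s ^ 3"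
    unfolding W2_def sq mult.assoc[of k \<epsilon> ?s, symmetric] .
  show ?thesis
    unfolding kern_main_def kern_scaled_def mult.left_commute[of "\<epsilon> ^ 3" "ball_cutoff R _"] F ..
qed

text \<open>With s the root of 1 + |z|^2, the first two terms decay at least like s^(-4). The third
  decays only like s^(-3), which is not integrable, but the cutoff restricts to \<epsilon> |z| \<le>
  R, where \<epsilon>^2 s^2 \<le> R^2 + 1; this buys the missing powers.\<close>

lemma kern_scaled_bound:
  assumes R: "R > 0" and \<epsilon>: "0 < \<epsilon>" "\<epsilon> \<le> 1"
  shows "\<bar>kern_scaled R k \<epsilon> z\<bar> \<le> (3 + 3 * \<bar>k\<bar> + k\<^sup>2 * (R\<^sup>2 + 1)) * (1 / (1 + z \<bullet> z)\<^sup>2)"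
proof (cases "norm (\<epsilon> *\<^sub>R z) \<ge> R")
  case True
  then have "kern_scaled R k \<epsilon> z = 0" using R by (simp add: kern_scaled_def ball_cutoff_eq_0)
  then show ?thesis by (simp add: add_nonneg_nonneg)
next
  case False
  let ?s = "sqrt (1 + z \<bullet> z)"
  let ?c = "cos (k * \<epsilon> * ?s)" and ?n = "sin (k * \<epsilon> * ?s)"
  have s1: "?s \<ge> 1" by simp
  have s4: "?s ^ 4 = (1 + z \<bullet> z)\<^sup>2"
  proof -
    have "?s ^ 4 = (?s\<^sup>2)\<^sup>2" by (simp only: power_mult[symmetric]) simp
    moreover have "?s\<^sup>2 = 1 + z \<bullet> z" by (rule real_sqrt_pow2) (simp add: add_nonneg_nonneg)
    ultimately show ?thesis by (simp only:)
  qed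
  have p4: "?s ^ 4 > 0" using s1 by (intro zero_less_power) linarith
  have "\<bar>3 * ?c / ?s ^ 5\<bar> \<le> 3 / ?s ^ 4"
  proof -
    have "?s ^ 4 \<le> ?s ^ 5" using s1 by (intro power_increasing) auto
    then have "3 * \<bar>?c\<bar> / ?s ^ 5 \<le> 3 * 1 / ?s ^ 4" using p4 by (intro frac_le mult_mono) auto
    then show ?thesis using s1 by (simp add: abs_mult)
  qed
  moreover have "\<bar>3 * k * \<epsilon> * ?n / ?s ^ 4\<bar> \<le> 3 * \<bar>k\<bar> / ?s ^ 4"
  proof -
    have "3 * \<bar>k\<bar> * \<epsilon> * \<bar>?n\<bar> \<le> 3 * \<bar>k\<bar> * 1 * 1" using \<epsilon> by (intro mult_mono) auto
    then show ?thesis using p4 \<epsilon> by (simp add: abs_mult divide_right_mono)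
  qed
  moreover have "\<bar>k\<^sup>2 * \<epsilon>\<^sup>2 * ?c / ?s ^ 3\<bar> \<le> k\<^sup>2 * (R\<^sup>2 + 1) / ?s ^ 4"
  proof -
    have "\<epsilon> * norm z \<le> R" using False \<epsilon> by simp
    then have "(\<epsilon> * norm z)\<^sup>2 \<le> R\<^sup>2" using \<epsilon> by (intro power_mono) auto
    moreover have "\<epsilon>\<^sup>2 \<le> 1" using \<epsilon> by (simp add: power_le_one)
    ultimately have e: "\<epsilon>\<^sup>2 * ?s\<^sup>2 \<le> R\<^sup>2 + 1"
      by (simp add: power_mult_distrib power2_norm_eq_inner algebra_simps add_nonneg_nonneg)
    have "\<bar>k\<^sup>2 * \<epsilon>\<^sup>2 * ?c / ?s ^ 3\<bar> = k\<^sup>2 * \<epsilon>\<^sup>2 * \<bar>?c\<bar> / ?s ^ 3"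
      using s1 by (simp add: abs_mult)
    also have "\<dots> \<le> k\<^sup>2 * \<epsilon>\<^sup>2 * 1 / ?s ^ 3"
      using s1 by (intro divide_right_mono mult_mono) auto
    also have "\<dots> = k\<^sup>2 * (\<epsilon>\<^sup>2 * ?s\<^sup>2) / ?s ^ 5"
    proof -
      have "?s ^ 5 = ?s ^ 3 * ?s\<^sup>2" by (simp only: power_add[symmetric]) simp
      moreover have "?s \<noteq> 0" using s1 by linarith
      ultimately show ?thesis by (simp only: ) (simp add: field_simps del: real_sqrt_pow2 real_sqrt_pow2_iff)
    qed
    also have "\<dots> \<le> k\<^sup>2 * (R\<^sup>2 + 1) / ?s ^ 4"
    proof (intro frac_le mult_left_mono e)
      show "?s ^ 4 \<le> ?s ^ 5" using s1 by (intro power_increasing) auto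
    qed (use p4 in auto)
    finally show ?thesis .
  qed
  ultimately have "\<bar>3 * ?c / ?s ^ 5 + 3 * k * \<epsilon> * ?n / ?s ^ 4 - k\<^sup>2 * \<epsilon>\<^sup>2 * ?c / ?s ^ 3\<bar>
      \<le> 3 / ?s ^ 4 + 3 * \<bar>k\<bar> / ?s ^ 4 + k\<^sup>2 * (R\<^sup>2 + 1) / ?s ^ 4"
    by linarith
  also have "\<dots> = (3 + 3 * \<bar>k\<bar> + k\<^sup>2 * (R\<^sup>2 + 1)) * (1 / (1 + z \<bullet> z)\<^sup>2)"
    unfolding s4 by (simp add: add_divide_distrib)
  finally have "\<bar>ball_cutoff R (\<epsilon> *\<^sub>R z)\<bar> * \<bar>3 * ?c / ?s ^ 5 + 3 * k * \<epsilon> * ?n / ?s ^ 4 - k\<^sup>2 * \<epsilon>\<^sup>2 * ?c / ?s ^ 3\<bar>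
      \<le> 1 * ((3 + 3 * \<bar>k\<bar> + k\<^sup>2 * (R\<^sup>2 + 1)) * (1 / (1 + z \<bullet> z)\<^sup>2))"
    using ball_cutoff_bounds[of R "\<epsilon> *\<^sub>R z"] by (intro mult_mono) auto
  then show ?thesis by (simp add: kern_scaled_def abs_mult)
qed

lemma kern_scaled_tendsto:
  assumes R: "R > 0" and X: "X \<longlonglongrightarrow> 0"
  shows "(\<lambda>n. kern_scaled R k (X n) z) \<longlonglongrightarrow> 3 / sqrt (1 + z \<bullet> z) ^ 5"
proof -
  have s: "sqrt (1 + z \<bullet> z) \<noteq> 0" by (simp add: add_nonneg_eq_0_iff)
  have "continuous_on UNIV (ball_cutoff R :: real^3 \<Rightarrow> real)"
    using Ck_on_imp_continuous[OF Ck_on_ball_cutoff] .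
  then have "(\<lambda>n. ball_cutoff R (X n *\<^sub>R z)) \<longlonglongrightarrow> ball_cutoff R (0 *\<^sub>R z)"
    by (intro continuous_on_tendsto_compose[of UNIV "ball_cutoff R"] tendsto_intros X) auto
  then have "(\<lambda>n. kern_scaled R k (X n) z) \<longlonglongrightarrow> ball_cutoff R (0 *\<^sub>R z) *
     (3 * cos (k * 0 * sqrt (1 + z \<bullet> z)) / sqrt (1 + z \<bullet> z) ^ 5
      + 3 * k * 0 * sin (k * 0 * sqrt (1 + z \<bullet> z)) / sqrt (1 + z \<bullet> z) ^ 4
      - k\<^sup>2 * 0\<^sup>2 * cos (k * 0 * sqrt (1 + z \<bullet> z)) / sqrt (1 + z \<bullet> z) ^ 3)"
    unfolding kern_scaled_def using s by (intro tendsto_intros X) auto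
  then show ?thesis using R by (simp add: ball_cutoff_eq_1)
qed

section \<open>Interior regularity for the Helmholtz equation\<close>

lemma lborel_integral_affine:
  fixes f :: "real^3 \<Rightarrow> real"
  assumes [measurable]: "f \<in> borel_measurable borel" and c: "c > 0"
  shows "(\<integral>x. f x \<partial>lborel) = (\<integral>z. c ^ 3 * f (t + c *\<^sub>R z) \<partial>lborel)"
proof -
  have "(\<integral>x. f x \<partial>lborel)
      = (\<integral>x. f x \<partial>density (distr lborel borel (\<lambda>x. t + c *\<^sub>R x)) (\<lambda>_. ennreal (\<bar>c\<bar> ^ DIM(real^3))))"
    using lborel_affine[of c t] c by simp
  also have "\<dots> = (\<integral>z. c ^ 3 * f (t + c *\<^sub>R z) \<partial>lborel)"
    using c by (subst integral_density) (auto simp: integral_distr)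
  finally show ?thesis .
qed

text \<open>\<open>Ck_on\<close> yields continuity of the derivative one direction at a time. Bounds
  on the finitely many basis vectors combine to a bound for the linear map.\<close>

lemma frechet_bounded_on_compact:
  fixes g :: "'a::euclidean_space \<Rightarrow> 'b::real_normed_vector"
  assumes "Ck_on 1 S g" "compact K" "K \<subseteq> S"
  obtains C where "C > 0" "\<And>x v. x \<in> K \<Longrightarrow> norm (frechet_derivative g (at x) v) \<le> C * norm v"
proof -
  have g: "Ck_on (Suc 0) S g" using assms(1) by simp
  have "\<exists>C. \<forall>x\<in>K. norm (frechet_derivative g (at x) b) \<le> C" for b
  proof -
    have "continuous_on K (\<lambda>x. frechet_derivative g (at x) b)"
      using g assms(3) by (auto intro: continuous_on_subset)
    then have "bounded ((\<lambda>x. frechet_derivative g (at x) b) ` K)"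
      using assms(2) by (intro compact_imp_bounded compact_continuous_image)
    then show ?thesis unfolding bounded_iff by blast
  qed
  then obtain C where C: "\<And>b x. x \<in> K \<Longrightarrow> norm (frechet_derivative g (at x) b) \<le> C b" by metis
  have "norm (frechet_derivative g (at x) v) \<le> (1 + (\<Sum>b\<in>Basis. \<bar>C b\<bar>)) * norm v" if x: "x \<in> K" for x v
  proof -
    have lin: "linear (frechet_derivative g (at x))"
      using Ck_on_SucD[OF g] x assms(3) has_derivative_linear by blast
    have "frechet_derivative g (at x) v = frechet_derivative g (at x) (\<Sum>b\<in>Basis. (v \<bullet> b) *\<^sub>R b)"
      by (simp add: euclidean_representation)
    also have "\<dots> = (\<Sum>b\<in>Basis. (v \<bullet> b) *\<^sub>R frechet_derivative g (at x) b)"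
      by (simp add: linear_sum[OF lin] linear_cmul[OF lin])
    also have "norm \<dots> \<le> (\<Sum>b\<in>Basis. norm v * \<bar>C b\<bar>)"
    proof (rule sum_norm_le)
      fix b :: 'a assume b: "b \<in> Basis"
      show "norm ((v \<bullet> b) *\<^sub>R frechet_derivative g (at x) b) \<le> norm v * \<bar>C b\<bar>"
        unfolding norm_scaleR
        by (intro mult_mono) (use Basis_le_norm[OF b, of v] C[OF x, of b] in auto)
    qed
    also have "\<dots> = (\<Sum>b\<in>Basis. \<bar>C b\<bar>) * norm v" by (simp add: sum_distrib_left mult.commute)
    also have "\<dots> \<le> (1 + (\<Sum>b\<in>Basis. \<bar>C b\<bar>)) * norm v" by (intro mult_right_mono) auto
    finally show ?thesis .
  qed
  moreover have "0 < 1 + (\<Sum>b\<in>Basis. \<bar>C b\<bar>)" by (intro add_pos_nonneg sum_nonneg) auto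
  ultimately show ?thesis by (intro that)
qed

lemma kern_main_uminus: "kern_main R k \<epsilon> (- x) = kern_main R k \<epsilon> x"
  by (simp add: kern_main_def ball_cutoff_def)

lemma borel_measurable_W [measurable]:
  "W0 k \<in> borel_measurable borel" "W1 k \<in> borel_measurable borel" "W2 k \<in> borel_measurable borel"
  unfolding W0_def[abs_def] W1_def[abs_def] W2_def[abs_def] by measurable

lemma borel_measurable_ball_cutoff [measurable]: "(ball_cutoff R :: real^3 \<Rightarrow> real) \<in> borel_measurable borel"
  using Ck_on_imp_continuous[OF Ck_on_ball_cutoff] by (rule borel_measurable_continuous_onI)

lemma borel_measurable_kern [measurable]:
  "kern R k \<epsilon> \<in> borel_measurable borel" "kern_main R k \<epsilon> \<in> borel_measurable borel"
  unfolding kern_def[abs_def] helm_def[abs_def] kern_main_def[abs_def] by measurable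

lemma kern_main_bounded:
  assumes "R > 0" "\<epsilon> \<noteq> 0"
  obtains C where "C > 0" "\<And>x. \<bar>kern_main R k \<epsilon> x\<bar> \<le> C"
proof -
  have pos: "0 < x \<bullet> x + \<epsilon>\<^sup>2" for x :: "real^3" using assms by (simp add: add_nonneg_pos)
  have "continuous_on UNIV (ball_cutoff R :: real^3 \<Rightarrow> real)"
    by (rule Ck_on_imp_continuous[OF Ck_on_ball_cutoff])
  moreover have "continuous_on UNIV (\<lambda>x::real^3. W2 k (x \<bullet> x + \<epsilon>\<^sup>2))"
    by (rule continuous_on_compose2[OF continuous_on_W(3)]) (use pos in \<open>auto intro!: continuous_intros\<close>)
  ultimately have "continuous_on UNIV (kern_main R k \<epsilon>)"
    unfolding kern_main_def[abs_def] by (intro continuous_intros)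
  moreover have "kern_main R k \<epsilon> x = 0" if "x \<notin> cball 0 R" for x
    using that assms by (simp add: kern_main_def ball_cutoff_eq_0)
  ultimately show ?thesis
    using bounded_compact_support[OF _ compact_cball[of "0::real^3" R], of "kern_main R k \<epsilon>"] that
    by (metis real_norm_def)
qed

text \<open>The mass of the Dirac measure in the limit of \<open>kern_main\<close>. Its value is 4
  \<pi>; since the argument divides by it, positivity is what has to be shown.\<close>

definition kern_mass :: real where
  "kern_mass = (\<integral>z. 3 / sqrt (1 + z \<bullet> (z::real^3)) ^ 5 \<partial>lborel)"

lemma integrable_kern_mass: "integrable lborel (\<lambda>z::real^3. 3 / sqrt (1 + z \<bullet> z) ^ 5)"
proof (rule Bochner_Integration.integrable_bound[OF integrable_mult_right[OF integrable_bracket, of 3]])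
  show "AE z::real^3 in lborel. norm (3 / sqrt (1 + z \<bullet> z) ^ 5) \<le> norm (3 * (1 / (1 + z \<bullet> z)\<^sup>2))"
  proof (rule AE_I2)
    fix z :: "real^3"
    let ?s = "sqrt (1 + z \<bullet> z)"
    have s1: "?s \<ge> 1" by simp
    have "?s ^ 4 = (?s\<^sup>2)\<^sup>2" by (simp only: power_mult[symmetric]) simp
    moreover have "?s\<^sup>2 = 1 + z \<bullet> z" by (rule real_sqrt_pow2) (simp add: add_nonneg_nonneg)
    ultimately have s4: "?s ^ 4 = (1 + z \<bullet> z)\<^sup>2" by (simp only:)
    have "?s ^ 4 \<le> ?s ^ 5" using s1 by (intro power_increasing) auto
    then have "3 / ?s ^ 5 \<le> 3 / ?s ^ 4" using s1 by (intro divide_left_mono mult_pos_pos zero_less_power) (auto simp: add_pos_nonneg)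
    then show "norm (3 / ?s ^ 5) \<le> norm (3 * (1 / (1 + z \<bullet> z)\<^sup>2))"
      using s1 unfolding s4 by (simp add: add_nonneg_nonneg)
  qed
  show "(\<lambda>z::real^3. 3 / sqrt (1 + z \<bullet> z) ^ 5) \<in> borel_measurable lborel" by measurable
qed

lemma kern_mass_pos: "kern_mass > 0"
proof -
  have pos: "0 < 3 / sqrt (1 + z \<bullet> z) ^ 5" for z :: "real^3"
    by (intro divide_pos_pos zero_less_power) (auto simp: add_pos_nonneg)
  have "kern_mass \<ge> 0" unfolding kern_mass_def using pos by (intro integral_nonneg_AE AE_I2 less_imp_le)
  moreover have "kern_mass \<noteq> 0"
  proof
    assume "kern_mass = 0"
    then have "AE z::real^3 in lborel. 3 / sqrt (1 + z \<bullet> z) ^ 5 = 0"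
      unfolding kern_mass_def using pos
      by (subst (asm) integral_nonneg_eq_0_iff_AE[OF integrable_kern_mass]) (auto intro: less_imp_le)
    then have "AE z::real^3 in lborel. False" by eventually_elim (use pos in \<open>metis less_irrefl\<close>)
    then show False by (simp add: AE_iff_null null_sets_def)
  qed
  ultimately show ?thesis by simp
qed

text \<open>\<open>T n\<close> mollifies the indicator of the box with \<open>kern_main\<close>.
  After rescaling, the integrand has a fixed integrable majorant, and it converges wherever the
  indicator is locally constant, that is off the null frontier of the box.\<close>

lemma kern_main_box_limit:
  fixes a b :: "real^3" and k R :: real
  assumes R: "R > 0"
  defines "T \<equiv> \<lambda>n x. \<integral>y. indicator (box a b) y * kern_main R k (inverse (real (Suc n))) (x - y) \<partial>lborel"
  shows "AE x in lborel. (\<lambda>n. T n x) \<longlonglongrightarrow> kern_mass * indicator (box a b) x"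
    and "\<exists>C. \<forall>n x. \<bar>T n x\<bar> \<le> C"
proof -
  let ?e = "\<lambda>n. inverse (real (Suc n))"
  let ?M = "3 + 3 * \<bar>k\<bar> + k\<^sup>2 * (R\<^sup>2 + 1)"
  let ?w = "\<lambda>z::real^3. ?M * (1 / (1 + z \<bullet> z)\<^sup>2)"
  have M: "?M \<ge> 0" by (intro add_nonneg_nonneg mult_nonneg_nonneg) auto
  have e: "?e n > 0" "?e n \<le> 1" for n by (auto simp: inverse_le_1_iff)
  have iw: "integrable lborel ?w" by (rule integrable_mult_right[OF integrable_bracket])
  \<comment> \<open>Substitution y = x + e z; the kernel is even, which removes the sign of its
    argument.\<close>
  have T: "T n x = (\<integral>z. indicator (box a b) (x + ?e n *\<^sub>R z) * kern_scaled R k (?e n) z \<partial>lborel)" for n x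
  proof -
    have "T n x = (\<integral>z. ?e n ^ 3 * (indicator (box a b) (x + ?e n *\<^sub>R z) * kern_main R k (?e n) (x - (x + ?e n *\<^sub>R z))) \<partial>lborel)"
      unfolding T_def by (rule lborel_integral_affine[OF _ e(1)]) measurable
    also have "\<dots> = (\<integral>z. indicator (box a b) (x + ?e n *\<^sub>R z) * kern_scaled R k (?e n) z \<partial>lborel)"
    proof (rule Bochner_Integration.integral_cong[OF refl])
      fix z :: "real^3"
      have "kern_main R k (?e n) (x - (x + ?e n *\<^sub>R z)) = kern_main R k (?e n) (?e n *\<^sub>R z)"
        using kern_main_uminus[of R k "?e n" "?e n *\<^sub>R z"] by simp
      then show "?e n ^ 3 * (indicator (box a b) (x + ?e n *\<^sub>R z) * kern_main R k (?e n) (x - (x + ?e n *\<^sub>R z)))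
          = indicator (box a b) (x + ?e n *\<^sub>R z) * kern_scaled R k (?e n) z"
        unfolding kern_main_scaled[OF e(1), symmetric] by (simp only: mult.left_commute)
    qed
    finally show ?thesis .
  qed
  have sc: "kern_scaled R k (?e n) \<in> borel_measurable borel" for n
    unfolding kern_scaled_def[abs_def] by measurable
  have meas: "(\<lambda>z. indicator (box a b) (x + ?e n *\<^sub>R z) * kern_scaled R k (?e n) z) \<in> borel_measurable lborel" for n x
    using sc[of n] by measurable
  have bd: "norm (indicator (box a b) (x + ?e n *\<^sub>R z) * kern_scaled R k (?e n) z) \<le> ?w z" for n x z
  proof -
    have "norm (indicator (box a b) (x + ?e n *\<^sub>R z) * kern_scaled R k (?e n) z) \<le> \<bar>kern_scaled R k (?e n) z\<bar>"
      by (auto simp: indicator_def)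
    also have "\<dots> \<le> ?w z" by (rule kern_scaled_bound[OF R e])
    finally show ?thesis .
  qed
  have "\<bar>T n x\<bar> \<le> integral\<^sup>L lborel ?w" for n x
  proof -
    have "\<bar>T n x\<bar> \<le> (\<integral>z. norm (indicator (box a b) (x + ?e n *\<^sub>R z) * kern_scaled R k (?e n) z) \<partial>lborel)"
      unfolding T real_norm_def by (rule integral_abs_bound)
    also have "\<dots> \<le> integral\<^sup>L lborel ?w"
      by (intro integral_mono_AE' iw AE_I2 bd) auto
    finally show ?thesis .
  qed
  then show "\<exists>C. \<forall>n x. \<bar>T n x\<bar> \<le> C" by blast
  have e0: "?e \<longlonglongrightarrow> 0" by (rule LIMSEQ_inverse_real_of_nat)
  have lim: "(\<lambda>n. T n x) \<longlonglongrightarrow> kern_mass * indicator (box a b) x" if x: "x \<notin> cbox a b - box a b" for x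
  proof -
    let ?f = "\<lambda>z. indicator (box a b) x * (3 / sqrt (1 + z \<bullet> (z::real^3)) ^ 5) :: real"
    have ae: "AE z in lborel. (\<lambda>n. indicator (box a b) (x + ?e n *\<^sub>R z) * kern_scaled R k (?e n) z)
          \<longlonglongrightarrow> ?f z"
    proof (intro AE_I2 tendsto_mult kern_scaled_tendsto[OF R e0])
      fix z :: "real^3"
      have L: "(\<lambda>n. x + ?e n *\<^sub>R z) \<longlonglongrightarrow> x + 0 *\<^sub>R z" by (intro tendsto_intros e0)
      have "\<forall>\<^sub>F n in sequentially. indicator (box a b) (x + ?e n *\<^sub>R z) = (indicator (box a b) x :: real)"
      proof (cases "x \<in> box a b")
        case True
        then show ?thesis
          using topological_tendstoD[OF L open_box[of a b]] by (simp add: eventually_mono)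
      next
        case False
        then have "x \<in> - cbox a b" using x by blast
        then have "\<forall>\<^sub>F n in sequentially. x + ?e n *\<^sub>R z \<in> - cbox a b"
          using topological_tendstoD[OF L open_Compl[OF closed_cbox[of a b]]] by simp
        then show ?thesis
        proof eventually_elim
          case (elim n)
          then have "x + ?e n *\<^sub>R z \<notin> box a b" using box_subset_cbox[of a b] by blast
          with False show ?case by (simp del: of_nat_Suc)
        qed
      qed
      then show "(\<lambda>n. indicator (box a b) (x + ?e n *\<^sub>R z)) \<longlonglongrightarrow> (indicator (box a b) x :: real)"
        by (rule tendsto_eventually)
    qed
    have mf: "?f \<in> borel_measurable lborel" by measurable
    have "(\<lambda>n. T n x) \<longlonglongrightarrow> integral\<^sup>L lborel ?f"
      unfolding T by (rule integral_dominated_convergence[OF mf meas iw ae AE_I2[OF bd]])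
    then show ?thesis
      unfolding integral_mult_right_zero kern_mass_def by (simp only: mult.commute)
  qed
  have "negligible (cbox a b - box a b)" by (rule negligible_frontier_interval)
  moreover have "cbox a b - box a b \<in> sets lborel" by simp
  ultimately have "AE x in lborel. x \<notin> cbox a b - box a b"
    by (intro AE_not_in) (simp add: negligible_iff_null_sets null_sets_completion_iff)
  then show "AE x in lborel. (\<lambda>n. T n x) \<longlonglongrightarrow> kern_mass * indicator (box a b) x"
    by eventually_elim (rule lim)
qed

text \<open>Testing with the regularised kernel centred at y expresses the mollification P of U as A
  - G, where A contains the smooth remainder of the kernel and G the right-hand side g. For
  \<epsilon> tending to 0 this converges to V = A - G at \<epsilon> = 0, which is of class C^1. That
  V equals \<open>kern_mass\<close> times U almost everywhere is checked by integrating over boxes,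
  where the mollification can be shifted onto the indicator.\<close>

lemma helmholtz_regularity_boxes:
  fixes U g :: "real^3 \<Rightarrow> complex"
  assumes R: "0 < R" "R \<le> 2"
    and U: "integrable lborel U"
    and g: "Ck_on 1 (ball x0 (3 * R)) g"
    and weak: "\<And>\<phi>. test_on (ball x0 (3 * R)) \<phi> \<Longrightarrow>
      (\<integral>x. (lap \<phi> x + k\<^sup>2 * \<phi> x) *\<^sub>R U x \<partial>lborel) = (\<integral>x. \<phi> x *\<^sub>R g x \<partial>lborel)"
  obtains v where "Ck_on 1 (ball x0 R) v"
    "\<And>a b. box a b \<subseteq> ball x0 R \<Longrightarrow> AE x in lborel. x \<in> box a b \<longrightarrow> U x = v x"
proof -
  define er where "er n = inverse (real (Suc n))" for n
  define A where "A \<epsilon> y = (\<integral>x. kern_rest R k \<epsilon> (x - y) *\<^sub>R U x \<partial>lborel)" for \<epsilon> y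
  define P where "P \<epsilon> y = (\<integral>x. kern_main R k \<epsilon> (x - y) *\<^sub>R U x \<partial>lborel)" for \<epsilon> y
  define G where "G \<epsilon> y = (\<integral>z. kern R k \<epsilon> z *\<^sub>R g (y + z) \<partial>lborel)" for \<epsilon> y
  define V where "V y = A 0 y - G 0 y" for y
  have e: "er n > 0" "er n \<le> 1" "er n \<noteq> 0" "er n \<in> {0..1}" for n by (auto simp: er_def inverse_le_1_iff)
  have e0: "er \<longlonglongrightarrow> 0" unfolding er_def[abs_def] by (rule LIMSEQ_inverse_real_of_nat)
  have Um [measurable]: "U \<in> borel_measurable borel" using borel_measurable_integrable[OF U] by simp
  have krc: "continuous_on UNIV (kern_rest R k \<epsilon>)" for \<epsilon>
    by (rule Ck_on_imp_continuous[OF Ck_on_kern_rest[OF R(1)]])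
  then have [measurable]: "kern_rest R k \<epsilon> \<in> borel_measurable borel" for \<epsilon>
    by (rule borel_measurable_continuous_onI)
  obtain C where C: "C > 0" "\<And>\<epsilon> x. \<epsilon> \<in> {0..1} \<Longrightarrow> \<bar>kern_rest R k \<epsilon> x\<bar> \<le> C"
    using kern_rest_bounded[OF R(1)] by blast
  have iCU: "integrable lborel (\<lambda>x. C * norm (U x))" using U by simp
  have bA: "norm (kern_rest R k \<epsilon> (x - y) *\<^sub>R U x) \<le> C * norm (U x)" if "\<epsilon> \<in> {0..1}" for \<epsilon> x y
    using C(2)[OF that, of "x - y"] by (simp add: mult_right_mono)
  have mA: "(\<lambda>x. kern_rest R k \<epsilon> (x - y) *\<^sub>R U x) \<in> borel_measurable lborel" for \<epsilon> y by measurable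
  have iA: "integrable lborel (\<lambda>x. kern_rest R k \<epsilon> (x - y) *\<^sub>R U x)" if "\<epsilon> \<in> {0..1}" for \<epsilon> y
    by (rule Bochner_Integration.integrable_bound[OF iCU mA]) (use bA[OF that] C(1) in auto)
  have cg: "continuous_on (ball x0 (3 * R)) g" by (rule Ck_on_imp_continuous[OF g])
  have sub: "y + z \<in> cball x0 (2 * R)" if "y \<in> ball x0 R" "z \<in> cball 0 R" for y z
  proof -
    have "dist x0 (y + z) \<le> dist x0 y + dist y (y + z)" by (rule dist_triangle)
    then show ?thesis using that by (simp add: dist_norm)
  qed
  \<comment> \<open>The centre y has distance less than R from x0 and the kernel reaches R further;
    the last third of the radius leaves a compact ball inside the domain of g.\<close>
  have sub3: "cball x0 (2 * R) \<subseteq> ball x0 (3 * R)" using R by (auto simp: subset_eq)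
  have "bounded (g ` cball x0 (2 * R))"
    by (intro compact_imp_bounded compact_continuous_image continuous_on_subset[OF cg sub3]) auto
  then obtain Cg where Cg: "\<And>x. x \<in> cball x0 (2 * R) \<Longrightarrow> norm (g x) \<le> Cg"
    unfolding bounded_iff by blast
  have "0 \<le> norm (g x0)" by simp
  also have "\<dots> \<le> Cg" using R by (intro Cg) auto
  finally have Cg0: "Cg \<ge> 0" .
  let ?w = "\<lambda>z::real^3. Cg * (indicator (cball 0 R) z / norm z)"
  have iw: "integrable lborel ?w" by (intro integrable_mult_right integrable_inverse_norm R)
  have bG: "norm (kern R k \<epsilon> z *\<^sub>R g (y + z)) \<le> ?w z" if "y \<in> ball x0 R" "z \<noteq> 0" for \<epsilon> y z
  proof (cases "z \<in> cball 0 R")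
    case True
    have "\<bar>kern R k \<epsilon> z\<bar> * norm (g (y + z)) \<le> indicator (cball 0 R) z / norm z * Cg"
      by (intro mult_mono norm_kern_le R that Cg sub True) auto
    then show ?thesis by (simp add: mult.commute)
  next
    case False
    then show ?thesis using norm_kern_le[OF R(1) that(2), of k \<epsilon>] by simp
  qed
  have mG: "(\<lambda>z. kern R k \<epsilon> z *\<^sub>R g (y + z)) \<in> borel_measurable lborel" if y: "y \<in> ball x0 R" for \<epsilon> y
  proof -
    have "continuous_on (cball 0 R) (\<lambda>z. g (y + z))"
    proof (rule continuous_on_compose2[OF cg])
      show "(\<lambda>z. y + z) ` cball 0 R \<subseteq> ball x0 (3 * R)" using sub[OF y] sub3 by blast
    qed (intro continuous_intros)
    then have [measurable]: "(\<lambda>z. indicator (cball 0 R) z *\<^sub>R g (y + z)) \<in> borel_measurable borel"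
      by (rule borel_measurable_continuous_on_indicator[rotated]) simp
    have "(\<lambda>z. kern R k \<epsilon> z *\<^sub>R (indicator (cball 0 R) z *\<^sub>R g (y + z))) \<in> borel_measurable lborel"
      by measurable
    also have "(\<lambda>z. kern R k \<epsilon> z *\<^sub>R (indicator (cball 0 R) z *\<^sub>R g (y + z))) = (\<lambda>z. kern R k \<epsilon> z *\<^sub>R g (y + z))"
    proof
      fix z
      show "kern R k \<epsilon> z *\<^sub>R (indicator (cball 0 R) z *\<^sub>R g (y + z)) = kern R k \<epsilon> z *\<^sub>R g (y + z)"
        using R by (cases "z \<in> cball 0 R") (simp_all add: kern_def ball_cutoff_eq_0)
    qed
    finally show ?thesis .
  qed
  have nz: "AE z::real^3 in lborel. z \<noteq> 0" by (rule AE_lborel_singleton)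
  have iG: "integrable lborel (\<lambda>z. kern R k \<epsilon> z *\<^sub>R g (y + z))" if y: "y \<in> ball x0 R" for \<epsilon> y
  proof (rule Bochner_Integration.integrable_bound[OF iw mG[OF y]])
    show "AE z in lborel. norm (kern R k \<epsilon> z *\<^sub>R g (y + z)) \<le> norm (?w z)"
      using nz
    proof eventually_elim
      case (elim z)
      show ?case using bG[OF y elim, of \<epsilon>] abs_ge_self[of "?w z"] unfolding real_norm_def by linarith
    qed
  qed
  have km: "\<exists>Cm. \<forall>x. \<bar>kern_main R k (er n) x\<bar> \<le> Cm" for n
    using kern_main_bounded[OF R(1) e(3)] by metis
  have iP: "integrable lborel (\<lambda>x. kern_main R k (er n) (x - y) *\<^sub>R U x)" for n y
  proof -
    obtain Cm where Cm: "\<And>x. \<bar>kern_main R k (er n) x\<bar> \<le> Cm" using km by blast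
    have "integrable lborel (\<lambda>x. Cm * norm (U x))" using U by simp
    then show ?thesis
    proof (rule Bochner_Integration.integrable_bound)
      show "AE x in lborel. norm (kern_main R k (er n) (x - y) *\<^sub>R U x) \<le> norm (Cm * norm (U x))"
        by (intro AE_I2) (simp add: abs_mult mult_right_mono order_trans[OF Cm abs_ge_self])
      show "(\<lambda>x. kern_main R k (er n) (x - y) *\<^sub>R U x) \<in> borel_measurable lborel" by measurable
    qed
  qed
  \<comment> \<open>The weak equation with the kernel centred at y; in the term with g, a
    translation moves y from the kernel to g.\<close>
  have eq: "P (er n) y = A (er n) y - G (er n) y" if y: "y \<in> ball x0 R" for n y
  proof -
    let ?\<phi> = "\<lambda>x. kern R k (er n) (x - y)"
    have K: "compact (cball y R)" "cball y R \<subseteq> ball x0 (3 * R)" "\<And>x. x \<notin> cball y R \<Longrightarrow> ?\<phi> x = 0"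
    proof -
      show "cball y R \<subseteq> ball x0 (3 * R)"
      proof
        fix x assume "x \<in> cball y R"
        then have "y + (x - y) \<in> cball x0 (2 * R)" using y by (intro sub) (auto simp: dist_norm norm_minus_commute)
        then show "x \<in> ball x0 (3 * R)" using sub3 by auto
      qed
      show "?\<phi> x = 0" if "x \<notin> cball y R" for x
        using that R by (simp add: kern_def ball_cutoff_eq_0 dist_norm norm_minus_commute)
    qed simp
    have CkT: "Ck_on m UNIV ?\<phi>" for m
      by (rule Ck_on_compose[of UNIV UNIV "\<lambda>x. x - y", OF _ _ _ _ Ck_on_kern[OF e(3)]])
        (rule open_UNIV subset_UNIV Ck_on_diff Ck_on_id Ck_on_const)+
    have "test_on (ball x0 (3 * R)) ?\<phi>"
      unfolding test_on_def using CkT K by blast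
    from weak[OF this] have W: "(\<integral>x. (lap ?\<phi> x + k\<^sup>2 * ?\<phi> x) *\<^sub>R U x \<partial>lborel) = (\<integral>x. ?\<phi> x *\<^sub>R g x \<partial>lborel)" .
    have "lap ?\<phi> x + k\<^sup>2 * ?\<phi> x = kern_rest R k (er n) (x - y) - kern_main R k (er n) (x - y)" for x
      unfolding lap_translate[OF Ck_on_kern[OF e(3)]] by (rule kern_helmholtz[OF e(3)])
    then have "(\<integral>x. (lap ?\<phi> x + k\<^sup>2 * ?\<phi> x) *\<^sub>R U x \<partial>lborel)
        = (\<integral>x. kern_rest R k (er n) (x - y) *\<^sub>R U x - kern_main R k (er n) (x - y) *\<^sub>R U x \<partial>lborel)"
      by (simp only: scaleR_diff_left)
    also have "\<dots> = A (er n) y - P (er n) y"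
      unfolding A_def P_def by (rule Bochner_Integration.integral_diff[OF iA[OF e(4)] iP])
    finally have L: "A (er n) y - P (er n) y = (\<integral>x. ?\<phi> x *\<^sub>R g x \<partial>lborel)" using W by simp
    have "continuous_on UNIV (\<lambda>x. ?\<phi> x *\<^sub>R g x)"
      by (rule Ck_on_imp_continuous[OF Ck_on_bilinear_extend_zero[OF bounded_bilinear_scaleR open_ball K Ck_on_subset[OF CkT subset_UNIV] g]])
    then have "integrable lborel (\<lambda>x. ?\<phi> x *\<^sub>R g x)"
      by (rule integrable_compact_support[OF _ K(1)]) (simp add: K(3))
    from lborel_integral_translate(2)[OF this, of y] have "(\<integral>x. ?\<phi> x *\<^sub>R g x \<partial>lborel) = G (er n) y"
      unfolding G_def by (simp only: add_diff_cancel_left')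
    then have "A (er n) y - P (er n) y = G (er n) y" using L by simp
    then show ?thesis by (simp flip: \<open>A (er n) y - P (er n) y = G (er n) y\<close>)
  qed
  have limA: "(\<lambda>n. A (er n) y) \<longlonglongrightarrow> A 0 y" for y
    unfolding A_def
    by (rule integral_dominated_convergence[OF mA mA iCU AE_I2 AE_I2[OF bA[OF e(4)]]])
      (intro tendsto_scaleR tendsto_const kern_rest_tendsto[OF R(1) e0])
  have limG: "(\<lambda>n. G (er n) y) \<longlonglongrightarrow> G 0 y" if y: "y \<in> ball x0 R" for y
  proof -
    have ae: "AE z in lborel. (\<lambda>n. kern R k (er n) z *\<^sub>R g (y + z)) \<longlonglongrightarrow> kern R k 0 z *\<^sub>R g (y + z)"
      using nz by eventually_elim (intro tendsto_scaleR tendsto_const kern_tendsto e0)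
    have bd: "AE z in lborel. norm (kern R k (er n) z *\<^sub>R g (y + z)) \<le> ?w z" for n
      using nz by eventually_elim (rule bG[OF y])
    show ?thesis
      unfolding G_def by (rule integral_dominated_convergence[OF mG[OF y] mG[OF y] iw ae bd])
  qed
  have limP: "(\<lambda>n. P (er n) y) \<longlonglongrightarrow> V y" if y: "y \<in> ball x0 R" for y
    unfolding eq[OF y] V_def by (intro tendsto_diff limA limG[OF y])
  let ?D = "(\<integral>x. C * norm (U x) \<partial>lborel) + integral\<^sup>L lborel ?w"
  have bP: "norm (P (er n) y) \<le> ?D" if y: "y \<in> ball x0 R" for n y
  proof -
    have "norm (A (er n) y) \<le> (\<integral>x. norm (kern_rest R k (er n) (x - y) *\<^sub>R U x) \<partial>lborel)"
      unfolding A_def by (rule integral_norm_bound)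
    also have "\<dots> \<le> (\<integral>x. C * norm (U x) \<partial>lborel)"
      using C(1) by (intro integral_mono_AE' iCU AE_I2 bA e) auto
    finally have 1: "norm (A (er n) y) \<le> (\<integral>x. C * norm (U x) \<partial>lborel)" .
    have "norm (G (er n) y) \<le> (\<integral>z. norm (kern R k (er n) z *\<^sub>R g (y + z)) \<partial>lborel)"
      unfolding G_def by (rule integral_norm_bound)
    also have "\<dots> \<le> integral\<^sup>L lborel ?w"
    proof (rule integral_mono_AE'[OF iw])
      show "AE z in lborel. norm (kern R k (er n) z *\<^sub>R g (y + z)) \<le> ?w z"
        using nz by eventually_elim (rule bG[OF y])
      show "AE z in lborel. 0 \<le> ?w z" using Cg0 by simp
    qed
    finally have 2: "norm (G (er n) y) \<le> integral\<^sup>L lborel ?w" .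
    show ?thesis unfolding eq[OF y] using 1 2 norm_triangle_ineq4[of "A (er n) y" "G (er n) y"] by linarith
  qed
  \<comment> \<open>In A the parameter y sits in the kernel remainder, which is smooth even at
    \<epsilon> = 0. In G the kernel is singular at \<epsilon> = 0, so there y sits in g, and it is g
    that gets differentiated.\<close>
  have VC: "Ck_on 1 (ball x0 R) V"
  proof -
    obtain C1 where C1: "C1 > 0" "\<And>x v. x \<in> cball 0 R \<Longrightarrow> norm (frechet_derivative (kern_rest R k 0) (at x) v) \<le> C1 * norm v"
      using frechet_bounded_on_compact[OF Ck_on_kern_rest[OF R(1), of 1 k 0] compact_cball[of 0 R]] by blast
    have C1': "norm (frechet_derivative (kern_rest R k 0) (at x) v) \<le> C1 * norm v" for x v
    proof (cases "x \<in> cball 0 R")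
      case False
      have "frechet_derivative (kern_rest R k 0) (at x) v = 0"
        by (rule frechet_derivative_eq_0_open[of "- cball 0 R"]) (use False R kern_rest_eq_0[OF R(1)] in auto)
      then show ?thesis using C1(1) by simp
    qed (use C1 in auto)
    have krd: "((\<lambda>y. kern_rest R k 0 (x - y) *\<^sub>R u) has_derivative
        (\<lambda>v. frechet_derivative (kern_rest R k 0) (at (x - y)) (- v) *\<^sub>R u)) (at y)" for x y and u :: complex
    proof -
      have t: "((\<lambda>y. x - y) has_derivative (\<lambda>v. - v)) (at y)" by (auto intro!: derivative_eq_intros)
      have "(kern_rest R k 0 has_derivative frechet_derivative (kern_rest R k 0) (at (x - y))) (at (x - y))"
        using Ck_on_SucD[OF Ck_on_kern_rest[OF R(1), of "Suc 0"]] by blast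
      from has_derivative_scaleR_left[OF has_derivative_compose[OF t this]] show ?thesis .
    qed
    have "Ck_on 1 UNIV (\<lambda>y. A 0 y)"
      unfolding A_def
    proof (rule Ck_on_parameter_integral[where b = "\<lambda>x. C1 * norm (U x)"])
      fix x
      have "Ck_on 1 UNIV (\<lambda>y. kern_rest R k 0 (x - y))"
        by (rule Ck_on_compose[of UNIV UNIV "\<lambda>y. x - y", OF _ _ _ _ Ck_on_kern_rest[OF R(1)]])
          (rule open_UNIV subset_UNIV Ck_on_diff Ck_on_id Ck_on_const)+
      then show "Ck_on 1 UNIV (\<lambda>y. kern_rest R k 0 (x - y) *\<^sub>R U x)"
        by (intro Ck_on_scaleR open_UNIV Ck_on_const)
      show "norm (frechet_derivative (\<lambda>y. kern_rest R k 0 (x - y) *\<^sub>R U x) (at y) v) \<le> C1 * norm (U x) * norm v" for y v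
        using mult_right_mono[OF C1'[of "x - y" "- v"] norm_ge_zero[of "U x"]]
        unfolding frechet_derivative_at[OF krd, symmetric] by (simp add: mult_ac)
    qed (use iA U in auto)
    then have 1: "Ck_on 1 (ball x0 R) (\<lambda>y. A 0 y)" by (rule Ck_on_subset) simp
    obtain C2 where C2: "C2 > 0" "\<And>x v. x \<in> cball x0 (2 * R) \<Longrightarrow> norm (frechet_derivative g (at x) v) \<le> C2 * norm v"
      using frechet_bounded_on_compact[OF g compact_cball sub3] by blast
    have "Ck_on 1 (ball x0 R) (\<lambda>y. G 0 y)"
      unfolding G_def
    proof (rule Ck_on_parameter_integral[where b = "\<lambda>z. C2 * (indicator (cball 0 R) z / norm z)"])
      show "integrable lborel (\<lambda>z::real^3. C2 * (indicator (cball 0 R) z / norm z))"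
        by (rule integrable_mult_right[OF integrable_inverse_norm[OF R(2)]])
      fix z :: "real^3"
      show "Ck_on 1 (ball x0 R) (\<lambda>y. kern R k 0 z *\<^sub>R g (y + z))"
      proof (cases "z \<in> cball 0 R")
        case True
        have "Ck_on 1 (ball x0 R) (\<lambda>y. g (y + z))"
        proof (rule Ck_on_compose[of _ "ball x0 (3 * R)" "\<lambda>y. y + z", OF _ _ _ _ g])
          show "(\<lambda>y. y + z) ` ball x0 R \<subseteq> ball x0 (3 * R)" using sub[OF _ True] sub3 by blast
        qed (rule open_ball Ck_on_add Ck_on_id Ck_on_const)+
        then show ?thesis by (intro Ck_on_scaleR open_ball Ck_on_const)
      next
        case False
        then have "kern R k 0 z = 0" using R by (simp add: kern_def ball_cutoff_eq_0)
        then show ?thesis by simp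
      qed
      fix y v assume y: "y \<in> ball x0 R"
      show "norm (frechet_derivative (\<lambda>y. kern R k 0 z *\<^sub>R g (y + z)) (at y) v)
          \<le> C2 * (indicator (cball 0 R) z / norm z) * norm v"
      proof (cases "z \<in> cball 0 R \<and> z \<noteq> 0")
        case True
        have t: "((\<lambda>y. y + z) has_derivative (\<lambda>v. v)) (at y)" by (auto intro!: derivative_eq_intros)
        have in2: "y + z \<in> cball x0 (2 * R)" using sub[OF y] True by blast
        have "Ck_on (Suc 0) (ball x0 (3 * R)) g" using g by (simp only: One_nat_def)
        then have "(g has_derivative frechet_derivative g (at (y + z))) (at (y + z))"
          by (rule Ck_on_SucD) (use in2 sub3 in blast)
        then have d: "((\<lambda>y. kern R k 0 z *\<^sub>R g (y + z)) has_derivative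
            (\<lambda>v. kern R k 0 z *\<^sub>R frechet_derivative g (at (y + z)) v)) (at y)"
          by (intro has_derivative_scaleR_right has_derivative_compose[OF t])
        have "frechet_derivative (\<lambda>y. kern R k 0 z *\<^sub>R g (y + z)) (at y) v
            = kern R k 0 z *\<^sub>R frechet_derivative g (at (y + z)) v"
          by (rule fun_cong[OF frechet_derivative_at[OF d, symmetric]])
        moreover have "\<bar>kern R k 0 z\<bar> * norm (frechet_derivative g (at (y + z)) v)
            \<le> (indicator (cball 0 R) z / norm z) * (C2 * norm v)"
          by (intro mult_mono norm_kern_le R C2 in2) (use True in auto)
        ultimately show ?thesis by (simp add: mult_ac)
      next
        case False
        \<comment> \<open>At z = 0 the kernel with \<epsilon> = 0 has the value 0, because
          \<open>W0\<close> divides by the root of 0.\<close>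
        then have "kern R k 0 z = 0" using R by (auto simp: kern_def ball_cutoff_eq_0 helm_def W0_def)
        then show ?thesis using C2(1) by (simp add: frechet_derivative_const)
      qed
    qed (fact open_ball iG)+
    then show ?thesis unfolding V_def using 1 by (intro Ck_on_diff open_ball)
  qed
  have main: "kern_mass *\<^sub>R (\<integral>x. indicator (box a b) x *\<^sub>R U x \<partial>lborel) = (\<integral>x. indicator (box a b) x *\<^sub>R V x \<partial>lborel)"
    and iV: "integrable lborel (\<lambda>x. indicator (box a b) x *\<^sub>R V x)"
    if ab: "box a b \<subseteq> ball x0 R" for a b
  proof -
    define T where "T n x = (\<integral>y. indicator (box a b) y * kern_main R k (er n) (x - y) \<partial>lborel)" for n x
    note TL = kern_main_box_limit[OF R(1), where a = a and b = b and k = k, folded er_def, folded T_def]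
    obtain CT where CT: "\<And>n x. \<bar>T n x\<bar> \<le> CT" using TL(2) by blast
    have ib: "integrable lborel (indicator (box a b) :: real^3 \<Rightarrow> real)"
      using emeasure_lborel_box_finite[of a b] by (intro integrable_real_indicator) auto
    have Tm: "T n \<in> borel_measurable lborel" for n
      unfolding T_def by measurable
    \<comment> \<open>Fubini moves the mollification from U, which is merely integrable, to the
      indicator of the box, where the limit is known.\<close>
    have fub: "(\<integral>y. indicator (box a b) y *\<^sub>R P (er n) y \<partial>lborel) = (\<integral>x. T n x *\<^sub>R U x \<partial>lborel)" for n
    proof -
      obtain Cm where Cm: "\<And>x. \<bar>kern_main R k (er n) x\<bar> \<le> Cm" using km by blast
      have Cm0: "0 \<le> Cm" using Cm[of 0] by linarith
      let ?f = "\<lambda>x y. (indicator (box a b) y * kern_main R k (er n) (x - y)) *\<^sub>R U x"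
      let ?h = "\<lambda>x y. (Cm * norm (U x)) * indicator (box a b) y :: real"
      have "integrable (lborel \<Otimes>\<^sub>M lborel) (case_prod ?h)"
      proof (rule lborel_pair.Fubini_integrable)
        show "case_prod ?h \<in> borel_measurable (lborel \<Otimes>\<^sub>M lborel)" by measurable
        have "(\<integral>y. norm (case_prod ?h (x, y)) \<partial>lborel) = (Cm * norm (U x)) * (\<integral>y. indicator (box a b) y \<partial>lborel)" for x
          using Cm0 by (simp add: abs_mult)
        then show "integrable lborel (\<lambda>x. \<integral>y. norm (case_prod ?h (x, y)) \<partial>lborel)" using U by simp
        show "AE x in lborel. integrable lborel (\<lambda>y. case_prod ?h (x, y))" using ib by simp
      qed
      then have "integrable (lborel \<Otimes>\<^sub>M lborel) (case_prod ?f)"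
      proof (rule Bochner_Integration.integrable_bound)
        show "case_prod ?f \<in> borel_measurable (lborel \<Otimes>\<^sub>M lborel)" by measurable
        show "AE z in lborel \<Otimes>\<^sub>M lborel. norm (case_prod ?f z) \<le> norm (case_prod ?h z)"
        proof (rule AE_I2)
          fix z :: "(real^3) \<times> (real^3)"
          have "indicator (box a b) (snd z) * (\<bar>kern_main R k (er n) (fst z - snd z)\<bar> * norm (U (fst z)))
              \<le> indicator (box a b) (snd z) * (Cm * norm (U (fst z)))"
            by (intro mult_left_mono mult_right_mono Cm) auto
          then show "norm (case_prod ?f z) \<le> norm (case_prod ?h z)"
            using Cm0 by (simp add: case_prod_beta abs_mult mult_ac)
        qed
      qed
      from lborel_pair.Fubini_integral[OF this]
      have "(\<integral>y. (\<integral>x. ?f x y \<partial>lborel) \<partial>lborel) = (\<integral>x. (\<integral>y. ?f x y \<partial>lborel) \<partial>lborel)" .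
      moreover have "(\<integral>x. ?f x y \<partial>lborel) = indicator (box a b) y *\<^sub>R P (er n) y" for y
        unfolding P_def by (simp only: scaleR_scaleR[symmetric] integral_scaleR_right)
      moreover have "(\<integral>y. ?f x y \<partial>lborel) = T n x *\<^sub>R U x" for x
      proof -
        have "integrable lborel (\<lambda>y. indicator (box a b) y * kern_main R k (er n) (x - y))"
        proof (rule Bochner_Integration.integrable_bound[OF integrable_mult_right[OF ib, of Cm]])
          show "AE y in lborel. norm (indicator (box a b) y * kern_main R k (er n) (x - y)) \<le> norm (Cm * indicator (box a b) y)"
            using Cm Cm0 by (intro AE_I2) (auto simp: indicator_def)
        qed measurable
        then show ?thesis unfolding T_def by (intro integral_scaleR_left)
      qed
      ultimately show ?thesis by simp
    qed
    have lim1: "(\<lambda>n. \<integral>x. T n x *\<^sub>R U x \<partial>lborel) \<longlonglongrightarrow> (\<integral>x. (kern_mass * indicator (box a b) x) *\<^sub>R U x \<partial>lborel)"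
    proof (rule integral_dominated_convergence)
      show "integrable lborel (\<lambda>x. CT * norm (U x))" using U by simp
      show "AE x in lborel. (\<lambda>n. T n x *\<^sub>R U x) \<longlonglongrightarrow> (kern_mass * indicator (box a b) x) *\<^sub>R U x"
        using TL(1) by eventually_elim (intro tendsto_scaleR tendsto_const)
      show "AE x in lborel. norm (T n x *\<^sub>R U x) \<le> CT * norm (U x)" for n
        using CT by (intro AE_I2) (simp add: mult_right_mono)
      show "(\<lambda>x. T n x *\<^sub>R U x) \<in> borel_measurable lborel" for n using Tm[of n] by measurable
    qed measurable
    have ibD: "integrable lborel (\<lambda>y. ?D * indicator (box a b) y)" using ib by (rule integrable_mult_right)
    have Pm: "(\<lambda>y. indicator (box a b) y *\<^sub>R P (er n) y) \<in> borel_measurable lborel" for n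
      unfolding P_def by measurable
    have Vm: "(\<lambda>y. indicator (box a b) y *\<^sub>R V y) \<in> borel_measurable lborel"
      using borel_measurable_continuous_on_indicator[OF _ continuous_on_subset[OF Ck_on_imp_continuous[OF VC] ab]]
      by simp
    have Plim: "AE y in lborel. (\<lambda>n. indicator (box a b) y *\<^sub>R P (er n) y) \<longlonglongrightarrow> indicator (box a b) y *\<^sub>R V y"
      using limP ab by (intro AE_I2) (auto simp: indicator_def)
    have Pbd: "AE y in lborel. norm (indicator (box a b) y *\<^sub>R P (er n) y) \<le> ?D * indicator (box a b) y" for n
      using bP ab by (intro AE_I2) (auto simp: indicator_def)
    have lim2: "(\<lambda>n. \<integral>y. indicator (box a b) y *\<^sub>R P (er n) y \<partial>lborel) \<longlonglongrightarrow> (\<integral>y. indicator (box a b) y *\<^sub>R V y \<partial>lborel)"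
      by (rule integral_dominated_convergence[OF Vm Pm ibD Plim Pbd])
    show "integrable lborel (\<lambda>y. indicator (box a b) y *\<^sub>R V y)"
      by (rule integrable_dominated_convergence[OF Vm Pm ibD Plim Pbd])
    have "(\<integral>x. (kern_mass * indicator (box a b) x) *\<^sub>R U x \<partial>lborel) = (\<integral>y. indicator (box a b) y *\<^sub>R V y \<partial>lborel)"
      using LIMSEQ_unique[OF lim1 lim2[unfolded fub]] .
    then show "kern_mass *\<^sub>R (\<integral>x. indicator (box a b) x *\<^sub>R U x \<partial>lborel) = (\<integral>x. indicator (box a b) x *\<^sub>R V x \<partial>lborel)"
      by (simp only: scaleR_scaleR[symmetric] integral_scaleR_right)
  qed
  show ?thesis
  proof (rule that[of "\<lambda>x. V x /\<^sub>R kern_mass"])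
    show "Ck_on 1 (ball x0 R) (\<lambda>x. V x /\<^sub>R kern_mass)"
      by (intro Ck_on_scaleR open_ball Ck_on_const VC)
    fix a b assume ab: "box a b \<subseteq> ball x0 R"
    let ?f = "\<lambda>x. indicator (box a b) x *\<^sub>R U x - (indicator (box a b) x *\<^sub>R V x) /\<^sub>R kern_mass"
    have iU: "integrable lborel (\<lambda>x. indicator B x *\<^sub>R U x)" if "B \<in> sets borel" for B
      using integrable_mult_indicator[OF _ U] that by simp
    have "AE x in lborel. ?f x = 0"
    proof (rule AE_eq_0_if_integral_boxes_eq_0)
      show "integrable lborel ?f" by (intro Bochner_Integration.integrable_diff integrable_scaleR_right iU iV[OF ab]) simp
      fix c d :: "real^3"
      \<comment> \<open>The trace of an arbitrary box on \<open>box a b\<close> is again a box, to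
        which \<open>main\<close> applies.\<close>
      obtain a' b' where ab': "box c d \<inter> box a b = box a' b'" unfolding box_Int_box by blast
      then have sub': "box a' b' \<subseteq> ball x0 R" using ab by blast
      have "(\<integral>x\<in>box c d. ?f x \<partial>lborel)
          = (\<integral>x. indicator (box a' b') x *\<^sub>R U x - (indicator (box a' b') x *\<^sub>R V x) /\<^sub>R kern_mass \<partial>lborel)"
        unfolding set_lebesgue_integral_def ab'[symmetric]
        by (intro Bochner_Integration.integral_cong) (auto simp: indicator_def)
      also have "\<dots> = (\<integral>x. indicator (box a' b') x *\<^sub>R U x \<partial>lborel) - (\<integral>x. indicator (box a' b') x *\<^sub>R V x \<partial>lborel) /\<^sub>R kern_mass"
      proof -
        have "integrable lborel (\<lambda>x. (indicator (box a' b') x *\<^sub>R V x) /\<^sub>R kern_mass)"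
          by (intro integrable_scaleR_right iV[OF sub'])
        from Bochner_Integration.integral_diff[OF iU[of "box a' b'"] this] show ?thesis
          by (simp only: integral_scaleR_right borel_open[OF open_box])
      qed
      also have "\<dots> = 0" unfolding main[OF sub', symmetric] using kern_mass_pos by simp
      finally show "(\<integral>x\<in>box c d. ?f x \<partial>lborel) = 0" .
    qed
    then show "AE x in lborel. x \<in> box a b \<longrightarrow> U x = V x /\<^sub>R kern_mass"
      by eventually_elim (auto simp: indicator_def)
  qed
qed

section \<open>Symmetry of second derivatives\<close>

text \<open>The mean value theorem twice: in direction v for the increment of f along w, then in
  direction w for the derivative of f along v.\<close>

lemma second_difference_mvt:
  fixes f :: "'a::euclidean_space \<Rightarrow> real"
  assumes f: "Ck_on 2 (ball x r) f" and t: "0 < t" "t * (norm v + norm w) < r"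
  shows "\<exists>z\<in>ball x r. f (x + t *\<^sub>R v + t *\<^sub>R w) - f (x + t *\<^sub>R v) - f (x + t *\<^sub>R w) + f x
    = t\<^sup>2 * frechet_derivative (\<lambda>y. frechet_derivative f (at y) v) (at z) w"
proof -
  let ?D = "\<lambda>v f y. frechet_derivative f (at y) v"
  have f2: "Ck_on (Suc (Suc 0)) (ball x r) f" using f by (simp only: numeral_2_eq_2)
  have Df: "Ck_on (Suc 0) (ball x r) (?D v f)" using f2 by simp
  have inb: "x + s *\<^sub>R v + u *\<^sub>R w \<in> ball x r" if "0 \<le> s" "s \<le> t" "0 \<le> u" "u \<le> t" for s u
  proof -
    have "norm (s *\<^sub>R v + u *\<^sub>R w) \<le> s * norm v + u * norm w"
      using norm_triangle_ineq[of "s *\<^sub>R v" "u *\<^sub>R w"] that by simp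
    also have "\<dots> \<le> t * norm v + t * norm w" using that by (intro add_mono mult_right_mono) auto
    also have "\<dots> < r" using t by (simp add: distrib_left)
    finally have "norm (s *\<^sub>R v + u *\<^sub>R w) < r" .
    moreover have "dist x (x + s *\<^sub>R v + u *\<^sub>R w) = norm (s *\<^sub>R v + u *\<^sub>R w)"
      by (metis add.assoc add_diff_cancel_left' dist_commute dist_norm)
    ultimately show ?thesis by simp
  qed
  have line: "((\<lambda>s. g (c + s *\<^sub>R d)) has_real_derivative ?D d g (c + s *\<^sub>R d)) (at s)"
    if "Ck_on (Suc m) (ball x r) g" "c + s *\<^sub>R d \<in> ball x r" for g :: "'a \<Rightarrow> real" and m c d s
  proof -
    have a: "((\<lambda>s. c + s *\<^sub>R d) has_derivative (\<lambda>h. h *\<^sub>R d)) (at s)" by (auto intro!: derivative_eq_intros)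
    note g = Ck_on_SucD[OF that]
    show ?thesis
      unfolding has_field_derivative_def
      using has_derivative_compose[OF a g] linear_cmul[OF has_derivative_linear[OF g]]
      by (simp add: mult_commute_abs)
  qed
  obtain \<xi> where \<xi>: "0 < \<xi>" "\<xi> < t"
    "(f ((x + t *\<^sub>R w) + t *\<^sub>R v) - f (x + t *\<^sub>R v)) - (f ((x + t *\<^sub>R w) + 0 *\<^sub>R v) - f (x + 0 *\<^sub>R v))
      = (t - 0) * (?D v f ((x + t *\<^sub>R w) + \<xi> *\<^sub>R v) - ?D v f (x + \<xi> *\<^sub>R v))"
  proof (rule exE[OF MVT2[OF t(1)]])
    fix s assume s: "0 \<le> s" "s \<le> t"
    show "((\<lambda>s. f ((x + t *\<^sub>R w) + s *\<^sub>R v) - f (x + s *\<^sub>R v)) has_real_derivative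
        ?D v f ((x + t *\<^sub>R w) + s *\<^sub>R v) - ?D v f (x + s *\<^sub>R v)) (at s)"
      using inb[of s t] inb[of s 0] s t by (intro DERIV_diff line[OF f2]) (auto simp: add_ac)
  qed blast
  obtain \<eta> where \<eta>: "0 < \<eta>" "\<eta> < t"
    "?D v f ((x + \<xi> *\<^sub>R v) + t *\<^sub>R w) - ?D v f ((x + \<xi> *\<^sub>R v) + 0 *\<^sub>R w)
      = (t - 0) * ?D w (?D v f) ((x + \<xi> *\<^sub>R v) + \<eta> *\<^sub>R w)"
  proof (rule exE[OF MVT2[OF t(1)]])
    fix s assume s: "0 \<le> s" "s \<le> t"
    show "((\<lambda>s. ?D v f ((x + \<xi> *\<^sub>R v) + s *\<^sub>R w)) has_real_derivative ?D w (?D v f) ((x + \<xi> *\<^sub>R v) + s *\<^sub>R w)) (at s)"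
      using inb[of \<xi> s] s \<xi> by (intro line[OF Df]) auto
  qed blast
  have "(x + \<xi> *\<^sub>R v) + \<eta> *\<^sub>R w \<in> ball x r" using inb[of \<xi> \<eta>] \<xi> \<eta> by simp
  moreover have "f (x + t *\<^sub>R v + t *\<^sub>R w) - f (x + t *\<^sub>R v) - f (x + t *\<^sub>R w) + f x
    = t\<^sup>2 * ?D w (?D v f) ((x + \<xi> *\<^sub>R v) + \<eta> *\<^sub>R w)"
    using \<xi>(3) \<eta>(3) by (simp add: add_ac power2_eq_square mult.assoc)
  ultimately show ?thesis by blast
qed

text \<open>The second difference is symmetric in v and w, so by
  \<open>second_difference_mvt\<close> the two mixed derivatives coincide at suitable points near x;
  continuity carries this to x.\<close>

lemma frechet_derivative_commute_real:
  fixes f :: "'a::euclidean_space \<Rightarrow> real"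
  assumes U: "open U" "x \<in> U" and f: "Ck_on 2 U f"
  shows "frechet_derivative (\<lambda>y. frechet_derivative f (at y) v) (at x) w
    = frechet_derivative (\<lambda>y. frechet_derivative f (at y) w) (at x) v"
proof -
  let ?D = "\<lambda>v w y. frechet_derivative (\<lambda>y. frechet_derivative f (at y) v) (at y) w"
  have c: "continuous_on U (?D v w)" for v w using f by (simp add: numeral_2_eq_2)
  have close: "\<exists>d>0. \<forall>y\<in>ball x d. y \<in> U \<and> \<bar>?D v w y - ?D v w x\<bar> < e" if "e > 0" for e v w
  proof -
    have "isCont (?D v w) x" using c U by (simp add: continuous_on_eq_continuous_at)
    then have "(?D v w \<longlongrightarrow> ?D v w x) (nhds x)"
      unfolding isCont_def by (rule tendsto_at_iff_tendsto_nhds[THEN iffD1])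
    then have "\<forall>\<^sub>F y in nhds x. dist (?D v w y) (?D v w x) < e" using that by (rule tendstoD)
    then have "\<forall>\<^sub>F y in nhds x. y \<in> U \<and> dist (?D v w y) (?D v w x) < e"
      using eventually_nhds_in_open[OF U] by (intro eventually_conj)
    then show ?thesis by (auto simp: eventually_nhds_metric dist_real_def dist_commute)
  qed
  have "\<bar>?D v w x - ?D w v x\<bar> \<le> 0 + e" if e: "e > 0" for e
  proof -
    obtain d1 where d1: "d1 > 0" "\<forall>y\<in>ball x d1. y \<in> U \<and> \<bar>?D v w y - ?D v w x\<bar> < e / 2"
      using close[OF half_gt_zero[OF e], of v w] by blast
    obtain d2 where d2: "d2 > 0" "\<forall>y\<in>ball x d2. y \<in> U \<and> \<bar>?D w v y - ?D w v x\<bar> < e / 2"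
      using close[OF half_gt_zero[OF e], of w v] by blast
    define r where "r = min d1 d2"
    have r: "r > 0" using d1 d2 by (simp add: r_def)
    define t where "t = r / (norm v + norm w + 1)"
    have p: "norm v + norm w + 1 > 0" by (simp add: add_nonneg_pos)
    have t: "t > 0" "t * (norm v + norm w) < r" "t * (norm w + norm v) < r"
      unfolding t_def using r p by (simp_all add: divide_simps)
    have fr: "Ck_on 2 (ball x r) f" by (rule Ck_on_subset[OF f]) (use d1 in \<open>auto simp: r_def\<close>)
    obtain z1 where z1: "z1 \<in> ball x r" "f (x + t *\<^sub>R v + t *\<^sub>R w) - f (x + t *\<^sub>R v) - f (x + t *\<^sub>R w) + f x = t\<^sup>2 * ?D v w z1"
      using second_difference_mvt[OF fr t(1,2)] by blast
    obtain z2 where z2: "z2 \<in> ball x r" "f (x + t *\<^sub>R w + t *\<^sub>R v) - f (x + t *\<^sub>R w) - f (x + t *\<^sub>R v) + f x = t\<^sup>2 * ?D w v z2"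
      using second_difference_mvt[OF fr t(1,3)] by blast
    have "t\<^sup>2 * ?D v w z1 = t\<^sup>2 * ?D w v z2"
      unfolding z1(2)[symmetric] z2(2)[symmetric] by (simp add: add_ac)
    then have "?D v w z1 = ?D w v z2" using t by simp
    moreover have "\<bar>?D v w z1 - ?D v w x\<bar> < e / 2" using d1(2) z1(1) by (simp add: r_def)
    moreover have "\<bar>?D w v z2 - ?D w v x\<bar> < e / 2" using d2(2) z2(1) by (simp add: r_def)
    ultimately show ?thesis by linarith
  qed
  then have "\<bar>?D v w x - ?D w v x\<bar> \<le> 0" by (rule field_le_epsilon)
  then show ?thesis by simp
qed

lemma frechet_derivative_bounded_linear:
  assumes L: "bounded_linear L" and f: "Ck_on (Suc n) U f" "x \<in> U"
  shows "frechet_derivative (\<lambda>y. L (f y)) (at x) v = L (frechet_derivative f (at x) v)"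
  by (rule fun_cong[OF frechet_derivative_at[OF bounded_linear.has_derivative[OF L Ck_on_SucD[OF f]], symmetric]])

lemma frechet_derivative_commute:
  fixes f :: "'a::euclidean_space \<Rightarrow> 'b::euclidean_space"
  assumes U: "open U" "x \<in> U" and f: "Ck_on 2 U f"
  shows "frechet_derivative (\<lambda>y. frechet_derivative f (at y) v) (at x) w
    = frechet_derivative (\<lambda>y. frechet_derivative f (at y) w) (at x) v"
proof (rule euclidean_eqI)
  fix b :: 'b assume "b \<in> Basis"
  have f2: "Ck_on (Suc (Suc 0)) U f" using f by (simp only: numeral_2_eq_2)
  have L: "bounded_linear (\<lambda>z::'b. z \<bullet> b)" by (rule bounded_linear_inner_left)
  have *: "frechet_derivative (\<lambda>y. frechet_derivative (\<lambda>y. f y \<bullet> b) (at y) v) (at x) w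
      = frechet_derivative (\<lambda>y. frechet_derivative f (at y) v) (at x) w \<bullet> b" for v w
  proof -
    have "frechet_derivative (\<lambda>y. frechet_derivative (\<lambda>y. f y \<bullet> b) (at y) v) (at x)
        = frechet_derivative (\<lambda>y. frechet_derivative f (at y) v \<bullet> b) (at x)"
      by (rule frechet_derivative_cong_open[OF U]) (rule frechet_derivative_bounded_linear[OF L f2])
    moreover have "frechet_derivative (\<lambda>y. frechet_derivative f (at y) v \<bullet> b) (at x) w
        = frechet_derivative (\<lambda>y. frechet_derivative f (at y) v) (at x) w \<bullet> b"
      by (rule frechet_derivative_bounded_linear[OF L, of 0 U]) (use f2 U in simp_all)
    ultimately show ?thesis by (simp only:)
  qed
  have "Ck_on 2 U (\<lambda>y. f y \<bullet> b)" by (rule Ck_on_bounded_linear_comp[OF L U(1) f])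
  from frechet_derivative_commute_real[OF U this, of v w]
  show "frechet_derivative (\<lambda>y. frechet_derivative f (at y) v) (at x) w \<bullet> b
    = frechet_derivative (\<lambda>y. frechet_derivative f (at y) w) (at x) v \<bullet> b"
    unfolding * .
qed

lemma partial_commute:
  fixes f :: "real^3 \<Rightarrow> 'b::euclidean_space"
  assumes "open U" "x \<in> U" "Ck_on 2 U f"
  shows "partial i (partial j f) x = partial j (partial i f) x"
  unfolding partial_def[abs_def] by (rule frechet_derivative_commute[OF assms])

section \<open>Continuous functions that agree almost everywhere\<close>

text \<open>The points of V where the functions differ form an open null set, which is
  empty.\<close>

lemma eq_on_open_if_AE_eq:
  fixes f g :: "'a::euclidean_space \<Rightarrow> 'b::real_normed_vector"
  assumes V: "open V" and c: "continuous_on V f" "continuous_on V g"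
    and ae: "AE x in lebesgue. x \<in> V \<longrightarrow> f x = g x" and x: "x \<in> V"
  shows "f x = g x"
proof (rule ccontr)
  assume ne: "f x \<noteq> g x"
  let ?N = "V \<inter> (\<lambda>x. f x - g x) -` (- {0})"
  have "open ?N"
    by (rule continuous_open_preimage[OF continuous_on_diff[OF c] V open_Compl[OF closed_singleton]])
  moreover have "negligible ?N"
  proof -
    obtain N where N: "N \<in> null_sets lebesgue" "{x. \<not> (x \<in> V \<longrightarrow> f x = g x)} \<subseteq> N"
      using ae unfolding eventually_ae_filter by auto
    then have "negligible N" by (simp add: negligible_iff_null_sets)
    then show ?thesis by (rule negligible_subset) (use N(2) in auto)
  qed
  moreover have "x \<in> ?N" using ne x by simp
  ultimately show False using open_not_negligible[of ?N] by blast
qed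

text \<open>Two local representatives are continuous and equal almost everywhere on the overlap, so
  they agree there and glue to one function.\<close>

lemma glue_Ck_representatives:
  fixes X :: "'a::euclidean_space \<Rightarrow> 'b::real_normed_vector"
  assumes W: "open W"
    and loc: "\<And>x. x \<in> W \<Longrightarrow> \<exists>V v. open V \<and> x \<in> V \<and> Ck_on n V v \<and> (AE y in lebesgue. y \<in> V \<longrightarrow> X y = v y)"
  obtains X' where "Ck_on n W X'" "AE y in lebesgue. y \<in> W \<longrightarrow> X y = X' y"
proof -
  from loc have "\<forall>x. \<exists>V v. x \<in> W \<longrightarrow> open V \<and> x \<in> V \<and> Ck_on n V v \<and> (AE y in lebesgue. y \<in> V \<longrightarrow> X y = v y)"
    by blast
  from choice[OF this] obtain V where
    "\<forall>x. \<exists>v. x \<in> W \<longrightarrow> open (V x) \<and> x \<in> V x \<and> Ck_on n (V x) v \<and> (AE y in lebesgue. y \<in> V x \<longrightarrow> X y = v y)"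
    by blast
  from choice[OF this] obtain v where
    *: "\<forall>x. x \<in> W \<longrightarrow> open (V x) \<and> x \<in> V x \<and> Ck_on n (V x) (v x) \<and> (AE y in lebesgue. y \<in> V x \<longrightarrow> X y = v x y)"
    by blast
  then have V: "\<And>x. x \<in> W \<Longrightarrow> open (V x)" "\<And>x. x \<in> W \<Longrightarrow> x \<in> V x"
    "\<And>x. x \<in> W \<Longrightarrow> Ck_on n (V x) (v x)" "\<And>x. x \<in> W \<Longrightarrow> AE y in lebesgue. y \<in> V x \<longrightarrow> X y = v x y"
    by blast+
  \<comment> \<open>At y the representative attached to y itself is used; \<open>eq\<close> shows
    that any other neighbourhood gives the same value.\<close>
  define X' where "X' y = v y y" for y
  have eq: "X' y = v x y" if "x \<in> W" "y \<in> W" "y \<in> V x" for x y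
  proof -
    have "v y y = v x y"
    proof (rule eq_on_open_if_AE_eq[of "V x \<inter> V y" "v y" "v x"])
      show "open (V x \<inter> V y)" using V(1) that by blast
      show "continuous_on (V x \<inter> V y) (v y)" "continuous_on (V x \<inter> V y) (v x)"
        using Ck_on_imp_continuous[OF V(3)] that by (auto intro: continuous_on_subset)
      show "AE z in lebesgue. z \<in> V x \<inter> V y \<longrightarrow> v y z = v x z"
        using V(4)[OF that(1)] V(4)[OF that(2)] by eventually_elim auto
      show "y \<in> V x \<inter> V y" using that V(2) by blast
    qed
    then show ?thesis by (simp add: X'_def)
  qed
  \<comment> \<open>Uncountably many exceptional null sets cannot be united; by the Lindelof
    property countably many neighbourhoods suffice.\<close>
  obtain F where F: "F \<subseteq> V ` W" "countable F" "\<Union>F = \<Union>(V ` W)"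
    using Lindelof[of "V ` W"] V(1) by blast
  obtain C where C: "countable C" "C \<subseteq> W" "F = V ` C"
    using countable_subset_image[of F V W] F by blast
  have "AE y in lebesgue. \<forall>x\<in>C. y \<in> V x \<longrightarrow> X y = v x y"
    using C V(4) by (subst AE_ball_countable) auto
  then have ae: "AE y in lebesgue. y \<in> W \<longrightarrow> X y = X' y"
  proof eventually_elim
    case (elim y)
    show ?case
    proof
      assume y: "y \<in> W"
      then have "y \<in> \<Union>F" using F V(2) by blast
      then obtain x where "x \<in> C" "y \<in> V x" using C by blast
      then show "X y = X' y" using elim eq[of x y] C y by auto
    qed
  qed
  show ?thesis
  proof (rule that[OF _ ae])
    show "Ck_on n W X'"
    proof (rule Ck_on_local)
      fix x assume x: "x \<in> W"
      have "Ck_on n (V x \<inter> W) (v x)" using V(3)[OF x] by (rule Ck_on_subset) blast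
      then have "Ck_on n (V x \<inter> W) X'"
        by (rule Ck_on_cong[rotated 2]) (use V(1)[OF x] W eq[OF x] in auto)
      then show "\<exists>U. open U \<and> x \<in> U \<and> Ck_on n U X'"
        using V(1,2)[OF x] W x by (intro exI[of _ "V x \<inter> W"]) auto
    qed
  qed
qed

section \<open>Weak solutions of Maxwell's equations are smooth\<close>

lemma bounded_bilinear_cdot: "bounded_bilinear cdot"
proof
  show "cdot (a + a') b = cdot a b + cdot a' b" "cdot a (b + b') = cdot a b + cdot a b'" for a a' b b'
    by (simp_all add: cdot_def sum.distrib algebra_simps)
  show "cdot (r *\<^sub>R a) b = r *\<^sub>R cdot a b" "cdot a (r *\<^sub>R b) = r *\<^sub>R cdot a b" for r a b
    by (simp_all add: cdot_def scaleR_sum_right)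
  show "\<exists>K. \<forall>a b. norm (cdot a b) \<le> norm a * norm b * K"
  proof (intro exI allI)
    fix a b
    have "norm (cdot a b) \<le> (\<Sum>j\<in>(UNIV::3 set). norm a * norm b)"
      unfolding cdot_def
      by (intro sum_norm_le) (simp add: norm_mult mult_mono Finite_Cartesian_Product.norm_nth_le)
    then show "norm (cdot a b) \<le> norm a * norm b * 3" by simp
  qed
qed

definition loc_integrable :: "'a::euclidean_space set \<Rightarrow> ('a \<Rightarrow> 'b::{banach, second_countable_topology}) \<Rightarrow> bool" where
  "loc_integrable W X \<longleftrightarrow> (\<forall>K. compact K \<longrightarrow> K \<subseteq> W \<longrightarrow> integrable lebesgue (\<lambda>x. indicator K x *\<^sub>R X x))"

lemma integrable_test_bilinear:
  fixes h :: "'a::euclidean_space \<Rightarrow> 'b::euclidean_space" and X :: "'a \<Rightarrow> 'c::euclidean_space"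
    and B :: "'b \<Rightarrow> 'c \<Rightarrow> 'd::{banach, second_countable_topology}"
  assumes B: "bounded_bilinear B" and h: "continuous_on UNIV h" and K: "compact K" "K \<subseteq> W" "\<And>x. x \<notin> K \<Longrightarrow> h x = 0"
    and X: "loc_integrable W X"
  shows "integrable lebesgue (\<lambda>x. B (h x) (X x))"
proof -
  obtain C where C: "\<And>x. norm (h x) \<le> C" using bounded_compact_support[OF h K(1,3)] by metis
  obtain M where M: "\<And>a b. norm (B a b) \<le> norm a * norm b * M" "M > 0"
    using bounded_bilinear.pos_bounded[OF B] by blast
  have i: "integrable lebesgue (\<lambda>x. indicator K x *\<^sub>R X x)" using X K unfolding loc_integrable_def by blast
  have eq: "B (h x) (X x) = B (h x) (indicator K x *\<^sub>R X x)" for x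
    using K(3)[of x] by (cases "x \<in> K") (simp_all add: bounded_bilinear.zero_left[OF B])
  have "integrable lebesgue (\<lambda>x. B (h x) (indicator K x *\<^sub>R X x))"
  proof (rule Bochner_Integration.integrable_bound)
    show "integrable lebesgue (\<lambda>x. C * norm (indicator K x *\<^sub>R X x) * M)"
      by (intro integrable_mult_left integrable_mult_right integrable_norm i)
    have "h \<in> borel_measurable lborel" using borel_measurable_continuous_onI[OF h] by simp
    then have "h \<in> borel_measurable lebesgue" by (rule measurable_completion)
    then show "(\<lambda>x. B (h x) (indicator K x *\<^sub>R X x)) \<in> borel_measurable lebesgue"
      by (rule borel_measurable_continuous_Pair[OF _ borel_measurable_integrable[OF i]])
        (rule bounded_bilinear.continuous_on[OF B] continuous_on_fst continuous_on_snd continuous_on_id)+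
    show "AE x in lebesgue. norm (B (h x) (indicator K x *\<^sub>R X x)) \<le> norm (C * norm (indicator K x *\<^sub>R X x) * M)"
    proof (rule AE_I2)
      fix x
      have "norm (B (h x) (indicator K x *\<^sub>R X x)) \<le> norm (h x) * norm (indicator K x *\<^sub>R X x) * M" by (rule M)
      also have "\<dots> \<le> C * norm (indicator K x *\<^sub>R X x) * M"
        using C M(2) by (intro mult_right_mono) auto
      finally show "norm (B (h x) (indicator K x *\<^sub>R X x)) \<le> norm (C * norm (indicator K x *\<^sub>R X x) * M)" by simp
    qed
  qed
  then show ?thesis by (simp flip: eq)
qed

text \<open>The weak form of curl X = c Y + A on W. Both Maxwell equations have this form: c = i k
  with X = E, Y = H, A = 0, and c = - i k with X = H, Y = E, A = J.\<close>

definition weak_curl :: "(real^3) set \<Rightarrow> complex \<Rightarrow> form \<Rightarrow> form \<Rightarrow> form \<Rightarrow> bool" where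
  "weak_curl W c X Y A \<longleftrightarrow> (\<forall>h. test_on W h \<longrightarrow>
     has_bochner_integral lebesgue (\<lambda>x. cdot (curl h x) (X x) - c * cdot (h x) (Y x) - cdot (h x) (A x)) 0)"

lemma partial_of_real:
  assumes "Ck_on (Suc n) U \<phi>" "x \<in> U"
  shows "partial p (\<lambda>y. complex_of_real (\<phi> y)) x = of_real (partial p \<phi> x)"
  unfolding partial_def by (rule frechet_derivative_bounded_linear[OF bounded_linear_of_real assms])

lemma test_on_partial: "test_on W \<phi> \<Longrightarrow> test_on W (partial p \<phi>)"
  unfolding partial_def[abs_def] by (rule test_on_derivative)

lemma test_on_vec:
  fixes h :: "real^3 \<Rightarrow> 'b::euclidean_space^3"
  assumes "\<And>i. test_on W (\<lambda>x. h x $ i)"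
  shows "test_on W h"
proof -
  obtain K where K: "\<And>i. compact (K i)" "\<And>i. K i \<subseteq> W" "\<And>i x. x \<notin> K i \<Longrightarrow> h x $ i = 0"
    using assms unfolding test_on_def by metis
  have "compact (\<Union>i\<in>UNIV. K i)" "(\<Union>i\<in>UNIV. K i) \<subseteq> W" using K by (auto intro: compact_UN)
  moreover have "h x = 0" if "x \<notin> (\<Union>i\<in>UNIV. K i)" for x using that K(3) by (auto simp: vec_eq_iff)
  ultimately show ?thesis
    unfolding test_on_def using test_on_Ck[OF assms] by (blast intro: Ck_on_vec)
qed

lemma test_on_zero: "test_on W (\<lambda>x. 0)"
  unfolding test_on_def by auto

lemma test_on_add:
  assumes "test_on W f" "test_on W g"
  shows "test_on W (\<lambda>x. f x + g x)"
proof -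
  obtain K K' where K: "compact K" "K \<subseteq> W" "\<And>x. x \<notin> K \<Longrightarrow> f x = 0"
    and K': "compact K'" "K' \<subseteq> W" "\<And>x. x \<notin> K' \<Longrightarrow> g x = 0"
    using assms unfolding test_on_def by metis
  have "compact (K \<union> K')" "K \<union> K' \<subseteq> W" "\<And>x. x \<notin> K \<union> K' \<Longrightarrow> f x + g x = 0"
    using K K' by auto
  then show ?thesis
    unfolding test_on_def using Ck_on_add[OF open_UNIV test_on_Ck[OF assms(1)] test_on_Ck[OF assms(2)]] by blast
qed

lemma test_on_sum: "(\<And>i. i \<in> I \<Longrightarrow> test_on W (f i)) \<Longrightarrow> test_on W (\<lambda>x. \<Sum>i\<in>I. f i x)"
  by (induction I rule: infinite_finite_induct) (auto intro: test_on_add test_on_zero)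

lemma test_on_curl:
  assumes "test_on W h"
  shows "test_on W (curl h)"
proof (rule test_on_vec)
  fix l
  have "test_on W (\<lambda>x. levi_civita l p q * partial p (\<lambda>y. h y $ q) x)" for p q
    by (rule test_on_compose_linear[OF bounded_linear_mult_right])
      (rule test_on_partial test_on_compose_linear[OF bounded_linear_vec_nth] assms)+
  then show "test_on W (\<lambda>x. curl h x $ l)"
    unfolding curl_def by (simp add: test_on_sum)
qed

lemma partial_lincomb:
  fixes f :: "'i \<Rightarrow> real^3 \<Rightarrow> 'b::real_normed_algebra"
  assumes "\<And>i. i \<in> I \<Longrightarrow> Ck_on (Suc n) U (f i)" "x \<in> U"
  shows "partial p (\<lambda>y. \<Sum>i\<in>I. c i * f i y) x = (\<Sum>i\<in>I. c i * partial p (f i) x)"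
  unfolding partial_def[of p "f _"]
  by (rule partial_eqI[OF has_derivative_sum[OF has_derivative_mult_right[OF Ck_on_SucD[OF assms]]]])

lemma integral_second_by_parts:
  assumes W: "open W" and \<phi>: "test_on W \<phi>" and f: "\<And>n. Ck_on n W f"
  shows "has_bochner_integral lebesgue
    (\<lambda>x. of_real (partial l (partial j \<phi>) x) * f x - of_real (\<phi> x) * partial j (partial l f) x :: complex) 0"
proof -
  obtain K where K: "compact K" "K \<subseteq> W" "\<And>x. x \<notin> K \<Longrightarrow> \<phi> x = 0"
    using \<phi> unfolding test_on_def by blast
  obtain K' where K': "compact K'" "K' \<subseteq> W" "\<And>x. x \<notin> K' \<Longrightarrow> partial j \<phi> x = 0"
    using test_on_partial[OF \<phi>] unfolding test_on_def by blast
  have C1: "Ck_on 1 W (\<lambda>x. complex_of_real (\<phi> x))"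
    by (intro Ck_on_of_real W Ck_on_subset[OF test_on_Ck[OF \<phi>]]) simp
  have C2: "Ck_on 1 W (\<lambda>x. complex_of_real (partial j \<phi> x))"
    by (intro Ck_on_of_real W Ck_on_subset[OF test_on_Ck[OF test_on_partial[OF \<phi>]]]) simp
  have fl: "Ck_on 1 W (partial l f)" using Ck_on_partial[OF f[of "Suc 1"]] .
  have 1: "has_bochner_integral lebesgue
    (\<lambda>x. partial l (\<lambda>x. of_real (partial j \<phi> x)) x * f x + of_real (partial j \<phi> x) * partial l f x) 0"
    unfolding partial_def[of l]
    by (rule integration_by_parts_test[OF W K'(1,2) _ C2 f]) (simp add: K')
  have 2: "has_bochner_integral lebesgue
    (\<lambda>x. partial j (\<lambda>x. of_real (\<phi> x)) x * partial l f x + of_real (\<phi> x) * partial j (partial l f) x) 0"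
    unfolding partial_def[of j]
    by (rule integration_by_parts_test[OF W K(1,2) _ C1 fl]) (simp add: K)
  note P1 = partial_of_real[OF test_on_Ck[OF test_on_partial[OF \<phi>], of "Suc 0"] UNIV_I]
  note P2 = partial_of_real[OF test_on_Ck[OF \<phi>, of "Suc 0"] UNIV_I]
  show ?thesis
    using has_bochner_integral_diff[OF 1 2] unfolding P1 P2 by simp
qed

text \<open>The weak version of taking the curl twice. With e equal to \<phi> times the j-th unit
  vector, curl curl e is the gradient of the j-th derivative of \<phi> minus the Laplacian of \<phi>
  in component j. The first equation is tested with curl e; the second with e, to eliminate Y, and
  with the gradient m, to eliminate the pairing of m with X.\<close>

lemma weak_maxwell_helmholtz:
  assumes W: "open W" and k: "k \<noteq> 0" and ck: "c = \<i> * of_real k"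
    and A: "\<And>n. Ck_on n W A" and B: "\<And>n. Ck_on n W B"
    and w1: "weak_curl W c X Y A" and w2: "weak_curl W (- c) Y X B"
    and \<phi>: "test_on W \<phi>"
  shows "has_bochner_integral lebesgue (\<lambda>x.
     of_real (\<phi> x) * ((1 / c) * (\<Sum>l\<in>UNIV. partial j (partial l (\<lambda>y. B y $ l)) x) - c * B x $ j - curl A x $ j)
     - of_real (lap \<phi> x + k\<^sup>2 * \<phi> x) * X x $ j) 0"
proof -
  have c0: "c \<noteq> 0" using k ck by simp
  have cc: "c * c = - (of_real k)\<^sup>2" 
    unfolding ck power2_eq_square[symmetric] power_mult_distrib by simp
  define e :: form where "e x = axis j (of_real (\<phi> x))" for x
  define m :: form where "m x = (\<chi> l. of_real (partial l (partial j \<phi>) x))" for x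
  have te: "test_on W e"
    unfolding e_def[abs_def] by (intro test_on_compose_linear[OF bounded_linear_axis] test_on_compose_linear[OF bounded_linear_of_real] \<phi>)
  have tm: "test_on W m"
    by (rule test_on_vec) (simp add: m_def test_on_compose_linear[OF bounded_linear_of_real test_on_partial[OF test_on_partial[OF \<phi>]]])
  have Ck\<phi>: "Ck_on n UNIV \<phi>" for n by (rule test_on_Ck[OF \<phi>])
  have sym: "partial p (partial q \<phi>) x = partial q (partial p \<phi>) x" for p q x
    by (rule partial_commute[OF open_UNIV UNIV_I Ck\<phi>])
  have sym3: "partial p (partial q (partial r \<phi>)) x = partial q (partial p (partial r \<phi>)) x" for p q r x
    by (rule partial_commute[OF open_UNIV UNIV_I Ck_on_partial[OF Ck\<phi>]])
  have pe: "partial p (\<lambda>y. e y $ q) x = (if q = j then of_real (partial p \<phi> x) else 0)" for p q x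
    using partial_of_real[OF Ck\<phi>[of "Suc 0"] UNIV_I, of p x]
    by (cases "q = j") (simp_all add: e_def axis_def partial_def[of _ "\<lambda>x. 0"])
  have ce: "curl e = (\<lambda>x. \<chi> l. \<Sum>p\<in>UNIV. levi_civita l p j * of_real (partial p \<phi> x))"
    by (simp add: fun_eq_iff curl_def pe if_distrib[of "(*) _"] cong: if_cong)
  have tce: "test_on W (curl e)"
    by (rule test_on_curl[OF te])
  have pce: "partial p (\<lambda>y. curl e y $ q) x = (\<Sum>r\<in>UNIV. levi_civita q r j * of_real (partial p (partial r \<phi>) x))" for p q x
    unfolding ce vec_lambda_beta
    by (subst partial_lincomb[of _ "Suc 0" UNIV])
      (simp_all add: Ck_on_of_real[OF open_UNIV Ck_on_partial[OF Ck\<phi>]] partial_of_real[OF Ck_on_partial[OF Ck\<phi>[of "Suc (Suc 0)"]]] del: Ck_on.simps)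
  have cce: "cdot (curl (curl e) x) (X x) = cdot (m x) (X x) - of_real (lap \<phi> x) * X x $ j" for x
    using exhaust_3[of j] sym
    by (auto simp: cdot_def curl_def[of "curl e"] pce m_def lap_def sum_3 levi_civita_def algebra_simps)
  have pm: "partial p (\<lambda>y. m y $ q) x = of_real (partial p (partial q (partial j \<phi>)) x)" for p q x
    using partial_of_real[OF Ck_on_partial[OF Ck_on_partial[OF Ck\<phi>[of "Suc (Suc (Suc 0))"]]], of x p q j]
    by (simp add: m_def)
  have cm: "curl m x = 0" for x
    by (simp add: vec_eq_iff forall_3 curl_def pm sum_3 levi_civita_def sym3)
  have I1: "has_bochner_integral lebesgue (\<lambda>x. cdot (curl (curl e) x) (X x) - c * cdot (curl e x) (Y x) - cdot (curl e x) (A x)) 0"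
    using w1 tce unfolding weak_curl_def by blast
  have I2: "has_bochner_integral lebesgue (\<lambda>x. cdot (curl e x) (Y x) - (- c) * cdot (e x) (X x) - cdot (e x) (B x)) 0"
    using w2 te unfolding weak_curl_def by blast
  have I3: "has_bochner_integral lebesgue (\<lambda>x. cdot (curl m x) (Y x) - (- c) * cdot (m x) (X x) - cdot (m x) (B x)) 0"
    using w2 tm unfolding weak_curl_def by blast
  obtain K where K: "compact K" "K \<subseteq> W" "\<And>x. x \<notin> K \<Longrightarrow> e x = 0"
    using te unfolding test_on_def by blast
  have I4: "has_bochner_integral lebesgue (\<lambda>x. cdot (curl e x) (A x) - cdot (e x) (curl A x)) 0"
    by (rule curl_by_parts[OF W K Ck_on_subset[OF test_on_Ck[OF te]] A]) simp_all
  have I5: "has_bochner_integral lebesgue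
     (\<lambda>x. \<Sum>l\<in>UNIV. of_real (partial l (partial j \<phi>) x) * B x $ l - of_real (\<phi> x) * partial j (partial l (\<lambda>y. B y $ l)) x) (\<Sum>l\<in>(UNIV::3 set). 0)"
    by (intro has_bochner_integral_sum integral_second_by_parts[OF W \<phi>] Ck_on_vec_nth W B)
  have ej: "cdot (e x) v = of_real (\<phi> x) * v $ j" for x v
    by (simp add: cdot_def e_def axis_def if_distrib[of "\<lambda>z. z * _"] cong: if_cong)
  \<comment> \<open>The factor c makes the terms with Y cancel, the factor 1 / c those with m and X.
    The last two summands shift the derivatives from \<phi> to A and B.\<close>
  have "has_bochner_integral lebesgue (\<lambda>x.
     (cdot (curl (curl e) x) (X x) - c * cdot (curl e x) (Y x) - cdot (curl e x) (A x))
     + c * (cdot (curl e x) (Y x) - (- c) * cdot (e x) (X x) - cdot (e x) (B x))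
     - (1 / c) * (cdot (curl m x) (Y x) - (- c) * cdot (m x) (X x) - cdot (m x) (B x))
     + (cdot (curl e x) (A x) - cdot (e x) (curl A x))
     - (1 / c) * (\<Sum>l\<in>UNIV. of_real (partial l (partial j \<phi>) x) * B x $ l - of_real (\<phi> x) * partial j (partial l (\<lambda>y. B y $ l)) x))
     (0 + c * 0 - (1 / c) * 0 + 0 - (1 / c) * (\<Sum>l\<in>(UNIV::3 set). 0))"
    by (intro has_bochner_integral_add has_bochner_integral_diff has_bochner_integral_mult_right I1 I2 I3 I4 I5)
  moreover have "(cdot (curl (curl e) x) (X x) - c * cdot (curl e x) (Y x) - cdot (curl e x) (A x))
     + c * (cdot (curl e x) (Y x) - (- c) * cdot (e x) (X x) - cdot (e x) (B x))
     - (1 / c) * (cdot (curl m x) (Y x) - (- c) * cdot (m x) (X x) - cdot (m x) (B x))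
     + (cdot (curl e x) (A x) - cdot (e x) (curl A x))
     - (1 / c) * (\<Sum>l\<in>UNIV. of_real (partial l (partial j \<phi>) x) * B x $ l - of_real (\<phi> x) * partial j (partial l (\<lambda>y. B y $ l)) x)
     = of_real (\<phi> x) * ((1 / c) * (\<Sum>l\<in>UNIV. partial j (partial l (\<lambda>y. B y $ l)) x) - c * B x $ j - curl A x $ j)
     - of_real (lap \<phi> x + k\<^sup>2 * \<phi> x) * X x $ j" for x
  proof -
    have mB: "cdot (m x) (B x) = (\<Sum>l\<in>UNIV. of_real (partial l (partial j \<phi>) x) * B x $ l)"
      by (simp add: cdot_def m_def)
    have cm0: "cdot (curl m x) (Y x) = 0" by (simp add: cm cdot_def)
    define S where "S = (\<Sum>l\<in>UNIV. partial j (partial l (\<lambda>y. B y $ l)) x)"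
    have s: "(\<Sum>l\<in>UNIV. of_real (partial l (partial j \<phi>) x) * B x $ l - of_real (\<phi> x) * partial j (partial l (\<lambda>y. B y $ l)) x)
       = cdot (m x) (B x) - of_real (\<phi> x) * S"
      by (simp add: mB S_def sum_subtractf sum_distrib_left)
    have id: "(mX - L * Xj - c * ceY - ceA) + c * (ceY - (- c) * (f * Xj) - f * Bj)
        - (1 / c) * (0 - (- c) * mX - mB) + (ceA - f * cA) - (1 / c) * (mB - f * S)
        = f * ((1 / c) * S - c * Bj - cA) - (L + (of_real k)\<^sup>2 * f) * Xj" for mX L Xj ceY ceA f Bj mB cA S :: complex
    proof -
      have 1: "(1 / c) * (0 - (- c) * mX - mB) = mX - (1 / c) * mB" using c0 by (simp add: field_simps)
      have 2: "c * (ceY - (- c) * (f * Xj) - f * Bj) = c * ceY - (of_real k)\<^sup>2 * f * Xj - c * f * Bj"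
      proof -
        have "c * (ceY - (- c) * (f * Xj) - f * Bj) = c * ceY + (c * c) * f * Xj - c * f * Bj"
          by (simp add: algebra_simps)
        then show ?thesis unfolding cc by simp
      qed
      show ?thesis unfolding 1 2 by (simp add: algebra_simps)
    qed
    show ?thesis
      unfolding s cce cm0 ej S_def[symmetric] of_real_add of_real_mult of_real_power by (rule id)
  qed
  ultimately show ?thesis by simp
qed

text \<open>A bridge from the weak equations, stated with \<open>lebesgue\<close>, to
  \<open>helmholtz_regularity_boxes\<close>, stated with \<open>lborel\<close>.\<close>

lemma lebesgue_integrable_borel_version:
  fixes f :: "'a::euclidean_space \<Rightarrow> complex"
  assumes f: "integrable lebesgue f"
  obtains g where "integrable lborel g" "AE x in lebesgue. f x = g x"
proof -
  have "(\<lambda>x. Re (f x)) \<in> borel_measurable lebesgue" "(\<lambda>x. Im (f x)) \<in> borel_measurable lebesgue"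
    using borel_measurable_integrable[OF f] by measurable
  then obtain r i where r: "r \<in> borel_measurable lborel" "AE x in lborel. Re (f x) = r x"
    and i: "i \<in> borel_measurable lborel" "AE x in lborel. Im (f x) = i x"
    using completion_ex_borel_measurable_real by metis
  define g where "g x = Complex (r x) (i x)" for x
  have gm: "g \<in> borel_measurable lborel"
    unfolding g_def[abs_def] Complex_eq using r(1) i(1) by measurable
  have ae: "AE x in lebesgue. f x = g x"
    using AE_completion[OF r(2)] AE_completion[OF i(2)] by eventually_elim (simp add: g_def complex_eq_iff)
  have "integrable lebesgue g"
    by (rule Bochner_Integration.integrable_cong_AE_imp[OF f])
      (use ae measurable_completion[OF gm] in \<open>auto elim: eventually_mono\<close>)
  then have "integrable lborel g" using integrable_completion[OF gm] by simp
  then show ?thesis using ae that by blast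
qed

lemma loc_integrable_nth: "loc_integrable W X \<Longrightarrow> loc_integrable W (\<lambda>x. X x $ j)"
  for X :: "'a::euclidean_space \<Rightarrow> complex^3"
  unfolding loc_integrable_def
proof (intro allI impI)
  fix K :: "'a set" assume "\<forall>K. compact K \<longrightarrow> K \<subseteq> W \<longrightarrow> integrable lebesgue (\<lambda>x. indicator K x *\<^sub>R X x)" "compact K" "K \<subseteq> W"
  then have "integrable lebesgue (\<lambda>x. indicator K x *\<^sub>R X x)" by blast
  from integrable_bounded_linear[OF bounded_linear_vec_nth[of j] this]
  show "integrable lebesgue (\<lambda>x. indicator K x *\<^sub>R X x $ j)" by simp
qed

text \<open>\<open>weak_maxwell_helmholtz\<close> eliminates Y and leaves for each component of X a
  scalar Helmholtz equation whose right-hand side is built from A and B. The local representatives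
  are then glued.\<close>

lemma weak_maxwell_regular:
  assumes W: "open W" and k: "k \<noteq> 0" and ck: "c = \<i> * of_real k"
    and A: "\<And>n. Ck_on n W A" and B: "\<And>n. Ck_on n W B"
    and X: "loc_integrable W X"
    and w1: "weak_curl W c X Y A" and w2: "weak_curl W (- c) Y X B"
  obtains X' where "Ck_on 1 W X'" "AE x in lebesgue. x \<in> W \<longrightarrow> X x = X' x"
proof (rule glue_Ck_representatives[OF W])
  fix x0 assume x0: "x0 \<in> W"
  obtain r where r: "r > 0" "cball x0 r \<subseteq> W" using W x0 open_contains_cball by blast
  \<comment> \<open>3 R \<le> r keeps the large ball inside W, and R \<le> 2 is required for the
    integrability of the singular kernel.\<close>
  define R where "R = min 2 (r / 3)"
  have R: "0 < R" "R \<le> 2" "3 * R \<le> r" using r by (auto simp: R_def)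
  have subW: "ball x0 (3 * R) \<subseteq> W" "cball x0 (3 * R) \<subseteq> W" using r R by (auto simp: subset_eq)
  define g where "g j x = (1 / c) * (\<Sum>l\<in>UNIV. partial j (partial l (\<lambda>y. B y $ l)) x) - c * B x $ j - curl A x $ j" for j x
  have Ckg: "Ck_on 1 W (g j)" for j
    unfolding g_def[abs_def] curl_def vec_lambda_beta
    by (intro Ck_on_diff Ck_on_mult Ck_on_sum Ck_on_const W Ck_on_partial Ck_on_vec_nth A B)
  have comp: "\<exists>v. Ck_on 1 (ball x0 R) v \<and>
      (\<forall>a b. box a b \<subseteq> ball x0 R \<longrightarrow> (AE x in lebesgue. x \<in> box a b \<longrightarrow> X x $ j = v x))" for j
  proof -
    let ?Q = "cball x0 (3 * R)"
    have Xj: "loc_integrable W (\<lambda>x. X x $ j)" by (rule loc_integrable_nth[OF X])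
    have "integrable lebesgue (\<lambda>x. indicator ?Q x *\<^sub>R (X x $ j))"
      using Xj subW(2) unfolding loc_integrable_def by (metis compact_cball)
    then obtain U where U: "integrable lborel U" "AE x in lebesgue. indicator ?Q x *\<^sub>R (X x $ j) = U x"
      by (rule lebesgue_integrable_borel_version)
    have Um: "U \<in> borel_measurable borel" using borel_measurable_integrable[OF U(1)] by simp
    have weak: "(\<integral>x. (lap \<phi> x + k\<^sup>2 * \<phi> x) *\<^sub>R U x \<partial>lborel) = (\<integral>x. \<phi> x *\<^sub>R g j x \<partial>lborel)"
      if \<phi>: "test_on (ball x0 (3 * R)) \<phi>" for \<phi>
    proof -
      obtain K where K: "compact K" "K \<subseteq> ball x0 (3 * R)" "\<And>x. x \<notin> K \<Longrightarrow> \<phi> x = 0"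
        using \<phi> unfolding test_on_def by blast
      have KW: "K \<subseteq> W" using K subW by blast
      let ?L = "\<lambda>x. lap \<phi> x + k\<^sup>2 * \<phi> x"
      have cL: "continuous_on UNIV ?L"
        by (intro continuous_intros Ck_on_imp_continuous[OF Ck_on_lap[OF test_on_Ck[OF \<phi>] open_UNIV]]
            Ck_on_imp_continuous[OF test_on_Ck[OF \<phi>]])
      have L0: "?L x = 0" if "x \<notin> K" for x
      proof -
        have o: "open (- K)" "x \<in> - K" using K(1) that compact_imp_closed by auto
        have p0: "partial j \<phi> y = 0" if "y \<in> - K" for y j
          unfolding partial_def by (rule frechet_derivative_eq_0_open[OF o(1) that]) (use K in auto)
        have "partial j (partial j \<phi>) x = 0" for j
          unfolding partial_def[of j "partial j \<phi>"] by (rule frechet_derivative_eq_0_open[OF o]) (rule p0)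
        then show ?thesis using K(3)[OF that] by (simp add: lap_def)
      qed
      have i1: "integrable lebesgue (\<lambda>x. ?L x *\<^sub>R (X x $ j))"
        by (rule integrable_test_bilinear[OF bounded_bilinear_scaleR cL K(1) KW L0 Xj])
      have cg: "continuous_on UNIV (\<lambda>x. \<phi> x *\<^sub>R g j x)"
        by (rule Ck_on_imp_continuous[OF Ck_on_bilinear_extend_zero[OF bounded_bilinear_scaleR W K(1) KW K(3) Ck_on_subset[OF test_on_Ck[OF \<phi>] subset_UNIV] Ckg]])
      have i2: "integrable lborel (\<lambda>x. \<phi> x *\<^sub>R g j x)"
        by (rule integrable_compact_support[OF cg K(1)]) (simp add: K)
      then have i2': "integrable lebesgue (\<lambda>x. \<phi> x *\<^sub>R g j x)" "(\<integral>x. \<phi> x *\<^sub>R g j x \<partial>lebesgue) = (\<integral>x. \<phi> x *\<^sub>R g j x \<partial>lborel)"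
        using integrable_completion[OF borel_measurable_integrable[OF i2]] integral_completion[OF borel_measurable_integrable[OF i2]]
        by auto
      have "has_bochner_integral lebesgue (\<lambda>x. of_real (\<phi> x) * g j x - of_real (?L x) * X x $ j) 0"
        unfolding g_def by (rule weak_maxwell_helmholtz[OF W k ck A B w1 w2 test_on_subset[OF \<phi> subW(1)]])
      then have "(\<integral>x. \<phi> x *\<^sub>R g j x - ?L x *\<^sub>R (X x $ j) \<partial>lebesgue) = 0"
        unfolding scaleR_conv_of_real by (simp add: has_bochner_integral_iff)
      then have "(\<integral>x. \<phi> x *\<^sub>R g j x \<partial>lebesgue) = (\<integral>x. ?L x *\<^sub>R (X x $ j) \<partial>lebesgue)"
        using Bochner_Integration.integral_diff[OF i2'(1) i1] by simp
      also have "\<dots> = (\<integral>x. ?L x *\<^sub>R U x \<partial>lebesgue)"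
      proof (rule integral_cong_AE)
        show "(\<lambda>x. ?L x *\<^sub>R (X x $ j)) \<in> borel_measurable lebesgue" using i1 by (rule borel_measurable_integrable)
        have "(\<lambda>x. ?L x *\<^sub>R U x) \<in> borel_measurable lborel"
          using borel_measurable_scaleR[OF borel_measurable_continuous_onI[OF cL] Um]
          by simp
        then show "(\<lambda>x. ?L x *\<^sub>R U x) \<in> borel_measurable lebesgue" by (rule measurable_completion)
        show "AE x in lebesgue. ?L x *\<^sub>R (X x $ j) = ?L x *\<^sub>R U x"
          using U(2)
        proof eventually_elim
          case (elim x)
          show ?case
          proof (cases "x \<in> K")
            case True
            then have "x \<in> ?Q" using K(2) ball_subset_cball by blast
            then show ?thesis using elim by simp
          qed (simp add: L0)
        qed
      qed
      also have "\<dots> = (\<integral>x. ?L x *\<^sub>R U x \<partial>lborel)"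
        by (rule integral_completion)
          (use borel_measurable_scaleR[OF borel_measurable_continuous_onI[OF cL] Um] in simp)
      finally show ?thesis using i2'(2) by simp
    qed
    obtain v where v: "Ck_on 1 (ball x0 R) v"
      "\<And>a b. box a b \<subseteq> ball x0 R \<Longrightarrow> AE x in lborel. x \<in> box a b \<longrightarrow> U x = v x"
      using helmholtz_regularity_boxes[OF R(1,2) U(1) Ck_on_subset[OF Ckg subW(1)] weak] by blast
    have "AE x in lebesgue. x \<in> box a b \<longrightarrow> X x $ j = v x" if ab: "box a b \<subseteq> ball x0 R" for a b
      using AE_completion[OF v(2)[OF ab]] U(2)
    proof eventually_elim
      case (elim x)
      show ?case
      proof
        assume x: "x \<in> box a b"
        then have "x \<in> ?Q" using ab R by (auto simp: subset_eq)
        then show "X x $ j = v x" using elim x by simp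
      qed
    qed
    then show ?thesis using v(1) by blast
  qed
  have "\<forall>j. \<exists>v. Ck_on 1 (ball x0 R) v \<and>
      (\<forall>a b. box a b \<subseteq> ball x0 R \<longrightarrow> (AE x in lebesgue. x \<in> box a b \<longrightarrow> X x $ j = v x))"
    by (rule allI) (rule comp)
  from choice[OF this] obtain v where v: "\<And>j. Ck_on 1 (ball x0 R) (v j)"
    "\<And>j a b. box a b \<subseteq> ball x0 R \<Longrightarrow> AE x in lebesgue. x \<in> box a b \<longrightarrow> X x $ j = v j x"
    by blast
  \<comment> \<open>\<open>helmholtz_regularity_boxes\<close> identifies the field on boxes, so the
    neighbourhood of x0 is chosen to be a box.\<close>
  obtain a b where ab: "x0 \<in> box a b" "box a b \<subseteq> ball x0 R"
    using rational_boxes[OF R(1), of x0] by blast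
  have "AE x in lebesgue. \<forall>j\<in>UNIV. x \<in> box a b \<longrightarrow> X x $ j = v j x"
    by (intro AE_finite_allI v ab) simp
  then have "AE x in lebesgue. x \<in> box a b \<longrightarrow> X x = (\<chi> j. v j x)"
    by eventually_elim (auto simp: vec_eq_iff)
  moreover have "Ck_on 1 (box a b) (\<lambda>x. \<chi> j. v j x)"
    by (rule Ck_on_vec[OF open_box]) (simp add: Ck_on_subset[OF v(1) ab(2)] del: Ck_on.simps One_nat_def)
  ultimately show "\<exists>V v. open V \<and> x0 \<in> V \<and> Ck_on 1 V v \<and> (AE y in lebesgue. y \<in> V \<longrightarrow> X y = v y)"
    using ab(1) open_box by blast
qed (rule that)

text \<open>If a component of Z is nonzero at x0, a bump function times the conjugate of that value
  makes the real part of the integrand nonnegative everywhere and positive near x0.\<close>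

lemma continuous_eq_0_if_weakly_0:
  fixes Z :: form
  assumes W: "open W" and Z: "continuous_on W Z"
    and weak: "\<And>h. test_on W h \<Longrightarrow> has_bochner_integral lebesgue (\<lambda>x. cdot (h x) (Z x)) 0"
    and x0: "x0 \<in> W"
  shows "Z x0 = 0"
proof (rule ccontr)
  assume "Z x0 \<noteq> 0"
  then obtain j where j: "Z x0 $ j \<noteq> 0" by (auto simp: vec_eq_iff)
  define z where "z = cnj (Z x0 $ j)"
  let ?q = "\<lambda>x. Re (z * Z x $ j)"
  have q0: "?q x0 > 0"
    using j sum_power2_gt_zero_iff[of "Re (Z x0 $ j)" "Im (Z x0 $ j)"]
    by (simp add: z_def complex_eq_iff power2_eq_square)
  have "continuous_on W ?q" by (intro continuous_intros Z)
  then have "open (W \<inter> ?q -` {0<..})" by (rule continuous_open_preimage[OF _ W open_greaterThan])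
  then obtain r where r: "r > 0" "cball x0 r \<subseteq> W \<inter> ?q -` {0<..}"
    using x0 q0 open_contains_cball by (metis (no_types, lifting) IntI greaterThan_iff vimageI)
  define \<phi> where "\<phi> x = ball_cutoff r (x - x0)" for x :: "real^3"
  have \<phi>0: "\<phi> x = 0" if "x \<notin> cball x0 r" for x
    using that r by (simp add: \<phi>_def ball_cutoff_eq_0 dist_norm norm_minus_commute)
  have \<phi>nn: "0 \<le> \<phi> x" for x by (simp add: \<phi>_def ball_cutoff_bounds)
  have "Ck_on n UNIV \<phi>" for n
    unfolding \<phi>_def[abs_def]
    by (rule Ck_on_compose[of UNIV UNIV "\<lambda>x. x - x0", OF _ _ _ _ Ck_on_ball_cutoff])
      (rule open_UNIV subset_UNIV Ck_on_diff Ck_on_id Ck_on_const)+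
  then have t\<phi>: "test_on W \<phi>"
    unfolding test_on_def using r \<phi>0 by (intro conjI allI exI[of _ "cball x0 r"]) auto
  have "bounded_linear (\<lambda>t::real. axis j (of_real t * z) :: complex^3)"
    by (intro bounded_linear_compose[OF bounded_linear_axis]
        bounded_linear_compose[OF bounded_linear_mult_left bounded_linear_of_real])
  from test_on_compose_linear[OF this t\<phi>]
  have "has_bochner_integral lebesgue (\<lambda>x. cdot (axis j (of_real (\<phi> x) * z)) (Z x)) 0" by (rule weak)
  moreover have "cdot (axis j (of_real (\<phi> x) * z)) (Z x) = of_real (\<phi> x) * (z * Z x $ j)" for x
    by (simp add: cdot_def axis_def if_distrib[of "\<lambda>z. z * _"] mult.assoc cong: if_cong)
  ultimately have "has_bochner_integral lebesgue (\<lambda>x. of_real (\<phi> x) * (z * Z x $ j)) 0" by simp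
  from has_bochner_integral_bounded_linear[OF bounded_linear_Re this]
  have I: "has_bochner_integral lebesgue (\<lambda>x. \<phi> x * ?q x) 0" by simp
  have nn: "0 \<le> \<phi> x * ?q x" for x
  proof (cases "x \<in> cball x0 r")
    case True
    then have "?q x > 0" using r by auto
    then show ?thesis using \<phi>nn by (intro mult_nonneg_nonneg) auto
  qed (simp add: \<phi>0)
  have "AE x in lebesgue. \<phi> x * ?q x = 0"
    using I integral_nonneg_eq_0_iff_AE[of lebesgue "\<lambda>x. \<phi> x * ?q x"] nn
    by (simp add: has_bochner_integral_iff)
  then have "AE x in lebesgue. x \<in> ball x0 (r / 2) \<longrightarrow> False"
  proof eventually_elim
    case (elim x)
    show ?case
    proof
      assume x: "x \<in> ball x0 (r / 2)"
      then have "\<phi> x = 1" using r by (simp add: \<phi>_def ball_cutoff_eq_1 dist_norm norm_minus_commute)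
      moreover have "?q x > 0" using r x by (auto simp: subset_eq)
      ultimately show False using elim by simp
    qed
  qed
  then have "(1::real) = 0"
    using eq_on_open_if_AE_eq[of "ball x0 (r / 2)" "\<lambda>_. 1::real" "\<lambda>_. 0" x0] r by (auto elim: eventually_mono)
  then show False by simp
qed

section \<open>Pull-back of forms\<close>

definition pull1 :: "real^3^3 \<Rightarrow> complex^3 \<Rightarrow> complex^3" where
  "pull1 A v = (\<chi> j. \<Sum>a\<in>UNIV. of_real (A $ a $ j) * v $ a)"

definition cofactor3 :: "real^3^3 \<Rightarrow> real^3^3" where
  "cofactor3 A = vector
    [vector [A$2$2 * A$3$3 - A$2$3 * A$3$2, A$2$3 * A$3$1 - A$2$1 * A$3$3, A$2$1 * A$3$2 - A$2$2 * A$3$1],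
     vector [A$3$2 * A$1$3 - A$3$3 * A$1$2, A$3$3 * A$1$1 - A$3$1 * A$1$3, A$3$1 * A$1$2 - A$3$2 * A$1$1],
     vector [A$1$2 * A$2$3 - A$1$3 * A$2$2, A$1$3 * A$2$1 - A$1$1 * A$2$3, A$1$1 * A$2$2 - A$1$2 * A$2$1]]"

text \<open>The pull-back of a 2-form under a linear map, in terms of the components
  \<open>J\<^sup>l\<close>. It is the adjugate of A applied to w, that is det A times the inverse of
  A for invertible A (the Piola transform).\<close>

definition pull2 :: "real^3^3 \<Rightarrow> complex^3 \<Rightarrow> complex^3" where
  "pull2 A w = (\<chi> l. \<Sum>c\<in>UNIV. of_real (cofactor3 A $ c $ l) * w $ c)"

lemma pullback1_eq: "pullback1 F E x = pull1 (jacobian F (at x)) (E (F x))"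
  by (simp add: pullback1_def pull1_def)

lemma cdot_commute: "cdot v w = cdot w v"
  by (simp add: cdot_def mult.commute)

text \<open>\<open>cdot\<close> of a 2-form with a 1-form is the coefficient of their wedge product,
  and a 3-form pulls back with the determinant.\<close>

lemma cdot_pull2_pull1: "cdot (pull2 A w) (pull1 A v) = of_real (det A) * cdot w v"
  by (simp add: cdot_def pull1_def pull2_def cofactor3_def sum_3 det_3 algebra_simps)

lemma cofactor3_mult: "(\<Sum>c\<in>UNIV. cofactor3 A $ c $ l * A $ c $ b) = (if l = b then det A else 0)"
  using exhaust_3[of l] exhaust_3[of b] by (auto simp: cofactor3_def sum_3 det_3 algebra_simps)

lemma pull2_mult:
  "pull2 A (\<chi> c. \<Sum>b\<in>UNIV. of_real (A $ c $ b) * v $ b) = of_real (det A) *s v"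
proof -
  have "(\<Sum>c\<in>UNIV. of_real (cofactor3 A $ c $ l) * (\<Sum>b\<in>UNIV. of_real (A $ c $ b) * v $ b))
      = (\<Sum>b\<in>UNIV. of_real (\<Sum>c\<in>UNIV. cofactor3 A $ c $ l * A $ c $ b) * v $ b)" for l
    by (simp add: sum_3 algebra_simps)
  then show ?thesis
    unfolding pull2_def cofactor3_mult by (simp add: vec_eq_iff if_distrib if_distribR cong: if_cong)
qed

lemma pull2_lin:
  "pull2 A (v + w) = pull2 A v + pull2 A w" "pull2 A (c *s v) = c *s pull2 A v" "pull2 A (- v) = - pull2 A v"
  by (simp_all add: pull2_def vec_eq_iff sum.distrib sum_distrib_left sum_negf algebra_simps)

lemma pull2_inj:
  assumes "det A \<noteq> 0" "pull2 A v = pull2 A w"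
  shows "v = w"
proof -
  have "cdot (v - w) u = 0" for u
  proof -
    have "of_real (det A) * cdot v u = of_real (det A) * cdot w u"
      using assms(2) cdot_pull2_pull1[of A v u] cdot_pull2_pull1[of A w u] by (simp only:)
    then have "cdot v u = cdot w u" using assms(1) mult_left_cancel[of "complex_of_real (det A)"] by simp
    then show ?thesis by (simp add: cdot_def left_diff_distrib sum_subtractf)
  qed
  then have "cdot (v - w) (axis j 1) = 0" for j by blast
  then show ?thesis by (simp add: vec_eq_iff cdot_def axis_def if_distrib cong: if_cong)
qed

lemma pull1_inverse:
  assumes "A ** A' = mat 1"
  shows "pull1 A' (pull1 A v) = v" 
proof -
  have "A' ** A = mat 1" using assms matrix_left_right_inverse by blast
  then have AA: "(\<Sum>b\<in>UNIV. A $ a $ b * A' $ b $ j) = (if a = j then 1 else 0)" for a j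
    using assms by (simp add: matrix_matrix_mult_def mat_def vec_eq_iff)
  have "pull1 A' (pull1 A v) $ j = (\<Sum>a\<in>UNIV. of_real (\<Sum>b\<in>UNIV. A $ a $ b * A' $ b $ j) * v $ a)" for j
    by (simp add: pull1_def sum_3 algebra_simps)
  then show ?thesis
    unfolding AA by (simp add: vec_eq_iff if_distrib if_distribR cong: if_cong)
qed

lemma is_pullback2_imp:
  assumes "is_pullback2 F Jt J x"
  shows "J x = pull2 (jacobian F (at x)) (Jt (F x))"
proof -
  let ?A = "jacobian F (at x)" and ?w = "Jt (F x)"
  have *: "form2_coeff (J x) p q = (\<Sum>a\<in>UNIV. \<Sum>b\<in>UNIV. of_real (?A $ a $ p) * of_real (?A $ b $ q) * form2_coeff ?w a b)" for p q
    using assms by (simp add: is_pullback2_def)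
  \<comment> \<open>Each component is recovered from the coefficient with the cyclic completion of
    its index.\<close>
  have "J x $ 1 = form2_coeff (J x) 2 3" "J x $ 2 = form2_coeff (J x) 3 1" "J x $ 3 = form2_coeff (J x) 1 2"
    by (simp_all add: form2_coeff_def sum_3 levi_civita_def)
  then show ?thesis
    unfolding * by (simp add: vec_eq_iff forall_3 pull2_def cofactor3_def form2_coeff_def sum_3 levi_civita_def algebra_simps)
qed

lemma matrix_inv_eqI:
  fixes A B :: "real^'n^'n"
  assumes "A ** B = mat 1" "B ** A = mat 1"
  shows "matrix_inv A = B"
proof -
  have "A ** matrix_inv A = mat 1 \<and> matrix_inv A ** A = mat 1"
    unfolding matrix_inv_def by (rule someI[of _ B]) (use assms in simp)
  then have "matrix_inv A = (matrix_inv A ** A) ** B"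
    using assms by (metis matrix_mul_assoc matrix_mul_rid)
  with \<open>A ** matrix_inv A = mat 1 \<and> matrix_inv A ** A = mat 1\<close> show ?thesis by simp
qed

lemma material_flat [simp]: "material flat_metric x = mat 1"
proof -
  have "matrix_inv (mat 1 :: real^3^3) = mat 1" by (simp add: matrix_inv_eqI)
  then show ?thesis by (simp add: material_def flat_metric_def)
qed

lemma apply_material_flat [simp]: "apply_material (material flat_metric) E x = E x"
  by (simp add: apply_material_def vec_eq_iff mat_def if_distrib if_distribR cong: if_cong)

text \<open>With A' the inverse of A, the metric is the transpose of A' times A'. Its inverse is A
  times the transpose of A, and the root of its determinant is 1 / det A.\<close>

lemma material_pullback_flat:
  assumes A': "jacobian G (at y) = A'" and inv: "A ** A' = mat 1" and d: "det A > 0"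
  shows "material (pullback_metric G flat_metric) y = (1 / det A) *\<^sub>R (A ** transpose A)"
proof -
  let ?g = "pullback_metric G flat_metric y"
  have inv': "A' ** A = mat 1" using inv matrix_left_right_inverse by blast
  have g: "?g = transpose A' ** A'"
    by (simp add: pullback_metric_def flat_metric_def A' vec_eq_iff matrix_matrix_mult_def transpose_def mat_def
        if_distrib cong: if_cong)
  have dd: "det A * det A' = 1" using arg_cong[OF inv, of det] by (simp add: det_mul)
  then have dA': "det A' = 1 / det A" using d by (simp add: field_simps)
  have "det ?g = (det A')\<^sup>2" unfolding g by (simp add: det_mul det_transpose power2_eq_square)
  then have s: "sqrt (det ?g) = 1 / det A" using d dA' by (simp add: real_sqrt_abs)
  have "?g ** (A ** transpose A) = transpose A' ** (A' ** A) ** transpose A"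
    unfolding g by (simp add: matrix_mul_assoc)
  also have "\<dots> = transpose (A ** A')" by (simp add: inv' matrix_transpose_mul)
  finally have 1: "?g ** (A ** transpose A) = mat 1" by (simp add: inv transpose_mat)
  then have 2: "(A ** transpose A) ** ?g = mat 1" using matrix_left_right_inverse by blast
  have "matrix_inv ?g = A ** transpose A" using 1 2 by (simp add: matrix_inv_eqI)
  then show ?thesis unfolding material_def s by simp
qed

text \<open>The material acts as a Hodge star, which commutes with pull-back: the 2-form \<epsilon>E
  of the coated metric becomes the flat one of the pulled-back field.\<close>

lemma apply_material_pull:
  assumes eps: "eps y = (1 / det A) *\<^sub>R (A ** transpose A)" and d: "det A \<noteq> 0"
  shows "pull2 A (apply_material eps E y) = pull1 A (E y)"
proof -
  have "apply_material eps E y = (\<chi> c. \<Sum>b\<in>UNIV. of_real (A $ c $ b) * ((1 / of_real (det A)) *s pull1 A (E y)) $ b)"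
    by (simp add: apply_material_def eps pull1_def matrix_matrix_mult_def transpose_def vec_eq_iff sum_3 algebra_simps)
  then have "pull2 A (apply_material eps E y) = of_real (det A) *s ((1 / of_real (det A)) *s pull1 A (E y))"
    by (simp only: pull2_mult)
  then show ?thesis using d by (simp add: vec_eq_iff)
qed

lemma energy_pull:
  assumes eps: "eps y = (1 / det A) *\<^sub>R (A ** transpose A)" and d: "det A \<noteq> 0"
  shows "of_real (det A) * (\<Sum>j\<in>UNIV. \<Sum>k\<in>UNIV. of_real (eps y $ j $ k) * v $ j * cnj (v $ k))
    = (\<Sum>j\<in>UNIV. pull1 A v $ j * cnj (pull1 A v $ j))"
proof -
  have "of_real (det A) * of_real (eps y $ j $ k) = complex_of_real (\<Sum>b\<in>UNIV. A $ j $ b * A $ k $ b)" for j k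
    using d by (simp add: eps matrix_matrix_mult_def transpose_def flip: of_real_mult)
  then have "of_real (det A) * (\<Sum>j\<in>UNIV. \<Sum>k\<in>UNIV. of_real (eps y $ j $ k) * v $ j * cnj (v $ k))
     = (\<Sum>j\<in>UNIV. \<Sum>k\<in>UNIV. of_real (\<Sum>b\<in>UNIV. A $ j $ b * A $ k $ b) * v $ j * cnj (v $ k))"
    by (simp add: sum_distrib_left mult.assoc[symmetric])
  also have "\<dots> = (\<Sum>j\<in>UNIV. pull1 A v $ j * cnj (pull1 A v $ j))"
    by (simp add: pull1_def sum_3 algebra_simps)
  finally show ?thesis .
qed

lemma jacobian_nth: "jacobian F (at x) $ i $ j = frechet_derivative F (at x) (axis j 1) $ i"
  by (simp add: jacobian_def matrix_def)

lemma jacobian_nth_partial: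
  assumes "Ck_on (Suc n) U F" "x \<in> U"
  shows "jacobian F (at x) $ i $ j = partial j (\<lambda>y. F y $ i) x"
  unfolding jacobian_nth partial_def
  by (rule frechet_derivative_bounded_linear[OF bounded_linear_vec_nth assms, symmetric])

lemma frechet_derivative_jacobian:
  fixes F :: "real^3 \<Rightarrow> real^3"
  assumes "Ck_on (Suc n) U F" "x \<in> U"
  shows "frechet_derivative F (at x) v = jacobian F (at x) *v v"
proof -
  have "linear (frechet_derivative F (at x))" using has_derivative_linear[OF Ck_on_SucD[OF assms]] .
  then show ?thesis unfolding jacobian_def by (simp add: matrix_works)
qed

lemma Ck_on_pullback1:
  assumes U: "open U" and V: "open V" and FU: "F ` U \<subseteq> V" and F: "Ck_on (Suc n) U F" and h: "Ck_on n V h"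
  shows "Ck_on n U (pullback1 F h)"
proof (rule Ck_on_vec[OF U])
  fix j
  have "Ck_on n U (\<lambda>x. \<Sum>a\<in>UNIV. of_real (partial j (\<lambda>y. F y $ a) x) * h (F x) $ a)"
    by (intro Ck_on_sum Ck_on_mult Ck_on_of_real Ck_on_partial Ck_on_vec_nth[OF U F] U Ck_on_vec_nth
        Ck_on_compose[OF U V FU Ck_on_Suc_imp[OF F] h])
  then show "Ck_on n U (\<lambda>x. pullback1 F h x $ j)"
    by (rule Ck_on_cong[OF U, rotated]) (simp add: pullback1_def jacobian_nth_partial[OF F])
qed

lemma partial_compose:
  fixes g :: "real^3 \<Rightarrow> 'b::real_normed_vector"
  assumes F: "Ck_on (Suc n) U F" "x \<in> U" and g: "Ck_on (Suc m) V g" "F x \<in> V"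
  shows "partial p (\<lambda>y. g (F y)) x = (\<Sum>b\<in>UNIV. partial p (\<lambda>y. F y $ b) x *\<^sub>R partial b g (F x))"
proof -
  note dF = Ck_on_SucD[OF F] and dg = Ck_on_SucD[OF g]
  have "partial p (\<lambda>y. g (F y)) x = frechet_derivative g (at (F x)) (frechet_derivative F (at x) (axis p 1))"
    by (rule partial_eqI[OF has_derivative_compose[OF dF dg]])
  also have "frechet_derivative F (at x) (axis p 1) = (\<Sum>b\<in>UNIV. partial p (\<lambda>y. F y $ b) x *\<^sub>R axis b 1)"
  proof -
    have "frechet_derivative F (at x) (axis p 1) $ i = partial p (\<lambda>y. F y $ i) x" for i
      using jacobian_nth[of F x i p] jacobian_nth_partial[OF F, of i p] by simp
    then show ?thesis by (simp add: vec_eq_iff axis_def if_distrib if_distribR cong: if_cong)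
  qed
  also have "frechet_derivative g (at (F x)) \<dots> = (\<Sum>b\<in>UNIV. partial p (\<lambda>y. F y $ b) x *\<^sub>R partial b g (F x))"
    using has_derivative_linear[OF dg] by (simp add: linear_sum linear_cmul partial_def)
  finally show ?thesis .
qed

text \<open>The exterior derivative commutes with pull-back. The second derivatives of F that appear
  are symmetric and are annihilated by the Levi-Civita symbol; the products of first derivatives
  assemble to the cofactors.\<close>

lemma curl_pullback1:
  assumes U: "open U" and V: "open V" and FU: "F ` U \<subseteq> V" and F: "Ck_on 2 U F" and h: "Ck_on 1 V h" and x: "x \<in> U"
  shows "curl (pullback1 F h) x = pull2 (jacobian F (at x)) (curl h (F x))"
proof -
  have F2: "Ck_on (Suc (Suc 0)) U F" using F by (simp only: numeral_2_eq_2)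
  have h1: "Ck_on (Suc 0) V h" using h by (simp only: One_nat_def)
  note F1 = Ck_on_Suc_imp[OF F2]
  have Fx: "F x \<in> V" using FU x by blast
  define S where "S a p q = partial p (partial q (\<lambda>y. F y $ a)) x" for a p q
  define D where "D b a = partial b (\<lambda>y. h y $ a) (F x)" for a b
  have sym: "S a p q = S a q p" for a p q
    unfolding S_def by (rule partial_commute[OF U x Ck_on_vec_nth[OF U F]])
  have jac: "jacobian F (at x) $ b $ p = partial p (\<lambda>y. F y $ b) x" for b p
    by (rule jacobian_nth_partial[OF F1 x])
  have pd: "partial p (\<lambda>y. pullback1 F h y $ q) x
      = (\<Sum>a\<in>UNIV. of_real (S a p q) * h (F x) $ a
          + of_real (jacobian F (at x) $ a $ q) * (\<Sum>b\<in>UNIV. of_real (jacobian F (at x) $ b $ p) * D b a))" for p q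
  proof -
    let ?t = "\<lambda>a y. of_real (partial q (\<lambda>y. F y $ a) y) * h (F y) $ a :: complex"
    have c1: "Ck_on (Suc 0) U (\<lambda>y. complex_of_real (partial q (\<lambda>y. F y $ a) y))" for a
      by (intro Ck_on_of_real Ck_on_partial Ck_on_vec_nth[OF U F2] U)
    have hF: "Ck_on (Suc 0) U (\<lambda>y. h (F y) $ a)" for a
      by (intro Ck_on_vec_nth U Ck_on_compose[OF U V FU F1 h1])
    have "partial p (\<lambda>y. pullback1 F h y $ q) x = partial p (\<lambda>y. \<Sum>a\<in>UNIV. 1 * ?t a y) x"
      by (rule partial_cong[OF U x]) (simp add: pullback1_def jacobian_nth_partial[OF F1])
    also have "\<dots> = (\<Sum>a\<in>UNIV. 1 * partial p (?t a) x)"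
      by (rule partial_lincomb[where n = 0, OF _ x]) (intro Ck_on_mult U c1 hF)
    also have "\<dots> = (\<Sum>a\<in>UNIV. of_real (S a p q) * h (F x) $ a
          + of_real (jacobian F (at x) $ a $ q) * (\<Sum>b\<in>UNIV. of_real (jacobian F (at x) $ b $ p) * D b a))"
    proof (rule sum.cong[OF refl])
      fix a :: 3
      have "partial p (?t a) x = of_real (partial q (\<lambda>y. F y $ a) x) * partial p (\<lambda>y. h (F y) $ a) x
          + partial p (\<lambda>y. complex_of_real (partial q (\<lambda>y. F y $ a) y)) x * h (F x) $ a"
        by (rule partial_mult[OF c1 hF x])
      also have "partial p (\<lambda>y. complex_of_real (partial q (\<lambda>y. F y $ a) y)) x = of_real (S a p q)"
        unfolding S_def by (rule partial_of_real[OF Ck_on_partial[OF Ck_on_vec_nth[OF U F2]] x])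
      also have "partial p (\<lambda>y. h (F y) $ a) x = (\<Sum>b\<in>UNIV. of_real (jacobian F (at x) $ b $ p) * D b a)"
        using partial_compose[OF F1 x Ck_on_vec_nth[OF V h1] Fx, of p a]
        by (simp add: jac D_def scaleR_conv_of_real)
      finally show "1 * partial p (?t a) x = of_real (S a p q) * h (F x) $ a
          + of_real (jacobian F (at x) $ a $ q) * (\<Sum>b\<in>UNIV. of_real (jacobian F (at x) $ b $ p) * D b a)"
        by (simp add: jac)
    qed
    finally show ?thesis .
  qed
  let ?A = "jacobian F (at x)"
  have c: "curl h (F x) = (\<chi> l. \<Sum>p\<in>UNIV. \<Sum>q\<in>UNIV. levi_civita l p q * D p q)"
    by (simp add: curl_def D_def)
  show ?thesis
    unfolding c curl_def[of "pullback1 F h"] pd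
    by (simp add: vec_eq_iff forall_3 pull2_def cofactor3_def sum_3 levi_civita_def sym[of _ 2 1] sym[of _ 3 1] sym[of _ 3 2])
      (simp add: algebra_simps)
qed

section \<open>Change of variables\<close>

text \<open>Complex values are passed through \<open>real^2\<close> to match the form of
  \<open>has_absolute_integral_change_of_variables\<close>. The equivalence includes integrability,
  so it can be used in either direction without prior knowledge of f.\<close>

lemma has_bochner_integral_change_of_variables:
  fixes F :: "real^3 \<Rightarrow> real^3" and f :: "real^3 \<Rightarrow> complex"
  assumes S: "S \<in> sets lebesgue" and FS: "F ` S \<in> sets lebesgue"
    and der: "\<And>x. x \<in> S \<Longrightarrow> (F has_derivative F' x) (at x within S)" and inj: "inj_on F S"
  shows "has_bochner_integral (lebesgue_on (F ` S)) f z \<longleftrightarrow>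
    has_bochner_integral (lebesgue_on S) (\<lambda>x. \<bar>det (matrix (F' x))\<bar> *\<^sub>R f (F x)) z"
proof -
  define T :: "complex \<Rightarrow> real^2" where "T z = vector [Re z, Im z]" for z
  define T' :: "real^2 \<Rightarrow> complex" where "T' v = Complex (v $ 1) (v $ 2)" for v
  have T: "bounded_linear T"
    unfolding T_def[abs_def] by (intro linear_conv_bounded_linear[THEN iffD1] linearI) (simp_all add: vec_eq_iff forall_2)
  have T': "bounded_linear T'"
    unfolding T'_def[abs_def] by (intro linear_conv_bounded_linear[THEN iffD1] linearI) (simp_all add: complex_eq_iff)
  have T'T: "T' (T z) = z" for z by (simp add: T_def T'_def)
  have hbi: "has_bochner_integral (lebesgue_on A) g z \<longleftrightarrow>
      (\<lambda>x. T (g x)) absolutely_integrable_on A \<and> integral A (\<lambda>x. T (g x)) = T z"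
    if A: "A \<in> sets lebesgue" for A :: "(real^3) set" and g z
  proof -
    have R: "has_bochner_integral (lebesgue_on A) h w \<longleftrightarrow> h absolutely_integrable_on A \<and> integral A h = w"
      for h :: "real^3 \<Rightarrow> real^2" and w
    proof -
      have "has_bochner_integral (lebesgue_on A) h w \<longleftrightarrow> has_bochner_integral lebesgue (\<lambda>x. indicator A x *\<^sub>R h x) w"
        by (rule has_bochner_integral_restrict_space) (use A in simp)
      also have "\<dots> \<longleftrightarrow> h absolutely_integrable_on A \<and> integral A h = w"
        using set_lebesgue_integral_eq_integral(2)[of A h]
        by (auto simp: has_bochner_integral_iff set_integrable_def set_lebesgue_integral_def)
      finally show ?thesis .
    qed
    have "has_bochner_integral (lebesgue_on A) g z \<longleftrightarrow> has_bochner_integral (lebesgue_on A) (\<lambda>x. T (g x)) (T z)"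
      using has_bochner_integral_bounded_linear[OF T, of "lebesgue_on A" g z]
        has_bochner_integral_bounded_linear[OF T', of "lebesgue_on A" "\<lambda>x. T (g x)" "T z"]
      by (auto simp: T'T)
    then show ?thesis unfolding R .
  qed
  have "(\<lambda>x. T (\<bar>det (matrix (F' x))\<bar> *\<^sub>R f (F x))) = (\<lambda>x. \<bar>det (matrix (F' x))\<bar> *\<^sub>R T (f (F x)))"
    by (rule ext) (rule linear_cmul[OF bounded_linear.linear[OF T]])
  then show ?thesis
    unfolding hbi[OF S] hbi[OF FS]
    using has_absolute_integral_change_of_variables[OF S der inj, of "\<lambda>y. T (f y)" "T z"] by simp
qed

lemma AE_lebesgue_on_iff_negligible:
  "S \<in> sets lebesgue \<Longrightarrow> (AE x in lebesgue_on S. R x) \<longleftrightarrow> negligible {x \<in> S. \<not> R x}"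
proof -
  assume S: "S \<in> sets lebesgue"
  have "(AE x in lebesgue_on S. R x) \<longleftrightarrow> (AE x in lebesgue. x \<in> S \<longrightarrow> R x)"
    by (rule AE_restrict_space_iff) (use S in simp)
  also have "\<dots> \<longleftrightarrow> negligible {x \<in> S. \<not> R x}"
  proof
    assume "AE x in lebesgue. x \<in> S \<longrightarrow> R x"
    then obtain N where "N \<in> null_sets lebesgue" "{x. \<not> (x \<in> S \<longrightarrow> R x)} \<subseteq> N"
      unfolding eventually_ae_filter by auto
    then show "negligible {x \<in> S. \<not> R x}"
      unfolding negligible_iff_null_sets[symmetric] by (auto elim: negligible_subset)
  next
    assume "negligible {x \<in> S. \<not> R x}"
    then show "AE x in lebesgue. x \<in> S \<longrightarrow> R x"
      unfolding eventually_ae_filter negligible_iff_null_sets by (intro bexI) auto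
  qed
  finally show ?thesis .
qed

text \<open>The exceptional set in S lies in the image under G of the exceptional set in T, and
  differentiable maps of a space to itself preserve null sets.\<close>

lemma AE_lebesgue_on_vimage:
  fixes F G :: "'a::euclidean_space \<Rightarrow> 'a"
  assumes S: "S \<in> sets lebesgue" "T \<in> sets lebesgue" and G: "G differentiable_on T"
    and FG: "\<And>x. x \<in> S \<Longrightarrow> F x \<in> T \<and> G (F x) = x" and ae: "AE y in lebesgue_on T. R y"
  shows "AE x in lebesgue_on S. R (F x)"
proof -
  have "negligible {y \<in> T. \<not> R y}" using ae AE_lebesgue_on_iff_negligible[OF S(2)] by blast
  then have "negligible (G ` {y \<in> T. \<not> R y})"
    by (rule negligible_differentiable_image_negligible[rotated])
      (use G in \<open>auto intro: differentiable_on_subset\<close>)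
  moreover have "{x \<in> S. \<not> R (F x)} \<subseteq> G ` {y \<in> T. \<not> R y}" using FG by force
  ultimately show ?thesis unfolding AE_lebesgue_on_iff_negligible[OF S(1)] by (rule negligible_subset)
qed

section \<open>Geometry of the coating\<close>

lemma continuous_on_cyl_radius: "continuous_on S cyl_radius"
  unfolding cyl_radius_def[abs_def] by (intro continuous_intros)

lemma cyl_radius_eq_0_iff: "cyl_radius x = 0 \<longleftrightarrow> x \<in> gamma1"
  by (auto simp: cyl_radius_def gamma1_def add_nonneg_eq_0_iff)

lemma mem_M1_gamma1: "x \<in> M1 - gamma1 \<longleftrightarrow> 0 < cyl_radius x \<and> cyl_radius x < 2"
  using cyl_radius_nonneg[of x] by (auto simp: M1_def cyl_radius_eq_0_iff[symmetric] less_le)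

lemma mem_N1: "x \<in> N1 \<longleftrightarrow> 1 < cyl_radius x \<and> cyl_radius x < 2"
  by (auto simp: N1_def M1_def)

lemma mem_outer_bdry: "x \<in> outer_bdry \<longleftrightarrow> cyl_radius x = 2"
  by (simp add: outer_bdry_def)

lemma open_M1: "open M1"
  unfolding M1_def by (intro open_Collect_less continuous_on_cyl_radius continuous_intros)

lemma closed_gamma1: "closed gamma1"
proof -
  have eq: "gamma1 = {x. cyl_radius x = 0}" using cyl_radius_eq_0_iff by blast
  show ?thesis unfolding eq by (intro closed_Collect_eq continuous_on_cyl_radius continuous_on_const)
qed

lemma open_punctured: "open (M1 - gamma1)"
  by (intro open_Diff open_M1 closed_gamma1)

lemma open_N1: "open N1"
proof -
  have eq: "N1 = {x. 1 < cyl_radius x} \<inter> {x. cyl_radius x < 2}" using mem_N1 by blast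
  show ?thesis
    unfolding eq by (intro open_Int open_Collect_less continuous_on_cyl_radius continuous_on_const)
qed

lemma negligible_gamma1: "negligible gamma1"
proof -
  have "negligible {x::real^3. axis 1 1 \<bullet> x = 0}"
    by (rule negligible_hyperplane) (simp add: axis_eq_0_iff)
  then show ?thesis by (rule negligible_subset) (auto simp: gamma1_def inner_axis')
qed

lemma cyl_radius_has_derivative:
  assumes "0 < cyl_radius x"
  shows "(cyl_radius has_derivative (\<lambda>h. (x$1 * h$1 + x$2 * h$2) / cyl_radius x)) (at x)"
proof -
  have n: "((\<lambda>y. y $ i) has_derivative (\<lambda>h. h $ i)) (at x)" for i :: 3
    by (rule bounded_linear_imp_has_derivative[OF bounded_linear_vec_nth])
  have q: "((\<lambda>y. (y$1)\<^sup>2 + (y$2)\<^sup>2) has_derivative (\<lambda>h. 2 * (x$1 * h$1 + x$2 * h$2))) (at x)"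
    by (auto intro!: derivative_eq_intros n simp: algebra_simps)
  have pos: "0 < (x$1)\<^sup>2 + (x$2)\<^sup>2" using assms by (simp add: cyl_radius_def)
  have half: "inverse S / 2 * (2 * D) = D / S" for S D :: real
    unfolding divide_inverse[of D S] by simp
  from has_derivative_compose[OF q DERIV_real_sqrt[OF pos, unfolded has_field_derivative_def]]
  show ?thesis
    unfolding cyl_radius_def[abs_def]
    by (rule has_derivative_eq_rhs) (rule ext, rule half)
qed

text \<open>A map that fixes the cylinder pointwise has a derivative that fixes its tangent vectors.
  The transposed Jacobian then preserves the tangential components of w, and these determine the
  cross product with the normal. This is why E and its transform share the boundary value f.\<close>

lemma tangential_fixed:
  fixes T :: "real^3 \<Rightarrow> real^3"
  assumes T: "Ck_on (Suc n) U T" "outer_bdry \<subseteq> U" and id: "\<And>y. y \<in> outer_bdry \<Longrightarrow> T y = y" and x: "x \<in> outer_bdry"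
  shows "cross_rc (nu x) (pull1 (jacobian T (at x)) w) = cross_rc (nu x) w"
proof -
  have xU: "x \<in> U" using T x by blast
  have fixes_tangent: "jacobian T (at x) *v v = v"
    if c: "(c has_vector_derivative v) (at (0::real))" "c 0 = x" "\<And>t. c t \<in> outer_bdry" for c v
  proof -
    have dT: "(T has_derivative frechet_derivative T (at x)) (at (c 0))"
      unfolding c(2) by (rule Ck_on_SucD[OF T(1) xU])
    have "((\<lambda>t. T (c t)) has_derivative (\<lambda>h. frechet_derivative T (at x) (h *\<^sub>R v))) (at 0)"
      by (rule has_derivative_compose[OF c(1)[unfolded has_vector_derivative_def] dT])
    then have "((\<lambda>t. T (c t)) has_vector_derivative frechet_derivative T (at x) v) (at 0)"
      using linear_cmul[OF has_derivative_linear[OF Ck_on_SucD[OF T(1) xU]]] by (simp add: has_vector_derivative_def)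
    moreover have "(\<lambda>t. T (c t)) = c" using id c(3) by auto
    ultimately have "(c has_vector_derivative frechet_derivative T (at x) v) (at 0)" by (simp only:)
    from vector_derivative_unique_at[OF this c(1)]
    have "frechet_derivative T (at x) v = v" .
    then show ?thesis by (simp add: frechet_derivative_jacobian[OF T(1) xU])
  qed
  have s: "(x$1)\<^sup>2 + (x$2)\<^sup>2 = 4"
  proof -
    have "(x$1)\<^sup>2 + (x$2)\<^sup>2 = (cyl_radius x)\<^sup>2" by (simp add: cyl_radius_def)
    then show ?thesis using x by (simp add: mem_outer_bdry)
  qed
  have 3: "jacobian T (at x) *v axis 3 1 = axis 3 1"
  proof (rule fixes_tangent[of "\<lambda>t. x + t *\<^sub>R axis 3 1"])
    show "((\<lambda>t. x + t *\<^sub>R axis 3 1) has_vector_derivative axis 3 1) (at 0)"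
      by (auto intro!: derivative_eq_intros)
    show "x + t *\<^sub>R axis 3 1 \<in> outer_bdry" for t
      using x by (simp add: mem_outer_bdry cyl_radius_def axis_def)
  qed simp
  have e: "jacobian T (at x) *v eta x = eta x"
  \<comment> \<open>The curve rotates x about the axis and so stays on the cylinder.\<close>
  proof (rule fixes_tangent[of "\<lambda>t. cos t *\<^sub>R vector [x$1, x$2, 0] + sin t *\<^sub>R eta x + vector [0, 0, x$3]"])
    show "((\<lambda>t. cos t *\<^sub>R vector [x$1, x$2, 0] + sin t *\<^sub>R eta x + vector [0, 0, x$3]) has_vector_derivative eta x) (at 0)"
      by (auto intro!: derivative_eq_intros)
    show "cos 0 *\<^sub>R vector [x$1, x$2, 0] + sin 0 *\<^sub>R eta x + vector [0, 0, x$3] = x"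
      by (simp add: vec_eq_iff forall_3)
    show "cos t *\<^sub>R vector [x$1, x$2, 0] + sin t *\<^sub>R eta x + vector [0, 0, x$3] \<in> outer_bdry" for t
    proof -
      have "(cos t * x$1 - sin t * x$2)\<^sup>2 + (cos t * x$2 + sin t * x$1)\<^sup>2 = ((sin t)\<^sup>2 + (cos t)\<^sup>2) * ((x$1)\<^sup>2 + (x$2)\<^sup>2)"
        by algebra
      also have "\<dots> = 4" by (simp add: s)
      finally show ?thesis by (simp add: mem_outer_bdry cyl_radius_def eta_def)
    qed
  qed
  let ?A = "jacobian T (at x)"
  have A3: "?A $ a $ 3 = (if a = 3 then 1 else 0)" for a
    using arg_cong[OF 3, of "\<lambda>v. v $ a"] by (simp add: matrix_vector_mult_def axis_def if_distrib cong: if_cong)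
  have Ae: "- (?A $ a $ 1 * x $ 2) + ?A $ a $ 2 * x $ 1 = eta x $ a" for a
    using arg_cong[OF e, of "\<lambda>v. v $ a"] by (simp add: matrix_vector_mult_def eta_def sum_3)
  have p3: "pull1 ?A w $ 3 = w $ 3" by (simp add: pull1_def A3 sum_3)
  have "of_real (x $ 1) * pull1 ?A w $ 2 - of_real (x $ 2) * pull1 ?A w $ 1
      = (\<Sum>a\<in>UNIV. of_real (- (?A $ a $ 1 * x $ 2) + ?A $ a $ 2 * x $ 1) * w $ a)"
    by (simp add: pull1_def sum_3 algebra_simps)
  also have "\<dots> = of_real (x $ 1) * w $ 2 - of_real (x $ 2) * w $ 1"
    unfolding Ae by (simp add: eta_def sum_3)
  finally have pe: "of_real (x $ 1) * pull1 ?A w $ 2 - of_real (x $ 2) * pull1 ?A w $ 1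
      = of_real (x $ 1) * w $ 2 - of_real (x $ 2) * w $ 1" .
  have r2: "cyl_radius x = 2" using x by (simp add: mem_outer_bdry)
  have cr: "cross_rc (nu x) v = vector [of_real (x $ 2) * v $ 3 / 2, - of_real (x $ 1) * v $ 3 / 2,
      (of_real (x $ 1) * v $ 2 - of_real (x $ 2) * v $ 1) / 2]" for v
    by (simp add: vec_eq_iff forall_3 cross_rc_def sum_3 levi_civita_def nu_def r2 diff_divide_distrib)
  show ?thesis unfolding cr p3 pe ..
qed

section \<open>The coating map: inverse, Jacobian and determinant\<close>

locale coating =
  fixes F1 :: "real \<Rightarrow> real" and F :: "real^3 \<Rightarrow> real^3"
  assumes single_coating: "single_coating F1 F"
begin

lemma F1_less: "0 < r \<Longrightarrow> r < t \<Longrightarrow> t \<le> 2 \<Longrightarrow> F1 r < F1 t"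
  using single_coating unfolding single_coating_def strict_mono_on_def by auto

lemma F1_2: "F1 2 = 2"
  using single_coating by (simp add: single_coating_def)

text \<open>The limit and monotonicity give only a weak inequality at r / 2; strict monotonicity
  from r / 2 to r makes it strict.\<close>

lemma F1_gt_1: 
  assumes "0 < r" "r \<le> 2"
  shows "1 < F1 r"
proof -
  have "(F1 \<longlongrightarrow> 1) (at_right 0)" using single_coating by (simp add: single_coating_def)
  moreover have "\<forall>\<^sub>F t in at_right 0. F1 t \<le> F1 (r / 2)"
    by (rule eventually_at_rightI[of 0 "r / 2"]) (use assms in \<open>auto intro!: less_imp_le F1_less\<close>)
  ultimately have "1 \<le> F1 (r / 2)" by (rule tendsto_upperbound) simp
  also have "\<dots> < F1 r" using assms by (intro F1_less) auto
  finally show ?thesis .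
qed

lemma F1_lt_2: "0 < r \<Longrightarrow> r < 2 \<Longrightarrow> F1 r < 2"
  using F1_less[of r 2] F1_2 by simp

lemma F_nth:
  assumes "x \<in> (M1 - gamma1) \<union> outer_bdry"
  shows "F x $ 1 = F1 (cyl_radius x) * (x $ 1 / cyl_radius x)"
    "F x $ 2 = F1 (cyl_radius x) * (x $ 2 / cyl_radius x)" "F x $ 3 = x $ 3"
  using assms single_coating by (simp_all add: single_coating_def radial_stretch_def Let_def)

lemma cyl_radius_F:
  assumes "x \<in> (M1 - gamma1) \<union> outer_bdry"
  shows "cyl_radius (F x) = F1 (cyl_radius x)"
proof -
  let ?s = "cyl_radius x"
  have s: "0 < ?s" "?s \<le> 2" using assms mem_M1_gamma1[of x] mem_outer_bdry[of x] by auto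
  have f: "F1 ?s > 0" using F1_gt_1[OF s] by simp
  have "(F x $ 1)\<^sup>2 + (F x $ 2)\<^sup>2 = (F1 ?s / ?s)\<^sup>2 * ((x$1)\<^sup>2 + (x$2)\<^sup>2)"
    unfolding F_nth[OF assms] by (simp add: power2_eq_square algebra_simps add_divide_distrib)
  then have "cyl_radius (F x) = (F1 ?s / ?s) * ?s"
    using f s by (simp add: cyl_radius_def[of "F x"] cyl_radius_def[of x, symmetric] real_sqrt_mult)
  then show ?thesis using s by simp
qed

lemma F_outer: "x \<in> outer_bdry \<Longrightarrow> F x = x"
  using F_nth[of x] F1_2 by (simp add: vec_eq_iff forall_3 mem_outer_bdry)

lemma bij_F: "bij_betw F ((M1 - gamma1) \<union> outer_bdry) (N1 \<union> outer_bdry)"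
  using single_coating by (simp add: single_coating_def diffeomorphism_on_def)

lemma F_in_N1: "x \<in> M1 - gamma1 \<Longrightarrow> F x \<in> N1"
  using cyl_radius_F[of x] F1_gt_1[of "cyl_radius x"] F1_lt_2[of "cyl_radius x"] mem_M1_gamma1[of x]
  by (simp add: mem_N1)

lemma inj_F: "inj_on F (M1 - gamma1)"
  using bij_F by (auto simp: bij_betw_def intro: inj_on_subset)

lemma F_image: "F ` (M1 - gamma1) = N1"
proof
  show "F ` (M1 - gamma1) \<subseteq> N1" using F_in_N1 by blast
  show "N1 \<subseteq> F ` (M1 - gamma1)"
  proof
    fix y assume y: "y \<in> N1"
    then obtain x where x: "x \<in> (M1 - gamma1) \<union> outer_bdry" "y = F x"
      using bij_F by (auto simp: bij_betw_def)
    have "x \<notin> outer_bdry"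
      using y x F_outer[of x] by (auto simp: mem_N1 mem_outer_bdry)
    then show "y \<in> F ` (M1 - gamma1)" using x by blast
  qed
qed

lemma F_inv_F: "x \<in> M1 - gamma1 \<Longrightarrow> F_inv F (F x) = x"
  unfolding F_inv_def by (rule inv_into_f_f[OF inj_F])

lemma F_F_inv: "y \<in> N1 \<Longrightarrow> F (F_inv F y) = y" "y \<in> N1 \<Longrightarrow> F_inv F y \<in> M1 - gamma1"
  unfolding F_inv_def by (rule f_inv_into_f, simp add: F_image) (rule inv_into_into, simp add: F_image)

text \<open>The values of F beyond the outer boundary are arbitrary, so derivatives at
  \<open>outer_bdry\<close> have to be taken of a smooth extension.\<close>

lemma F_ext:
  "\<exists>U Fe. open U \<and> (M1 - gamma1) \<union> outer_bdry \<subseteq> U \<and> (\<forall>n. Ck_on n U Fe) \<and>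
    (\<forall>x\<in>(M1 - gamma1) \<union> outer_bdry. Fe x = F x)"
  using single_coating unfolding single_coating_def diffeomorphism_on_def smooth_on_def by blast

text \<open>\<open>F_inv\<close> inverts F on the open punctured cylinder only. The smooth extension
  comes from the inverse on the larger set, which agrees with it on \<open>N1\<close> and is the
  identity on \<open>outer_bdry\<close>.\<close>

lemma F_inv_ext:
  "\<exists>U Ge. open U \<and> N1 \<union> outer_bdry \<subseteq> U \<and> (\<forall>n. Ck_on n U Ge) \<and>
    (\<forall>y\<in>N1. Ge y = F_inv F y) \<and> (\<forall>y\<in>outer_bdry. Ge y = y)"
proof -
  obtain U Ge where G: "open U" "N1 \<union> outer_bdry \<subseteq> U" "\<And>n. Ck_on n U Ge"
    "\<And>y. y \<in> N1 \<union> outer_bdry \<Longrightarrow> Ge y = inv_into ((M1 - gamma1) \<union> outer_bdry) F y"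
    using single_coating unfolding single_coating_def diffeomorphism_on_def smooth_on_def by blast
  have inj: "inj_on F ((M1 - gamma1) \<union> outer_bdry)" using bij_F by (simp add: bij_betw_def)
  have "Ge y = F_inv F y" if "y \<in> N1" for y
    using G(4)[of y] inv_into_f_f[OF inj, of "F_inv F y"] F_F_inv[OF that] that by simp
  moreover have "Ge y = y" if "y \<in> outer_bdry" for y
    using G(4)[of y] inv_into_f_f[OF inj, of y] F_outer[OF that] that by simp
  ultimately show ?thesis using G(1-3) by (intro exI[of _ U] exI[of _ Ge]) auto
qed

lemma Ck_on_F: "Ck_on n (M1 - gamma1) F"
proof -
  obtain U Fe where F: "open U" "(M1 - gamma1) \<union> outer_bdry \<subseteq> U" "\<forall>n. Ck_on n U Fe"
    "\<forall>x\<in>(M1 - gamma1) \<union> outer_bdry. Fe x = F x"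
    using F_ext by (elim exE conjE) (rule that)
  have "Ck_on n (M1 - gamma1) Fe" by (rule Ck_on_subset[OF F(3)[rule_format]]) (use F(2) in blast)
  then show ?thesis by (rule Ck_on_cong[OF open_punctured, rotated]) (use F(4) in blast)
qed

lemma Ck_on_F_inv: "Ck_on n N1 (F_inv F)"
proof -
  obtain U Ge where G: "open U" "N1 \<union> outer_bdry \<subseteq> U" "\<forall>n. Ck_on n U Ge"
    "\<forall>y\<in>N1. Ge y = F_inv F y" "\<forall>y\<in>outer_bdry. Ge y = y"
    using F_inv_ext by (elim exE conjE) (rule that)
  have "Ck_on n N1 Ge" by (rule Ck_on_subset[OF G(3)[rule_format]]) (use G(2) in blast)
  then show ?thesis by (rule Ck_on_cong[OF open_N1, rotated]) (use G(4) in blast)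
qed

lemma jacobian_inverse:
  assumes x: "x \<in> M1 - gamma1"
  shows "jacobian F (at x) ** jacobian (F_inv F) (at (F x)) = mat 1"
proof -
  have dG: "(F_inv F has_derivative frechet_derivative (F_inv F) (at (F x))) (at (F x))"
    by (rule Ck_on_SucD[OF Ck_on_F_inv F_in_N1[OF x]])
  have dF: "(F has_derivative frechet_derivative F (at x)) (at (F_inv F (F x)))"
    unfolding F_inv_F[OF x] by (rule Ck_on_SucD[OF Ck_on_F x])
  from has_derivative_compose[OF dG dF]
  have "((\<lambda>y. y) has_derivative (\<lambda>h. frechet_derivative F (at x) (frechet_derivative (F_inv F) (at (F x)) h))) (at (F x))"
    by (rule has_derivative_transform_within_open[OF _ open_N1 F_in_N1[OF x]]) (rule F_F_inv(1))
  then have eq: "(\<lambda>h. frechet_derivative F (at x) (frechet_derivative (F_inv F) (at (F x)) h)) = (\<lambda>h. h)"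
    using has_derivative_unique[OF _ has_derivative_ident] by blast
  have "jacobian F (at x) *v (jacobian (F_inv F) (at (F x)) *v h) = h" for h
    using fun_cong[OF eq, of h]
    by (simp add: frechet_derivative_jacobian[OF Ck_on_F x] frechet_derivative_jacobian[OF Ck_on_F_inv F_in_N1[OF x]])
  then show ?thesis by (simp add: matrix_eq matrix_vector_mul_assoc[symmetric])
qed

text \<open>Smoothness is known for F, and \<open>F1\<close> is read off from F along a horizontal
  ray. Monotonicity gives only a nonnegative derivative.\<close>

lemma F1_deriv:
  assumes r: "0 < r" "r < 2"
  shows "(F1 has_real_derivative deriv F1 r) (at r)" "0 \<le> deriv F1 r"
proof -
  let ?l = "\<lambda>t::real. t *\<^sub>R (axis 1 1 :: real^3)"
  have s: "cyl_radius (?l t) = t" if "t > 0" for t using that by (simp add: cyl_radius_def axis_def)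
  have l: "?l ` {0<..<2} \<subseteq> M1 - gamma1"
  proof (rule image_subsetI)
    fix t :: real assume "t \<in> {0<..<2}"
    then show "?l t \<in> M1 - gamma1" unfolding mem_M1_gamma1 using s[of t] by simp
  qed
  have "Ck_on (Suc 0) {0<..<2} (\<lambda>t. F (?l t) $ 1)"
    by (intro Ck_on_vec_nth open_greaterThanLessThan Ck_on_compose[OF _ open_punctured l _ Ck_on_F]
        Ck_on_bounded_linear bounded_linear_scaleR_left)
  then have "Ck_on (Suc 0) {0<..<2} F1"
  proof (rule Ck_on_cong[rotated 2])
    fix t :: real assume t: "t \<in> {0<..<2}"
    then have "?l t \<in> M1 - gamma1" using l by blast
    then show "F (?l t) $ 1 = F1 t" using F_nth(1)[of "?l t"] s[of t] t by (simp add: axis_def)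
  qed simp
  then have "F1 differentiable (at r)" using r by simp
  then show d: "(F1 has_real_derivative deriv F1 r) (at r)"
    by (simp add: DERIV_deriv_iff_real_differentiable)
  have "mono_on {0<..<2} F1"
    by (rule mono_onI) (metis F1_less greaterThanLessThan_iff less_eq_real_def order_refl)
  then show "0 \<le> deriv F1 r"
    by (rule mono_on_imp_deriv_nonneg[OF _ d]) (use r in simp)
qed

text \<open>With e the horizontal unit vector in radial direction, the horizontal block is F1' times
  the projection to e plus F1 / s times the complementary projection; the axial direction is left
  alone.\<close>

lemma jacobian_F:
  assumes x: "x \<in> M1 - gamma1"
  defines "s \<equiv> cyl_radius x"
  shows "\<And>i j. i \<in> {1,2} \<Longrightarrow> j \<in> {1,2} \<Longrightarrow> jacobian F (at x) $ i $ j
      = deriv F1 s * (x $ i * x $ j) / s\<^sup>2 + F1 s * ((if i = j then 1 else 0) / s - x $ i * x $ j / s ^ 3)"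
    "\<And>i. i \<in> {1,2} \<Longrightarrow> jacobian F (at x) $ i $ 3 = 0"
    "\<And>j. jacobian F (at x) $ 3 $ j = (if j = 3 then 1 else 0)"
proof -
  have s: "0 < s" "s < 2" using x mem_M1_gamma1 by (auto simp: s_def simp del: Diff_iff)
  let ?d = "\<lambda>h::real^3. (x$1 * h$1 + x$2 * h$2) / s"
  have dr: "(cyl_radius has_derivative ?d) (at x)"
    unfolding s_def by (rule cyl_radius_has_derivative) (use s in \<open>simp add: s_def\<close>)
  have dF1: "((\<lambda>y. F1 (cyl_radius y)) has_derivative (\<lambda>h. deriv F1 s * ?d h)) (at x)"
    using has_derivative_compose[OF dr F1_deriv(1)[OF s, unfolded has_field_derivative_def s_def]]
    unfolding s_def .
  have n: "((\<lambda>y. y $ i) has_derivative (\<lambda>h. h $ i)) (at x)" for i :: 3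
    by (rule bounded_linear_imp_has_derivative[OF bounded_linear_vec_nth])
  have dq: "((\<lambda>y. y $ i / cyl_radius y) has_derivative (\<lambda>h. (h $ i * s - x $ i * ?d h) / (s * s))) (at x)" for i
    using has_derivative_divide'[OF n dr, of i] s by (simp add: s_def[symmetric])
  have comp: "((\<lambda>y. F1 (cyl_radius y) * (y $ i / cyl_radius y)) has_derivative
      (\<lambda>h. F1 s * ((h $ i * s - x $ i * ?d h) / (s * s)) + deriv F1 s * ?d h * (x $ i / s))) (at x)" for i
    using has_derivative_mult[OF dF1 dq[of i]] by (simp add: s_def[symmetric])
  have pF: "jacobian F (at x) $ i $ j = partial j (\<lambda>y. F y $ i) x" for i j
    by (rule jacobian_nth_partial[OF Ck_on_F x])
  have p12: "partial j (\<lambda>y. F y $ i) x = F1 s * ((axis j 1 $ i * s - x $ i * ?d (axis j 1)) / (s * s)) + deriv F1 s * ?d (axis j 1) * (x $ i / s)"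
    if "i \<in> {1,2}" for i j
  proof -
    have "partial j (\<lambda>y. F y $ i) x = partial j (\<lambda>y. F1 (cyl_radius y) * (y $ i / cyl_radius y)) x"
      by (rule partial_cong[OF open_punctured x]) (use that F_nth in auto)
    then show ?thesis using partial_eqI[OF comp[of i]] by simp
  qed
  show "jacobian F (at x) $ i $ j
      = deriv F1 s * (x $ i * x $ j) / s\<^sup>2 + F1 s * ((if i = j then 1 else 0) / s - x $ i * x $ j / s ^ 3)"
    if "i \<in> {1,2}" "j \<in> {1,2}" for i j
    unfolding pF p12[OF that(1)] using that s by (auto simp: axis_def field_simps eval_nat_numeral)
  show "jacobian F (at x) $ i $ 3 = 0" if "i \<in> {1,2}" for i
    unfolding pF p12[OF that] using that by (auto simp: axis_def)
  have "partial j (\<lambda>y. F y $ 3) x = partial j (\<lambda>y. y $ 3) x" for j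
    by (rule partial_cong[OF open_punctured x]) (use F_nth in auto)
  then show "jacobian F (at x) $ 3 $ j = (if j = 3 then 1 else 0)" for j
    unfolding pF using partial_eqI[OF n[of 3], of j] by (simp add: axis_def)
qed

text \<open>The eigenvalues are F1' in radial, F1 / r in angular and 1 in axial direction.
  Monotonicity gives a nonnegative determinant, and invertibility makes it positive.\<close>

lemma det_jacobian_F:
  assumes x: "x \<in> M1 - gamma1"
  shows "det (jacobian F (at x)) = F1 (cyl_radius x) / cyl_radius x * deriv F1 (cyl_radius x)"
    "0 < det (jacobian F (at x))"
proof -
  let ?s = "cyl_radius x"
  have s: "0 < ?s" "?s < 2" using x mem_M1_gamma1 by (auto simp del: Diff_iff)
  define u where "u = F1 ?s / ?s"
  define v where "v = deriv F1 ?s / ?s\<^sup>2 - F1 ?s / ?s ^ 3"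
  have j: "jacobian F (at x) $ i $ j = (if i = j then u else 0) + v * (x $ i * x $ j)" if "i \<in> {1,2}" "j \<in> {1,2}" for i j
    unfolding jacobian_F(1)[OF x that] u_def v_def by (simp add: algebra_simps)
  have ss: "(x$1)\<^sup>2 + (x$2)\<^sup>2 = ?s\<^sup>2" by (simp add: cyl_radius_def)
  have "det (jacobian F (at x)) = u * (u + v * ((x$1)\<^sup>2 + (x$2)\<^sup>2))"
    by (simp add: det_3 j jacobian_F(2,3)[OF x] power2_eq_square algebra_simps)
  also have "u + v * ((x$1)\<^sup>2 + (x$2)\<^sup>2) = deriv F1 ?s"
    unfolding ss u_def v_def using s by (simp add: field_simps eval_nat_numeral)
  finally show d: "det (jacobian F (at x)) = F1 ?s / ?s * deriv F1 ?s" by (simp add: u_def)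
  have "0 \<le> det (jacobian F (at x))"
    unfolding d using F1_deriv(2)[OF s] F1_gt_1[of ?s] s by (intro mult_nonneg_nonneg) auto
  moreover have "det (jacobian F (at x)) \<noteq> 0"
    using arg_cong[OF jacobian_inverse[OF x], of det] by (auto simp: det_mul)
  ultimately show "0 < det (jacobian F (at x))" by simp
qed

text \<open>The angular stretch F1 / r is at most 2 / r. The radial stretch F1' may be unbounded at
  the axis, but F1 / r is at least 1/2, so F1' is at most twice the determinant. Both summands of
  the bound turn out to be integrable on bounded parts of the cylinder.\<close>

lemma jacobian_F_bound:
  assumes x: "x \<in> M1 - gamma1"
  shows "\<bar>jacobian F (at x) $ i $ j\<bar> \<le> 2 * det (jacobian F (at x)) + 4 / cyl_radius x"
    "\<bar>cofactor3 (jacobian F (at x)) $ i $ j\<bar> \<le> 2 * det (jacobian F (at x)) + 4 / cyl_radius x"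
proof -
  let ?s = "cyl_radius x" and ?A = "jacobian F (at x)"
  let ?M = "2 * det ?A + 4 / ?s"
  have s: "0 < ?s" "?s < 2" using x mem_M1_gamma1 by (auto simp del: Diff_iff)
  have f: "1 < F1 ?s" "F1 ?s < 2" using F1_gt_1[of ?s] F1_lt_2[of ?s] s by auto
  have d0: "0 \<le> deriv F1 ?s" by (rule F1_deriv(2)[OF s])
  have dle: "deriv F1 ?s \<le> 2 * det ?A"
  proof -
    have "deriv F1 ?s * 1 \<le> deriv F1 ?s * (2 * (F1 ?s / ?s))"
      using d0 f s by (intro mult_left_mono) (auto simp: field_simps)
    then show ?thesis by (simp add: det_jacobian_F(1)[OF x] mult_ac)
  qed
  have M1: "1 \<le> ?M"
  proof -
    have "1 \<le> 4 / ?s" using s by (simp add: field_simps)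
    then show ?thesis using det_jacobian_F(2)[OF x] by linarith
  qed
  have fs: "0 \<le> F1 ?s / ?s" "F1 ?s / ?s \<le> 2 / ?s" using f s by (auto simp: divide_right_mono)
  have arith: "a \<le> m + 2 * t" if "a \<le> z + f" "z \<le> \<bar>d - f\<bar>" "0 \<le> d" "d \<le> m" "0 \<le> f" "f \<le> t" for a z d f m t :: real
    using that by linarith
  have e12: "\<bar>?A $ i $ j\<bar> \<le> ?M" if ij: "i \<in> {1,2}" "j \<in> {1,2}" for i j
  proof -
    have xs: "\<bar>x $ i\<bar> \<le> ?s" "\<bar>x $ j\<bar> \<le> ?s" using ij abs_le_cyl_radius[of x] by auto
    then have "\<bar>x $ i * x $ j\<bar> \<le> ?s\<^sup>2" unfolding abs_mult power2_eq_square by (intro mult_mono) auto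
    then have q: "\<bar>x $ i * x $ j / ?s\<^sup>2\<bar> \<le> 1" using s by (simp add: abs_mult)
    have "?A $ i $ j = (deriv F1 ?s - F1 ?s / ?s) * (x $ i * x $ j / ?s\<^sup>2) + F1 ?s / ?s * (if i = j then 1 else 0)"
      unfolding jacobian_F(1)[OF x ij] using s by (simp add: field_simps eval_nat_numeral)
    then have "\<bar>?A $ i $ j\<bar> \<le> \<bar>(deriv F1 ?s - F1 ?s / ?s) * (x $ i * x $ j / ?s\<^sup>2)\<bar> + F1 ?s / ?s"
      using fs(1) by (auto intro: order_trans[OF abs_triangle_ineq])
    moreover have "\<bar>(deriv F1 ?s - F1 ?s / ?s) * (x $ i * x $ j / ?s\<^sup>2)\<bar> \<le> \<bar>deriv F1 ?s - F1 ?s / ?s\<bar> * 1"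
      unfolding abs_mult[of "deriv F1 ?s - F1 ?s / ?s"] by (intro mult_left_mono q) auto
    ultimately have "\<bar>?A $ i $ j\<bar> \<le> 2 * det ?A + 2 * (2 / ?s)"
      using d0 dle fs by (intro arith) simp_all
    then show ?thesis by simp
  qed
  have eall: "\<bar>?A $ i $ j\<bar> \<le> ?M" for i j
  proof (cases "i = 3 \<or> j = 3")
    case True
    then show ?thesis
      using jacobian_F(3)[OF x, of j] jacobian_F(2)[OF x, of i] exhaust_3[of i] M1 by auto
  next
    case False
    then show ?thesis using exhaust_3[of i] exhaust_3[of j] by (intro e12) auto
  qed
  then show "\<bar>?A $ i $ j\<bar> \<le> ?M" .
  \<comment> \<open>The third row and column of the Jacobian are those of the unit matrix, so its
    cofactors are, up to sign, entries of the block, the determinant of the block, or 0.\<close>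
  have d: "?A $ 1 $ 1 * ?A $ 2 $ 2 - ?A $ 1 $ 2 * ?A $ 2 $ 1 = det ?A"
    by (simp add: det_3 jacobian_F(2,3)[OF x])
  have dM: "\<bar>det ?A\<bar> \<le> ?M"
  proof -
    have "0 \<le> 4 / ?s" using s by simp
    then show ?thesis using det_jacobian_F(2)[OF x] by linarith
  qed
  show "\<bar>cofactor3 ?A $ i $ j\<bar> \<le> ?M"
    using exhaust_3[of i] exhaust_3[of j] eall d dM M1
    by (auto simp: cofactor3_def jacobian_F(2,3)[OF x])
qed

lemma pull1_F_3:
  assumes x: "x \<in> M1 - gamma1"
  shows "pull1 (jacobian F (at x)) h $ 3 = h $ 3"
  by (simp add: pull1_def sum_3 jacobian_F(2,3)[OF x])

text \<open>F commutes with rotations about the axis, so its derivative sends \<open>eta\<close> at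
  x to \<open>eta\<close> at F x. Hence a condition on \<open>eta\<close> at \<Sigma> becomes one on
  the angular component near the axis.\<close>

lemma eta_pull1_F:
  assumes x: "x \<in> M1 - gamma1"
  shows "cdot (cvec (eta x)) (pull1 (jacobian F (at x)) h) = cdot (cvec (eta (F x))) h"
proof -
  let ?A = "jacobian F (at x)" and ?s = "cyl_radius x"
  have s: "0 < ?s" using x mem_M1_gamma1 by (auto simp del: Diff_iff)
  have "- (?A $ a $ 1 * x $ 2) + ?A $ a $ 2 * x $ 1 = eta (F x) $ a" for a
    using exhaust_3[of a] s F_nth[of x] x
    by (auto simp: eta_def jacobian_F(2,3)[OF x] jacobian_F(1)[OF x] algebra_simps)
  then have e: "of_real (- (?A $ a $ 1 * x $ 2) + ?A $ a $ 2 * x $ 1) = complex_of_real (eta (F x) $ a)" for a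
    by (simp only:)
  have "cdot (cvec (eta x)) (pull1 ?A h) = (\<Sum>a\<in>UNIV. of_real (- (?A $ a $ 1 * x $ 2) + ?A $ a $ 2 * x $ 1) * h $ a)"
    by (simp add: cdot_def cvec_def eta_def pull1_def sum_3 algebra_simps)
  also have "\<dots> = cdot (cvec (eta (F x))) h" unfolding e by (simp add: cdot_def cvec_def)
  finally show ?thesis .
qed

lemma material_g_tilde:
  assumes x: "x \<in> M1 - gamma1"
  shows "material (g_tilde F) (F x) = (1 / det (jacobian F (at x))) *\<^sub>R (jacobian F (at x) ** transpose (jacobian F (at x)))"
  unfolding g_tilde_def
  by (rule material_pullback_flat[OF refl jacobian_inverse[OF x] det_jacobian_F(2)[OF x]])

lemma has_bochner_integral_N1_iff:
  fixes f :: "real^3 \<Rightarrow> complex"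
  shows "has_bochner_integral (lebesgue_on N1) f z \<longleftrightarrow>
    has_bochner_integral (lebesgue_on (M1 - gamma1)) (\<lambda>x. of_real (det (jacobian F (at x))) * f (F x)) z"
proof -
  have "has_bochner_integral (lebesgue_on N1) f z \<longleftrightarrow>
    has_bochner_integral (lebesgue_on (M1 - gamma1)) (\<lambda>x. \<bar>det (matrix (frechet_derivative F (at x)))\<bar> *\<^sub>R f (F x)) z"
    unfolding F_image[symmetric]
  proof (rule has_bochner_integral_change_of_variables)
    show "M1 - gamma1 \<in> sets lebesgue" by (rule lebesgue_openin[of UNIV, simplified]) (simp_all add: open_punctured)
    show "F ` (M1 - gamma1) \<in> sets lebesgue" unfolding F_image by (rule lebesgue_openin[of UNIV, simplified]) (simp_all add: open_N1)
    show "(F has_derivative frechet_derivative F (at x)) (at x within M1 - gamma1)" if "x \<in> M1 - gamma1" for x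
      by (rule has_derivative_at_withinI[OF Ck_on_SucD[OF Ck_on_F that]])
  qed (rule inj_F)
  also have "\<dots> \<longleftrightarrow> has_bochner_integral (lebesgue_on (M1 - gamma1)) (\<lambda>x. of_real (det (jacobian F (at x))) * f (F x)) z"
  proof (rule has_bochner_integral_cong[OF refl _ refl])
    fix x assume "x \<in> space (lebesgue_on (M1 - gamma1))"
    then have x: "x \<in> M1 - gamma1" by (simp add: space_restrict_space)
    show "\<bar>det (matrix (frechet_derivative F (at x)))\<bar> *\<^sub>R f (F x) = of_real (det (jacobian F (at x))) * f (F x)"
      using det_jacobian_F(2)[OF x] by (simp add: jacobian_def scaleR_conv_of_real)
  qed
  finally show ?thesis .
qed

end

section \<open>Integrals over measurable subsets\<close>

lemma has_bochner_integral_lebesgue_on_iff: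
  fixes h :: "'a::euclidean_space \<Rightarrow> 'b::euclidean_space"
  assumes A: "A \<in> sets lebesgue"
  shows "has_bochner_integral (lebesgue_on A) h w \<longleftrightarrow> h absolutely_integrable_on A \<and> integral A h = w"
proof -
  have "has_bochner_integral (lebesgue_on A) h w \<longleftrightarrow> has_bochner_integral lebesgue (\<lambda>x. indicator A x *\<^sub>R h x) w"
    by (rule has_bochner_integral_restrict_space) (use A in simp)
  also have "\<dots> \<longleftrightarrow> h absolutely_integrable_on A \<and> integral A h = w"
    using set_lebesgue_integral_eq_integral(2)[of A h]
    by (auto simp: has_bochner_integral_iff set_integrable_def set_lebesgue_integral_def)
  finally show ?thesis .
qed

lemma has_bochner_integral_lebesgue_on_cong_AE:
  fixes f g :: "'a::euclidean_space \<Rightarrow> 'b::euclidean_space"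
  assumes A: "A \<in> sets lebesgue" and ae: "AE x in lebesgue_on A. f x = g x"
  shows "has_bochner_integral (lebesgue_on A) f z \<longleftrightarrow> has_bochner_integral (lebesgue_on A) g z"
proof -
  let ?N = "{x \<in> A. f x \<noteq> g x}"
  have N: "negligible ?N" using ae AE_lebesgue_on_iff_negligible[OF A, of "\<lambda>x. f x = g x"] by blast
  have "f absolutely_integrable_on A \<longleftrightarrow> g absolutely_integrable_on A"
    by (rule absolutely_integrable_spike_eq[OF N]) auto
  moreover have "integral A f = integral A g"
    by (rule integral_spike[OF N]) auto
  ultimately show ?thesis unfolding has_bochner_integral_lebesgue_on_iff[OF A] by simp
qed

lemma has_bochner_integral_lebesgue_on_support:
  fixes f :: "'a::euclidean_space \<Rightarrow> 'b::euclidean_space"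
  assumes A: "A \<in> sets lebesgue" and f: "\<And>x. x \<notin> A \<Longrightarrow> f x = 0"
  shows "has_bochner_integral (lebesgue_on A) f z \<longleftrightarrow> has_bochner_integral lebesgue f z"
proof -
  have "(\<lambda>x. indicator A x *\<^sub>R f x) = f" using f by (auto simp: fun_eq_iff indicator_def)
  moreover have "has_bochner_integral (lebesgue_on A) f z \<longleftrightarrow> has_bochner_integral lebesgue (\<lambda>x. indicator A x *\<^sub>R f x) z"
    by (rule has_bochner_integral_restrict_space) (use A in simp)
  ultimately show ?thesis by simp
qed

lemma sets_lebesgue_open: "open S \<Longrightarrow> S \<in> sets lebesgue"
  by (intro sets_completionI_sets) simp

section \<open>Cutoffs near the axis\<close>

text \<open>A function of the squared radius, so no root disturbs smoothness at the axis. It rises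
  from 0 to 1 between the radii 1 / (n + 1) and sqrt 2 / (n + 1).\<close>

definition axis_cutoff :: "nat \<Rightarrow> real^3 \<Rightarrow> real" where
  "axis_cutoff n x = smooth_step ((real (Suc n))\<^sup>2 * ((x$1)\<^sup>2 + (x$2)\<^sup>2))"

lemma cyl_radius_sq: "(x$1)\<^sup>2 + (x$2)\<^sup>2 = (cyl_radius x)\<^sup>2"
  by (simp add: cyl_radius_def)

lemma Ck_on_axis_cutoff: "Ck_on m UNIV (axis_cutoff n)"
  unfolding axis_cutoff_def[abs_def] power2_eq_square
  by (rule Ck_on_compose[OF _ _ _ _ Ck_on_smooth_step])
    (rule open_UNIV subset_UNIV Ck_on_mult Ck_on_add Ck_on_const Ck_on_vec_nth Ck_on_id)+

lemma axis_cutoff_bounds: "0 \<le> axis_cutoff n x" "axis_cutoff n x \<le> 1"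
  by (simp_all add: axis_cutoff_def smooth_step_bounds)

lemma axis_cutoff_eq_0: "real (Suc n) * cyl_radius x \<le> 1 \<Longrightarrow> axis_cutoff n x = 0"
proof -
  assume "real (Suc n) * cyl_radius x \<le> 1"
  then have "(real (Suc n) * cyl_radius x)\<^sup>2 \<le> 1" by (intro power_le_one) auto
  then show ?thesis
    unfolding axis_cutoff_def cyl_radius_sq power_mult_distrib[symmetric] by (rule smooth_step_eq_0)
qed

lemma axis_cutoff_tendsto:
  assumes "0 < cyl_radius x"
  shows "(\<lambda>n. axis_cutoff n x) \<longlonglongrightarrow> 1"
proof -
  obtain N where N: "2 / cyl_radius x < real N" using reals_Archimedean2 by blast
  have "axis_cutoff n x = 1" if "n \<ge> N" for n
  proof -
    have "2 / cyl_radius x \<le> real (Suc n)" using N that by linarith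
    then have "2 \<le> real (Suc n) * cyl_radius x" using assms by (simp add: pos_divide_le_eq)
    then have "2\<^sup>2 \<le> (real (Suc n) * cyl_radius x)\<^sup>2" by (intro power_mono) auto
    then have "2 \<le> (real (Suc n) * cyl_radius x)\<^sup>2" by simp
    then show ?thesis
      unfolding axis_cutoff_def cyl_radius_sq power_mult_distrib[symmetric] by (rule smooth_step_eq_1)
  qed
  then have "\<forall>\<^sub>F n in sequentially. axis_cutoff n x = 1" unfolding eventually_sequentially by blast
  then show ?thesis by (rule tendsto_eventually)
qed

lemma partial_axis_cutoff:
  "partial j (axis_cutoff n) x
    = deriv smooth_step ((real (Suc n))\<^sup>2 * (cyl_radius x)\<^sup>2) * ((real (Suc n))\<^sup>2 * (2 * (if j = 3 then 0 else x $ j)))"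
proof -
  have n: "((\<lambda>y. y $ i) has_derivative (\<lambda>h. h $ i)) (at x)" for i :: 3
    by (rule bounded_linear_imp_has_derivative[OF bounded_linear_vec_nth])
  have q: "((\<lambda>y. (real (Suc n))\<^sup>2 * ((y$1)\<^sup>2 + (y$2)\<^sup>2)) has_derivative
      (\<lambda>h. (real (Suc n))\<^sup>2 * (2 * (x$1 * h$1 + x$2 * h$2)))) (at x)"
    by (auto intro!: derivative_eq_intros n simp: algebra_simps)
  have "(axis_cutoff n has_derivative (\<lambda>h. deriv smooth_step ((real (Suc n))\<^sup>2 * ((x$1)\<^sup>2 + (x$2)\<^sup>2))
      * ((real (Suc n))\<^sup>2 * (2 * (x$1 * h$1 + x$2 * h$2))))) (at x)"
    unfolding axis_cutoff_def[abs_def]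
    using has_derivative_compose[OF q smooth_step_deriv(1)[unfolded has_field_derivative_def]] .
  from partial_eqI[OF this, of j] show ?thesis
    unfolding cyl_radius_sq using exhaust_3[of j] by (auto simp: axis_def)
qed

lemma deriv_cutoff_eq_0:
  assumes "\<not> (1 \<le> real (Suc n) * cyl_radius x \<and> real (Suc n) * cyl_radius x \<le> 2)"
  shows "deriv smooth_step ((real (Suc n))\<^sup>2 * (cyl_radius x)\<^sup>2) = 0"
proof (rule smooth_step_deriv(3))
  let ?t = "real (Suc n) * cyl_radius x"
  have t0: "0 \<le> ?t" by simp
  have "?t\<^sup>2 \<le> 1 \<or> 2 \<le> ?t\<^sup>2"
  proof (cases "?t < 1")
    case True
    then have "?t\<^sup>2 \<le> 1" using t0 by (intro power_le_one) auto
    then show ?thesis ..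
  next
    case False
    then have "2 \<le> ?t" using assms by linarith
    then have "2\<^sup>2 \<le> ?t\<^sup>2" by (intro power_mono) auto
    then show ?thesis by simp
  qed
  then show "(real (Suc n))\<^sup>2 * (cyl_radius x)\<^sup>2 \<le> 1 \<or> 2 \<le> (real (Suc n))\<^sup>2 * (cyl_radius x)\<^sup>2"
    unfolding power_mult_distrib .
qed

text \<open>Contains the points at height at most L where the gradient of
  \<open>axis_cutoff n\<close> is nonzero.\<close>

definition tube :: "nat \<Rightarrow> real \<Rightarrow> (real^3) set" where
  "tube n L = {x. cyl_radius x \<le> 2 / real (Suc n) \<and> \<bar>x $ 3\<bar> \<le> L}"

lemma tube_measurable [measurable]: "tube n L \<in> sets borel"
  unfolding tube_def by measurable

text \<open>The tube lies in a box with two sides 4 / (n + 1) and height 2 L.\<close>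

lemma tube_measure:
  assumes "0 \<le> L"
  shows "integrable lborel (indicator (tube n L) :: real^3 \<Rightarrow> real)"
    "(\<integral>x. indicator (tube n L) x \<partial>lborel) \<le> 32 * L / (real (Suc n))\<^sup>2"
proof -
  let ?r = "2 / real (Suc n)"
  let ?C = "cbox (vector [- ?r, - ?r, - L]) (vector [?r, ?r, L]) :: (real^3) set"
  have sub: "tube n L \<subseteq> ?C"
  proof
    fix x assume "x \<in> tube n L"
    then have "cyl_radius x \<le> ?r" "\<bar>x $ 3\<bar> \<le> L" by (auto simp: tube_def)
    moreover then have "\<bar>x $ 1\<bar> \<le> ?r" "\<bar>x $ 2\<bar> \<le> ?r" using abs_le_cyl_radius[of x] by linarith+
    ultimately show "x \<in> ?C" by (auto simp: mem_box_cart forall_3 abs_le_iff)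
  qed
  have eC: "emeasure lborel ?C = ennreal (2 * ?r * (2 * ?r) * (2 * L))"
    using assms by (subst emeasure_lborel_cbox_cart) (simp_all add: forall_3 prod_UNIV_3)
  then have iC: "integrable lborel (indicator ?C :: real^3 \<Rightarrow> real)"
    by (intro integrable_real_indicator) auto
  have "(\<integral>x. indicator ?C x \<partial>lborel) = 2 * ?r * (2 * ?r) * (2 * L)"
    using eC assms by (simp add: measure_def)
  also have "\<dots> = 32 * L / (real (Suc n))\<^sup>2" by (simp add: power2_eq_square)
  finally have C: "(\<integral>x. indicator ?C x \<partial>lborel) = 32 * L / (real (Suc n))\<^sup>2" .
  have le: "indicator (tube n L) x \<le> (indicator ?C x :: real)" for x using sub by (auto simp: indicator_def)
  show i: "integrable lborel (indicator (tube n L) :: real^3 \<Rightarrow> real)"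
    by (rule Bochner_Integration.integrable_bound[OF iC]) (use sub in \<open>auto simp: indicator_def\<close>)
  show "(\<integral>x. indicator (tube n L) x \<partial>lborel) \<le> 32 * L / (real (Suc n))\<^sup>2"
    unfolding C[symmetric] by (rule integral_mono[OF i iC le])
qed

lemma tube_measure_lebesgue:
  assumes "0 \<le> L"
  shows "integrable lebesgue (indicator (tube n L) :: real^3 \<Rightarrow> real)"
    "(\<integral>x. indicator (tube n L) x \<partial>lebesgue) \<le> 32 * L / (real (Suc n))\<^sup>2"
proof -
  have m: "(indicator (tube n L) :: real^3 \<Rightarrow> real) \<in> borel_measurable lborel" by measurable
  show "integrable lebesgue (indicator (tube n L) :: real^3 \<Rightarrow> real)"
    using integrable_completion[OF m] tube_measure(1)[OF assms] by simp
  show "(\<integral>x. indicator (tube n L) x \<partial>lebesgue) \<le> 32 * L / (real (Suc n))\<^sup>2"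
    using integral_completion[OF m] tube_measure(2)[OF assms] by simp
qed

section \<open>The curl of a cut-off form\<close>

definition grad :: "(real^3 \<Rightarrow> real) \<Rightarrow> real^3 \<Rightarrow> real^3" where
  "grad \<psi> x = (\<chi> j. partial j \<psi> x)"

lemma curl_scale:
  assumes \<psi>: "Ck_on (Suc n) W \<psi>" and h: "Ck_on (Suc m) W h" and W: "open W" and x: "x \<in> W"
  shows "curl (\<lambda>x. \<psi> x *\<^sub>R h x) x = \<psi> x *\<^sub>R curl h x + cross_rc (grad \<psi> x) (h x)"
proof -
  have p: "partial p (\<lambda>y. (\<psi> y *\<^sub>R h y) $ q) x = of_real (\<psi> x) * partial p (\<lambda>y. h y $ q) x + of_real (partial p \<psi> x) * h x $ q" for p q
    using partial_mult[OF Ck_on_of_real[OF W \<psi>] Ck_on_vec_nth[OF W h] x, of p q] partial_of_real[OF \<psi> x, of p]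
    by (simp add: scaleR_conv_of_real[where 'a = complex])
  show ?thesis
    unfolding curl_def p by (simp add: vec_eq_iff cross_rc_def grad_def sum_3 algebra_simps scaleR_conv_of_real[where 'a = complex])
qed

lemma norm_cross_rc_le: "norm (cross_rc v w) \<le> 27 * norm v * norm w"
proof -
  have l: "norm (levi_civita a b c) \<le> 1" for a b c by (simp add: levi_civita_def)
  have "norm (cross_rc v w $ l) \<le> (\<Sum>p\<in>(UNIV::3 set). \<Sum>q\<in>(UNIV::3 set). norm v * norm w)" for l
    unfolding cross_rc_def vec_lambda_beta
  proof (intro sum_norm_le)
    fix p q :: 3
    have "norm (levi_civita l p q * of_real (v $ p) * w $ q) = norm (levi_civita l p q) * (\<bar>v $ p\<bar> * norm (w $ q))"
      by (simp add: norm_mult)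
    also have "\<dots> \<le> 1 * (norm v * norm w)"
      by (intro mult_mono l component_le_norm_cart Finite_Cartesian_Product.norm_nth_le) auto
    finally show "norm (levi_civita l p q * of_real (v $ p) * w $ q) \<le> norm v * norm w" by simp
  qed
  then have c: "norm (cross_rc v w $ l) \<le> 9 * (norm v * norm w)" for l by simp
  have "norm (cross_rc v w) \<le> (\<Sum>l\<in>UNIV. norm (cross_rc v w $ l))"
    unfolding norm_vec_def by (rule L2_set_le_sum) simp
  also have "\<dots> \<le> (\<Sum>l\<in>(UNIV::3 set). 9 * (norm v * norm w))" by (intro sum_mono c)
  also have "\<dots> = 27 * (norm v * norm w)" by simp
  finally show ?thesis by simp
qed

text \<open>Plays the part of the Cauchy-Schwarz inequality under the integral; the free weight t is
  sent to 0 at the end.\<close>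

lemma young_inequality:
  fixes t N y :: real
  assumes "0 < t" "0 \<le> N" "0 \<le> y"
  shows "N * y \<le> t * N\<^sup>2 + y\<^sup>2 / t"
proof -
  have "0 \<le> (t * N - y)\<^sup>2 / t" using assms by simp
  also have "(t * N - y)\<^sup>2 / t = t * N\<^sup>2 - 2 * (N * y) + y\<^sup>2 / t"
    using assms(1) by (simp add: power2_eq_square field_simps)
  finally have "2 * (N * y) \<le> t * N\<^sup>2 + y\<^sup>2 / t" by simp
  moreover have "0 \<le> N * y" using assms by simp
  ultimately show ?thesis by linarith
qed

section \<open>The axis is removable\<close>

text \<open>Cutting off a test form near the axis leaves the error \<open>?R n\<close>, bounded by a
  multiple of N |X| on a tube of volume of order 1 / N^2, where N = n + 1. Young's inequality splits
  N |X| into t N^2, whose integral is of order t uniformly in n, and |X|^2 / t, whose integral over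
  the shrinking tubes tends to 0.\<close>

lemma weak_curl_removable:
  assumes w: "weak_curl (M1 - gamma1) c X Y A"
    and X: "loc_integrable M1 X" and Y: "loc_integrable M1 Y" and A: "loc_integrable M1 A"
    and X2: "integrable lebesgue (\<lambda>x. indicator M1 x * (norm (X x))\<^sup>2)"
  shows "weak_curl M1 c X Y A"
  unfolding weak_curl_def
proof (intro allI impI)
  fix h :: form assume h: "test_on M1 h"
  obtain K where K: "compact K" "K \<subseteq> M1" "\<And>x. x \<notin> K \<Longrightarrow> h x = 0"
    using h unfolding test_on_def by blast
  obtain L where L: "L > 0" "\<And>x. x \<in> K \<Longrightarrow> norm x \<le> L"
    using compact_imp_bounded[OF K(1)] unfolding bounded_pos by blast
  let ?I = "\<lambda>x. cdot (curl h x) (X x) - c * cdot (h x) (Y x) - cdot (h x) (A x)"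
  let ?R = "\<lambda>n x. cdot (cross_rc (grad (axis_cutoff n) x) (h x)) (X x)"
  let ?N = "\<lambda>n. real (Suc n)"
  have ch: "continuous_on UNIV h" by (rule Ck_on_imp_continuous[OF test_on_Ck[OF h]])
  have cch: "continuous_on UNIV (curl h)" by (rule Ck_on_imp_continuous[OF test_on_Ck[OF test_on_curl[OF h]]])
  have curl0: "curl h x = 0" if "x \<notin> K" for x
  proof -
    have "open (- K)" "x \<in> - K" using K(1) that compact_imp_closed by auto
    then have "partial p (\<lambda>y. h y $ q) x = 0" for p q
      unfolding partial_def by (rule frechet_derivative_eq_0_open) (simp add: K(3))
    then show ?thesis by (simp add: curl_def vec_eq_iff)
  qed
  have iI: "integrable lebesgue ?I"
    by (intro Bochner_Integration.integrable_diff integrable_mult_right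
        integrable_test_bilinear[OF bounded_bilinear_cdot cch K(1,2) curl0 X]
        integrable_test_bilinear[OF bounded_bilinear_cdot ch K Y] integrable_test_bilinear[OF bounded_bilinear_cdot ch K A])
  have tn: "has_bochner_integral lebesgue (\<lambda>x. of_real (axis_cutoff n x) * ?I x + ?R n x) 0" for n
  proof -
    let ?h = "\<lambda>x. axis_cutoff n x *\<^sub>R h x"
    \<comment> \<open>The cutoff vanishes at radii up to 1 / (n + 1), so the remaining support keeps
      off the axis.\<close>
    let ?K = "K \<inter> {x. 1 \<le> ?N n * cyl_radius x}"
    have "compact ?K"
      by (intro compact_Int_closed K closed_Collect_le continuous_intros continuous_on_cyl_radius)
    moreover have "?K \<subseteq> M1 - gamma1" using K(2) cyl_radius_eq_0_iff by force
    moreover have "?h x = 0" if "x \<notin> ?K" for x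
      using that K(3)[of x] axis_cutoff_eq_0[of n x] by auto
    moreover have "Ck_on m UNIV ?h" for m
      by (intro Ck_on_scaleR open_UNIV Ck_on_axis_cutoff test_on_Ck[OF h])
    ultimately have "test_on (M1 - gamma1) ?h" unfolding test_on_def by blast
    then have "has_bochner_integral lebesgue (\<lambda>x. cdot (curl ?h x) (X x) - c * cdot (?h x) (Y x) - cdot (?h x) (A x)) 0"
      using w unfolding weak_curl_def by blast
    moreover have "cdot (curl ?h x) (X x) - c * cdot (?h x) (Y x) - cdot (?h x) (A x)
        = of_real (axis_cutoff n x) * ?I x + ?R n x" for x
      unfolding curl_scale[OF Ck_on_axis_cutoff test_on_Ck[OF h] open_UNIV UNIV_I]
      by (simp add: bounded_bilinear.add_left[OF bounded_bilinear_cdot]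
          bounded_bilinear.scaleR_left[OF bounded_bilinear_cdot] scaleR_conv_of_real[where 'a = complex] algebra_simps)
    ultimately show ?thesis by simp
  qed
  have mcut: "axis_cutoff n \<in> borel_measurable lebesgue" for n
  proof -
    have "axis_cutoff n \<in> borel_measurable lborel"
      using borel_measurable_continuous_onI[OF Ck_on_imp_continuous[OF Ck_on_axis_cutoff]] by simp
    then show ?thesis by (rule measurable_completion)
  qed
  have mcI: "(\<lambda>x. of_real (axis_cutoff n x) * ?I x) \<in> borel_measurable lebesgue" for n
    using borel_measurable_integrable[OF iI] mcut[of n] by measurable
  have bcI: "norm (of_real (axis_cutoff n x) * ?I x) \<le> norm (?I x)" for n x
    using axis_cutoff_bounds[of n x] by (simp add: norm_mult mult_left_le_one_le)
  have icI: "integrable lebesgue (\<lambda>x. of_real (axis_cutoff n x) * ?I x)" for n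
    by (rule Bochner_Integration.integrable_bound[OF iI mcI]) (simp add: bcI)
  have g0: "AE x in lebesgue. x \<notin> gamma1"
    using negligible_gamma1 by (intro AE_not_in) (simp add: negligible_iff_null_sets)
  have lim: "(\<lambda>n. \<integral>x. of_real (axis_cutoff n x) * ?I x \<partial>lebesgue) \<longlonglongrightarrow> (\<integral>x. ?I x \<partial>lebesgue)"
  proof (rule integral_dominated_convergence[OF borel_measurable_integrable[OF iI] mcI integrable_norm[OF iI] _ AE_I2[OF bcI]])
    show "AE x in lebesgue. (\<lambda>n. of_real (axis_cutoff n x) * ?I x) \<longlonglongrightarrow> ?I x"
      using g0
    proof eventually_elim
      case (elim x)
      then have "0 < cyl_radius x" using cyl_radius_eq_0_iff[of x] cyl_radius_nonneg[of x] by linarith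
      then have "(\<lambda>n. of_real (axis_cutoff n x) * ?I x) \<longlonglongrightarrow> of_real 1 * ?I x"
        by (intro tendsto_mult tendsto_of_real axis_cutoff_tendsto tendsto_const)
      then show ?case by simp
    qed
  qed
  \<comment> \<open>The error is integrable as the difference of the tested weak equation and the
    integrable cut-off integrand.\<close>
  have iR: "integrable lebesgue (?R n)" and R: "(\<integral>x. of_real (axis_cutoff n x) * ?I x \<partial>lebesgue) = - (\<integral>x. ?R n x \<partial>lebesgue)" for n
  proof -
    have "has_bochner_integral lebesgue (\<lambda>x. (of_real (axis_cutoff n x) * ?I x + ?R n x) - of_real (axis_cutoff n x) * ?I x)
        (0 - (\<integral>x. of_real (axis_cutoff n x) * ?I x \<partial>lebesgue))"
      by (intro has_bochner_integral_diff tn has_bochner_integral_integrable icI)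
    then have "has_bochner_integral lebesgue (?R n) (- (\<integral>x. of_real (axis_cutoff n x) * ?I x \<partial>lebesgue))" by simp
    then show "integrable lebesgue (?R n)" "(\<integral>x. of_real (axis_cutoff n x) * ?I x \<partial>lebesgue) = - (\<integral>x. ?R n x \<partial>lebesgue)"
      by (auto simp: has_bochner_integral_iff)
  qed
  obtain Ch where Ch: "Ch > 0" "\<And>x. norm (h x) \<le> Ch" using bounded_compact_support[OF ch K(1,3)] by blast
  obtain Cs where Cs: "Cs > 0" "\<And>t. \<bar>deriv smooth_step t\<bar> \<le> Cs" using smooth_step_deriv(4) by blast
  obtain M where M: "M > 0" "\<And>a b. norm (cdot a b) \<le> norm a * norm b * M"
    using bounded_bilinear.pos_bounded[OF bounded_bilinear_cdot] by blast
  \<comment> \<open>M bounds \<open>cdot\<close>, 27 comes from the cross product, Ch bounds h, and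
    12 Cs (n + 1) bounds the gradient by the sum of its three components.\<close>
  define B where "B = M * (27 * (12 * Cs) * Ch)"
  have B: "B > 0" using M Cs Ch by (simp add: B_def)
  have Rb: "norm (?R n x) \<le> B * (indicator (tube n L) x * (?N n * norm (X x)))" for n x
  proof (cases "x \<in> K \<and> 1 \<le> ?N n * cyl_radius x \<and> ?N n * cyl_radius x \<le> 2")
    case False
    have "?R n x = 0"
    proof (cases "x \<in> K")
      case True
      then have "deriv smooth_step ((?N n)\<^sup>2 * (cyl_radius x)\<^sup>2) = 0" using False by (intro deriv_cutoff_eq_0) blast
      then have "grad (axis_cutoff n) x = 0" by (simp add: grad_def vec_eq_iff partial_axis_cutoff)
      then show ?thesis by (simp add: cross_rc_def cdot_def)
    qed (simp add: K(3) cross_rc_def cdot_def)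
    then show ?thesis using B by simp
  next
    case True
    then have s: "cyl_radius x \<le> 2 / ?N n" by (simp add: field_simps)
    have "\<bar>x $ 3\<bar> \<le> L" using L(2)[of x] True component_le_norm_cart[of x 3] by linarith
    then have tube: "x \<in> tube n L" using s by (simp add: tube_def)
    \<comment> \<open>The derivative of the cutoff carries the factor N^2, and on the tube the
      coordinate x $ j is at most 2 / N; one power of N survives.\<close>
    have gj: "\<bar>partial j (axis_cutoff n) x\<bar> \<le> 4 * Cs * ?N n" for j
    proof -
      have "\<bar>if j = 3 then 0 else x $ j\<bar> \<le> cyl_radius x"
        using exhaust_3[of j] abs_le_cyl_radius[of x] by auto
      then have xj: "\<bar>if j = 3 then 0 else x $ j\<bar> \<le> 2 / ?N n" using s by linarith
      have "\<bar>partial j (axis_cutoff n) x\<bar>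
          = \<bar>deriv smooth_step ((?N n)\<^sup>2 * (cyl_radius x)\<^sup>2)\<bar> * ((?N n)\<^sup>2 * (2 * \<bar>if j = 3 then 0 else x $ j\<bar>))"
        unfolding partial_axis_cutoff by (simp add: abs_mult)
      also have "\<dots> \<le> Cs * ((?N n)\<^sup>2 * (2 * (2 / ?N n)))"
        using Cs xj by (intro mult_mono mult_nonneg_nonneg) auto
      also have "\<dots> = 4 * Cs * ?N n" by (simp add: power2_eq_square)
      finally show ?thesis .
    qed
    have "norm (grad (axis_cutoff n) x) \<le> (\<Sum>j\<in>UNIV. \<bar>grad (axis_cutoff n) x $ j\<bar>)" by (rule norm_le_l1_cart)
    also have "\<dots> \<le> (\<Sum>j\<in>(UNIV::3 set). 4 * Cs * ?N n)" 
      unfolding grad_def vec_lambda_beta by (intro sum_mono gj)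
    finally have g: "norm (grad (axis_cutoff n) x) \<le> 12 * Cs * ?N n" by simp
    have "norm (?R n x) \<le> norm (cross_rc (grad (axis_cutoff n) x) (h x)) * norm (X x) * M" by (rule M)
    also have "\<dots> \<le> (27 * (12 * Cs * ?N n) * Ch) * norm (X x) * M"
      using M by (intro mult_right_mono order_trans[OF norm_cross_rc_le] mult_mono g Ch) (use Cs in auto)
    finally show ?thesis using tube by (simp add: B_def mult_ac)
  qed
  let ?b = "\<lambda>n. \<integral>x. indicator (tube n L) x * (indicator M1 x * (norm (X x))\<^sup>2) \<partial>lebesgue"
  have tm: "(\<lambda>x. indicator (tube n L) x * (indicator M1 x * (norm (X x))\<^sup>2)) \<in> borel_measurable lebesgue" for n
  proof -
    have "(indicator (tube n L) :: real^3 \<Rightarrow> real) \<in> borel_measurable lborel" by measurable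
    then have "(indicator (tube n L) :: real^3 \<Rightarrow> real) \<in> borel_measurable lebesgue" by (rule measurable_completion)
    then show ?thesis using borel_measurable_integrable[OF X2] by measurable
  qed
  have tb: "norm (indicator (tube n L) x * (indicator M1 x * (norm (X x))\<^sup>2)) \<le> indicator M1 x * (norm (X x))\<^sup>2" for n x
    by (auto simp: indicator_def)
  have ib: "integrable lebesgue (\<lambda>x. indicator (tube n L) x * (indicator M1 x * (norm (X x))\<^sup>2))" for n
    by (rule Bochner_Integration.integrable_bound[OF X2 tm]) (use tb in \<open>simp add: indicator_def\<close>)
  have b0: "?b \<longlonglongrightarrow> 0"
  proof -
    have "?b \<longlonglongrightarrow> (\<integral>x. 0 \<partial>(lebesgue :: (real^3) measure))"
    proof (rule integral_dominated_convergence[OF _ tm X2 _ AE_I2[OF tb]])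
      show "AE x in lebesgue. (\<lambda>n. indicator (tube n L) x * (indicator M1 x * (norm (X x))\<^sup>2)) \<longlonglongrightarrow> 0"
        using g0
      proof eventually_elim
        case (elim x)
        then have s: "0 < cyl_radius x" using cyl_radius_eq_0_iff[of x] cyl_radius_nonneg[of x] by linarith
        obtain N where N: "2 / cyl_radius x < real N" using reals_Archimedean2 by blast
        have "indicator (tube n L) x = (0::real)" if "n \<ge> N" for n
        proof -
          have "2 / cyl_radius x < ?N n" using N that by linarith
          then have "2 / ?N n < cyl_radius x" using s by (simp add: field_simps)
          then show ?thesis by (simp add: tube_def)
        qed
        then have "\<forall>\<^sub>F n in sequentially. indicator (tube n L) x * (indicator M1 x * (norm (X x))\<^sup>2) = 0"
          unfolding eventually_sequentially by (metis mult_zero_left)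
        then show ?case by (rule tendsto_eventually)
      qed
    qed simp
    then show ?thesis by simp
  qed
  \<comment> \<open>First n tends to infinity for fixed t, which removes the energy term; t remains
    free.\<close>
  have bound: "norm (\<integral>x. ?I x \<partial>lebesgue) \<le> 32 * B * L * t" if t: "t > 0" for t
  proof -
    have each: "norm (\<integral>x. of_real (axis_cutoff n x) * ?I x \<partial>lebesgue) \<le> 32 * B * L * t + (B / t) * ?b n" for n
    proof -
      let ?w = "\<lambda>x. B * t * (?N n)\<^sup>2 * indicator (tube n L) x + (B / t) * (indicator (tube n L) x * (indicator M1 x * (norm (X x))\<^sup>2))"
      have iw: "integrable lebesgue ?w"
        by (intro Bochner_Integration.integrable_add integrable_mult_right ib tube_measure_lebesgue(1)) (use L in simp)
      have Rw: "norm (?R n x) \<le> ?w x" for x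
      proof (cases "x \<in> M1")
        case True
        let ?y = "norm (X x)" and ?N' = "?N n"
        have "?N' * ?y \<le> t * ?N'\<^sup>2 + ?y\<^sup>2 / t" by (rule young_inequality[OF t]) auto
        then have "B * (indicator (tube n L) x * (?N' * ?y)) \<le> B * (indicator (tube n L) x * (t * ?N'\<^sup>2 + ?y\<^sup>2 / t))"
          using B by (intro mult_left_mono) auto
        also have "\<dots> = ?w x" using True by (simp add: algebra_simps)
        finally show ?thesis using Rb[of n x] by linarith
      next
        case False
        then have "h x = 0" using K by blast
        then have "?R n x = 0" by (simp add: cross_rc_def cdot_def)
        then show ?thesis using B t by simp
      qed
      have "norm (\<integral>x. of_real (axis_cutoff n x) * ?I x \<partial>lebesgue) \<le> (\<integral>x. norm (?R n x) \<partial>lebesgue)"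
        unfolding R norm_minus_cancel by (rule integral_norm_bound)
      also have "\<dots> \<le> integral\<^sup>L lebesgue ?w"
        by (rule integral_mono[OF integrable_norm[OF iR] iw Rw])
      also have "\<dots> = B * t * (?N n)\<^sup>2 * (\<integral>x. indicator (tube n L) x \<partial>lebesgue) + (B / t) * ?b n"
        using ib[of n] tube_measure_lebesgue(1)[of L n] L by simp
      also have "B * t * (?N n)\<^sup>2 * (\<integral>x. indicator (tube n L) x \<partial>lebesgue) \<le> B * t * (?N n)\<^sup>2 * (32 * L / (?N n)\<^sup>2)"
        using B t L by (intro mult_left_mono tube_measure_lebesgue(2)) auto
      also have "\<dots> = 32 * B * L * t" by (simp del: of_nat_Suc)
      finally show ?thesis by simp
    qed
    have "(\<lambda>n. 32 * B * L * t + (B / t) * ?b n) \<longlonglongrightarrow> 32 * B * L * t + (B / t) * 0"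
      by (intro tendsto_intros b0)
    then show ?thesis
      using LIMSEQ_le[OF tendsto_norm[OF lim]] each by auto
  qed
  have "norm (\<integral>x. ?I x \<partial>lebesgue) \<le> 0 + e" if "e > 0" for e
  proof -
    have p: "32 * B * L > 0" using B L by simp
    have "norm (\<integral>x. ?I x \<partial>lebesgue) \<le> 32 * B * L * (e / (32 * B * L))"
      by (rule bound) (use p that in simp)
    also have "\<dots> = e" using B L by simp
    finally show ?thesis by simp
  qed
  then have "norm (\<integral>x. ?I x \<partial>lebesgue) \<le> 0" by (rule field_le_epsilon)
  then show "has_bochner_integral lebesgue ?I 0" using iI by (simp add: has_bochner_integral_iff)
qed

section \<open>Transfer of the weak formulation\<close>

lemma Ck_on_curl:
  assumes "Ck_on (Suc n) U h" "open U"
  shows "Ck_on n U (curl h)"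
proof (rule Ck_on_vec[OF assms(2)])
  show "Ck_on n U (\<lambda>x. curl h x $ l)" for l
    unfolding curl_def vec_lambda_beta
    by (intro Ck_on_sum Ck_on_mult Ck_on_const Ck_on_partial Ck_on_vec_nth assms)
qed

lemma continuous_on_cdot:
  "continuous_on S f \<Longrightarrow> continuous_on S g \<Longrightarrow> continuous_on S (\<lambda>x. cdot (f x) (g x))"
  by (rule bounded_bilinear.continuous_on[OF bounded_bilinear_cdot])

lemma curl_eq_0_open:
  assumes "open U" "x \<in> U" "\<And>y. y \<in> U \<Longrightarrow> h y = 0"
  shows "curl h x = 0"
proof -
  have "partial p (\<lambda>y. h y $ q) x = 0" for p q
    unfolding partial_def by (rule frechet_derivative_eq_0_open[OF assms(1,2)]) (simp add: assms(3))
  then show ?thesis by (simp add: curl_def vec_eq_iff)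
qed

lemma curl_cong:
  assumes "open U" "x \<in> U" "\<And>y. y \<in> U \<Longrightarrow> h y = g y"
  shows "curl h x = curl g x"
proof -
  have "partial p (\<lambda>y. h y $ q) x = partial p (\<lambda>y. g y $ q) x" for p q
    by (rule partial_cong[OF assms(1,2)]) (simp add: assms(3))
  then show ?thesis by (simp add: curl_def)
qed

lemma continuous_on_compact_norm_bound:
  fixes f :: "'a::topological_space \<Rightarrow> 'b::real_normed_vector"
  assumes "compact S" "continuous_on S f"
  shows "\<exists>C. \<forall>x\<in>S. norm (f x) \<le> C"
proof -
  have "bounded (f ` S)" using assms by (intro compact_imp_bounded compact_continuous_image)
  then obtain C where "\<forall>y\<in>f ` S. norm y \<le> C" unfolding bounded_iff by blast
  then show ?thesis by (intro exI[of _ C]) simp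
qed

lemma norm_le_sum_nth: "norm (v :: complex^3) \<le> (\<Sum>j\<in>UNIV. norm (v $ j))"
  unfolding norm_vec_def by (rule L2_set_le_sum) simp

lemma norm_linear_form_le:
  fixes A :: "real^3^3"
  assumes "\<And>i j. \<bar>A $ i $ j\<bar> \<le> m"
  shows "norm (\<chi> l. \<Sum>c\<in>UNIV. of_real (A $ c $ l) * (w :: complex^3) $ c) \<le> 9 * m * norm w"
proof -
  have "norm (\<Sum>c\<in>UNIV. of_real (A $ c $ l) * w $ c) \<le> (\<Sum>c\<in>(UNIV::3 set). m * norm w)" for l
    by (intro sum_norm_le)
      (simp add: norm_mult mult_mono assms Finite_Cartesian_Product.norm_nth_le order_trans[OF abs_ge_zero assms])
  then have l: "norm (\<Sum>c\<in>UNIV. of_real (A $ c $ l) * w $ c) \<le> 3 * (m * norm w)" for l by simp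
  have "norm (\<chi> l. \<Sum>c\<in>UNIV. of_real (A $ c $ l) * w $ c) \<le> (\<Sum>l\<in>(UNIV::3 set). 3 * (m * norm w))"
    by (rule order_trans[OF norm_le_sum_nth]) (intro sum_mono, simp add: l)
  then show ?thesis by simp
qed

lemma integrable_lebesgue_on_subset:
  fixes f :: "'a::euclidean_space \<Rightarrow> 'b::{banach, second_countable_topology}"
  assumes "integrable lebesgue f" "S \<in> sets lebesgue"
  shows "integrable (lebesgue_on S) f"
  using integrable_mult_indicator[OF assms(2,1)] assms(2) by (simp add: integrable_restrict_space)

lemma bounded_linear_cvec_eta: "bounded_linear (\<lambda>y. cvec (eta y))"
proof -
  have "linear (\<lambda>y. cvec (eta y))"
    by (rule linearI) (simp_all add: cvec_def eta_def vec_eq_iff forall_3 scaleR_conv_of_real[where 'a = complex])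
  then show ?thesis by (simp add: linear_conv_bounded_linear)
qed

context coating
begin

lemma punctured_sets: "M1 - gamma1 \<in> sets lebesgue"
  by (rule sets_lebesgue_open[OF open_punctured])

text \<open>Each of the three pairings is a 2-form against a 1-form, so it pulls back with the
  determinant, which is the factor in the change of variables. The material disappears because the
  Hodge star commutes with the pull-back.\<close>

lemma weak_transfer:
  fixes Xt Yt At X Y A h :: form
  assumes h: "Ck_on 1 N1 h"
    and X: "AE x in lebesgue_on (M1 - gamma1). X x = pullback1 F Xt x"
    and Y: "AE x in lebesgue_on (M1 - gamma1). Y x = pullback1 F Yt x"
    and A: "\<And>x. x \<in> M1 - gamma1 \<Longrightarrow> A x = pull2 (jacobian F (at x)) (At (F x))"
  shows "has_bochner_integral (lebesgue_on N1)
      (\<lambda>y. cdot (curl h y) (Xt y) - c * cdot (h y) (apply_material (material (g_tilde F)) Yt y) - cdot (h y) (At y)) z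
    \<longleftrightarrow> has_bochner_integral (lebesgue_on (M1 - gamma1))
      (\<lambda>x. cdot (curl (pullback1 F h) x) (X x) - c * cdot (pullback1 F h x) (Y x) - cdot (pullback1 F h x) (A x)) z"
  unfolding has_bochner_integral_N1_iff
proof (rule has_bochner_integral_lebesgue_on_cong_AE[OF punctured_sets])
  have "AE x in lebesgue_on (M1 - gamma1). x \<in> M1 - gamma1"
    by (rule AE_I2) (simp add: space_restrict_space)
  then show "AE x in lebesgue_on (M1 - gamma1). of_real (det (jacobian F (at x))) * (cdot (curl h (F x)) (Xt (F x))
      - c * cdot (h (F x)) (apply_material (material (g_tilde F)) Yt (F x)) - cdot (h (F x)) (At (F x)))
    = cdot (curl (pullback1 F h) x) (X x) - c * cdot (pullback1 F h x) (Y x) - cdot (pullback1 F h x) (A x)"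
    using X Y
  proof eventually_elim
    case (elim x)
    let ?A = "jacobian F (at x)"
    have d: "det ?A \<noteq> 0" using det_jacobian_F(2)[OF elim(1)] by simp
    have c: "curl (pullback1 F h) x = pull2 ?A (curl h (F x))"
      by (rule curl_pullback1[OF open_punctured open_N1 _ Ck_on_F h elim(1)]) (simp add: F_image)
    have m: "pull2 ?A (apply_material (material (g_tilde F)) Yt (F x)) = pull1 ?A (Yt (F x))"
      by (rule apply_material_pull[of "material (g_tilde F)", OF material_g_tilde[OF elim(1)] d])
    have 1: "cdot (curl (pullback1 F h) x) (X x) = of_real (det ?A) * cdot (curl h (F x)) (Xt (F x))"
      unfolding c elim(2) pullback1_eq by (rule cdot_pull2_pull1)
    have 2: "cdot (pullback1 F h x) (Y x)
        = of_real (det ?A) * cdot (h (F x)) (apply_material (material (g_tilde F)) Yt (F x))"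
      unfolding elim(3) pullback1_eq m[symmetric] cdot_commute[of "pull1 ?A _"] cdot_pull2_pull1
      by (simp add: cdot_commute)
    have 3: "cdot (pullback1 F h x) (A x) = of_real (det ?A) * cdot (h (F x)) (At (F x))"
      unfolding A[OF elim(1)] pullback1_eq cdot_commute[of "pull1 ?A _"] cdot_pull2_pull1
      by (simp add: cdot_commute)
    show ?case unfolding 1 2 3 by (simp add: algebra_simps)
  qed
qed

lemma energy_transfer:
  fixes Xt X :: form
  assumes X: "AE x in lebesgue_on (M1 - gamma1). X x = pullback1 F Xt x"
  shows "finite_energy N1 (material (g_tilde F)) Xt \<longleftrightarrow> finite_energy (M1 - gamma1) (material flat_metric) X"
proof -
  have flat: "(\<Sum>j\<in>UNIV. \<Sum>k\<in>UNIV. of_real (material flat_metric x $ j $ k) * v $ j * cnj (v $ k))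
      = (\<Sum>j\<in>UNIV. v $ j * cnj (v $ j))" for x and v :: "complex^3"
    by (simp add: mat_def if_distrib if_distribR cong: if_cong)
  have "AE x in lebesgue_on (M1 - gamma1). x \<in> M1 - gamma1"
    by (rule AE_I2) (simp add: space_restrict_space)
  then have ae: "AE x in lebesgue_on (M1 - gamma1). of_real (det (jacobian F (at x))) *
      (\<Sum>j\<in>UNIV. \<Sum>k\<in>UNIV. of_real (material (g_tilde F) (F x) $ j $ k) * Xt (F x) $ j * cnj (Xt (F x) $ k))
    = (\<Sum>j\<in>UNIV. X x $ j * cnj (X x $ j))"
    using X
  proof eventually_elim
    case (elim x)
    have d: "det (jacobian F (at x)) \<noteq> 0" using det_jacobian_F(2)[OF elim(1)] by simp
    show ?case
      unfolding elim(2) pullback1_eq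
      by (rule energy_pull[of "material (g_tilde F)", OF material_g_tilde[OF elim(1)] d])
  qed
  show ?thesis
    unfolding finite_energy_def integrable.simps has_bochner_integral_N1_iff flat
      has_bochner_integral_lebesgue_on_cong_AE[OF punctured_sets ae] ..
qed

lemma pullback_F_inv:
  assumes x: "x \<in> M1 - gamma1"
  shows "pullback1 F (pullback1 (F_inv F) e) x = e x"
proof -
  have "jacobian (F_inv F) (at (F x)) ** jacobian F (at x) = mat 1"
    using jacobian_inverse[OF x] matrix_left_right_inverse by blast
  then show ?thesis by (simp add: pullback1_eq F_inv_F[OF x] pull1_inverse)
qed

text \<open>A test form with compact support off the axis is pushed forward to \<open>N1\<close> and
  extended by 0. It vanishes near \<Sigma>, so it satisfies the boundary condition there.\<close>

lemma weak_curl_punctured: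
  fixes Xt Yt At X Y A :: form
  assumes X: "AE x in lebesgue_on (M1 - gamma1). X x = pullback1 F Xt x"
    and Y: "AE x in lebesgue_on (M1 - gamma1). Y x = pullback1 F Yt x"
    and A: "\<And>x. x \<in> M1 - gamma1 \<Longrightarrow> A x = pull2 (jacobian F (at x)) (At (F x))"
    and weak: "\<And>h. h \<in> SHS_test_forms \<Longrightarrow> has_bochner_integral (lebesgue_on N1)
      (\<lambda>y. cdot (curl h y) (Xt y) - c * cdot (h y) (apply_material (material (g_tilde F)) Yt y) - cdot (h y) (At y)) 0"
  shows "weak_curl (M1 - gamma1) c X Y A"
  unfolding weak_curl_def
proof (intro allI impI)
  fix e :: form assume e: "test_on (M1 - gamma1) e"
  obtain K where K: "compact K" "K \<subseteq> M1 - gamma1" "\<And>x. x \<notin> K \<Longrightarrow> e x = 0"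
    using e unfolding test_on_def by blast
  define h where "h y = (if y \<in> N1 then pullback1 (F_inv F) e y else 0)" for y
  have FK: "compact (F ` K)" "F ` K \<subseteq> N1"
    using K Ck_on_imp_continuous[OF Ck_on_F[of 0]] F_in_N1
    by (auto intro!: compact_continuous_image elim: continuous_on_subset)
  have h0: "h y = 0" if "y \<notin> F ` K" for y
  proof (cases "y \<in> N1")
    case True
    then have "F_inv F y \<notin> K" using that F_F_inv(1)[OF True] by force
    then show ?thesis using K(3) by (simp add: h_def pullback1_eq pull1_def vec_eq_iff)
  qed (simp add: h_def)
  have CN: "Ck_on n N1 h" for n
  proof (rule Ck_on_cong[OF open_N1])
    show "Ck_on n N1 (pullback1 (F_inv F) e)"
      by (rule Ck_on_pullback1[OF open_N1 open_UNIV _ Ck_on_F_inv test_on_Ck[OF e]]) simp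
  qed (simp add: h_def)
  have CU: "Ck_on n UNIV h" for n
    by (rule Ck_on_extend_zero[OF open_N1 compact_imp_closed[OF FK(1)] FK(2) h0 CN])
  have "smooth_on (N1 \<union> Sigma1) h"
    unfolding smooth_on_def using CU by (intro exI[of _ UNIV] exI[of _ h]) auto
  moreover have "\<exists>K. compact K \<and> K \<subseteq> N1 \<union> Sigma1 \<and> (\<forall>x\<in>(N1 \<union> Sigma1) - K. h x = 0)"
    using FK h0 by (intro exI[of _ "F ` K"]) auto
  moreover have "h x = 0" if "x \<in> Sigma1" for x using that by (auto simp: h_def mem_N1 Sigma1_def)
  ultimately have "h \<in> SHS_test_forms" by (simp add: SHS_test_forms_def test_forms_def cdot_def)
  then have "has_bochner_integral (lebesgue_on N1)
      (\<lambda>y. cdot (curl h y) (Xt y) - c * cdot (h y) (apply_material (material (g_tilde F)) Yt y) - cdot (h y) (At y)) 0"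
    by (rule weak)
  then have "has_bochner_integral (lebesgue_on (M1 - gamma1))
      (\<lambda>x. cdot (curl (pullback1 F h) x) (X x) - c * cdot (pullback1 F h x) (Y x) - cdot (pullback1 F h x) (A x)) 0"
    using weak_transfer[where A = A and At = At and c = c, OF CN X Y A] by blast
  also have "?this \<longleftrightarrow> has_bochner_integral (lebesgue_on (M1 - gamma1))
      (\<lambda>x. cdot (curl e x) (X x) - c * cdot (e x) (Y x) - cdot (e x) (A x)) 0"
  proof (rule has_bochner_integral_cong[OF refl _ refl])
    have he: "pullback1 F h x = e x" if "x \<in> M1 - gamma1" for x
      using pullback_F_inv[OF that, of e] F_in_N1[OF that] by (simp add: pullback1_eq h_def)
    fix x assume "x \<in> space (lebesgue_on (M1 - gamma1))"
    then have x: "x \<in> M1 - gamma1" by (simp add: space_restrict_space)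
    have "curl (pullback1 F h) x = curl e x" by (rule curl_cong[OF open_punctured x]) (rule he)
    then show "cdot (curl (pullback1 F h) x) (X x) - c * cdot (pullback1 F h x) (Y x) - cdot (pullback1 F h x) (A x)
        = cdot (curl e x) (X x) - c * cdot (e x) (Y x) - cdot (e x) (A x)"
      by (simp add: he[OF x])
  qed
  also have "\<dots> \<longleftrightarrow> has_bochner_integral lebesgue
      (\<lambda>x. cdot (curl e x) (X x) - c * cdot (e x) (Y x) - cdot (e x) (A x)) 0"
  proof (rule has_bochner_integral_lebesgue_on_support[OF punctured_sets])
    fix x assume "x \<notin> M1 - gamma1"
    then have x: "x \<in> - K" using K by blast
    have "curl e x = 0"
      by (rule curl_eq_0_open[OF _ x]) (use K compact_imp_closed in auto)
    then show "cdot (curl e x) (X x) - c * cdot (e x) (Y x) - cdot (e x) (A x) = 0"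
      using K(3) x by (simp add: cdot_def)
  qed
  finally show "has_bochner_integral lebesgue
      (\<lambda>x. cdot (curl e x) (X x) - c * cdot (e x) (Y x) - cdot (e x) (A x)) 0" .
qed

section \<open>Classical solutions satisfy the weak formulation up to the inner boundary\<close>

text \<open>Pulled-back test forms may reach the axis and are unbounded there, so integration by
  parts is done for their cut-off versions. Dominated convergence handles the main integral. In the
  error, a gradient of order N^2 times the radius is paired with an angular component of order 1 / r
  times \<eta> \<cdot> h, and this product times the volume of the tube tends to 0 only because
  \<eta> \<cdot> h does.\<close>

lemma SHS_weak_from_classical:
  fixes X Y A h :: form
  assumes X: "Ck_on 1 M1 X" and Y: "continuous_on M1 Y" and A: "continuous_on M1 A"
    and curlX: "\<And>x. x \<in> M1 - gamma1 \<Longrightarrow> curl X x = c *s Y x + A x"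
    and h: "h \<in> SHS_test_forms"
  shows "has_bochner_integral (lebesgue_on (M1 - gamma1))
     (\<lambda>x. cdot (curl (pullback1 F h) x) (X x) - c * cdot (pullback1 F h x) (Y x) - cdot (pullback1 F h x) (A x)) 0"
proof -
  let ?P = "M1 - gamma1"
  obtain V g where g: "open V" "N1 \<union> Sigma1 \<subseteq> V" "\<And>n. Ck_on n V g" "\<And>x. x \<in> N1 \<union> Sigma1 \<Longrightarrow> g x = h x"
    using h unfolding SHS_test_forms_def test_forms_def smooth_on_def by blast
  obtain K where K: "compact K" "K \<subseteq> N1 \<union> Sigma1" "\<And>x. x \<in> N1 \<Longrightarrow> x \<notin> K \<Longrightarrow> h x = 0"
    using h unfolding SHS_test_forms_def test_forms_def by blast
  have KV: "K \<subseteq> V" using K g by blast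
  have hSigma: "cdot (cvec (eta x)) (h x) = 0" if "x \<in> Sigma1" for x
    using h that by (simp add: SHS_test_forms_def)
  have Ckh: "Ck_on n N1 h" for n
    by (rule Ck_on_cong[OF open_N1 _ Ck_on_subset[OF g(3)]]) (use g in auto)
  have cg: "continuous_on V g" by (rule Ck_on_imp_continuous[OF g(3)])
  have ccg: "continuous_on V (curl g)" by (rule Ck_on_imp_continuous[OF Ck_on_curl[OF g(3,1)]])
  \<comment> \<open>The support K may meet \<Sigma>, where h is known only through its smooth
    extension g; the bounds are therefore taken from g on the compact set K.\<close>
  obtain C1 where C1: "\<And>x. x \<in> K \<Longrightarrow> norm (g x) \<le> C1"
    using continuous_on_compact_norm_bound[OF K(1) continuous_on_subset[OF cg KV]] by blast
  obtain C2 where C2: "\<And>x. x \<in> K \<Longrightarrow> norm (curl g x) \<le> C2"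
    using continuous_on_compact_norm_bound[OF K(1) continuous_on_subset[OF ccg KV]] by blast
  define Ch where "Ch = max 1 (max C1 C2)"
  have Ch0: "Ch \<ge> 1" by (simp add: Ch_def)
  have Ch: "norm (h y) \<le> Ch" "norm (curl h y) \<le> Ch" "y \<notin> K \<Longrightarrow> curl h y = 0" if y: "y \<in> N1" for y
  proof -
    have cz: "curl h y = 0" if "y \<notin> K"
      by (rule curl_eq_0_open[of "N1 - K"]) (use K y that open_N1 compact_imp_closed in auto)
    then show "y \<notin> K \<Longrightarrow> curl h y = 0" .
    have "curl h y = curl g y" by (rule curl_cong[OF open_N1 y]) (use g in auto)
    then show "norm (h y) \<le> Ch" "norm (curl h y) \<le> Ch"
      using C1[of y] C2[of y] K(3)[OF y] cz g(4)[of y] y Ch0 by (cases "y \<in> K"; force simp: Ch_def)+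
  qed
  define H where "H = pullback1 F h"
  have CkH: "Ck_on n ?P H" for n
    unfolding H_def by (rule Ck_on_pullback1[OF open_punctured open_N1 _ Ck_on_F Ckh]) (simp add: F_image)
  have Hx: "H x = pull1 (jacobian F (at x)) (h (F x))" for x by (simp add: H_def pullback1_eq)
  have cHx: "curl H x = pull2 (jacobian F (at x)) (curl h (F x))" if "x \<in> ?P" for x
    unfolding H_def by (rule curl_pullback1[OF open_punctured open_N1 _ Ck_on_F Ckh that]) (simp add: F_image)
  define Q where "Q = {x \<in> ?P. F x \<in> K}"
  have supp: "H x = 0" "curl H x = 0" if "x \<in> ?P" "x \<notin> Q" for x
    using that K(3)[OF F_in_N1[OF that(1)]] Ch(3)[OF F_in_N1[OF that(1)]]
    by (auto simp: Q_def Hx cHx pull1_def pull2_def vec_eq_iff)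
  obtain L where L: "L > 0" "\<And>x. x \<in> K \<Longrightarrow> norm x \<le> L"
    using compact_imp_bounded[OF K(1)] unfolding bounded_pos by blast
  have QL: "\<bar>x $ 3\<bar> \<le> L" if "x \<in> Q" for x
    using that L(2)[of "F x"] component_le_norm_cart[of "F x" 3] F_nth(3)[of x] by (auto simp: Q_def)
  \<comment> \<open>K keeps a distance from the outer boundary, hence so does its preimage. This
    matters because the fields are continuous on the open set \<open>M1\<close> and may be unbounded
    near its boundary.\<close>
  obtain s0 where s0: "0 < s0" "s0 < 2" "\<And>x. x \<in> Q \<Longrightarrow> cyl_radius x \<le> s0"
  proof (cases "K = {}")
    case True
    then show ?thesis using that[of 1] by (simp add: Q_def)
  next
    case False
    obtain y0 where y0: "y0 \<in> K" "\<And>y. y \<in> K \<Longrightarrow> cyl_radius y \<le> cyl_radius y0"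
      using continuous_attains_sup[OF K(1) False continuous_on_cyl_radius] by blast
    have "\<exists>s0>0. s0 < 2 \<and> cyl_radius y0 \<le> F1 s0"
    proof (cases "y0 \<in> N1")
      case True
      then have "F_inv F y0 \<in> ?P" by (rule F_F_inv(2))
      then show ?thesis
        using cyl_radius_F[of "F_inv F y0"] F_F_inv(1)[OF True] mem_M1_gamma1[of "F_inv F y0"]
        by (intro exI[of _ "cyl_radius (F_inv F y0)"]) auto
    next
      case False
      then have "cyl_radius y0 = 1" using y0 K by (auto simp: Sigma1_def)
      then show ?thesis using F1_gt_1[of 1] by (intro exI[of _ 1]) auto
    qed
    then obtain s0 where s0: "0 < s0" "s0 < 2" "cyl_radius y0 \<le> F1 s0" by blast
    have "cyl_radius x \<le> s0" if "x \<in> Q" for x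
    proof (rule ccontr)
      assume "\<not> cyl_radius x \<le> s0"
      moreover have xP: "x \<in> ?P" using that by (simp add: Q_def)
      ultimately have "F1 s0 < F1 (cyl_radius x)" using s0 mem_M1_gamma1[of x] by (intro F1_less) auto
      moreover have "F1 (cyl_radius x) \<le> cyl_radius y0"
        using cyl_radius_F[of x] xP y0(2)[of "F x"] that by (simp add: Q_def)
      ultimately show False using s0 by linarith
    qed
    then show ?thesis using that s0 by blast
  qed
  \<comment> \<open>In contrast to Q this solid cylinder contains the axis and is compact; the
    fields are continuous across the axis, hence bounded on it.\<close>
  define Q0 where "Q0 = {x. cyl_radius x \<le> s0 \<and> \<bar>x $ 3\<bar> \<le> L}"
  have QQ: "Q \<subseteq> Q0" using QL s0(3) by (auto simp: Q0_def)
  have Q0M: "Q0 \<subseteq> M1" using s0 by (auto simp: Q0_def M1_def)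
  have cQ0: "compact Q0"
  proof -
    have "closed Q0" unfolding Q0_def
      by (intro closed_Collect_conj closed_Collect_le continuous_intros continuous_on_cyl_radius)
    moreover have "bounded Q0"
    proof (rule bounded_subset[OF bounded_cbox])
      show "Q0 \<subseteq> cbox (vector [- 2, - 2, - L]) (vector [2, 2, L])"
      proof
        fix x assume x: "x \<in> Q0"
        have "\<bar>x $ 1\<bar> \<le> 2" "\<bar>x $ 2\<bar> \<le> 2" using x s0 abs_le_cyl_radius[of x] unfolding Q0_def by auto
        then show "x \<in> cbox (vector [- 2, - 2, - L]) (vector [2, 2, L])"
          using x by (auto simp: mem_box_cart forall_3 abs_le_iff Q0_def)
      qed
    qed
    ultimately show ?thesis by (simp add: compact_eq_bounded_closed)
  qed
  have cX: "continuous_on M1 X" by (rule Ck_on_imp_continuous[OF X])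
  obtain D1 where D1: "\<And>x. x \<in> Q0 \<Longrightarrow> norm (X x) \<le> D1"
    using continuous_on_compact_norm_bound[OF cQ0 continuous_on_subset[OF cX Q0M]] by blast
  obtain D2 where D2: "\<And>x. x \<in> Q0 \<Longrightarrow> norm (Y x) \<le> D2"
    using continuous_on_compact_norm_bound[OF cQ0 continuous_on_subset[OF Y Q0M]] by blast
  obtain D3 where D3: "\<And>x. x \<in> Q0 \<Longrightarrow> norm (A x) \<le> D3"
    using continuous_on_compact_norm_bound[OF cQ0 continuous_on_subset[OF A Q0M]] by blast
  define D where "D = max 1 (max D1 (max D2 D3))"
  have D0: "D \<ge> 1" by (simp add: D_def)
  have D: "norm (X x) \<le> D" "norm (Y x) \<le> D" "norm (A x) \<le> D" if "x \<in> Q0" for x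
    using D1[OF that] D2[OF that] D3[OF that] by (auto simp: D_def)
  obtain M where M: "M > 0" "\<And>a b. norm (cdot a b) \<le> norm a * norm b * M"
    using bounded_bilinear.pos_bounded[OF bounded_bilinear_cdot] by blast
  define I where "I x = cdot (curl H x) (X x) - c * cdot (H x) (Y x) - cdot (H x) (A x)" for x
  \<comment> \<open>The common bound for the entries of the Jacobian and of its cofactors.\<close>
  define m where "m x = 2 * det (jacobian F (at x)) + 4 / cyl_radius x" for x
  have m0: "0 \<le> m x" if "x \<in> ?P" for x
    using det_jacobian_F(2)[OF that] by (simp add: m_def)
  let ?S = "{x. cyl_radius x \<le> 2 \<and> \<bar>x $ 3\<bar> \<le> L}"
  define E where "E = (2 + norm c) * (9 * Ch * D * M)"
  have E0: "E \<ge> 0" using Ch0 D0 M by (simp add: E_def)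
  have HI: "norm (H x) \<le> 9 * m x * Ch" "norm (curl H x) \<le> 9 * m x * Ch" if x: "x \<in> ?P" for x
  proof -
    have "norm (H x) \<le> 9 * m x * norm (h (F x))"
      unfolding Hx pull1_def by (rule norm_linear_form_le) (use jacobian_F_bound(1)[OF x] in \<open>simp add: m_def\<close>)
    then show "norm (H x) \<le> 9 * m x * Ch"
      using Ch(1)[OF F_in_N1[OF x]] m0[OF x] by (meson mult_left_mono mult_nonneg_nonneg order_trans zero_le_numeral)
    have "norm (curl H x) \<le> 9 * m x * norm (curl h (F x))"
      unfolding cHx[OF x] pull2_def by (rule norm_linear_form_le) (use jacobian_F_bound(2)[OF x] in \<open>simp add: m_def\<close>)
    then show "norm (curl H x) \<le> 9 * m x * Ch"
      using Ch(2)[OF F_in_N1[OF x]] m0[OF x] by (meson mult_left_mono mult_nonneg_nonneg order_trans zero_le_numeral)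
  qed
  have Ib: "norm (I x) \<le> E * (m x * indicator ?S x)" if x: "x \<in> ?P" for x
  proof (cases "x \<in> Q")
    case True
    then have q: "x \<in> Q0" and S: "x \<in> ?S" using QQ s0(3)[OF True] s0(2) QL[OF True] by auto
    have cd: "norm (cdot a b) \<le> (9 * m x * Ch) * D * M" if "norm a \<le> 9 * m x * Ch" "norm b \<le> D" for a b
    proof (rule order_trans[OF M(2)])
      show "norm a * norm b * M \<le> (9 * m x * Ch) * D * M"
        using that M m0[OF x] Ch0 by (intro mult_right_mono mult_mono) auto
    qed
    have "norm (I x) \<le> norm (cdot (curl H x) (X x)) + norm c * norm (cdot (H x) (Y x)) + norm (cdot (H x) (A x))"
      unfolding I_def norm_mult[symmetric]
      using norm_triangle_ineq4[of "cdot (curl H x) (X x) - c * cdot (H x) (Y x)" "cdot (H x) (A x)"]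
        norm_triangle_ineq4[of "cdot (curl H x) (X x)" "c * cdot (H x) (Y x)"]
      by linarith
    also have "\<dots> \<le> (9 * m x * Ch) * D * M + norm c * ((9 * m x * Ch) * D * M) + (9 * m x * Ch) * D * M"
      by (intro add_mono mult_left_mono cd HI[OF x] D[OF q]) auto
    also have "\<dots> = E * (m x * indicator ?S x)" using S by (simp add: E_def algebra_simps)
    finally show ?thesis .
  next
    case False
    then have "I x = 0" using supp[OF x] by (simp add: I_def cdot_def)
    then show ?thesis using E0 m0[OF x] by (simp add: indicator_def)
  qed
  have sp: "space (lebesgue_on ?P) = ?P" by (simp add: space_restrict_space)
  \<comment> \<open>F maps the truncated cylinder \<open>?S\<close> without its axis into itself and
    its complement in the punctured cylinder into the complement. So the determinant integrates over
    it to the finite volume of \<open>?S\<close> inside \<open>N1\<close>; the term 4 / r is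
    integrable by the dyadic estimate.\<close>
  have im: "integrable (lebesgue_on ?P) (\<lambda>x. m x * indicator ?S x)"
  proof -
    let ?T = "{y::real^3. \<bar>y $ 3\<bar> \<le> L}"
    have Tm: "?T \<in> sets borel" by measurable
    have "integrable lborel (indicator ?S :: real^3 \<Rightarrow> real)"
      using tube_measure(1)[of L 0] L by (simp add: tube_def)
    then have "integrable lebesgue (indicator ?S :: real^3 \<Rightarrow> real)"
      by (simp add: integrable_completion)
    then have "integrable lebesgue (\<lambda>x. complex_of_real (indicator ?S x))" by (rule integrable_of_real)
    then have "integrable (lebesgue_on N1) (\<lambda>x. complex_of_real (indicator ?S x))"
      by (rule integrable_lebesgue_on_subset[OF _ sets_lebesgue_open[OF open_N1]])
    then have "integrable (lebesgue_on ?P) (\<lambda>x. of_real (det (jacobian F (at x))) * complex_of_real (indicator ?S (F x)))"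
      unfolding integrable.simps has_bochner_integral_N1_iff .
    then have "integrable (lebesgue_on ?P) (\<lambda>x. Re (of_real (det (jacobian F (at x))) * complex_of_real (indicator ?S (F x))))"
      by (rule integrable_Re)
    also have "?this \<longleftrightarrow> integrable (lebesgue_on ?P) (\<lambda>x. det (jacobian F (at x)) * indicator ?S x)"
    proof (rule Bochner_Integration.integrable_cong[OF refl])
      fix x assume "x \<in> space (lebesgue_on ?P)"
      then have x: "x \<in> ?P" using sp by simp
      have "(F x \<in> ?S) = (x \<in> ?S)"
        using F_nth(3)[of x] F_in_N1[OF x] x mem_M1_gamma1[of x] by (auto simp: mem_N1)
      then have "(indicator ?S (F x) :: real) = indicator ?S x" by (simp only: indicator_def)
      then show "Re (of_real (det (jacobian F (at x))) * complex_of_real (indicator ?S (F x))) = det (jacobian F (at x)) * indicator ?S x"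
        by simp
    qed
    finally have 1: "integrable (lebesgue_on ?P) (\<lambda>x. det (jacobian F (at x)) * indicator ?S x)" .
    have "integrable lborel (\<lambda>x. indicator ?S x / cyl_radius x)"
      using L by (intro integrable_inverse_cyl_radius) simp
    then have "integrable lebesgue (\<lambda>x. indicator ?S x / cyl_radius x)"
      using integrable_completion[of "\<lambda>x. indicator ?S x / cyl_radius x" lborel]
        borel_measurable_integrable[of lborel "\<lambda>x. indicator ?S x / cyl_radius x"] by blast
    then have 2: "integrable (lebesgue_on ?P) (\<lambda>x. indicator ?S x / cyl_radius x)"
      by (rule integrable_lebesgue_on_subset[OF _ punctured_sets])
    have "integrable (lebesgue_on ?P) (\<lambda>x. 2 * (det (jacobian F (at x)) * indicator ?S x) + 4 * (indicator ?S x / cyl_radius x))"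
      by (intro Bochner_Integration.integrable_add integrable_mult_right 1 2)
    then show ?thesis by (simp add: m_def distrib_right mult.assoc)
  qed
  have cI: "continuous_on ?P I"
  proof -
    have "continuous_on ?P X" "continuous_on ?P Y" "continuous_on ?P A"
      using cX Y A by (auto intro: continuous_on_subset)
    moreover have "continuous_on ?P H" "continuous_on ?P (curl H)"
      using Ck_on_imp_continuous[OF CkH] Ck_on_imp_continuous[OF Ck_on_curl[OF CkH open_punctured]] .
    ultimately show ?thesis
      unfolding I_def[abs_def] by (intro continuous_intros continuous_on_cdot)
  qed
  have mI: "I \<in> borel_measurable (lebesgue_on ?P)"
    by (rule continuous_imp_measurable_on_sets_lebesgue[OF cI punctured_sets])
  have iI: "integrable (lebesgue_on ?P) I"
  proof (rule Bochner_Integration.integrable_bound[OF integrable_mult_right[OF im, of E] mI])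
    show "AE x in lebesgue_on ?P. norm (I x) \<le> norm (E * (m x * indicator ?S x))"
      using Ib by (intro AE_I2) (auto simp: sp intro: order_trans[OF _ abs_ge_self])
  qed
  let ?N = "\<lambda>n. real (Suc n)"
  let ?R = "\<lambda>n x. cdot (cross_rc (grad (axis_cutoff n) x) (H x)) (X x)"
  have tn: "has_bochner_integral (lebesgue_on ?P) (\<lambda>x. of_real (axis_cutoff n x) * I x + ?R n x) 0" for n
  proof -
    \<comment> \<open>Outside the punctured cylinder H has no meaning; the cutoff and the compact
      support of h make the extension by 0 vanish off a compact set inside it.\<close>
    define w where "w x = (if x \<in> ?P then axis_cutoff n x *\<^sub>R H x else 0)" for x
    let ?K = "Q0 \<inter> {x. 1 \<le> ?N n * cyl_radius x}"
    have K1: "compact ?K"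
      by (intro compact_Int_closed cQ0 closed_Collect_le continuous_intros continuous_on_cyl_radius)
    have K2: "?K \<subseteq> ?P" using Q0M cyl_radius_eq_0_iff by force
    have w0: "w x = 0" if "x \<notin> ?K" for x
    proof (cases "x \<in> ?P")
      case True
      then show ?thesis
        using that supp(1)[OF True] QQ axis_cutoff_eq_0[of n x] by (cases "x \<in> Q") (auto simp: w_def)
    qed (auto simp: w_def)
    have Cw: "Ck_on 1 ?P w"
    proof (rule Ck_on_cong[OF open_punctured])
      show "Ck_on 1 ?P (\<lambda>x. axis_cutoff n x *\<^sub>R H x)"
        by (intro Ck_on_scaleR open_punctured CkH Ck_on_subset[OF Ck_on_axis_cutoff]) simp
    qed (simp add: w_def)
    have Iw: "has_bochner_integral lebesgue (\<lambda>x. cdot (curl w x) (X x) - cdot (w x) (curl X x)) 0"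
      by (rule curl_by_parts[OF open_punctured K1 K2 w0 Cw Ck_on_subset[OF X]]) auto
    have Zw: "cdot (curl w x) (X x) - cdot (w x) (curl X x) = 0" if "x \<notin> ?P" for x
    proof -
      have x: "x \<in> - ?K" using that K2 by blast
      have "curl w x = 0"
        by (rule curl_eq_0_open[OF open_Compl[OF compact_imp_closed[OF K1]] x]) (rule w0, erule ComplD)
      then show ?thesis using w0 x by (simp add: cdot_def)
    qed
    have "has_bochner_integral (lebesgue_on ?P) (\<lambda>x. cdot (curl w x) (X x) - cdot (w x) (curl X x)) 0"
      by (rule iffD2[OF has_bochner_integral_lebesgue_on_support[OF punctured_sets] Iw]) (rule Zw)
    also have "?this \<longleftrightarrow> ?thesis"
    proof (rule has_bochner_integral_cong[OF refl _ refl])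
      fix x assume "x \<in> space (lebesgue_on ?P)"
      then have x: "x \<in> ?P" using sp by simp
      have "curl w x = curl (\<lambda>x. axis_cutoff n x *\<^sub>R H x) x"
        by (rule curl_cong[OF open_punctured x]) (simp add: w_def)
      also have "\<dots> = axis_cutoff n x *\<^sub>R curl H x + cross_rc (grad (axis_cutoff n) x) (H x)"
        by (rule curl_scale[OF Ck_on_subset[OF Ck_on_axis_cutoff subset_UNIV] CkH open_punctured x])
      finally have cw: "curl w x = axis_cutoff n x *\<^sub>R curl H x + cross_rc (grad (axis_cutoff n) x) (H x)" .
      have wx: "w x = axis_cutoff n x *\<^sub>R H x" using x by (simp add: w_def)
      have cdc: "cdot (H x) (c *s Y x + A x) = c * cdot (H x) (Y x) + cdot (H x) (A x)"
        by (simp add: cdot_def sum_distrib_left sum.distrib algebra_simps)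
      show "cdot (curl w x) (X x) - cdot (w x) (curl X x) = of_real (axis_cutoff n x) * I x + ?R n x"
        unfolding cw wx curlX[OF x] I_def bounded_bilinear.add_left[OF bounded_bilinear_cdot]
          bounded_bilinear.scaleR_left[OF bounded_bilinear_cdot] cdc
        by (simp add: scaleR_conv_of_real[where 'a = complex] algebra_simps)
    qed
    finally show ?thesis .
  qed
  have mcI: "(\<lambda>x. of_real (axis_cutoff n x) * I x) \<in> borel_measurable (lebesgue_on ?P)" for n
    by (rule continuous_imp_measurable_on_sets_lebesgue[OF _ punctured_sets])
      (intro continuous_intros cI continuous_on_subset[OF Ck_on_imp_continuous[OF Ck_on_axis_cutoff]] subset_UNIV)
  have bcI: "norm (of_real (axis_cutoff n x) * I x) \<le> norm (I x)" for n x
    using axis_cutoff_bounds[of n x] by (simp add: norm_mult mult_left_le_one_le)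
  have icI: "integrable (lebesgue_on ?P) (\<lambda>x. of_real (axis_cutoff n x) * I x)" for n
    by (rule Bochner_Integration.integrable_bound[OF iI mcI]) (simp add: bcI)
  have lim: "(\<lambda>n. \<integral>x. of_real (axis_cutoff n x) * I x \<partial>lebesgue_on ?P) \<longlonglongrightarrow> (\<integral>x. I x \<partial>lebesgue_on ?P)"
  proof (rule integral_dominated_convergence[OF mI mcI integrable_norm[OF iI] AE_I2 AE_I2[OF bcI]])
    fix x assume "x \<in> space (lebesgue_on ?P)"
    then have "0 < cyl_radius x" using sp mem_M1_gamma1[of x] by simp
    then have "(\<lambda>n. of_real (axis_cutoff n x) * I x) \<longlonglongrightarrow> of_real 1 * I x"
      by (intro tendsto_mult tendsto_of_real axis_cutoff_tendsto tendsto_const)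
    then show "(\<lambda>n. of_real (axis_cutoff n x) * I x) \<longlonglongrightarrow> I x" by simp
  qed
  have iR: "integrable (lebesgue_on ?P) (?R n)"
    and R: "(\<integral>x. of_real (axis_cutoff n x) * I x \<partial>lebesgue_on ?P) = - (\<integral>x. ?R n x \<partial>lebesgue_on ?P)" for n
  proof -
    have "has_bochner_integral (lebesgue_on ?P) (\<lambda>x. (of_real (axis_cutoff n x) * I x + ?R n x) - of_real (axis_cutoff n x) * I x)
        (0 - (\<integral>x. of_real (axis_cutoff n x) * I x \<partial>lebesgue_on ?P))"
      by (intro has_bochner_integral_diff tn has_bochner_integral_integrable icI)
    then have "has_bochner_integral (lebesgue_on ?P) (?R n) (- (\<integral>x. of_real (axis_cutoff n x) * I x \<partial>lebesgue_on ?P))" by simp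
    then show "integrable (lebesgue_on ?P) (?R n)" "(\<integral>x. of_real (axis_cutoff n x) * I x \<partial>lebesgue_on ?P) = - (\<integral>x. ?R n x \<partial>lebesgue_on ?P)"
      by (auto simp: has_bochner_integral_iff)
  qed
  obtain Cs where Cs: "Cs > 0" "\<And>t. \<bar>deriv smooth_step t\<bar> \<le> Cs" using smooth_step_deriv(4) by blast
  define B where "B = 2 * Cs * D * M"
  have B: "B > 0" using Cs D0 M by (simp add: B_def)
  text \<open>The gradient of the cutoff is radial, so only the axial and the angular component of the
    pulled-back test form enter; the former is bounded and the latter vanishes on the axis
    because of the boundary condition.\<close>
  have Rb: "norm (?R n x) \<le> B * (?N n)\<^sup>2 * (4 * Ch / ?N n + e) * indicator (tube n L) x"
    if x: "x \<in> ?P" and e: "0 \<le> e" "x \<in> Q \<Longrightarrow> cyl_radius x \<le> 2 / ?N n \<Longrightarrow> norm (cdot (cvec (eta (F x))) (h (F x))) \<le> e" for n x e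
  proof (cases "x \<in> Q \<and> 1 \<le> ?N n * cyl_radius x \<and> ?N n * cyl_radius x \<le> 2")
    case False
    have "?R n x = 0"
    proof (cases "x \<in> Q")
      case True
      then have "deriv smooth_step ((?N n)\<^sup>2 * (cyl_radius x)\<^sup>2) = 0" using False by (intro deriv_cutoff_eq_0) blast
      then have "grad (axis_cutoff n) x = 0" by (simp add: grad_def vec_eq_iff partial_axis_cutoff)
      then show ?thesis by (simp add: cross_rc_def cdot_def)
    qed (simp add: supp[OF x] cross_rc_def cdot_def)
    moreover have "0 \<le> B * (?N n)\<^sup>2 * (4 * Ch / ?N n + e) * indicator (tube n L) x"
      using B Ch0 e by (intro mult_nonneg_nonneg add_nonneg_nonneg) auto
    ultimately show ?thesis by (simp del: of_nat_Suc)
  next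
    case True
    then have s: "cyl_radius x \<le> 2 / ?N n" by (simp add: field_simps)
    then have tube: "x \<in> tube n L" using True QL by (simp add: tube_def)
    define \<kappa> where "\<kappa> = deriv smooth_step ((?N n)\<^sup>2 * (cyl_radius x)\<^sup>2) * ((?N n)\<^sup>2 * 2)"
    have \<kappa>: "\<bar>\<kappa>\<bar> \<le> Cs * ((?N n)\<^sup>2 * 2)"
      unfolding \<kappa>_def abs_mult using Cs by (intro mult_mono) auto
    have g: "grad (axis_cutoff n) x = vector [\<kappa> * x $ 1, \<kappa> * x $ 2, 0]"
      by (simp add: grad_def vec_eq_iff forall_3 partial_axis_cutoff \<kappa>_def)
    have H3: "H x $ 3 = h (F x) $ 3" unfolding Hx by (rule pull1_F_3[OF x])
    have He: "of_real (x $ 1) * H x $ 2 - of_real (x $ 2) * H x $ 1 = cdot (cvec (eta (F x))) (h (F x))"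
      unfolding eta_pull1_F[OF x, symmetric] Hx[symmetric] by (simp add: cdot_def cvec_def eta_def sum_3)
    let ?z = "cross_rc (grad (axis_cutoff n) x) (H x)"
    have z: "?z $ 1 = of_real (\<kappa> * x $ 2) * h (F x) $ 3" "?z $ 2 = - (of_real (\<kappa> * x $ 1) * h (F x) $ 3)"
      "?z $ 3 = of_real \<kappa> * cdot (cvec (eta (F x))) (h (F x))"
      unfolding g He[symmetric] H3[symmetric]
      by (simp_all add: cross_rc_def sum_3 levi_civita_def algebra_simps)
    have h3: "norm (h (F x) $ 3) \<le> Ch"
      using Ch(1)[OF F_in_N1[OF x]] Finite_Cartesian_Product.norm_nth_le[of "h (F x)" 3] by linarith
    have xi: "\<bar>x $ i\<bar> \<le> 2 / ?N n" if "i \<in> {1, 2}" for i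
      using that abs_le_cyl_radius[of x] s by auto
    have t: "\<bar>\<kappa>\<bar> * (\<bar>x $ i\<bar> * norm (h (F x) $ 3)) \<le> (Cs * ((?N n)\<^sup>2 * 2)) * (2 / ?N n * Ch)" if "i \<in> {1,2}" for i
      using \<kappa> xi[OF that] h3 Cs by (intro mult_mono mult_nonneg_nonneg) auto
    have t3: "\<bar>\<kappa>\<bar> * norm (cdot (cvec (eta (F x))) (h (F x))) \<le> (Cs * ((?N n)\<^sup>2 * 2)) * e"
      using \<kappa> e(2) s True Cs by (intro mult_mono) auto
    have "norm ?z \<le> norm (?z $ 1) + norm (?z $ 2) + norm (?z $ 3)"
      using norm_le_sum_nth[of ?z] by (simp add: sum_3)
    also have "\<dots> = \<bar>\<kappa>\<bar> * (\<bar>x $ 2\<bar> * norm (h (F x) $ 3)) + \<bar>\<kappa>\<bar> * (\<bar>x $ 1\<bar> * norm (h (F x) $ 3))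
        + \<bar>\<kappa>\<bar> * norm (cdot (cvec (eta (F x))) (h (F x)))"
      unfolding z norm_minus_cancel norm_mult norm_of_real abs_mult mult.assoc ..
    also have "\<dots> \<le> (Cs * ((?N n)\<^sup>2 * 2)) * (2 / ?N n * Ch) + (Cs * ((?N n)\<^sup>2 * 2)) * (2 / ?N n * Ch) + (Cs * ((?N n)\<^sup>2 * 2)) * e"
      by (intro add_mono t t3) auto
    also have "\<dots> = 2 * Cs * (?N n)\<^sup>2 * (4 * Ch / ?N n + e)"
      by (simp add: distrib_left mult_ac del: of_nat_Suc)
    finally have nz: "norm ?z \<le> 2 * Cs * (?N n)\<^sup>2 * (4 * Ch / ?N n + e)" .
    have "norm (?R n x) \<le> norm ?z * norm (X x) * M" by (rule M)
    also have "\<dots> \<le> (2 * Cs * (?N n)\<^sup>2 * (4 * Ch / ?N n + e)) * D * M"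
      using D(1)[of x] QQ True M Cs Ch0 e(1)
      by (intro mult_right_mono mult_mono nz mult_nonneg_nonneg add_nonneg_nonneg) auto
    also have "\<dots> = B * (?N n)\<^sup>2 * (4 * Ch / ?N n + e) * indicator (tube n L) x"
      using tube by (simp add: B_def mult_ac del: of_nat_Suc)
    finally show ?thesis .
  qed
  \<comment> \<open>The points of K where \<eta> \<cdot> h has size at least e form a compact set
    that misses \<Sigma>, so their radius is at least some 1 + \<delta>. Since F1 tends to 1, points
    close to the axis are mapped to smaller radii.\<close>
  have small: "\<exists>n0. \<forall>n\<ge>n0. \<forall>x\<in>Q. cyl_radius x \<le> 2 / ?N n \<longrightarrow> norm (cdot (cvec (eta (F x))) (h (F x))) \<le> e" if e: "e > 0" for e
  proof -
    let ?\<theta> = "\<lambda>y. norm (cdot (cvec (eta y)) (g y))"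
    have c\<theta>: "continuous_on K ?\<theta>"
      by (rule continuous_on_norm[OF continuous_on_cdot[OF linear_continuous_on[OF bounded_linear_cvec_eta] continuous_on_subset[OF cg KV]]])
    have "closed (K \<inter> ?\<theta> -` {e..})"
      by (rule continuous_closed_preimage[OF c\<theta> compact_imp_closed[OF K(1)] closed_atLeast])
    then have cZ: "compact (K \<inter> ?\<theta> -` {e..})"
      using compact_Int_closed[OF K(1)] by (metis inf.left_idem)
    have "\<exists>\<delta>>0. \<forall>y\<in>K. cyl_radius y < 1 + \<delta> \<longrightarrow> ?\<theta> y \<le> e"
    proof (cases "K \<inter> ?\<theta> -` {e..} = {}")
      case True
      then have "?\<theta> y \<le> e" if "y \<in> K" for y using that by force
      then show ?thesis by (intro exI[of _ 1]) auto
    next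
      case False
      obtain y1 where y1: "y1 \<in> K \<inter> ?\<theta> -` {e..}" "\<And>y. y \<in> K \<inter> ?\<theta> -` {e..} \<Longrightarrow> cyl_radius y1 \<le> cyl_radius y"
        using continuous_attains_inf[OF cZ False continuous_on_cyl_radius] by blast
      have "y1 \<notin> Sigma1" using y1(1) hSigma[of y1] g(4)[of y1] e by auto
      then have "y1 \<in> N1" using y1(1) K(2) by blast
      then have "cyl_radius y1 > 1" by (simp add: mem_N1)
      moreover have "?\<theta> y \<le> e" if "y \<in> K" "cyl_radius y < 1 + (cyl_radius y1 - 1)" for y
        using y1(2)[of y] that by force
      ultimately show ?thesis by (intro exI[of _ "cyl_radius y1 - 1"]) auto
    qed
    then obtain \<delta> where \<delta>: "\<delta> > 0" "\<And>y. y \<in> K \<Longrightarrow> cyl_radius y < 1 + \<delta> \<Longrightarrow> ?\<theta> y \<le> e" by blast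
    have "(F1 \<longlongrightarrow> 1) (at_right 0)" using single_coating by (simp add: single_coating_def)
    then have "\<forall>\<^sub>F s in at_right 0. F1 s < 1 + \<delta>" by (rule order_tendstoD) (use \<delta> in simp)
    then obtain b where b: "b > 0" "\<And>s. 0 < s \<Longrightarrow> s < b \<Longrightarrow> F1 s < 1 + \<delta>"
      unfolding eventually_at_right_field by blast
    obtain n0 where n0: "2 / b < real n0" using reals_Archimedean2 by blast
    have "norm (cdot (cvec (eta (F x))) (h (F x))) \<le> e" if "n \<ge> n0" "x \<in> Q" "cyl_radius x \<le> 2 / ?N n" for n x
    proof -
      have x: "x \<in> ?P" "F x \<in> K" using that by (auto simp: Q_def)
      have "2 / b < ?N n" using n0 that by linarith
      then have "2 / ?N n < b" using b by (simp add: field_simps)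
      then have "F1 (cyl_radius x) < 1 + \<delta>" using that mem_M1_gamma1[of x] x by (intro b) auto
      then have "cyl_radius (F x) < 1 + \<delta>" using cyl_radius_F[of x] x by simp
      then show ?thesis using \<delta>(2)[OF x(2)] g(4)[of "F x"] F_in_N1[OF x(1)] by simp
    qed
    then show ?thesis by blast
  qed
  \<comment> \<open>The volume of the tube cancels N^2. The axial component leaves a multiple of 1 /
    N, which vanishes in the limit, and the angular one leaves the multiple of e.\<close>
  have bound: "norm (\<integral>x. I x \<partial>lebesgue_on ?P) \<le> 32 * B * L * e" if e: "e > 0" for e
  proof -
    obtain n0 where n0: "\<And>n x. n \<ge> n0 \<Longrightarrow> x \<in> Q \<Longrightarrow> cyl_radius x \<le> 2 / ?N n \<Longrightarrow> norm (cdot (cvec (eta (F x))) (h (F x))) \<le> e"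
      using small[OF e] by blast
    have each: "norm (\<integral>x. of_real (axis_cutoff n x) * I x \<partial>lebesgue_on ?P) \<le> 32 * B * L * (4 * Ch * (1 / ?N n) + e)" if "n \<ge> n0" for n
    proof -
      let ?c = "B * (?N n)\<^sup>2 * (4 * Ch / ?N n + e)"
      have c0: "0 \<le> ?c" using B Ch0 e by (intro mult_nonneg_nonneg add_nonneg_nonneg) auto
      have it: "integrable lebesgue (indicator (tube n L) :: real^3 \<Rightarrow> real)"
        by (rule tube_measure_lebesgue(1)) (use L in simp)
      have itP: "integrable (lebesgue_on ?P) (indicator (tube n L) :: real^3 \<Rightarrow> real)"
        by (rule integrable_lebesgue_on_subset[OF it punctured_sets])
      have "norm (\<integral>x. of_real (axis_cutoff n x) * I x \<partial>lebesgue_on ?P) \<le> (\<integral>x. norm (?R n x) \<partial>lebesgue_on ?P)"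
        unfolding R norm_minus_cancel by (rule integral_norm_bound)
      also have "\<dots> \<le> (\<integral>x. ?c * indicator (tube n L) x \<partial>lebesgue_on ?P)"
      proof (rule integral_mono[OF integrable_norm[OF iR] integrable_mult_right[OF itP]])
        fix x assume "x \<in> space (lebesgue_on ?P)"
        then have x: "x \<in> ?P" using sp by simp
        show "norm (?R n x) \<le> ?c * indicator (tube n L) x"
          by (rule Rb[OF x]) (use e n0[OF that] in auto)
      qed
      also have "\<dots> = ?c * (\<integral>x. indicator (tube n L) x \<partial>lebesgue_on ?P)" by (rule integral_mult_right_zero)
      also have "\<dots> \<le> ?c * (32 * L / (?N n)\<^sup>2)"
      proof (rule mult_left_mono[OF _ c0])
        have "(\<integral>x. indicator (tube n L) x \<partial>lebesgue_on ?P) = (\<integral>x. indicator ?P x *\<^sub>R (indicator (tube n L) x :: real) \<partial>(lebesgue :: (real^3) measure))"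
          by (rule integral_restrict_space) (use punctured_sets in simp)
        also have "\<dots> \<le> (\<integral>x. indicator (tube n L) x \<partial>(lebesgue :: (real^3) measure))"
          by (rule integral_mono[OF integrable_mult_indicator[OF punctured_sets it] it]) (simp add: indicator_def)
        also have "\<dots> \<le> 32 * L / (?N n)\<^sup>2" by (rule tube_measure_lebesgue(2)) (use L in simp)
        finally show "(\<integral>x. indicator (tube n L) x \<partial>lebesgue_on ?P) \<le> 32 * L / (?N n)\<^sup>2" .
      qed
      also have "\<dots> = 32 * B * L * (4 * Ch * (1 / ?N n) + e)" by (simp add: field_simps del: of_nat_Suc)
      finally show ?thesis .
    qed
    have "(\<lambda>n. 1 / ?N n) \<longlonglongrightarrow> 0"
      using LIMSEQ_inverse_real_of_nat by (simp add: inverse_eq_divide)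
    then have "(\<lambda>n. 32 * B * L * (4 * Ch * (1 / ?N n) + e)) \<longlonglongrightarrow> 32 * B * L * (4 * Ch * 0 + e)"
      by (intro tendsto_intros)
    then have "(\<lambda>n. 32 * B * L * (4 * Ch * (1 / ?N n) + e)) \<longlonglongrightarrow> 32 * B * L * e" by simp
    then show ?thesis
      by (rule LIMSEQ_le[OF tendsto_norm[OF lim]]) (use each in blast)
  qed
  have "norm (\<integral>x. I x \<partial>lebesgue_on ?P) \<le> 0 + e" if "e > 0" for e
  proof -
    have p: "32 * B * L > 0" using B L by simp
    have "norm (\<integral>x. I x \<partial>lebesgue_on ?P) \<le> 32 * B * L * (e / (32 * B * L))"
      by (rule bound) (use p that in simp)
    also have "\<dots> = e" using B L by simp
    finally show ?thesis by simp
  qed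
  then have "norm (\<integral>x. I x \<partial>lebesgue_on ?P) \<le> 0" by (rule field_le_epsilon)
  then have "has_bochner_integral (lebesgue_on ?P) I 0" using iI by (simp add: has_bochner_integral_iff)
  then show ?thesis unfolding I_def[abs_def] H_def .
qed

end

section \<open>Classical solutions\<close>

lemma AE_lebesgue_on_mono:
  assumes "AE x in lebesgue_on S. R x" "S \<in> sets lebesgue" "T \<in> sets lebesgue" "T \<subseteq> S"
  shows "AE x in lebesgue_on T. R x"
proof -
  have "negligible {x \<in> S. \<not> R x}" using assms AE_lebesgue_on_iff_negligible by blast
  then have "negligible {x \<in> T. \<not> R x}" by (rule negligible_subset) (use assms in auto)
  then show ?thesis using assms AE_lebesgue_on_iff_negligible by blast
qed

lemma AE_lebesgue_on_D: "AE x in lebesgue_on S. R x \<Longrightarrow> S \<in> sets lebesgue \<Longrightarrow> AE x in lebesgue. x \<in> S \<longrightarrow> R x"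
  by (subst (asm) AE_restrict_space_iff) simp_all

lemma AE_lebesgue_on_I: "AE x in lebesgue. x \<in> S \<longrightarrow> R x \<Longrightarrow> S \<in> sets lebesgue \<Longrightarrow> AE x in lebesgue_on S. R x"
  by (subst AE_restrict_space_iff) simp_all

lemma has_bochner_integral_lebesgue_cong_AE:
  fixes f g :: "'a::euclidean_space \<Rightarrow> 'b::euclidean_space"
  assumes "AE x in lebesgue. f x = g x"
  shows "has_bochner_integral lebesgue f z \<longleftrightarrow> has_bochner_integral lebesgue g z"
  using has_bochner_integral_lebesgue_on_cong_AE[of UNIV f g z] assms unfolding lebesgue_on_UNIV_eq by simp

text \<open>Integrating by parts with the C^1 representative turns the weak equation into the
  statement that the continuous residual is orthogonal to all test forms.\<close>

lemma strong_curl_from_weak: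
  fixes X Y X' Y' A :: form
  assumes W: "open W" and X': "Ck_on 1 W X'" and Y': "continuous_on W Y'" and A: "continuous_on W A"
    and X: "AE x in lebesgue. x \<in> W \<longrightarrow> X x = X' x" and Y: "AE x in lebesgue. x \<in> W \<longrightarrow> Y x = Y' x"
    and weak: "weak_curl W c X Y A" and x: "x \<in> W"
  shows "curl X' x = c *s Y' x + A x"
proof -
  let ?Z = "\<lambda>x. curl X' x - c *s Y' x - A x"
  have X1: "Ck_on (Suc 0) W X'" using X' by (simp only: One_nat_def)
  have cs: "continuous_on W (\<lambda>x. c *s Y' x)"
  proof -
    have "continuous_on W (\<lambda>x. (c *s Y' x) $ j)" for j
      by (simp add: continuous_intros Y')
    then show ?thesis by (subst vec_eq_sum_axis) (intro continuous_on_sum bounded_linear.continuous_on[OF bounded_linear_axis])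
  qed
  have "?Z x = 0"
  proof (rule continuous_eq_0_if_weakly_0[OF W _ _ x])
    show "continuous_on W ?Z"
      by (intro continuous_on_diff cs A Ck_on_imp_continuous[OF Ck_on_curl[OF X1 W]])
    fix h :: form assume h: "test_on W h"
    obtain K where K: "compact K" "K \<subseteq> W" "\<And>x. x \<notin> K \<Longrightarrow> h x = 0" using h unfolding test_on_def by blast
    have curl0: "curl h x = 0" if "x \<notin> K" for x
      by (rule curl_eq_0_open[OF open_Compl[OF compact_imp_closed[OF K(1)]]]) (use that K in auto)
    have w: "has_bochner_integral lebesgue (\<lambda>x. cdot (curl h x) (X x) - c * cdot (h x) (Y x) - cdot (h x) (A x)) 0"
      using weak h unfolding weak_curl_def by blast
    have ae: "AE x in lebesgue. cdot (curl h x) (X x) - c * cdot (h x) (Y x) - cdot (h x) (A x)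
        = cdot (curl h x) (X' x) - c * cdot (h x) (Y' x) - cdot (h x) (A x)"
      using X Y
    proof eventually_elim
      case (elim x)
      show ?case
      proof (cases "x \<in> K")
        case True
        then show ?thesis using elim K(2) by auto
      qed (simp add: K curl0 cdot_def)
    qed
    have w': "has_bochner_integral lebesgue (\<lambda>x. cdot (curl h x) (X' x) - c * cdot (h x) (Y' x) - cdot (h x) (A x)) 0"
      by (rule iffD1[OF has_bochner_integral_lebesgue_cong_AE[OF ae] w])
    have p: "has_bochner_integral lebesgue (\<lambda>x. cdot (curl h x) (X' x) - cdot (h x) (curl X' x)) 0"
      by (rule curl_by_parts[OF W K Ck_on_subset[OF test_on_Ck[OF h] subset_UNIV] X'])
    have "(cdot (curl h x) (X' x) - c * cdot (h x) (Y' x) - cdot (h x) (A x)) - (cdot (curl h x) (X' x) - cdot (h x) (curl X' x))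
        = cdot (h x) (?Z x)" for x
      by (simp add: cdot_def sum_3 algebra_simps)
    then show "has_bochner_integral lebesgue (\<lambda>x. cdot (h x) (?Z x)) 0"
      using has_bochner_integral_diff[OF w' p] by simp
  qed
  then show ?thesis by (simp add: algebra_simps)
qed

lemma loc_integrable_continuous:
  fixes f :: "'a::euclidean_space \<Rightarrow> 'b::{banach, second_countable_topology}"
  assumes "continuous_on W f"
  shows "loc_integrable W f"
  unfolding loc_integrable_def
proof (intro allI impI)
  fix K assume K: "compact K" "K \<subseteq> W"
  have "integrable lborel (\<lambda>x. indicator K x *\<^sub>R f x)"
    by (rule borel_integrable_compact[OF K(1) continuous_on_subset[OF assms K(2)]])
  then show "integrable lebesgue (\<lambda>x. indicator K x *\<^sub>R f x)"
    using integrable_completion[of "\<lambda>x. indicator K x *\<^sub>R f x" lborel] borel_measurable_integrable by blast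
qed

text \<open>The axis is a null set, so integrability need only be known off it.\<close>

lemma integrable_lebesgue_on_puncturedD:
  fixes f :: "real^3 \<Rightarrow> 'b::euclidean_space"
  assumes "integrable (lebesgue_on (M1 - gamma1)) f" and f: "\<And>x. x \<notin> M1 \<Longrightarrow> f x = 0"
  shows "integrable lebesgue f"
proof -
  have P: "M1 - gamma1 \<in> sets lebesgue" by (rule sets_lebesgue_open[OF open_punctured])
  have i: "integrable lebesgue (\<lambda>x. indicator (M1 - gamma1) x *\<^sub>R f x)"
    using assms(1) P by (simp add: integrable_restrict_space)
  have "AE x in lebesgue. x \<notin> gamma1"
    using negligible_gamma1 by (intro AE_not_in) (simp add: negligible_iff_null_sets)
  then have ae: "AE x in lebesgue. indicator (M1 - gamma1) x *\<^sub>R f x = f x"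
    by eventually_elim (use f in \<open>auto simp: indicator_def\<close>)
  from i obtain z where "has_bochner_integral lebesgue (\<lambda>x. indicator (M1 - gamma1) x *\<^sub>R f x) z"
    unfolding integrable.simps by blast
  then have "has_bochner_integral lebesgue f z"
    by (rule iffD1[OF has_bochner_integral_lebesgue_cong_AE[OF ae]])
  then show ?thesis by (auto simp: has_bochner_integral_iff)
qed

text \<open>For the flat material the energy density is |E|^2, and |E| \<le> 1 + |E|^2 makes it
  control E on compact sets; the axis is a null set.\<close>

lemma finite_energy_flat:
  fixes E :: form
  assumes m: "E \<in> borel_measurable (lebesgue_on (M1 - gamma1))"
    and fe: "finite_energy (M1 - gamma1) (material flat_metric) E"
  shows "integrable lebesgue (\<lambda>x. indicator M1 x * (norm (E x))\<^sup>2)" "loc_integrable M1 E"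
proof -
  let ?P = "M1 - gamma1"
  have P: "?P \<in> sets lebesgue" by (rule sets_lebesgue_open[OF open_punctured])
  have flat: "(\<Sum>j\<in>UNIV. \<Sum>k\<in>UNIV. of_real (material flat_metric x $ j $ k) * v $ j * cnj (v $ k))
      = of_real ((norm v)\<^sup>2)" for x and v :: "complex^3"
  proof -
    have "(\<Sum>j\<in>UNIV. \<Sum>k\<in>UNIV. of_real (material flat_metric x $ j $ k) * v $ j * cnj (v $ k))
        = (\<Sum>j\<in>UNIV. v $ j * cnj (v $ j))"
      by (simp add: mat_def if_distrib if_distribR cong: if_cong)
    also have "\<dots> = of_real (\<Sum>j\<in>UNIV. (norm (v $ j))\<^sup>2)"
      by (simp only: complex_norm_square of_real_sum)
    also have "(\<Sum>j\<in>UNIV. (norm (v $ j))\<^sup>2) = (norm v)\<^sup>2"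
      by (simp add: norm_vec_def L2_set_def sum_nonneg)
    finally show ?thesis .
  qed
  have "integrable (lebesgue_on ?P) (\<lambda>x. complex_of_real ((norm (E x))\<^sup>2))"
    using fe unfolding finite_energy_def flat .
  then have "integrable (lebesgue_on ?P) (\<lambda>x. Re (complex_of_real ((norm (E x))\<^sup>2)))" by (rule integrable_Re)
  then have i: "integrable (lebesgue_on ?P) (\<lambda>x. (norm (E x))\<^sup>2)" by simp
  have "integrable (lebesgue_on ?P) (\<lambda>x. indicator M1 x * (norm (E x))\<^sup>2) \<longleftrightarrow> integrable (lebesgue_on ?P) (\<lambda>x. (norm (E x))\<^sup>2)"
    by (rule Bochner_Integration.integrable_cong[OF refl]) (auto simp: space_restrict_space)
  then show "integrable lebesgue (\<lambda>x. indicator M1 x * (norm (E x))\<^sup>2)"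
    using i by (intro integrable_lebesgue_on_puncturedD) auto
  show "loc_integrable M1 E"
    unfolding loc_integrable_def
  proof (intro allI impI)
    fix K assume K: "compact K" "K \<subseteq> M1"
    have iK: "integrable lborel (indicator K :: real^3 \<Rightarrow> real)"
      using emeasure_compact_finite[OF K(1)] compact_imp_closed[OF K(1)]
      by (intro integrable_real_indicator) auto
    then have "integrable lebesgue (indicator K :: real^3 \<Rightarrow> real)"
      using integrable_completion[of "indicator K :: real^3 \<Rightarrow> real" lborel] borel_measurable_integrable by blast
    then have iK: "integrable (lebesgue_on ?P) (indicator K :: real^3 \<Rightarrow> real)"
      by (rule integrable_lebesgue_on_subset[OF _ P])
    have "integrable (lebesgue_on ?P) (\<lambda>x. indicator K x *\<^sub>R E x)"
    proof (rule Bochner_Integration.integrable_bound[OF Bochner_Integration.integrable_add[OF iK i]])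
      show "(\<lambda>x. indicator K x *\<^sub>R E x) \<in> borel_measurable (lebesgue_on ?P)"
        by (rule borel_measurable_scaleR[OF borel_measurable_integrable[OF iK] m])
      show "AE x in lebesgue_on ?P. norm (indicator K x *\<^sub>R E x) \<le> norm (indicator K x + (norm (E x))\<^sup>2)"
      proof (rule AE_I2)
        fix x
        have "norm (E x) \<le> 1 * 1\<^sup>2 + (norm (E x))\<^sup>2 / 1" using young_inequality[of 1 1 "norm (E x)"] by simp
        then show "norm (indicator K x *\<^sub>R E x) \<le> norm (indicator K x + (norm (E x))\<^sup>2)"
          by (auto simp: indicator_def)
      qed
    qed
    then show "integrable lebesgue (\<lambda>x. indicator K x *\<^sub>R E x)"
      by (rule integrable_lebesgue_on_puncturedD) (use K in \<open>auto simp: indicator_def\<close>)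
  qed
qed

lemma continuous_on_pull1:
  fixes T :: "real^3 \<Rightarrow> real^3"
  assumes U: "open U" and T: "Ck_on (Suc 0) U T" and S: "S \<subseteq> U" and v: "continuous_on S v"
  shows "continuous_on S (\<lambda>x. pull1 (jacobian T (at x)) (v x))"
proof -
  have p: "continuous_on S (partial j (\<lambda>y. T y $ a))" for j a
    by (rule continuous_on_subset[OF Ck_on_imp_continuous[OF Ck_on_partial[OF Ck_on_vec_nth[OF U T]]] S])
  have "continuous_on S (\<lambda>x. pull1 (jacobian T (at x)) (v x) $ j)" for j
  proof -
    have "continuous_on S (\<lambda>x. \<Sum>a\<in>UNIV. of_real (partial j (\<lambda>y. T y $ a) x) * v x $ a)"
      by (intro continuous_intros p v)
    then show ?thesis
      by (rule continuous_on_eq) (use S jacobian_nth_partial[OF T] in \<open>auto simp: pull1_def intro!: sum.cong\<close>)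
  qed
  then show ?thesis by (subst vec_eq_sum_axis) (intro continuous_on_sum bounded_linear.continuous_on[OF bounded_linear_axis])
qed

lemma jacobian_cong:
  assumes "open U" "x \<in> U" "\<And>y. y \<in> U \<Longrightarrow> f y = g y"
  shows "jacobian f (at x) = jacobian g (at x)"
  unfolding jacobian_def using frechet_derivative_cong_open[OF assms] by simp

lemma continuous_on_locally:
  fixes f :: "'a::t2_space \<Rightarrow> 'b::topological_space"
  assumes "\<And>x. x \<in> S \<Longrightarrow> \<exists>T. open T \<and> x \<in> T \<and> continuous_on (S \<inter> T) f"
  shows "continuous_on S f"
  unfolding continuous_on_eq_continuous_within
proof
  fix x assume x: "x \<in> S"
  then obtain T where T: "open T" "x \<in> T" "continuous_on (S \<inter> T) f" using assms by blast
  then have "continuous (at x within S \<inter> T) f" using x by (simp add: continuous_on_eq_continuous_within)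
  moreover have "at x within S \<inter> T = at x within S"
    by (rule at_within_nhd[OF T(2,1)]) auto
  ultimately show "continuous (at x within S) f" by simp
qed

section \<open>Transport of classical solutions and boundary values\<close>

context coating
begin

lemma N1_sets: "N1 \<in> sets lebesgue"
  by (rule sets_lebesgue_open[OF open_N1])

lemma F_differentiable: "F differentiable_on M1 - gamma1"
  unfolding differentiable_on_def using Ck_on_F[of "Suc 0"] by (auto intro: differentiable_at_withinI)

lemma F_inv_differentiable: "F_inv F differentiable_on N1"
  unfolding differentiable_on_def using Ck_on_F_inv[of "Suc 0"] by (auto intro: differentiable_at_withinI)

text \<open>On \<open>N1\<close> the material is continuous: it is a formula in the Jacobian of F
  evaluated at \<open>F_inv\<close>, whose determinant is nonzero.\<close>

lemma apply_material_measurable: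
  fixes E :: form
  assumes E: "E \<in> borel_measurable (lebesgue_on N1)"
  shows "apply_material (material (g_tilde F)) E \<in> borel_measurable (lebesgue_on N1)"
proof -
  let ?P = "M1 - gamma1" and ?G = "F_inv F"
  have cj: "continuous_on ?P (\<lambda>x. jacobian F (at x) $ a $ b)" for a b
    by (rule continuous_on_eq[OF Ck_on_imp_continuous[OF Ck_on_partial[OF Ck_on_vec_nth[OF open_punctured Ck_on_F[of "Suc 0"]]], of b a]])
      (rule jacobian_nth_partial[OF Ck_on_F[of "Suc 0"], symmetric])
  have cG: "continuous_on N1 ?G" by (rule Ck_on_imp_continuous[OF Ck_on_F_inv])
  have cjG: "continuous_on N1 (\<lambda>y. jacobian F (at (?G y)) $ a $ b)" for a b
    by (rule continuous_on_compose2[OF cj cG]) (use F_F_inv(2) in blast)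
  have ceps: "continuous_on N1 (\<lambda>y. material (g_tilde F) y $ j $ l)" for j l
  proof (rule continuous_on_eq)
    show "continuous_on N1 (\<lambda>y. (1 / det (jacobian F (at (?G y)))) * (\<Sum>b\<in>UNIV. jacobian F (at (?G y)) $ j $ b * jacobian F (at (?G y)) $ l $ b))"
    proof -
      have "continuous_on N1 (\<lambda>y. det (jacobian F (at (?G y))))"
        unfolding det_3 by (intro continuous_on_add continuous_on_diff continuous_on_mult cjG)
      moreover have "\<forall>y\<in>N1. det (jacobian F (at (?G y))) \<noteq> 0"
      proof
        fix y assume "y \<in> N1"
        from det_jacobian_F(2)[OF F_F_inv(2)[OF this]] show "det (jacobian F (at (?G y))) \<noteq> 0" by simp
      qed
      ultimately show ?thesis
        by (intro continuous_on_mult continuous_on_divide continuous_on_const continuous_on_sum cjG)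
    qed
    show "(1 / det (jacobian F (at (?G y)))) * (\<Sum>b\<in>UNIV. jacobian F (at (?G y)) $ j $ b * jacobian F (at (?G y)) $ l $ b)
        = material (g_tilde F) y $ j $ l" if "y \<in> N1" for y
      using material_g_tilde[OF F_F_inv(2)[OF that]] F_F_inv(1)[OF that]
      by (simp add: matrix_matrix_mult_def transpose_def)
  qed
  have Ej: "(\<lambda>y. E y $ j) \<in> borel_measurable (lebesgue_on N1)" for j
    by (rule measurable_compose[OF E borel_measurable_continuous_onI]) (intro continuous_intros)
  have c: "(\<lambda>y. \<Sum>j\<in>UNIV. of_real (material (g_tilde F) y $ j $ l) * E y $ j) \<in> borel_measurable (lebesgue_on N1)" for l
    by (intro borel_measurable_sum borel_measurable_times Ej
        continuous_imp_measurable_on_sets_lebesgue[OF _ N1_sets] continuous_intros ceps)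
  have ax: "(\<lambda>y. axis l (g y) :: complex^3) \<in> borel_measurable (lebesgue_on N1)"
    if "g \<in> borel_measurable (lebesgue_on N1)" for g :: "real^3 \<Rightarrow> complex" and l
    by (rule measurable_compose[OF that borel_measurable_continuous_onI])
      (intro linear_continuous_on bounded_linear_axis)
  have "(\<lambda>y. \<Sum>l\<in>UNIV. axis l (\<Sum>j\<in>UNIV. of_real (material (g_tilde F) y $ j $ l) * E y $ j)) \<in> borel_measurable (lebesgue_on N1)"
    by (intro borel_measurable_sum ax c)
  also have "(\<lambda>y. \<Sum>l\<in>UNIV. axis l (\<Sum>j\<in>UNIV. of_real (material (g_tilde F) y $ j $ l) * E y $ j)) = apply_material (material (g_tilde F)) E"
    by (rule ext, subst vec_eq_sum_axis) (simp add: apply_material_def)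
  finally show ?thesis .
qed

text \<open>The field is pulled back by the smooth extension of \<open>F_inv\<close> beyond the
  outer boundary rather than by \<open>F_inv\<close> itself, which yields continuity up to
  \<open>outer_bdry\<close>. The tangential values survive by
  \<open>tangential_fixed\<close>.\<close>

lemma push_forward_classical:
  fixes E' :: form
  assumes E': "Ck_on 1 M1 E'" "continuous_on (M1 \<union> outer_bdry) E'"
  obtains Et' :: form where "Ck_on 1 N1 Et'" "continuous_on (N1 \<union> outer_bdry) Et'"
    "\<And>x. x \<in> M1 - gamma1 \<Longrightarrow> pullback1 F Et' x = E' x"
    "\<And>x. x \<in> M1 - gamma1 \<Longrightarrow> pull2 (jacobian F (at x)) (curl Et' (F x)) = curl E' x"
    "\<And>x. x \<in> outer_bdry \<Longrightarrow> cross_rc (nu x) (Et' x) = cross_rc (nu x) (E' x)"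
    "\<And>Et. AE x in lebesgue_on (M1 - gamma1). E' x = pullback1 F Et x \<Longrightarrow> AE y in lebesgue_on N1. Et y = Et' y"
proof -
  let ?P = "M1 - gamma1" and ?G = "F_inv F"
  obtain U Ge where G: "open U" "N1 \<union> outer_bdry \<subseteq> U" "\<forall>n. Ck_on n U Ge"
    "\<forall>y\<in>N1. Ge y = F_inv F y" "\<forall>y\<in>outer_bdry. Ge y = y"
    using F_inv_ext by (elim exE conjE) (rule that)
  define Et' where "Et' y = pull1 (jacobian Ge (at y)) (E' (Ge y))" for y
  have eq: "Et' y = pullback1 ?G E' y" if "y \<in> N1" for y
    unfolding Et'_def pullback1_eq using G(4) that jacobian_cong[OF open_N1 that, of Ge ?G] by simp
  have CG: "Ck_on 1 N1 (pullback1 ?G E')"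
    by (rule Ck_on_pullback1[OF open_N1 open_M1 _ Ck_on_F_inv E'(1)]) (use F_F_inv(2) in blast)
  then have C1: "Ck_on 1 N1 Et'" by (rule Ck_on_cong[OF open_N1, rotated]) (simp add: eq)
  have "Ge ` (N1 \<union> outer_bdry) \<subseteq> M1 \<union> outer_bdry" using G(4,5) F_F_inv(2) by auto
  then have "continuous_on (N1 \<union> outer_bdry) (\<lambda>y. E' (Ge y))"
    by (rule continuous_on_compose2[OF E'(2) continuous_on_subset[OF Ck_on_imp_continuous[OF G(3)[rule_format]] G(2)]])
  then have c: "continuous_on (N1 \<union> outer_bdry) Et'"
    unfolding Et'_def[abs_def] by (rule continuous_on_pull1[OF G(1) G(3)[rule_format] G(2)])
  have pb: "pullback1 F Et' x = E' x" if "x \<in> ?P" for x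
    using pullback_F_inv[OF that, of E'] eq[OF F_in_N1[OF that]] by (simp add: pullback1_eq)
  have cu: "pull2 (jacobian F (at x)) (curl Et' (F x)) = curl E' x" if "x \<in> ?P" for x
  proof -
    have "curl (pullback1 F Et') x = pull2 (jacobian F (at x)) (curl Et' (F x))"
      by (rule curl_pullback1[OF open_punctured open_N1 _ Ck_on_F C1 that]) (simp add: F_image)
    moreover have "curl (pullback1 F Et') x = curl E' x" by (rule curl_cong[OF open_punctured that pb])
    ultimately show ?thesis by simp
  qed
  have nu: "cross_rc (nu x) (Et' x) = cross_rc (nu x) (E' x)" if "x \<in> outer_bdry" for x
  proof -
    have "Et' x = pull1 (jacobian Ge (at x)) (E' x)" using G(5) that by (simp add: Et'_def)
    moreover have "cross_rc (nu x) (pull1 (jacobian Ge (at x)) (E' x)) = cross_rc (nu x) (E' x)"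
      by (rule tangential_fixed[OF G(3)[rule_format, of "Suc 0"] _ _ that]) (use G(2,5) in auto)
    ultimately show ?thesis by simp
  qed
  have ae: "AE y in lebesgue_on N1. Et y = Et' y" if "AE x in lebesgue_on ?P. E' x = pullback1 F Et x" for Et
  proof -
    have "AE y in lebesgue_on N1. E' (?G y) = pullback1 F Et (?G y)"
      by (rule AE_lebesgue_on_vimage[OF N1_sets punctured_sets F_differentiable _ that]) (use F_F_inv in blast)
    moreover have "AE y in lebesgue_on N1. y \<in> N1" by (rule AE_I2) (simp add: space_restrict_space)
    ultimately show ?thesis
    proof eventually_elim
      case (elim y)
      have x: "?G y \<in> ?P" "F (?G y) = y" using F_F_inv[OF elim(2)] by auto
      have "Et' y = pull1 (jacobian ?G (at y)) (pull1 (jacobian F (at (?G y))) (Et y))"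
        unfolding eq[OF elim(2)] pullback1_eq elim(1) x(2) ..
      also have "\<dots> = Et y" using jacobian_inverse[OF x(1)] unfolding x(2) by (rule pull1_inverse)
      finally show ?case by simp
    qed
  qed
  show ?thesis by (rule that[OF C1 c pb cu nu ae])
qed

text \<open>The representative X' from interior regularity lives on \<open>M1\<close> only. Near the
  outer boundary the pull-back of Xt' by the smooth extension of F is a second representative,
  continuous up to the boundary; the two agree where both exist and so supply the boundary values of
  Z.\<close>

lemma extend_to_boundary:
  fixes X X' Xt Xt' :: form
  assumes X': "continuous_on M1 X'" "AE x in lebesgue. x \<in> M1 \<longrightarrow> X x = X' x"
    and X: "AE x in lebesgue_on (M1 - gamma1). X x = pullback1 F Xt x"
    and U: "open U" "outer_bdry \<subseteq> U"
    and Xt': "continuous_on ((U \<inter> N1) \<union> outer_bdry) Xt'" "AE y in lebesgue_on (U \<inter> N1). Xt y = Xt' y"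
  obtains Z where "continuous_on (M1 \<union> outer_bdry) Z" "\<And>x. x \<in> M1 \<Longrightarrow> Z x = X' x"
    "\<And>x. x \<in> outer_bdry \<Longrightarrow> cross_rc (nu x) (Z x) = cross_rc (nu x) (Xt' x)"
proof -
  let ?P = "M1 - gamma1"
  obtain V Fe where Fe: "open V" "?P \<union> outer_bdry \<subseteq> V" "\<forall>n. Ck_on n V Fe" "\<forall>x\<in>?P \<union> outer_bdry. Fe x = F x"
    using F_ext by (elim exE conjE) (rule that)
  have FeB: "Fe x = x" if "x \<in> outer_bdry" for x using Fe(4) F_outer[OF that] that by simp
  have cFe: "continuous_on V Fe" by (rule Ck_on_imp_continuous[OF Fe(3)[rule_format]])
  define W where "W = V \<inter> Fe -` U"
  have W: "open W" unfolding W_def by (rule continuous_open_preimage[OF cFe Fe(1) U(1)])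
  have BW: "outer_bdry \<subseteq> W" using Fe(2) U(2) FeB by (auto simp: W_def)
  define Y where "Y x = pull1 (jacobian Fe (at x)) (Xt' (Fe x))" for x
  let ?S = "(W \<inter> ?P) \<union> outer_bdry"
  have SV: "?S \<subseteq> V" using Fe(2) by blast
  have "Fe ` ?S \<subseteq> (U \<inter> N1) \<union> outer_bdry"
    using Fe(4) FeB F_in_N1 by (auto simp: W_def)
  then have "continuous_on ?S (\<lambda>x. Xt' (Fe x))"
    by (rule continuous_on_compose2[OF Xt'(1) continuous_on_subset[OF cFe SV]])
  then have cY: "continuous_on ?S Y"
    unfolding Y_def[abs_def] by (rule continuous_on_pull1[OF Fe(1) Fe(3)[rule_format] SV])
  have oWP: "open (W \<inter> ?P)" by (intro open_Int W open_punctured)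
  have oUN: "open (U \<inter> N1)" by (intro open_Int U open_N1)
  have "AE x in lebesgue_on (W \<inter> ?P). Xt (F x) = Xt' (F x)"
  proof (rule AE_lebesgue_on_vimage[OF sets_lebesgue_open[OF oWP] sets_lebesgue_open[OF oUN] _ _ Xt'(2)])
    show "F_inv F differentiable_on U \<inter> N1" using F_inv_differentiable by (rule differentiable_on_subset) blast
    show "F x \<in> U \<inter> N1 \<and> F_inv F (F x) = x" if "x \<in> W \<inter> ?P" for x
      using that F_in_N1 F_inv_F Fe(4) by (auto simp: W_def)
  qed
  then have a1: "AE x in lebesgue. x \<in> W \<inter> ?P \<longrightarrow> Xt (F x) = Xt' (F x)"
    by (rule AE_lebesgue_on_D[OF _ sets_lebesgue_open[OF oWP]])
  have a2: "AE x in lebesgue. x \<in> ?P \<longrightarrow> X x = pullback1 F Xt x"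
    by (rule AE_lebesgue_on_D[OF X punctured_sets])
  \<comment> \<open>Both are continuous on the open overlap and agree with X there almost
    everywhere.\<close>
  have YX: "Y x = X' x" if x: "x \<in> W \<inter> ?P" for x
  proof (rule eq_on_open_if_AE_eq[OF oWP, of Y X' x])
    show "continuous_on (W \<inter> ?P) Y" using cY by (rule continuous_on_subset) blast
    show "continuous_on (W \<inter> ?P) X'" using X'(1) by (rule continuous_on_subset) blast
    show "AE x in lebesgue. x \<in> W \<inter> ?P \<longrightarrow> Y x = X' x"
      using a1 a2 X'(2)
    proof eventually_elim
      case (elim x)
      show ?case
      proof
        assume x: "x \<in> W \<inter> ?P"
        then have "jacobian Fe (at x) = jacobian F (at x)"
          by (intro jacobian_cong[OF open_punctured]) (use Fe(4) in auto)
        moreover have "Fe x = F x" using x Fe(4) by blast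
        moreover have "Xt (F x) = Xt' (F x)" using elim(1) x by blast
        moreover have "X x = pullback1 F Xt x" "X x = X' x" using elim(2,3) x by blast+
        ultimately show "Y x = X' x" by (simp add: Y_def pullback1_eq)
      qed
    qed
  qed (rule x)
  define Z where "Z x = (if x \<in> outer_bdry then Y x else X' x)" for x
  have disj: "x \<notin> outer_bdry" if "x \<in> M1" for x using that by (auto simp: M1_def mem_outer_bdry)
  have ZS: "Z x = Y x" if "x \<in> ?S" for x
    using that YX[of x] by (auto simp: Z_def)
  have cZ: "continuous_on (M1 \<union> outer_bdry) Z"
  proof (rule continuous_on_locally)
    fix x assume "x \<in> M1 \<union> outer_bdry"
    then show "\<exists>T. open T \<and> x \<in> T \<and> continuous_on ((M1 \<union> outer_bdry) \<inter> T) Z"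
    proof
      assume x: "x \<in> M1"
      have "continuous_on M1 Z" using X'(1) by (rule continuous_on_eq) (use disj in \<open>auto simp: Z_def\<close>)
      then have "continuous_on ((M1 \<union> outer_bdry) \<inter> M1) Z" by (rule continuous_on_subset) blast
      then show ?thesis using x open_M1 by blast
    next
      assume x: "x \<in> outer_bdry"
      have xg: "x \<notin> gamma1" using x cyl_radius_eq_0_iff[of x] by (auto simp: mem_outer_bdry)
      have "continuous_on ?S Z" using cY by (rule continuous_on_eq) (simp add: ZS)
      then have "continuous_on ((M1 \<union> outer_bdry) \<inter> (W - gamma1)) Z" by (rule continuous_on_subset) blast
      then show ?thesis using x xg BW open_Diff[OF W closed_gamma1] by blast
    qed
  qed
  have nuZ: "cross_rc (nu x) (Z x) = cross_rc (nu x) (Xt' x)" if x: "x \<in> outer_bdry" for x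
  proof -
    have "Z x = pull1 (jacobian Fe (at x)) (Xt' x)" using x FeB[OF x] by (simp add: Z_def Y_def)
    moreover have "cross_rc (nu x) (pull1 (jacobian Fe (at x)) (Xt' x)) = cross_rc (nu x) (Xt' x)"
      by (rule tangential_fixed[OF Fe(3)[rule_format, of "Suc 0"] _ FeB x]) (use Fe(2) in blast)
    ultimately show ?thesis by simp
  qed
  show ?thesis by (rule that[OF cZ _ nuZ]) (use disj in \<open>simp_all add: Z_def\<close>)
qed

end

lemma SHS_test_forms_Ck:
  assumes "h \<in> SHS_test_forms"
  shows "Ck_on n N1 h"
proof -
  obtain V g where g: "open V" "N1 \<union> Sigma1 \<subseteq> V" "\<And>n. Ck_on n V g" "\<And>x. x \<in> N1 \<union> Sigma1 \<Longrightarrow> g x = h x"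
    using assms unfolding SHS_test_forms_def test_forms_def smooth_on_def by blast
  show ?thesis by (rule Ck_on_cong[OF open_N1 _ Ck_on_subset[OF g(3)]]) (use g in auto)
qed

text \<open>J is prescribed off the axis only. It vanishes near every point of the axis, so the
  value 0 there fits smoothly.\<close>

lemma Ck_on_extend_current:
  assumes J: "smooth_on (M1 - gamma1) J" and supp: "closure {x \<in> M1 - gamma1. J x \<noteq> 0} \<inter> gamma1 = {}"
  shows "Ck_on n M1 (\<lambda>x. if x \<in> gamma1 then 0 else J x)" (is "Ck_on n M1 ?J")
proof (rule Ck_on_local)
  fix x assume x: "x \<in> M1"
  let ?C = "closure {x \<in> M1 - gamma1. J x \<noteq> 0}"
  show "\<exists>V. open V \<and> x \<in> V \<and> Ck_on n V ?J"
  proof (cases "x \<in> gamma1")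
    case True
    have o: "open (M1 - ?C)" by (rule open_Diff[OF open_M1 closed_closure])
    have "0 = ?J y" if "y \<in> M1 - ?C" for y
      using that closure_subset[of "{x \<in> M1 - gamma1. J x \<noteq> 0}"] by auto
    then have "Ck_on n (M1 - ?C) ?J" by (rule Ck_on_cong[OF o _ Ck_on_const])
    then show ?thesis using True x supp o by blast
  next
    case False
    obtain U g where g: "open U" "M1 - gamma1 \<subseteq> U" "\<And>n. Ck_on n U g" "\<And>x. x \<in> M1 - gamma1 \<Longrightarrow> g x = J x"
      using J unfolding smooth_on_def by blast
    have "Ck_on n (M1 - gamma1) ?J"
      by (rule Ck_on_cong[OF open_punctured _ Ck_on_subset[OF g(3,2)]]) (use g in auto)
    then show ?thesis using x False open_punctured by blast
  qed
qed

section \<open>The two implications\<close>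

context coating
begin

text \<open>The weak equations are pulled back off the axis and extended across it by
  \<open>weak_curl_removable\<close>. Maxwell's system is invariant under exchanging E and H
  together with the sign of k, so the regularity lemma serves for both fields.\<close>

lemma classical_if_SHS:
  fixes E H Et Ht J Jt f :: form
  assumes k: "k \<noteq> 0"
    and mE: "E \<in> borel_measurable (lebesgue_on (M1 - gamma1))" and mH: "H \<in> borel_measurable (lebesgue_on (M1 - gamma1))"
    and E: "AE x in lebesgue_on (M1 - gamma1). E x = pullback1 F Et x"
    and H: "AE x in lebesgue_on (M1 - gamma1). H x = pullback1 F Ht x"
    and J: "\<And>n. Ck_on n M1 J" "\<And>x. x \<in> M1 - gamma1 \<Longrightarrow> J x = pull2 (jacobian F (at x)) (Jt (F x))"
    and sol: "finite_energy_SHS_solution (material (g_tilde F)) (material (g_tilde F)) k Jt f Et Ht"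
  shows "classical_solution M1 outer_bdry (material flat_metric) (material flat_metric) k J f E H"
    "finite_energy (M1 - gamma1) (material flat_metric) E"
    "finite_energy (M1 - gamma1) (material flat_metric) H"
proof -
  let ?P = "M1 - gamma1" and ?eps = "material (g_tilde F)"
  define c where "c = \<i> * complex_of_real k"
  have fe: "finite_energy N1 ?eps Et" "finite_energy N1 ?eps Ht"
    using sol unfolding finite_energy_SHS_solution_def by blast+
  have w: "has_bochner_integral (lebesgue_on N1)
      (\<lambda>x. cdot (curl h x) (Et x) - c * cdot (h x) (apply_material ?eps Ht x)) 0"
    "has_bochner_integral (lebesgue_on N1)
      (\<lambda>x. cdot (curl h x) (Ht x) + cdot (h x) (c *s apply_material ?eps Et x - Jt x)) 0"
    if "h \<in> SHS_test_forms" for h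
    using sol that unfolding finite_energy_SHS_solution_def c_def by blast+
  show feE: "finite_energy ?P (material flat_metric) E" using energy_transfer[OF E] fe(1) by blast
  show feH: "finite_energy ?P (material flat_metric) H" using energy_transfer[OF H] fe(2) by blast
  note E2 = finite_energy_flat[OF mE feE] and H2 = finite_energy_flat[OF mH feH]
  have p1: "weak_curl ?P c E H (\<lambda>_. 0)"
  proof (rule weak_curl_punctured[OF E H, where At = "\<lambda>_. 0"])
    fix h assume h: "h \<in> SHS_test_forms"
    show "has_bochner_integral (lebesgue_on N1)
      (\<lambda>y. cdot (curl h y) (Et y) - c * cdot (h y) (apply_material ?eps Ht y) - cdot (h y) 0) 0"
      using w(1)[OF h] by (simp add: cdot_def)
  qed (simp add: pull2_def vec_eq_iff)
  have p2: "weak_curl ?P (- c) H E J"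
  proof (rule weak_curl_punctured[OF H E J(2)])
    fix h assume h: "h \<in> SHS_test_forms"
    have "cdot (curl h y) (Ht y) + cdot (h y) (c *s apply_material ?eps Et y - Jt y)
        = cdot (curl h y) (Ht y) - (- c) * cdot (h y) (apply_material ?eps Et y) - cdot (h y) (Jt y)" for y
      by (simp add: cdot_def sum_3 algebra_simps)
    then show "has_bochner_integral (lebesgue_on N1)
      (\<lambda>y. cdot (curl h y) (Ht y) - (- c) * cdot (h y) (apply_material ?eps Et y) - cdot (h y) (Jt y)) 0"
      using w(2)[OF h] by (simp only:)
  qed
  have W1: "weak_curl M1 c E H (\<lambda>_. 0)"
    by (rule weak_curl_removable[OF p1 E2(2) H2(2) loc_integrable_continuous[OF continuous_on_const] E2(1)])
  have W2: "weak_curl M1 (- c) H E J"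
    by (rule weak_curl_removable[OF p2 H2(2) E2(2) loc_integrable_continuous[OF Ck_on_imp_continuous[OF J(1)]] H2(1)])
  \<comment> \<open>Brings the first equation into the shape that the regularity lemma expects when
    - c takes the place of c.\<close>
  have W1': "weak_curl M1 (- (- c)) E H (\<lambda>_. 0)" using W1 by (simp only: minus_minus)
  obtain E' where E': "Ck_on 1 M1 E'" "AE x in lebesgue. x \<in> M1 \<longrightarrow> E x = E' x"
    by (rule weak_maxwell_regular[OF open_M1 k c_def Ck_on_const J(1) E2(2) W1 W2])
  have k': "- k \<noteq> 0" "- c = \<i> * complex_of_real (- k)" using k by (simp_all add: c_def)
  obtain H' where H': "Ck_on 1 M1 H'" "AE x in lebesgue. x \<in> M1 \<longrightarrow> H x = H' x"
    by (rule weak_maxwell_regular[OF open_M1 k' J(1) Ck_on_const H2(2) W2 W1'])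
  note cont = Ck_on_imp_continuous[OF E'(1)] Ck_on_imp_continuous[OF H'(1)]
  have curlE: "curl E' x = c *s H' x + 0" if "x \<in> M1" for x
    by (rule strong_curl_from_weak[OF open_M1 E'(1) cont(2) continuous_on_const E'(2) H'(2) W1 that])
  have curlH: "curl H' x = (- c) *s E' x + J x" if "x \<in> M1" for x
    by (rule strong_curl_from_weak[OF open_M1 H'(1) cont(1) Ck_on_imp_continuous[OF J(1)] H'(2) E'(2) W2 that])
  obtain U where U: "open U" "outer_bdry \<subseteq> U" "classical_solution (U \<inter> N1) outer_bdry ?eps ?eps k Jt f Et Ht"
    using sol unfolding finite_energy_SHS_solution_def by blast
  from U(3) obtain Et' Ht' where t: "AE x in lebesgue_on (U \<inter> N1). Et x = Et' x \<and> Ht x = Ht' x"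
    "continuous_on ((U \<inter> N1) \<union> outer_bdry) Et'" "continuous_on ((U \<inter> N1) \<union> outer_bdry) Ht'"
    "\<forall>x\<in>outer_bdry. cross_rc (nu x) (Et' x) = f x"
    unfolding classical_solution_def by (elim exE conjE) (rule that)
  have t1: "AE x in lebesgue_on (U \<inter> N1). Et x = Et' x" "AE x in lebesgue_on (U \<inter> N1). Ht x = Ht' x"
    using t(1) by (auto elim: eventually_mono)
  obtain ZE where ZE: "continuous_on (M1 \<union> outer_bdry) ZE" "\<And>x. x \<in> M1 \<Longrightarrow> ZE x = E' x"
    "\<And>x. x \<in> outer_bdry \<Longrightarrow> cross_rc (nu x) (ZE x) = cross_rc (nu x) (Et' x)"
    by (rule extend_to_boundary[OF cont(1) E'(2) E U(1,2) t(2) t1(1)]) (rule that)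
  obtain ZH where ZH: "continuous_on (M1 \<union> outer_bdry) ZH" "\<And>x. x \<in> M1 \<Longrightarrow> ZH x = H' x"
    by (rule extend_to_boundary[OF cont(2) H'(2) H U(1,2) t(3) t1(2)]) (rule that)
  show "classical_solution M1 outer_bdry (material flat_metric) (material flat_metric) k J f E H"
    unfolding classical_solution_def
  proof (intro exI conjI)
    have "AE x in lebesgue. x \<in> M1 \<longrightarrow> E x = ZE x \<and> H x = ZH x"
      using E'(2) H'(2) by eventually_elim (auto simp: ZE(2) ZH(2))
    then show "AE x in lebesgue_on M1. E x = ZE x \<and> H x = ZH x"
      by (rule AE_lebesgue_on_I[OF _ sets_lebesgue_open[OF open_M1]])
    show "Ck_on 1 M1 ZE" by (rule Ck_on_cong[OF open_M1 _ E'(1)]) (simp add: ZE(2))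
    show "Ck_on 1 M1 ZH" by (rule Ck_on_cong[OF open_M1 _ H'(1)]) (simp add: ZH(2))
    show "continuous_on (M1 \<union> outer_bdry) ZE" "continuous_on (M1 \<union> outer_bdry) ZH" by (rule ZE ZH)+
    show "\<forall>x\<in>M1. curl ZE x = (\<i> * complex_of_real k) *s apply_material (material flat_metric) ZH x"
    proof
      fix x assume x: "x \<in> M1"
      have "curl ZE x = curl E' x" by (rule curl_cong[OF open_M1 x ZE(2)])
      then show "curl ZE x = (\<i> * complex_of_real k) *s apply_material (material flat_metric) ZH x"
        using curlE[OF x] x by (simp add: ZH(2) c_def)
    qed
    show "\<forall>x\<in>M1. curl ZH x = - ((\<i> * complex_of_real k) *s apply_material (material flat_metric) ZE x) + J x"
    proof
      fix x assume x: "x \<in> M1"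
      have "curl ZH x = curl H' x" by (rule curl_cong[OF open_M1 x ZH(2)])
      then show "curl ZH x = - ((\<i> * complex_of_real k) *s apply_material (material flat_metric) ZE x) + J x"
        using curlH[OF x] x by (simp add: ZE(2) c_def vec_eq_iff)
    qed
    show "\<forall>x\<in>outer_bdry. cross_rc (nu x) (ZE x) = f x" using ZE(3) t(4) by simp
  qed
qed

text \<open>The finite energies enter as hypotheses because smoothness gives no decay along the
  unbounded cylinder.\<close>

lemma SHS_if_classical:
  fixes E H Et Ht J Jt f :: form
  assumes mEt: "Et \<in> borel_measurable (lebesgue_on N1)" and mHt: "Ht \<in> borel_measurable (lebesgue_on N1)"
    and E: "AE x in lebesgue_on (M1 - gamma1). E x = pullback1 F Et x"
    and H: "AE x in lebesgue_on (M1 - gamma1). H x = pullback1 F Ht x"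
    and J: "continuous_on M1 J" "\<And>x. x \<in> M1 - gamma1 \<Longrightarrow> J x = pull2 (jacobian F (at x)) (Jt (F x))"
    and sol: "classical_solution M1 outer_bdry (material flat_metric) (material flat_metric) k J f E H"
    and feE: "finite_energy (M1 - gamma1) (material flat_metric) E"
    and feH: "finite_energy (M1 - gamma1) (material flat_metric) H"
  shows "finite_energy_SHS_solution (material (g_tilde F)) (material (g_tilde F)) k Jt f Et Ht"
proof -
  let ?P = "M1 - gamma1" and ?eps = "material (g_tilde F)"
  define c where "c = \<i> * complex_of_real k"
  obtain E' H' where s: "AE x in lebesgue_on M1. E x = E' x \<and> H x = H' x"
    "Ck_on 1 M1 E'" "Ck_on 1 M1 H'"
    "continuous_on (M1 \<union> outer_bdry) E'" "continuous_on (M1 \<union> outer_bdry) H'"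
    "\<forall>x\<in>M1. curl E' x = c *s apply_material (material flat_metric) H' x"
    "\<forall>x\<in>M1. curl H' x = - (c *s apply_material (material flat_metric) E' x) + J x"
    "\<forall>x\<in>outer_bdry. cross_rc (nu x) (E' x) = f x"
    using sol unfolding classical_solution_def c_def[symmetric] by (elim exE conjE) (rule that)
  have curlE: "curl E' x = c *s H' x" and curlH: "curl H' x = (- c) *s E' x + J x" if "x \<in> M1" for x
    using s(6,7) that by (simp_all add: vec_eq_iff)
  have sP: "AE x in lebesgue_on ?P. E x = E' x \<and> H x = H' x"
    by (rule AE_lebesgue_on_mono[OF s(1) sets_lebesgue_open[OF open_M1] punctured_sets Diff_subset])
  have E': "AE x in lebesgue_on ?P. E' x = pullback1 F Et x"
    using sP E by eventually_elim simp
  have H': "AE x in lebesgue_on ?P. H' x = pullback1 F Ht x"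
    using sP H by eventually_elim simp
  obtain Et' where Et': "Ck_on 1 N1 Et'" "continuous_on (N1 \<union> outer_bdry) Et'"
    "\<And>x. x \<in> ?P \<Longrightarrow> pullback1 F Et' x = E' x"
    "\<And>x. x \<in> ?P \<Longrightarrow> pull2 (jacobian F (at x)) (curl Et' (F x)) = curl E' x"
    "\<And>x. x \<in> outer_bdry \<Longrightarrow> cross_rc (nu x) (Et' x) = cross_rc (nu x) (E' x)"
    "\<And>Et. AE x in lebesgue_on ?P. E' x = pullback1 F Et x \<Longrightarrow> AE y in lebesgue_on N1. Et y = Et' y"
    by (rule push_forward_classical[OF s(2,4)]) (rule that)
  obtain Ht' where Ht': "Ck_on 1 N1 Ht'" "continuous_on (N1 \<union> outer_bdry) Ht'"
    "\<And>x. x \<in> ?P \<Longrightarrow> pullback1 F Ht' x = H' x"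
    "\<And>x. x \<in> ?P \<Longrightarrow> pull2 (jacobian F (at x)) (curl Ht' (F x)) = curl H' x"
    "\<And>x. x \<in> outer_bdry \<Longrightarrow> cross_rc (nu x) (Ht' x) = cross_rc (nu x) (H' x)"
    "\<And>Et. AE x in lebesgue_on ?P. H' x = pullback1 F Et x \<Longrightarrow> AE y in lebesgue_on N1. Et y = Ht' y"
    by (rule push_forward_classical[OF s(3,5)]) (rule that)
  have eps: "pull2 (jacobian F (at x)) (apply_material ?eps v (F x)) = pullback1 F v x" if "x \<in> ?P" for v x
    unfolding pullback1_eq using det_jacobian_F(2)[OF that]
    by (intro apply_material_pull material_g_tilde[OF that]) simp
  have det: "det (jacobian F (at x)) \<noteq> 0" if "x \<in> ?P" for x
    using det_jacobian_F(2)[OF that] by simp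
  have cl: "curl Et' y = c *s apply_material ?eps Ht' y"
    "curl Ht' y = - (c *s apply_material ?eps Et' y) + Jt y" if y: "y \<in> N1" for y
  proof -
    define x where "x = F_inv F y"
    have x: "x \<in> ?P" "F x = y" using F_F_inv[OF y] by (simp_all add: x_def)
    have M: "x \<in> M1" using x by blast
    \<comment> \<open>The equations on \<open>N1\<close> are compared after pull-back to x, where
      they are the equations on \<open>M1\<close>; the pull-back of 2-forms is injective.\<close>
    have "pull2 (jacobian F (at x)) (curl Et' y) = pull2 (jacobian F (at x)) (c *s apply_material ?eps Ht' y)"
      unfolding pull2_lin using Et'(4)[OF x(1)] eps[OF x(1), of Ht'] Ht'(3)[OF x(1)] curlE[OF M] x(2) by simp
    then show "curl Et' y = c *s apply_material ?eps Ht' y" by (rule pull2_inj[OF det[OF x(1)]])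
    have "pull2 (jacobian F (at x)) (curl Ht' y)
        = pull2 (jacobian F (at x)) (- (c *s apply_material ?eps Et' y) + Jt y)"
      unfolding pull2_lin using Ht'(4)[OF x(1)] eps[OF x(1), of Et'] Et'(3)[OF x(1)] curlH[OF M] J(2)[OF x(1)] x(2)
      by (simp add: vec_eq_iff)
    then show "curl Ht' y = - (c *s apply_material ?eps Et' y) + Jt y" by (rule pull2_inj[OF det[OF x(1)]])
  qed
  \<comment> \<open>The transformed fields are classical on all of \<open>N1\<close>, so no smaller
    neighbourhood of the outer boundary has to be chosen.\<close>
  have classical: "classical_solution (UNIV \<inter> N1) outer_bdry ?eps ?eps k Jt f Et Ht"
    unfolding classical_solution_def Int_UNIV_left
  proof (intro exI conjI)
    show "AE x in lebesgue_on N1. Et x = Et' x \<and> Ht x = Ht' x"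
      using Et'(6)[OF E'] Ht'(6)[OF H'] by eventually_elim simp
    show "\<forall>x\<in>outer_bdry. cross_rc (nu x) (Et' x) = f x" using Et'(5) s(8) by simp
    show "\<forall>x\<in>N1. curl Et' x = (\<i> * complex_of_real k) *s apply_material ?eps Ht' x"
      "\<forall>x\<in>N1. curl Ht' x = - ((\<i> * complex_of_real k) *s apply_material ?eps Et' x) + Jt x"
      using cl unfolding c_def by blast+
  qed (rule Et' Ht')+
  have c0: "continuous_on M1 E'" "continuous_on M1 H'"
    using Ck_on_imp_continuous[OF s(2)] Ck_on_imp_continuous[OF s(3)] .
  have w1: "has_bochner_integral (lebesgue_on N1)
      (\<lambda>x. cdot (curl h x) (Et x) - \<i> * complex_of_real k * cdot (h x) (apply_material ?eps Ht x)) 0"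
    if h: "h \<in> SHS_test_forms" for h
  proof -
    have "has_bochner_integral (lebesgue_on N1)
      (\<lambda>y. cdot (curl h y) (Et y) - c * cdot (h y) (apply_material ?eps Ht y) - cdot (h y) ((\<lambda>_. 0) y)) 0"
    proof (rule iffD2[OF weak_transfer[OF SHS_test_forms_Ck[OF h] E' H'] SHS_weak_from_classical[OF s(2) c0(2) continuous_on_const _ h]])
      show "(\<lambda>_. 0) x = pull2 (jacobian F (at x)) ((\<lambda>_. 0) (F x))" for x
        by (simp add: pull2_def vec_eq_iff)
      show "curl E' x = c *s H' x + (\<lambda>_. 0) x" if "x \<in> ?P" for x using curlE[of x] that by simp
    qed
    then show ?thesis by (simp add: cdot_def c_def)
  qed
  have w2: "has_bochner_integral (lebesgue_on N1)
      (\<lambda>x. cdot (curl h x) (Ht x) + cdot (h x) ((\<i> * complex_of_real k) *s apply_material ?eps Et x - Jt x)) 0"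
    if h: "h \<in> SHS_test_forms" for h
  proof -
    have "has_bochner_integral (lebesgue_on N1)
      (\<lambda>y. cdot (curl h y) (Ht y) - (- c) * cdot (h y) (apply_material ?eps Et y) - cdot (h y) (Jt y)) 0"
      by (rule iffD2[OF weak_transfer[OF SHS_test_forms_Ck[OF h] H' E' J(2)] SHS_weak_from_classical[OF s(3) c0(1) J(1) _ h]])
        (use curlH in auto)
    moreover have "cdot (curl h y) (Ht y) - (- c) * cdot (h y) (apply_material ?eps Et y) - cdot (h y) (Jt y)
        = cdot (curl h y) (Ht y) + cdot (h y) ((\<i> * complex_of_real k) *s apply_material ?eps Et y - Jt y)" for y
      by (simp add: cdot_def sum_3 c_def algebra_simps)
    ultimately show ?thesis by (simp only:)
  qed
  have "\<exists>U. open U \<and> outer_bdry \<subseteq> U \<and> classical_solution (U \<inter> N1) outer_bdry ?eps ?eps k Jt f Et Ht"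
    using classical by (intro exI[of _ UNIV]) simp
  then show ?thesis
    unfolding finite_energy_SHS_solution_def
    using mEt mHt apply_material_measurable[OF mEt] apply_material_measurable[OF mHt]
      energy_transfer[OF E] energy_transfer[OF H] feE feH w1 w2 by blast
qed

end

theorem theorem8p2:
  fixes F1 :: "real \<Rightarrow> real" and F :: "real^3 \<Rightarrow> real^3" and k :: real
    and E H Et Ht J Jt f :: form
  assumes "single_coating F1 F"
    and "k \<noteq> 0"
    and "E \<in> borel_measurable (lebesgue_on (M1 - gamma1))"
    and "H \<in> borel_measurable (lebesgue_on (M1 - gamma1))"
    and "Et \<in> borel_measurable (lebesgue_on N1)"
    and "Ht \<in> borel_measurable (lebesgue_on N1)"
    and "AE x in lebesgue_on (M1 - gamma1). E x = pullback1 F Et x"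
    and "AE x in lebesgue_on (M1 - gamma1). H x = pullback1 F Ht x"
    and "smooth_on (M1 - gamma1) J"
    and "smooth_on (N1 - Sigma1) Jt"
    and "\<forall>x\<in>M1 - gamma1. is_pullback2 F Jt J x"
    and "closure {x \<in> M1 - gamma1. J x \<noteq> 0} \<inter> (gamma1 \<union> outer_bdry) = {}"
    and "closure {x \<in> N1 - Sigma1. Jt x \<noteq> 0} \<inter> (Sigma1 \<union> outer_bdry) = {}"
  shows "finite_energy_SHS_solution (material (g_tilde F)) (material (g_tilde F)) k Jt f Et Ht
    \<longleftrightarrow>
      classical_solution M1 outer_bdry (material flat_metric) (material flat_metric) k
        (\<lambda>x. if x \<in> gamma1 then 0 else J x) f E H \<and>
      finite_energy (M1 - gamma1) (material flat_metric) E \<and>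
      finite_energy (M1 - gamma1) (material flat_metric) H"
proof -
  interpret coating F1 F by unfold_locales (rule assms(1))
  let ?J = "\<lambda>x. if x \<in> gamma1 then 0 else J x"
  have J: "Ck_on n M1 ?J" for n by (rule Ck_on_extend_current[OF assms(9)]) (use assms(12) in blast)
  have Jt: "?J x = pull2 (jacobian F (at x)) (Jt (F x))" if "x \<in> M1 - gamma1" for x
    using is_pullback2_imp[of F Jt J x] assms(11) that by auto
  show ?thesis
    using classical_if_SHS[OF assms(2-4,7,8) J Jt, of f]
      SHS_if_classical[OF assms(5-8) Ck_on_imp_continuous[OF J] Jt, of k f] by blast
qed

end
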